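(* Let $F$ be a field of characteristic different from $2$, and let $(A,\sigma)$ and $(B,\tau)$ be two Brauer-equivalent central simple algebras over $F$, each endowed with an orthogonal involution. Let $F_B$ be the function field of the Brauer–Severi variety of $B$ and $I_B\subset B_{F_B}$ the generic ideal of $B$. Then $(A,\sigma)$ contains $(B,\tau)$ as a direct summand if and only if there exist a $\sigma$-symmetric idempotent $e\in A$ and an isomorphism of $F$-algebras $\Psi: eAe\to B$ such that $$\forall g\in I_B,\ \exists f\in A_{F_B}\ \text{ with }\ \Psi_{F_B}(e\,\sigma(f)f\,e)=\tau(g)g .$$
   Context: Involutions are $F$-linear. For a field extension $K/F$, $A_K=A\otimes_F K$, $B_K=B\otimes_F K$; the extensions of $\sigma$ and $\tau$ to $A_K$ and $B_K$ are again denoted $\sigma$ and $\tau$, and $\Psi_K: eA_Ke\to B_K$ denotes the extension of $\Psi$. An element $e\in A$ is a $\sigma$-symmetric idempotent if $e^2=e=\sigma(e)$. Direct summand: $(B,\tau)$ is a direct summand of $(A,\sigma)$ (equivalently, $(A,\sigma)$ contains $(B,\tau)$ as a direct summand) if there exists a $\sigma$-symmetric idempotent $e\in A$ such that $(eAe,\sigma_{|eAe})$ is isomorphic to $(B,\tau)$ as an algebra with involution. Generic ideal: let $X_B$ be the Brauer–Severi variety of $B$ (the variety of right ideals of reduced dimension $1$ of $B$) and $F_B=F(X_B)$ its function field, over which $B$ splits. The generic point of $X_B$, viewed as an $F_B$-rational point, corresponds to a right ideal of reduced dimension $1$ of the split algebra $B_{F_B}$; this right ideal is the generic ideal $I_B$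 of $B$. (The reduced dimension of a right or left ideal is its dimension over the base field divided by the degree of the algebra.) *)

theory Defs
  imports "HOL-Algebra.Algebra" "Jordan_Normal_Form.Missing_VectorSpace"
begin

section \<open>Central simple algebras\<close>

text \<open>The library locale \<^locale>\<open>algebra\<close> requires a commutative multiplication, so algebras over a
  field are introduced here on the same record type, for possibly noncommutative rings.\<close>

locale field_algebra = vectorspace F A + A?: ring A for F and A (structure) +
  assumes smult_mult_left: "\<lbrakk>c \<in> carrier F; x \<in> carrier A; y \<in> carrier A\<rbrakk>
      \<Longrightarrow> (c \<odot> x) \<otimes> y = c \<odot> (x \<otimes> y)"
    and smult_mult_right: "\<lbrakk>c \<in> carrier F; x \<in> carrier A; y \<in> carrier A\<rbrakk>
      \<Longrightarrow> x \<otimes> (c \<odot> y) = c \<odot> (x \<otimes> y)"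

locale central_simple_algebra = field_algebra +
  assumes finite_dimensional: "vectorspace.fin_dim F A"
    and nontrivial: "\<one> \<noteq> \<zero>"
    and central: "\<lbrakk>z \<in> carrier A; \<And>x. x \<in> carrier A \<Longrightarrow> z \<otimes> x = x \<otimes> z\<rbrakk>
      \<Longrightarrow> \<exists>c \<in> carrier F. z = c \<odot> \<one>"
    and simple: "ideal J A \<Longrightarrow> J = {\<zero>} \<or> J = carrier A"

definition alg_degree :: "'f ring \<Rightarrow> ('f, 'a) module \<Rightarrow> nat" where
  "alg_degree F A = (THE n. n ^ 2 = vectorspace.dim F A)"

definition alg_iso :: "'f ring \<Rightarrow> ('f, 'a) module \<Rightarrow> ('f, 'b) module \<Rightarrow> ('a \<Rightarrow> 'b) set" where
  "alg_iso F A B = {h \<in> ring_iso A B.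
     \<forall>c \<in> carrier F. \<forall>x \<in> carrier A. h (c \<odot>\<^bsub>A\<^esub> x) = c \<odot>\<^bsub>B\<^esub> h x}"

definition self_alg :: "'f ring \<Rightarrow> ('f, 'f) module" where
  "self_alg F = \<lparr>carrier = carrier F, monoid.mult = monoid.mult F, one = \<one>\<^bsub>F\<^esub>,
     ring.zero = \<zero>\<^bsub>F\<^esub>, ring.add = ring.add F, smult = monoid.mult F\<rparr>"

definition matrix_alg :: "nat \<Rightarrow> ('f, 'a) module \<Rightarrow> ('f, nat \<times> nat \<Rightarrow> 'a) module" where
  "matrix_alg n A =
    \<lparr>carrier = {..<n} \<times> {..<n} \<rightarrow>\<^sub>E carrier A,
     monoid.mult = (\<lambda>M N. \<lambda>(i, j) \<in> {..<n} \<times> {..<n}. \<Oplus>\<^bsub>A\<^esub>k \<in> {..<n}. M (i, k) \<otimes>\<^bsub>A\<^esub> N (k, j)),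
     one = (\<lambda>(i, j) \<in> {..<n} \<times> {..<n}. if i = j then \<one>\<^bsub>A\<^esub> else \<zero>\<^bsub>A\<^esub>),
     ring.zero = (\<lambda>_ \<in> {..<n} \<times> {..<n}. \<zero>\<^bsub>A\<^esub>),
     ring.add = (\<lambda>M N. \<lambda>p \<in> {..<n} \<times> {..<n}. M p \<oplus>\<^bsub>A\<^esub> N p),
     smult = (\<lambda>c M. \<lambda>p \<in> {..<n} \<times> {..<n}. c \<odot>\<^bsub>A\<^esub> M p)\<rparr>"

definition mat_transpose :: "nat \<Rightarrow> (nat \<times> nat \<Rightarrow> 'a) \<Rightarrow> nat \<times> nat \<Rightarrow> 'a" where
  "mat_transpose n M = (\<lambda>(i, j) \<in> {..<n} \<times> {..<n}. M (j, i))"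

definition brauer_equivalent :: "'f ring \<Rightarrow> ('f, 'a) module \<Rightarrow> ('f, 'b) module \<Rightarrow> bool" where
  "brauer_equivalent F A B \<longleftrightarrow>
     (\<exists>m \<ge> 1. \<exists>n \<ge> 1. alg_iso F (matrix_alg m A) (matrix_alg n B) \<noteq> {})"


section \<open>Extension of scalars\<close>

definition field_ext :: "'f ring \<Rightarrow> 'k ring \<Rightarrow> ('f \<Rightarrow> 'k) \<Rightarrow> bool" where
  "field_ext F K \<iota> \<longleftrightarrow> field F \<and> field K \<and> \<iota> \<in> ring_hom F K"

text \<open>\<open>K[A]\<close>: the free \<open>K\<close>-module on the set \<open>carrier A\<close>, as finitely supported functions vanishing
  off \<open>carrier A\<close>, with the convolution product coming from the multiplication of \<open>A\<close>.\<close>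

definition monoid_alg :: "'k ring \<Rightarrow> ('f, 'a) module \<Rightarrow> ('k, 'a \<Rightarrow> 'k) module" where
  "monoid_alg K A =
    \<lparr>carrier = {u. (\<forall>a. u a \<in> carrier K) \<and> (\<forall>a. a \<notin> carrier A \<longrightarrow> u a = \<zero>\<^bsub>K\<^esub>)
        \<and> finite {a. u a \<noteq> \<zero>\<^bsub>K\<^esub>}},
     monoid.mult = (\<lambda>u v. \<lambda>c.
        \<Oplus>\<^bsub>K\<^esub>p \<in> {(a, b). u a \<noteq> \<zero>\<^bsub>K\<^esub> \<and> v b \<noteq> \<zero>\<^bsub>K\<^esub> \<and> a \<otimes>\<^bsub>A\<^esub> b = c}.
          u (fst p) \<otimes>\<^bsub>K\<^esub> v (snd p)),
     one = (\<lambda>c. if c = \<one>\<^bsub>A\<^esub> then \<one>\<^bsub>K\<^esub> else \<zero>\<^bsub>K\<^esub>),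
     ring.zero = (\<lambda>c. \<zero>\<^bsub>K\<^esub>),
     ring.add = (\<lambda>u v. \<lambda>c. u c \<oplus>\<^bsub>K\<^esub> v c),
     smult = (\<lambda>k u. \<lambda>c. k \<otimes>\<^bsub>K\<^esub> u c)\<rparr>"

definition gen :: "'k ring \<Rightarrow> 'a \<Rightarrow> 'a \<Rightarrow> 'k" where
  "gen K a = (\<lambda>c. if c = a then \<one>\<^bsub>K\<^esub> else \<zero>\<^bsub>K\<^esub>)"

text \<open>The relations imposing \<open>F\<close>-bilinearity on \<open>a \<otimes> k\<close>, the class of \<open>k[a]\<close>. Since \<open>A\<close> is an
  \<open>F\<close>-algebra, their \<open>K\<close>-span is already a two-sided ideal of \<open>K[A]\<close>; so the quotient
  below is the usual \<open>A \<otimes>\<^sub>F K\<close>.\<close>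

definition tensor_ideal :: "'f ring \<Rightarrow> 'k ring \<Rightarrow> ('f \<Rightarrow> 'k) \<Rightarrow> ('f, 'a) module \<Rightarrow> ('a \<Rightarrow> 'k) set" where
  "tensor_ideal F K \<iota> A = Idl\<^bsub>monoid_alg K A\<^esub>
     ({gen K (a \<oplus>\<^bsub>A\<^esub> b) \<ominus>\<^bsub>monoid_alg K A\<^esub> (gen K a \<oplus>\<^bsub>monoid_alg K A\<^esub> gen K b) | a b.
         a \<in> carrier A \<and> b \<in> carrier A} \<union>
      {gen K (c \<odot>\<^bsub>A\<^esub> a) \<ominus>\<^bsub>monoid_alg K A\<^esub> (\<iota> c \<odot>\<^bsub>monoid_alg K A\<^esub> gen K a) | c a.
         c \<in> carrier F \<and> a \<in> carrier A})"

definition base_change ::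
  "'f ring \<Rightarrow> 'k ring \<Rightarrow> ('f \<Rightarrow> 'k) \<Rightarrow> ('f, 'a) module \<Rightarrow> ('k, ('a \<Rightarrow> 'k) set) module" where
  "base_change F K \<iota> A =
    (let R = monoid_alg K A; J = tensor_ideal F K \<iota> A; Q = R Quot J in
     \<lparr>carrier = carrier Q, monoid.mult = monoid.mult Q, one = \<one>\<^bsub>Q\<^esub>, ring.zero = \<zero>\<^bsub>Q\<^esub>, ring.add = ring.add Q,
      smult = (\<lambda>k C. \<Union>u \<in> C. J +>\<^bsub>R\<^esub> (k \<odot>\<^bsub>R\<^esub> u))\<rparr>)"

text \<open>\<open>a \<otimes> 1 \<in> A\<^sub>K\<close>\<close>

definition base_incl ::
  "'f ring \<Rightarrow> 'k ring \<Rightarrow> ('f \<Rightarrow> 'k) \<Rightarrow> ('f, 'a) module \<Rightarrow> 'a \<Rightarrow> ('a \<Rightarrow> 'k) set" where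
  "base_incl F K \<iota> A a = tensor_ideal F K \<iota> A +>\<^bsub>monoid_alg K A\<^esub> gen K a"

text \<open>The extension \<open>\<phi>\<^sub>K : A\<^sub>K \<rightarrow> B\<^sub>K\<close> of an \<open>F\<close>-linear map \<open>\<phi> : A \<rightarrow> B\<close>, sending the class of
  \<open>\<Sum>\<^sub>a u(a)[a]\<close> to \<open>\<Sum>\<^sub>a u(a)(\<phi>(a) \<otimes> 1)\<close>; this does not depend on the representative \<open>u\<close>.\<close>

definition base_change_map ::
  "'f ring \<Rightarrow> 'k ring \<Rightarrow> ('f \<Rightarrow> 'k) \<Rightarrow> ('f, 'a) module \<Rightarrow> ('f, 'b) module \<Rightarrow> ('a \<Rightarrow> 'b)
    \<Rightarrow> ('a \<Rightarrow> 'k) set \<Rightarrow> ('b \<Rightarrow> 'k) set" where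
  "base_change_map F K \<iota> A B \<phi> C =
    (let BK = base_change F K \<iota> B in
     THE y. \<forall>u \<in> C. y = (\<Oplus>\<^bsub>BK\<^esub>a \<in> {a. u a \<noteq> \<zero>\<^bsub>K\<^esub>}. u a \<odot>\<^bsub>BK\<^esub> base_incl F K \<iota> B (\<phi> a)))"


section \<open>Algebras with involution\<close>

definition involution :: "'f ring \<Rightarrow> ('f, 'a) module \<Rightarrow> ('a \<Rightarrow> 'a) \<Rightarrow> bool" where
  "involution F A \<sigma> \<longleftrightarrow> \<sigma> \<in> module_hom F A A
     \<and> (\<forall>x \<in> carrier A. \<forall>y \<in> carrier A. \<sigma> (x \<otimes>\<^bsub>A\<^esub> y) = \<sigma> y \<otimes>\<^bsub>A\<^esub> \<sigma> x)
     \<and> (\<forall>x \<in> carrier A. \<sigma> (\<sigma> x) = x)"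

text \<open>In characteristic different from 2, an involution is orthogonal if over a splitting field it
  becomes adjoint to a nonsingular symmetric bilinear form. The type does not depend on the
  splitting field, for which the algebraic closure \<open>L\<close> of \<open>F\<close> is taken. The form is
  \<open>b(v, w) = v\<^sup>T G w\<close> on \<open>L\<^sup>n\<close>; the last clause says \<open>b(M v, w) = b(v, \<sigma>(M) w)\<close>.\<close>

definition orthogonal_involution :: "'f ring \<Rightarrow> ('f, 'a) module \<Rightarrow> ('a \<Rightarrow> 'a) \<Rightarrow> bool" where
  "orthogonal_involution F A \<sigma> \<longleftrightarrow> involution F A \<sigma> \<and>
    (let L = field.alg_closure F; j = ring.indexed_const F; n = alg_degree F A;
         AL = base_change F L j A; Mn = matrix_alg n (self_alg L)
     in \<exists>\<Phi> \<in> alg_iso L AL Mn. \<exists>G \<in> Units Mn. mat_transpose n G = G \<and>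
       (\<forall>x \<in> carrier AL. mat_transpose n (\<Phi> x) \<otimes>\<^bsub>Mn\<^esub> G
          = G \<otimes>\<^bsub>Mn\<^esub> \<Phi> (base_change_map F L j A A \<sigma> x)))"

definition symmetric_idempotent :: "('f, 'a) module \<Rightarrow> ('a \<Rightarrow> 'a) \<Rightarrow> 'a \<Rightarrow> bool" where
  "symmetric_idempotent A \<sigma> e \<longleftrightarrow> e \<in> carrier A \<and> e \<otimes>\<^bsub>A\<^esub> e = e \<and> \<sigma> e = e"

text \<open>\<open>eAe\<close>, with unit element \<open>e\<close>\<close>

definition corner :: "('f, 'a) module \<Rightarrow> 'a \<Rightarrow> ('f, 'a) module" where
  "corner A e = A\<lparr>carrier := {e \<otimes>\<^bsub>A\<^esub> x \<otimes>\<^bsub>A\<^esub> e | x. x \<in> carrier A}, one := e\<rparr>"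

definition direct_summand ::
  "'f ring \<Rightarrow> ('f, 'a) module \<Rightarrow> ('a \<Rightarrow> 'a) \<Rightarrow> ('f, 'b) module \<Rightarrow> ('b \<Rightarrow> 'b) \<Rightarrow> bool" where
  "direct_summand F A \<sigma> B \<tau> \<longleftrightarrow>
     (\<exists>e. symmetric_idempotent A \<sigma> e \<and>
       (\<exists>\<Phi> \<in> alg_iso F (corner A e) B. \<forall>x \<in> carrier (corner A e). \<Phi> (\<sigma> x) = \<tau> (\<Phi> x)))"

text \<open>The extension \<open>\<Psi>\<^sub>K : eA\<^sub>Ke \<rightarrow> B\<^sub>K\<close> of \<open>\<Psi> : eAe \<rightarrow> B\<close>, where \<open>eA\<^sub>Ke \<subseteq> A\<^sub>K\<close> is identified with
  \<open>(eAe) \<otimes>\<^sub>F K\<close> by means of the extension of the inclusion \<open>eAe \<rightarrow> A\<close>.\<close>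

definition corner_base_change_map ::
  "'f ring \<Rightarrow> 'k ring \<Rightarrow> ('f \<Rightarrow> 'k) \<Rightarrow> ('f, 'a) module \<Rightarrow> 'a \<Rightarrow> ('f, 'b) module \<Rightarrow> ('a \<Rightarrow> 'b)
    \<Rightarrow> ('a \<Rightarrow> 'k) set \<Rightarrow> ('b \<Rightarrow> 'k) set" where
  "corner_base_change_map F K \<iota> A e B \<Psi> x =
     base_change_map F K \<iota> (corner A e) B \<Psi>
       (THE h. h \<in> carrier (base_change F K \<iota> (corner A e))
          \<and> base_change_map F K \<iota> (corner A e) A (\<lambda>a. a) h = x)"


section \<open>The Brauer--Severi variety and its generic point\<close>

definition right_ideal :: "'a set \<Rightarrow> ('f, 'a) module \<Rightarrow> bool" where
  "right_ideal I A \<longleftrightarrow> additive_subgroup I A \<and>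
     (\<forall>x \<in> I. \<forall>a \<in> carrier A. x \<otimes>\<^bsub>A\<^esub> a \<in> I)"

definition reduced_dim :: "'f ring \<Rightarrow> ('f, 'a) module \<Rightarrow> 'a set \<Rightarrow> rat" where
  "reduced_dim F A I =
     of_nat (vectorspace.dim F (A\<lparr>carrier := I\<rparr>)) / of_nat (alg_degree F A)"

text \<open>\<open>X\<^sub>B(K)\<close> for a field extension \<open>K/F\<close>\<close>

definition brauer_severi_points ::
  "'f ring \<Rightarrow> ('f, 'b) module \<Rightarrow> 'k ring \<Rightarrow> ('f \<Rightarrow> 'k) \<Rightarrow> ('b \<Rightarrow> 'k) set set set" where
  "brauer_severi_points F B K \<iota> =
     {I. right_ideal I (base_change F K \<iota> B) \<and> reduced_dim K (base_change F K \<iota> B) I = 1}"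

text \<open>\<open>X\<^sub>B\<close> is a closed subvariety of the Grassmannian of \<open>n\<close>-dimensional subspaces of \<open>B\<close>, where
  \<open>n = deg B\<close>. A basis \<open>b\<^sub>0, \<dots>, b\<^bsub>N-1\<^esub>\<close> of \<open>B\<close> (with \<open>N = n\<^sup>2\<close>) determines the standard affine open
  chart of the subspaces complementary to the span of \<open>b\<^sub>n, \<dots>, b\<^bsub>N-1\<^esub>\<close>. Its coordinates
  are \<open>x\<^bsub>s,t\<^esub>\<close> with \<open>s < n \<le> t < N\<close>; the corresponding subspace is spanned by the vectors
  \<open>b\<^sub>s + \<Sum>\<^sub>t x\<^bsub>s,t\<^esub> b\<^sub>t\<close>.\<close>

definition enum_basis :: "'f ring \<Rightarrow> ('f, 'b) module \<Rightarrow> (nat \<Rightarrow> 'b) \<Rightarrow> bool" where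
  "enum_basis F B b \<longleftrightarrow> inj_on b {..<vectorspace.dim F B} \<and>
     vectorspace.basis F B (b ` {..<vectorspace.dim F B})"

definition chart_index :: "'f ring \<Rightarrow> ('f, 'b) module \<Rightarrow> (nat \<times> nat) set" where
  "chart_index F B = {..<alg_degree F B} \<times> {alg_degree F B..<vectorspace.dim F B}"

definition chart_subspace ::
  "'f ring \<Rightarrow> ('f, 'b) module \<Rightarrow> (nat \<Rightarrow> 'b) \<Rightarrow> 'k ring \<Rightarrow> ('f \<Rightarrow> 'k) \<Rightarrow> (nat \<times> nat \<Rightarrow> 'k)
    \<Rightarrow> ('b \<Rightarrow> 'k) set set" where
  "chart_subspace F B b K \<iota> x =
    (let BK = base_change F K \<iota> B; b' = (\<lambda>i. base_incl F K \<iota> B (b i)) in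
     module.span K BK
       ((\<lambda>s. b' s \<oplus>\<^bsub>BK\<^esub> (\<Oplus>\<^bsub>BK\<^esub>t \<in> {alg_degree F B..<vectorspace.dim F B}. x (s, t) \<odot>\<^bsub>BK\<^esub> b' t))
        ` {..<alg_degree F B}))"

text \<open>Coordinates of the \<open>K\<close>-points of \<open>X\<^sub>B\<close> in the chart\<close>

definition chart_points ::
  "'f ring \<Rightarrow> ('f, 'b) module \<Rightarrow> (nat \<Rightarrow> 'b) \<Rightarrow> 'k ring \<Rightarrow> ('f \<Rightarrow> 'k) \<Rightarrow> (nat \<times> nat \<Rightarrow> 'k) set" where
  "chart_points F B b K \<iota> = {x \<in> chart_index F B \<rightarrow>\<^sub>E carrier K.
     chart_subspace F B b K \<iota> x \<in> brauer_severi_points F B K \<iota>}"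

text \<open>The value at \<open>x\<close> of a polynomial over \<open>F\<close> (a function from monomials, i.e. multisets of
  variables, to coefficients, as in \<^const>\<open>ring.indexed_pset\<close>)\<close>

definition poly_value ::
  "'f ring \<Rightarrow> 'k ring \<Rightarrow> ('f \<Rightarrow> 'k) \<Rightarrow> ('v multiset \<Rightarrow> 'f) \<Rightarrow> ('v \<Rightarrow> 'k) \<Rightarrow> 'k" where
  "poly_value F K \<iota> p x = (\<Oplus>\<^bsub>K\<^esub>m \<in> {m. p m \<noteq> \<zero>\<^bsub>F\<^esub>}.
     \<iota> (p m) \<otimes>\<^bsub>K\<^esub> (\<Otimes>\<^bsub>K\<^esub>v \<in> set_mset m. x v [^]\<^bsub>K\<^esub> count m v))"

text \<open>The ideal in the polynomial ring over \<open>F\<close> of the affine variety \<open>X\<^sub>B \<inter> chart\<close>, i.e. the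
  polynomials vanishing at all its points over the algebraic closure of \<open>F\<close>\<close>

definition chart_ideal ::
  "'f ring \<Rightarrow> ('f, 'b) module \<Rightarrow> (nat \<Rightarrow> 'b) \<Rightarrow> ((nat \<times> nat) multiset \<Rightarrow> 'f) set" where
  "chart_ideal F B b = {p \<in> ring.indexed_pset F (chart_index F B) (carrier F).
     \<forall>y \<in> chart_points F B b (field.alg_closure F) (ring.indexed_const F).
       poly_value F (field.alg_closure F) (ring.indexed_const F) p y = \<zero>\<^bsub>field.alg_closure F\<^esub>}"

text \<open>\<open>K/F\<close> is the function field \<open>F(X\<^sub>B)\<close>, and the point of \<open>X\<^sub>B(K)\<close> given by the generic point of \<open>X\<^sub>B\<close>
  is the right ideal \<open>I\<close>: in some chart, with \<open>x\<close> the coordinates of \<open>I\<close>, evaluation at \<open>x\<close>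
  induces an embedding of the coordinate ring of \<open>X\<^sub>B \<inter> chart\<close> into \<open>K\<close>, and \<open>K\<close> is the field of
  fractions of its image. Since \<open>X\<^sub>B\<close> is an integral variety, this determines \<open>(K, I)\<close> up to a
  unique isomorphism over \<open>F\<close>, whatever the chart. (The condition forces \<open>X\<^sub>B \<inter> chart\<close> to be
  nonempty, as otherwise the constant polynomial 1 would lie in \<^const>\<open>chart_ideal\<close>.)\<close>

definition function_field_generic_ideal ::
  "'f ring \<Rightarrow> ('f, 'b) module \<Rightarrow> 'k ring \<Rightarrow> ('f \<Rightarrow> 'k) \<Rightarrow> ('b \<Rightarrow> 'k) set set \<Rightarrow> bool" where
  "function_field_generic_ideal F B K \<iota> I \<longleftrightarrow>
     field_ext F K \<iota> \<and> I \<in> brauer_severi_points F B K \<iota> \<and>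
     (\<exists>b. enum_basis F B b \<and>
       (\<exists>x \<in> chart_points F B b K \<iota>. I = chart_subspace F B b K \<iota> x \<and>
          {p \<in> ring.indexed_pset F (chart_index F B) (carrier F). poly_value F K \<iota> p x = \<zero>\<^bsub>K\<^esub>}
            = chart_ideal F B b \<and>
          generate_field K (\<iota> ` carrier F \<union> x ` chart_index F B) = carrier K))"

end

theory Submission
  imports Defs
begin

text \<open>Let \<open>\<Psi> : eAe \<rightarrow> B\<close> be an isomorphism for some \<open>\<sigma>\<close>-symmetric idempotent \<open>e\<close>, and let
  \<open>\<tau>' = \<Psi> \<circ> \<sigma> \<circ> \<Psi>\<^sup>-\<^sup>1\<close> be the involution of \<open>B\<close> that corresponds to \<open>\<sigma>\<close> on the corner. Then \<open>e\<close> and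
  \<open>\<Psi>\<close> present \<open>(B, \<tau>)\<close> as a direct summand of \<open>(A, \<sigma>)\<close> if and only if \<open>\<tau>' = \<tau>\<close>. The proof shows,
  for each pair \<open>(e, \<Psi>)\<close>, that this holds if and only if every \<open>\<tau>(g) g\<close> with \<open>g\<close> in the generic
  ideal is represented in the form \<open>\<Psi>\<^sub>K(e \<sigma>(f) f e)\<close>.

  If \<open>\<tau>' = \<tau>\<close>, then any \<open>g \<in> B\<^sub>K\<close> is \<open>\<Psi>\<^sub>K(f)\<close> for some \<open>f\<close> in the corner \<open>e A\<^sub>K e\<close>, and this \<open>f\<close>
  represents \<open>\<tau>(g) g\<close> (\<open>hermitian_square_represented\<close>).

  Conversely, \<open>e \<sigma>(f) f e\<close> is \<open>\<sigma>\<close>-symmetric whatever \<open>f\<close> is, so that representability gives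
  \<open>\<tau>'(\<tau>(g) g) = \<tau>(g) g\<close> for all \<open>g\<close> in the generic ideal (\<open>hermitian_square_fixed\<close>). This alone
  forces \<open>\<tau>' = \<tau>\<close> (\<open>hermitian_squares_determine_involution\<close>), for the following reasons.

  \<^item> Genericity. As 2 is invertible, the equations \<open>\<tau>'(\<tau>(g) g) = \<tau>(g) g\<close> on a subspace are
    equivalent to their polarisations on a spanning set. For the spanning vectors provided by a
    chart of the Grassmannian the polarised equations are polynomial over \<open>F\<close> in the chart
    coordinates. As they hold at the generic point, they hold at every point of the Brauer--Severi
    variety in that chart over the algebraic closure \<open>L\<close> of \<open>F\<close>.

  \<^item> Anisotropic points. Over \<open>L\<close> the algebra \<open>B\<close> becomes \<open>M\<^sub>n(L)\<close> and \<open>\<tau>\<close> becomes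
    \<open>x \<mapsto> G\<^sup>-\<^sup>1 x\<^sup>T G\<close> for a symmetric matrix \<open>G\<close>. The right ideals of reduced dimension 1 consist of
    the matrices \<open>v x\<close>, where \<open>v\<close> is a fixed column and \<open>x\<close> varies over the rows. Moving \<open>v\<close> along
    a line avoids the finitely many values of the parameter at which \<open>v\<^sup>T G v\<close> vanishes or the
    ideal leaves the chart (\<open>perturbation_to_anisotropic\<close>, \<open>exists_anisotropic_chart_point\<close>).

  \<^item> Rank one matrices. If \<open>\<beta> = v\<^sup>T G v \<noteq> 0\<close>, then \<open>\<tau>(v x) v x = \<beta> G\<^sup>-\<^sup>1 x\<^sup>T x\<close>, so that \<open>\<tau>'\<close> fixes
    all matrices \<open>G\<^sup>-\<^sup>1 x\<^sup>T x\<close>. They generate enough of \<open>M\<^sub>n(L)\<close> to identify \<open>\<tau>'\<close> with \<open>\<tau>\<close>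
    (\<open>adjoint_determined\<close>).

  Calculations in \<open>A\<^sub>K\<close>, a quotient of the algebra \<open>K[A]\<close> of formal sums, are made with the
  functionals \<open>l : A \<rightarrow> K\<close> that are linear over \<open>F\<close>. Each of them extends to a linear form on
  \<open>A\<^sub>K\<close>, and these forms separate the elements of \<open>A\<^sub>K\<close> (\<open>AK_eqI\<close>).\<close>

section \<open>Finite sums\<close>

lemma (in abelian_monoid) finsum_Times:
  assumes "finite S" "finite T" and f: "\<And>a b. a \<in> S \<Longrightarrow> b \<in> T \<Longrightarrow> f a b \<in> carrier G"
  shows "(\<Oplus>a\<in>S. \<Oplus>b\<in>T. f a b) = (\<Oplus>p\<in>S \<times> T. f (fst p) (snd p))"
  using assms(1) f
proof (induction S rule: finite_induct)
  case (insert s S)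
  have split: "insert s S \<times> T = {s} \<times> T \<union> S \<times> T" by blast
  have "(\<Oplus>p\<in>{s} \<times> T. f (fst p) (snd p)) = (\<Oplus>p\<in>Pair s ` T. f (fst p) (snd p))"
    by (rule arg_cong[of _ _ "finsum G _"]) auto
  also have "\<dots> = (\<Oplus>b\<in>T. f s b)"
    using insert.prems by (subst finsum_reindex) (auto simp: inj_on_def)
  finally have row: "(\<Oplus>p\<in>{s} \<times> T. f (fst p) (snd p)) = (\<Oplus>b\<in>T. f s b)" .
  show ?case
    unfolding split using insert \<open>finite T\<close>
    by (subst finsum_Un_disjoint) (auto simp: row intro!: finsum_closed)
qed simp

lemma (in abelian_monoid) finsum_swap:
  assumes "finite S" "finite T" and f: "\<And>a b. a \<in> S \<Longrightarrow> b \<in> T \<Longrightarrow> f a b \<in> carrier G"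
  shows "(\<Oplus>a\<in>S. \<Oplus>b\<in>T. f a b) = (\<Oplus>b\<in>T. \<Oplus>a\<in>S. f a b)"
proof -
  have "(\<Oplus>a\<in>S. \<Oplus>b\<in>T. f a b) = (\<Oplus>p\<in>S \<times> T. f (fst p) (snd p))"
    by (rule finsum_Times[OF assms])
  also have "\<dots> = (\<Oplus>p\<in>prod.swap ` (T \<times> S). f (fst p) (snd p))"
    by (simp add: product_swap)
  also have "\<dots> = (\<Oplus>p\<in>T \<times> S. f (snd p) (fst p))"
    using f by (subst finsum_reindex) (auto simp: inj_on_def)
  also have "\<dots> = (\<Oplus>b\<in>T. \<Oplus>a\<in>S. f a b)"
    by (rule finsum_Times[symmetric]) (use assms in auto)
  finally show ?thesis .
qed

lemma (in abelian_monoid) finsum_fibres: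
  assumes "finite S" and f: "f \<in> S \<rightarrow> carrier G"
  shows "(\<Oplus>c\<in>h ` S. \<Oplus>p\<in>{p \<in> S. h p = c}. f p) = (\<Oplus>p\<in>S. f p)"
proof -
  have "(\<Oplus>p\<in>(\<Union>c\<in>h ` S. {p \<in> S. h p = c}). f p) = (\<Oplus>c\<in>h ` S. \<Oplus>p\<in>{p \<in> S. h p = c}. f p)"
    using assms by (intro add.finprod_UN_disjoint) (auto simp: pairwise_def disjnt_def)
  moreover have "(\<Union>c\<in>h ` S. {p \<in> S. h p = c}) = S" by auto
  ultimately show ?thesis by simp
qed

lemma (in abelian_monoid) finsum_delta:
  assumes "finite S" "i \<in> S" "f \<in> S \<rightarrow> carrier G"
  shows "(\<Oplus>j\<in>S. if j = i then f j else \<zero>) = f i"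
  using add.finprod_singleton_swap[OF assms(2,1,3)] by simp

section \<open>Formal sums\<close>

text \<open>The value at \<open>u\<close> of the \<open>K\<close>-linear extension of \<open>h\<close> to the formal sums.\<close>

definition pairing
 :: "'k ring \<Rightarrow> ('a \<Rightarrow> 'k) \<Rightarrow> ('a \<Rightarrow> 'k) \<Rightarrow> 'k" where
  "pairing K u h = (\<Oplus>\<^bsub>K\<^esub>a \<in> {a. u a \<noteq> \<zero>\<^bsub>K\<^esub>}. u a \<otimes>\<^bsub>K\<^esub> h a)"

locale formal_sums = K: cring K + A: ring A for K :: "'k ring" and A :: "('f, 'a) module"
begin

abbreviation KA where "KA \<equiv> monoid_alg K A"

lemma formal_sum_iff: "u \<in> carrier KA \<longleftrightarrow>
   (\<forall>a. u a \<in> carrier K) \<and> (\<forall>a. a \<notin> carrier A \<longrightarrow> u a = \<zero>\<^bsub>K\<^esub>) \<and> finite {a. u a \<noteq> \<zero>\<^bsub>K\<^esub>}"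
  by (simp add: monoid_alg_def)

lemma formal_sum_simps:
  "\<one>\<^bsub>KA\<^esub> = gen K \<one>\<^bsub>A\<^esub>" "\<zero>\<^bsub>KA\<^esub> = (\<lambda>c. \<zero>\<^bsub>K\<^esub>)"
  "u \<oplus>\<^bsub>KA\<^esub> v = (\<lambda>c. u c \<oplus>\<^bsub>K\<^esub> v c)" "k \<odot>\<^bsub>KA\<^esub> u = (\<lambda>c. k \<otimes>\<^bsub>K\<^esub> u c)"
  by (simp_all add: monoid_alg_def gen_def)

lemma gen_closed: "a \<in> carrier A \<Longrightarrow> gen K a \<in> carrier KA"
  by (auto simp: formal_sum_iff gen_def)

lemma add_closed: "u \<in> carrier KA \<Longrightarrow> v \<in> carrier KA \<Longrightarrow> u \<oplus>\<^bsub>KA\<^esub> v \<in> carrier KA"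
  unfolding formal_sum_iff formal_sum_simps
  by (auto intro: finite_subset[of _ "{a. u a \<noteq> \<zero>\<^bsub>K\<^esub>} \<union> {a. v a \<noteq> \<zero>\<^bsub>K\<^esub>}"])

lemma smult_closed: "k \<in> carrier K \<Longrightarrow> u \<in> carrier KA \<Longrightarrow> k \<odot>\<^bsub>KA\<^esub> u \<in> carrier KA"
  unfolding formal_sum_iff formal_sum_simps
  by (auto intro: finite_subset[of _ "{a. u a \<noteq> \<zero>\<^bsub>K\<^esub>}"])

lemma zero_closed: "\<zero>\<^bsub>KA\<^esub> \<in> carrier KA"
  unfolding formal_sum_iff formal_sum_simps by simp

lemma pairing_superset:
  assumes "u \<in> carrier KA" "h \<in> carrier A \<rightarrow> carrier K" "finite S" "{a. u a \<noteq> \<zero>\<^bsub>K\<^esub>} \<subseteq> S" "S \<subseteq> carrier A"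
  shows "pairing K u h = (\<Oplus>\<^bsub>K\<^esub>a \<in> S. u a \<otimes>\<^bsub>K\<^esub> h a)"
  unfolding pairing_def
  using assms by (intro K.add.finprod_mono_neutral_cong_left) (auto simp: formal_sum_iff Pi_iff subset_iff)

lemma support_subset: "u \<in> carrier KA \<Longrightarrow> {a. u a \<noteq> \<zero>\<^bsub>K\<^esub>} \<subseteq> carrier A"
  by (auto simp: formal_sum_iff)

lemma pairing_closed:
  assumes "u \<in> carrier KA" "h \<in> carrier A \<rightarrow> carrier K" shows "pairing K u h \<in> carrier K"
  unfolding pairing_def
  using assms support_subset[OF assms(1)] by (intro K.finsum_closed) (auto simp: formal_sum_iff Pi_iff subset_iff)

lemma pairing_cong:
  assumes "u \<in> carrier KA" "\<And>a. a \<in> carrier A \<Longrightarrow> h a = h' a" "h' \<in> carrier A \<rightarrow> carrier K"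
  shows "pairing K u h = pairing K u h'"
  unfolding pairing_def
  using assms support_subset[OF assms(1)]
  by (intro K.finsum_cong') (auto simp: formal_sum_iff Pi_iff subset_iff)

lemma pairing_add:
  assumes u: "u \<in> carrier KA" and v: "v \<in> carrier KA" and h: "h \<in> carrier A \<rightarrow> carrier K"
  shows "pairing K (u \<oplus>\<^bsub>KA\<^esub> v) h = pairing K u h \<oplus>\<^bsub>K\<^esub> pairing K v h"
proof -
  let ?S = "{a. u a \<noteq> \<zero>\<^bsub>K\<^esub>} \<union> {a. v a \<noteq> \<zero>\<^bsub>K\<^esub>}"
  have S: "finite ?S" "?S \<subseteq> carrier A" using u v by (auto simp: formal_sum_iff)
  have c: "u a \<in> carrier K" "v a \<in> carrier K" for a using u v by (simp_all add: formal_sum_iff)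
  have hc: "h a \<in> carrier K" if "a \<in> ?S" for a using funcset_mem[OF h] S(2) that by blast
  have "{a. (u \<oplus>\<^bsub>KA\<^esub> v) a \<noteq> \<zero>\<^bsub>K\<^esub>} \<subseteq> ?S" by (auto simp: formal_sum_simps)
  then have "pairing K (u \<oplus>\<^bsub>KA\<^esub> v) h = (\<Oplus>\<^bsub>K\<^esub>a \<in> ?S. (u a \<oplus>\<^bsub>K\<^esub> v a) \<otimes>\<^bsub>K\<^esub> h a)"
    using pairing_superset[OF add_closed[OF u v] h S(1) _ S(2)] by (simp add: formal_sum_simps)
  also have "\<dots> = (\<Oplus>\<^bsub>K\<^esub>a \<in> ?S. u a \<otimes>\<^bsub>K\<^esub> h a \<oplus>\<^bsub>K\<^esub> v a \<otimes>\<^bsub>K\<^esub> h a)"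
    by (intro K.finsum_cong' refl Pi_I K.l_distr K.a_closed K.m_closed c hc)
  also have "\<dots> = (\<Oplus>\<^bsub>K\<^esub>a \<in> ?S. u a \<otimes>\<^bsub>K\<^esub> h a) \<oplus>\<^bsub>K\<^esub> (\<Oplus>\<^bsub>K\<^esub>a \<in> ?S. v a \<otimes>\<^bsub>K\<^esub> h a)"
    by (intro K.finsum_addf Pi_I K.m_closed c hc)
  also have "\<dots> = pairing K u h \<oplus>\<^bsub>K\<^esub> pairing K v h"
    by (simp add: pairing_superset[OF u h S(1) _ S(2)] pairing_superset[OF v h S(1) _ S(2)])
  finally show ?thesis .
qed

lemma pairing_smult:
  assumes k: "k \<in> carrier K" and u: "u \<in> carrier KA" and h: "h \<in> carrier A \<rightarrow> carrier K"
  shows "pairing K (k \<odot>\<^bsub>KA\<^esub> u) h = k \<otimes>\<^bsub>K\<^esub> pairing K u h"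
proof -
  let ?S = "{a. u a \<noteq> \<zero>\<^bsub>K\<^esub>}"
  have S: "finite ?S" "?S \<subseteq> carrier A" using u by (auto simp: formal_sum_iff)
  have "pairing K (k \<odot>\<^bsub>KA\<^esub> u) h = (\<Oplus>\<^bsub>K\<^esub>a \<in> ?S. (k \<otimes>\<^bsub>K\<^esub> u a) \<otimes>\<^bsub>K\<^esub> h a)"
    using S k pairing_superset[OF smult_closed[OF k u] h S(1) _ S(2)] by (force simp: formal_sum_simps)
  also have "\<dots> = (\<Oplus>\<^bsub>K\<^esub>a \<in> ?S. k \<otimes>\<^bsub>K\<^esub> (u a \<otimes>\<^bsub>K\<^esub> h a))"
    using S u h k by (intro K.finsum_cong') (auto simp: formal_sum_iff K.m_assoc Pi_iff subset_iff)
  also have "\<dots> = k \<otimes>\<^bsub>K\<^esub> pairing K u h"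
    unfolding pairing_def using S u h k by (intro K.finsum_rdistr[symmetric]) (auto simp: formal_sum_iff Pi_iff subset_iff)
  finally show ?thesis .
qed

lemma pairing_gen:
  assumes a: "a \<in> carrier A" and h: "h \<in> carrier A \<rightarrow> carrier K"
  shows "pairing K (gen K a) h = h a"
proof -
  have "pairing K (gen K a) h = (\<Oplus>\<^bsub>K\<^esub>b \<in> {a}. gen K a b \<otimes>\<^bsub>K\<^esub> h b)"
    using a by (intro pairing_superset gen_closed h) (auto simp: gen_def)
  also have "\<dots> = h a" using funcset_mem[OF h a] by (simp add: gen_def)
  finally show ?thesis .
qed

lemma pairing_zero: "pairing K \<zero>\<^bsub>KA\<^esub> h = \<zero>\<^bsub>K\<^esub>"
  by (simp add: pairing_def formal_sum_simps)

lemma pairing_const_zero: "u \<in> carrier KA \<Longrightarrow> pairing K u (\<lambda>a. \<zero>\<^bsub>K\<^esub>) = \<zero>\<^bsub>K\<^esub>"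
  unfolding pairing_def by (intro K.add.finprod_one_eqI) (simp add: formal_sum_iff)

lemma pairing_fun_add:
  assumes u: "u \<in> carrier KA" and h: "h \<in> carrier A \<rightarrow> carrier K" "h' \<in> carrier A \<rightarrow> carrier K"
  shows "pairing K u (\<lambda>a. h a \<oplus>\<^bsub>K\<^esub> h' a) = pairing K u h \<oplus>\<^bsub>K\<^esub> pairing K u h'"
proof -
  let ?S = "{a. u a \<noteq> \<zero>\<^bsub>K\<^esub>}"
  have S: "?S \<subseteq> carrier A" using u by (rule support_subset)
  have "pairing K u (\<lambda>a. h a \<oplus>\<^bsub>K\<^esub> h' a) = (\<Oplus>\<^bsub>K\<^esub>a \<in> ?S. u a \<otimes>\<^bsub>K\<^esub> h a \<oplus>\<^bsub>K\<^esub> u a \<otimes>\<^bsub>K\<^esub> h' a)"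
    unfolding pairing_def
    using S u h by (intro K.finsum_cong') (auto simp: formal_sum_iff K.r_distr Pi_iff subset_iff)
  also have "\<dots> = pairing K u h \<oplus>\<^bsub>K\<^esub> pairing K u h'"
    unfolding pairing_def using S u h by (intro K.finsum_addf) (auto simp: formal_sum_iff Pi_iff subset_iff)
  finally show ?thesis .
qed

lemma pairing_fun_smult:
  assumes u: "u \<in> carrier KA" and h: "h \<in> carrier A \<rightarrow> carrier K" and k: "k \<in> carrier K"
  shows "pairing K u (\<lambda>a. k \<otimes>\<^bsub>K\<^esub> h a) = k \<otimes>\<^bsub>K\<^esub> pairing K u h"
proof -
  let ?S = "{a. u a \<noteq> \<zero>\<^bsub>K\<^esub>}"
  have S: "?S \<subseteq> carrier A" "finite ?S" using u by (auto simp: formal_sum_iff)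
  have "pairing K u (\<lambda>a. k \<otimes>\<^bsub>K\<^esub> h a) = (\<Oplus>\<^bsub>K\<^esub>a \<in> ?S. k \<otimes>\<^bsub>K\<^esub> (u a \<otimes>\<^bsub>K\<^esub> h a))"
    unfolding pairing_def
    using S u h k by (intro K.finsum_cong') (auto simp: formal_sum_iff K.m_lcomm Pi_iff subset_iff)
  also have "\<dots> = k \<otimes>\<^bsub>K\<^esub> pairing K u h"
    unfolding pairing_def using S u h k by (intro K.finsum_rdistr[symmetric]) (auto simp: formal_sum_iff Pi_iff subset_iff)
  finally show ?thesis .
qed

lemma pairing_swap:
  assumes u: "u \<in> carrier KA" and v: "v \<in> carrier (monoid_alg K B)" and B: "ring B"
    and H: "\<And>a b. a \<in> carrier A \<Longrightarrow> b \<in> carrier B \<Longrightarrow> H a b \<in> carrier K"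
  shows "pairing K u (\<lambda>a. pairing K v (H a)) = pairing K v (\<lambda>b. pairing K u (\<lambda>a. H a b))"
proof -
  interpret B: formal_sums K B using B by (intro formal_sums.intro K.is_cring)
  let ?S = "{a. u a \<noteq> \<zero>\<^bsub>K\<^esub>}" and ?T = "{b. v b \<noteq> \<zero>\<^bsub>K\<^esub>}"
  have S: "?S \<subseteq> carrier A" "finite ?S" "\<And>a. u a \<in> carrier K" using u by (auto simp: formal_sum_iff)
  have T: "?T \<subseteq> carrier B" "finite ?T" "\<And>a. v a \<in> carrier K" using v by (auto simp: B.formal_sum_iff)
  have "pairing K u (\<lambda>a. pairing K v (H a)) = (\<Oplus>\<^bsub>K\<^esub>a \<in> ?S. \<Oplus>\<^bsub>K\<^esub>b \<in> ?T. u a \<otimes>\<^bsub>K\<^esub> (v b \<otimes>\<^bsub>K\<^esub> H a b))"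
    unfolding pairing_def using S T H
    by (intro K.finsum_cong' refl K.finsum_rdistr) (auto simp: Pi_iff subset_iff intro!: K.finsum_closed)
  also have "\<dots> = (\<Oplus>\<^bsub>K\<^esub>b \<in> ?T. \<Oplus>\<^bsub>K\<^esub>a \<in> ?S. u a \<otimes>\<^bsub>K\<^esub> (v b \<otimes>\<^bsub>K\<^esub> H a b))"
    using S T H by (intro K.finsum_swap) (auto simp: subset_iff)
  also have "\<dots> = (\<Oplus>\<^bsub>K\<^esub>b \<in> ?T. \<Oplus>\<^bsub>K\<^esub>a \<in> ?S. v b \<otimes>\<^bsub>K\<^esub> (u a \<otimes>\<^bsub>K\<^esub> H a b))"
    using S T H by (intro K.finsum_cong' refl) (auto simp: Pi_iff subset_iff K.m_lcomm intro!: K.finsum_closed)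
  also have "\<dots> = pairing K v (\<lambda>b. pairing K u (\<lambda>a. H a b))"
    unfolding pairing_def using S T H
    by (intro K.finsum_cong' refl K.finsum_rdistr[symmetric]) (auto simp: Pi_iff subset_iff intro!: K.finsum_closed)
  finally show ?thesis .
qed

text \<open>Equalities of formal sums are tested by pairing. This avoids the convolution formula for products:
  by \<open>pairing_mult\<close>, the pairing of a product is an iterated pairing, and associativity and
  distributivity in \<open>K[A]\<close> become associativity and distributivity in \<open>A\<close>.\<close>

lemma formal_sum_eqI:
  assumes u: "u \<in> carrier KA" and v: "v \<in> carrier KA"
    and eq: "\<And>h. h \<in> carrier A \<rightarrow> carrier K \<Longrightarrow> pairing K u h = pairing K v h"
  shows "u = v"
proof
  fix c
  have coeff: "pairing K w (gen K c) = w c" if w: "w \<in> carrier KA" and c: "c \<in> carrier A" for w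
  proof -
    let ?S = "insert c {a. w a \<noteq> \<zero>\<^bsub>K\<^esub>}"
    have S: "finite ?S" "?S \<subseteq> carrier A" using w c by (auto simp: formal_sum_iff)
    have "pairing K w (gen K c) = (\<Oplus>\<^bsub>K\<^esub>a \<in> ?S. w a \<otimes>\<^bsub>K\<^esub> gen K c a)"
      using w c S by (intro pairing_superset) (auto simp: gen_def)
    also have "\<dots> = (\<Oplus>\<^bsub>K\<^esub>a \<in> ?S. if a = c then w a else \<zero>\<^bsub>K\<^esub>)"
      using w by (intro K.finsum_cong') (auto simp: gen_def formal_sum_iff)
    also have "\<dots> = w c" using w S by (intro K.finsum_delta) (auto simp: formal_sum_iff)
    finally show ?thesis .
  qed
  show "u c = v c"
  proof (cases "c \<in> carrier A")
    case True
    then show ?thesis using coeff[OF u] coeff[OF v] eq[of "gen K c"] by (auto simp: gen_def)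
  next
    case False
    then show ?thesis using u v by (simp add: formal_sum_iff)
  qed
qed

lemma mult_closed_pairing:
  assumes u: "u \<in> carrier KA" and v: "v \<in> carrier KA"
  shows mult_closed: "u \<otimes>\<^bsub>KA\<^esub> v \<in> carrier KA"
    and pairing_mult: "h \<in> carrier A \<rightarrow> carrier K \<Longrightarrow>
      pairing K (u \<otimes>\<^bsub>KA\<^esub> v) h = pairing K u (\<lambda>a. pairing K v (\<lambda>b. h (a \<otimes>\<^bsub>A\<^esub> b)))"
proof -
  let ?S = "{a. u a \<noteq> \<zero>\<^bsub>K\<^esub>}" and ?T = "{b. v b \<noteq> \<zero>\<^bsub>K\<^esub>}"
  let ?m = "\<lambda>p. fst p \<otimes>\<^bsub>A\<^esub> snd p" and ?w = "\<lambda>p. u (fst p) \<otimes>\<^bsub>K\<^esub> v (snd p)"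
  have S: "?S \<subseteq> carrier A" "finite ?S" "\<And>a. u a \<in> carrier K" using u by (auto simp: formal_sum_iff)
  have T: "?T \<subseteq> carrier A" "finite ?T" "\<And>a. v a \<in> carrier K" using v by (auto simp: formal_sum_iff)
  have uv: "(u \<otimes>\<^bsub>KA\<^esub> v) c = (\<Oplus>\<^bsub>K\<^esub>p \<in> {p \<in> ?S \<times> ?T. ?m p = c}. ?w p)" for c
  proof -
    have "{(a, b). u a \<noteq> \<zero>\<^bsub>K\<^esub> \<and> v b \<noteq> \<zero>\<^bsub>K\<^esub> \<and> a \<otimes>\<^bsub>A\<^esub> b = c} = {p \<in> ?S \<times> ?T. ?m p = c}" by auto
    then show ?thesis by (simp add: monoid_alg_def)
  qed
  have fin: "finite (?m ` (?S \<times> ?T))" and sub: "?m ` (?S \<times> ?T) \<subseteq> carrier A"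
    using S T by (auto simp: subset_iff)
  have supp: "{c. (u \<otimes>\<^bsub>KA\<^esub> v) c \<noteq> \<zero>\<^bsub>K\<^esub>} \<subseteq> ?m ` (?S \<times> ?T)"
  proof (intro subsetI, rule ccontr)
    fix c assume c: "c \<in> {c. (u \<otimes>\<^bsub>KA\<^esub> v) c \<noteq> \<zero>\<^bsub>K\<^esub>}" "c \<notin> ?m ` (?S \<times> ?T)"
    have "?m p \<noteq> c" if "p \<in> ?S \<times> ?T" for p using c(2) imageI[OF that, of ?m] by metis
    then have "{p \<in> ?S \<times> ?T. ?m p = c} = {}" by (simp only: Collect_empty_eq) metis
    then have "(u \<otimes>\<^bsub>KA\<^esub> v) c = \<zero>\<^bsub>K\<^esub>" by (simp only: uv K.finsum_empty)
    then show False using c(1) by simp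
  qed
  show closed: "u \<otimes>\<^bsub>KA\<^esub> v \<in> carrier KA"
    unfolding formal_sum_iff
  proof (intro conjI allI impI)
    show "(u \<otimes>\<^bsub>KA\<^esub> v) c \<in> carrier K" for c
      unfolding uv using S T by (intro K.finsum_closed) auto
    show "(u \<otimes>\<^bsub>KA\<^esub> v) c = \<zero>\<^bsub>K\<^esub>" if "c \<notin> carrier A" for c
      using supp sub that by blast
    show "finite {c. (u \<otimes>\<^bsub>KA\<^esub> v) c \<noteq> \<zero>\<^bsub>K\<^esub>}" using supp fin by (rule finite_subset)
  qed
  assume h: "h \<in> carrier A \<rightarrow> carrier K"
  have hc: "h (a \<otimes>\<^bsub>A\<^esub> b) \<in> carrier K" if "a \<in> ?S" "b \<in> ?T" for a b
    using that S(1) T(1) by (intro funcset_mem[OF h] A.m_closed) auto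
  have "pairing K (u \<otimes>\<^bsub>KA\<^esub> v) h = (\<Oplus>\<^bsub>K\<^esub>c \<in> ?m ` (?S \<times> ?T). (u \<otimes>\<^bsub>KA\<^esub> v) c \<otimes>\<^bsub>K\<^esub> h c)"
    by (rule pairing_superset[OF closed h fin supp sub])
  also have "\<dots> = (\<Oplus>\<^bsub>K\<^esub>c \<in> ?m ` (?S \<times> ?T). \<Oplus>\<^bsub>K\<^esub>p \<in> {p \<in> ?S \<times> ?T. ?m p = c}. ?w p \<otimes>\<^bsub>K\<^esub> h (?m p))"
  proof (rule K.finsum_cong'[OF refl])
    show "(\<lambda>c. \<Oplus>\<^bsub>K\<^esub>p \<in> {p \<in> ?S \<times> ?T. ?m p = c}. ?w p \<otimes>\<^bsub>K\<^esub> h (?m p)) \<in> ?m ` (?S \<times> ?T) \<rightarrow> carrier K"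
      using S T hc by (intro Pi_I K.finsum_closed) auto
    fix c assume c: "c \<in> ?m ` (?S \<times> ?T)"
    then have c': "h c \<in> carrier K" using sub h by auto
    have "(u \<otimes>\<^bsub>KA\<^esub> v) c \<otimes>\<^bsub>K\<^esub> h c = (\<Oplus>\<^bsub>K\<^esub>p \<in> {p \<in> ?S \<times> ?T. ?m p = c}. ?w p \<otimes>\<^bsub>K\<^esub> h c)"
      unfolding uv using S T c' by (intro K.finsum_ldistr) auto
    also have "\<dots> = (\<Oplus>\<^bsub>K\<^esub>p \<in> {p \<in> ?S \<times> ?T. ?m p = c}. ?w p \<otimes>\<^bsub>K\<^esub> h (?m p))"
      using S T hc by (intro K.finsum_cong' refl) auto
    finally show "(u \<otimes>\<^bsub>KA\<^esub> v) c \<otimes>\<^bsub>K\<^esub> h c = (\<Oplus>\<^bsub>K\<^esub>p \<in> {p \<in> ?S \<times> ?T. ?m p = c}. ?w p \<otimes>\<^bsub>K\<^esub> h (?m p))" .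
  qed
  also have "\<dots> = (\<Oplus>\<^bsub>K\<^esub>p \<in> ?S \<times> ?T. ?w p \<otimes>\<^bsub>K\<^esub> h (?m p))"
    using S T hc by (intro K.finsum_fibres) auto
  also have "\<dots> = (\<Oplus>\<^bsub>K\<^esub>a \<in> ?S. \<Oplus>\<^bsub>K\<^esub>b \<in> ?T. (u a \<otimes>\<^bsub>K\<^esub> v b) \<otimes>\<^bsub>K\<^esub> h (a \<otimes>\<^bsub>A\<^esub> b))"
    using S T hc by (intro K.finsum_Times[symmetric]) auto
  also have "\<dots> = pairing K u (\<lambda>a. pairing K v (\<lambda>b. h (a \<otimes>\<^bsub>A\<^esub> b)))"
    unfolding pairing_def
  proof (intro K.finsum_cong' refl)
    show "(\<lambda>a. u a \<otimes>\<^bsub>K\<^esub> (\<Oplus>\<^bsub>K\<^esub>b \<in> ?T. v b \<otimes>\<^bsub>K\<^esub> h (a \<otimes>\<^bsub>A\<^esub> b))) \<in> ?S \<rightarrow> carrier K"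
      using S T hc by (intro Pi_I K.m_closed K.finsum_closed) auto
    fix a assume a: "a \<in> ?S"
    have "(\<Oplus>\<^bsub>K\<^esub>b \<in> ?T. (u a \<otimes>\<^bsub>K\<^esub> v b) \<otimes>\<^bsub>K\<^esub> h (a \<otimes>\<^bsub>A\<^esub> b)) = (\<Oplus>\<^bsub>K\<^esub>b \<in> ?T. u a \<otimes>\<^bsub>K\<^esub> (v b \<otimes>\<^bsub>K\<^esub> h (a \<otimes>\<^bsub>A\<^esub> b)))"
      using S T hc a by (intro K.finsum_cong' refl) (auto simp: K.m_assoc)
    also have "\<dots> = u a \<otimes>\<^bsub>K\<^esub> (\<Oplus>\<^bsub>K\<^esub>b \<in> ?T. v b \<otimes>\<^bsub>K\<^esub> h (a \<otimes>\<^bsub>A\<^esub> b))"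
      using S T hc a by (intro K.finsum_rdistr[symmetric]) auto
    finally show "(\<Oplus>\<^bsub>K\<^esub>b \<in> ?T. (u a \<otimes>\<^bsub>K\<^esub> v b) \<otimes>\<^bsub>K\<^esub> h (a \<otimes>\<^bsub>A\<^esub> b)) = u a \<otimes>\<^bsub>K\<^esub> (\<Oplus>\<^bsub>K\<^esub>b \<in> ?T. v b \<otimes>\<^bsub>K\<^esub> h (a \<otimes>\<^bsub>A\<^esub> b))" .
  qed
  finally show "pairing K (u \<otimes>\<^bsub>KA\<^esub> v) h = pairing K u (\<lambda>a. pairing K v (\<lambda>b. h (a \<otimes>\<^bsub>A\<^esub> b)))" .
qed

lemma monoid_alg_ring: "ring KA"
proof (rule ringI)
  show "abelian_group KA"
  proof (rule abelian_groupI)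
    show "\<exists>v \<in> carrier KA. v \<oplus>\<^bsub>KA\<^esub> u = \<zero>\<^bsub>KA\<^esub>" if u: "u \<in> carrier KA" for u
    proof
      show "(\<ominus>\<^bsub>K\<^esub> \<one>\<^bsub>K\<^esub>) \<odot>\<^bsub>KA\<^esub> u \<in> carrier KA" using u by (intro smult_closed) auto
      show "(\<ominus>\<^bsub>K\<^esub> \<one>\<^bsub>K\<^esub>) \<odot>\<^bsub>KA\<^esub> u \<oplus>\<^bsub>KA\<^esub> u = \<zero>\<^bsub>KA\<^esub>"
        using u by (auto simp: formal_sum_simps formal_sum_iff K.l_minus K.l_neg)
    qed
  qed (use add_closed zero_closed in \<open>auto simp: formal_sum_simps(2-) formal_sum_iff K.a_ac\<close>)
  show "Group.monoid KA"
  proof (rule monoidI)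
    fix u v w assume u: "u \<in> carrier KA" and v: "v \<in> carrier KA" and w: "w \<in> carrier KA"
    show "u \<otimes>\<^bsub>KA\<^esub> v \<otimes>\<^bsub>KA\<^esub> w = u \<otimes>\<^bsub>KA\<^esub> (v \<otimes>\<^bsub>KA\<^esub> w)"
    proof (rule formal_sum_eqI)
      fix h assume h: "h \<in> carrier A \<rightarrow> carrier K"
      have "pairing K (u \<otimes>\<^bsub>KA\<^esub> v \<otimes>\<^bsub>KA\<^esub> w) h
          = pairing K u (\<lambda>a. pairing K v (\<lambda>b. pairing K w (\<lambda>c. h (a \<otimes>\<^bsub>A\<^esub> b \<otimes>\<^bsub>A\<^esub> c))))"
        using u v w h by (simp add: mult_closed pairing_mult pairing_closed Pi_iff)
      also have "\<dots> = pairing K u (\<lambda>a. pairing K v (\<lambda>b. pairing K w (\<lambda>c. h (a \<otimes>\<^bsub>A\<^esub> (b \<otimes>\<^bsub>A\<^esub> c)))))"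
        using h by (intro pairing_cong u v w) (simp_all add: A.m_assoc pairing_closed u v w Pi_iff)
      also have "\<dots> = pairing K u (\<lambda>a. pairing K (v \<otimes>\<^bsub>KA\<^esub> w) (\<lambda>b. h (a \<otimes>\<^bsub>A\<^esub> b)))"
        using h by (intro pairing_cong u) (simp_all add: pairing_mult mult_closed pairing_closed u v w Pi_iff)
      also have "\<dots> = pairing K (u \<otimes>\<^bsub>KA\<^esub> (v \<otimes>\<^bsub>KA\<^esub> w)) h"
        by (simp add: mult_closed pairing_mult u v w h)
      finally show "pairing K (u \<otimes>\<^bsub>KA\<^esub> v \<otimes>\<^bsub>KA\<^esub> w) h = pairing K (u \<otimes>\<^bsub>KA\<^esub> (v \<otimes>\<^bsub>KA\<^esub> w)) h" .
    qed (simp_all add: mult_closed u v w)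
  next
    fix u assume u: "u \<in> carrier KA"
    have one: "gen K \<one>\<^bsub>A\<^esub> \<in> carrier KA" by (simp add: gen_closed)
    show "\<one>\<^bsub>KA\<^esub> \<otimes>\<^bsub>KA\<^esub> u = u"
    proof (rule formal_sum_eqI)
      fix h assume h: "h \<in> carrier A \<rightarrow> carrier K"
      have "pairing K (\<one>\<^bsub>KA\<^esub> \<otimes>\<^bsub>KA\<^esub> u) h = pairing K u (\<lambda>b. h (\<one>\<^bsub>A\<^esub> \<otimes>\<^bsub>A\<^esub> b))"
        using u one h by (simp add: formal_sum_simps(1) pairing_mult pairing_gen pairing_closed Pi_iff)
      also have "\<dots> = pairing K u h" using u h by (intro pairing_cong) (simp_all add: Pi_iff)
      finally show "pairing K (\<one>\<^bsub>KA\<^esub> \<otimes>\<^bsub>KA\<^esub> u) h = pairing K u h" .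
    qed (simp_all add: mult_closed u one formal_sum_simps(1))
    show "u \<otimes>\<^bsub>KA\<^esub> \<one>\<^bsub>KA\<^esub> = u"
    proof (rule formal_sum_eqI)
      fix h assume h: "h \<in> carrier A \<rightarrow> carrier K"
      have "pairing K (u \<otimes>\<^bsub>KA\<^esub> \<one>\<^bsub>KA\<^esub>) h = pairing K u (\<lambda>a. pairing K (gen K \<one>\<^bsub>A\<^esub>) (\<lambda>b. h (a \<otimes>\<^bsub>A\<^esub> b)))"
        using u one h by (simp add: formal_sum_simps(1) pairing_mult)
      also have "\<dots> = pairing K u h" using u h by (intro pairing_cong) (simp_all add: Pi_iff pairing_gen)
      finally show "pairing K (u \<otimes>\<^bsub>KA\<^esub> \<one>\<^bsub>KA\<^esub>) h = pairing K u h" .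
    qed (simp_all add: mult_closed u one formal_sum_simps(1))
  qed (simp_all add: mult_closed formal_sum_simps(1) gen_closed)
  fix u v w assume u: "u \<in> carrier KA" and v: "v \<in> carrier KA" and w: "w \<in> carrier KA"
  show "(u \<oplus>\<^bsub>KA\<^esub> v) \<otimes>\<^bsub>KA\<^esub> w = u \<otimes>\<^bsub>KA\<^esub> w \<oplus>\<^bsub>KA\<^esub> v \<otimes>\<^bsub>KA\<^esub> w"
    by (rule formal_sum_eqI) (simp_all add: u v w mult_closed add_closed pairing_add pairing_mult pairing_closed Pi_iff)
  show "w \<otimes>\<^bsub>KA\<^esub> (u \<oplus>\<^bsub>KA\<^esub> v) = w \<otimes>\<^bsub>KA\<^esub> u \<oplus>\<^bsub>KA\<^esub> w \<otimes>\<^bsub>KA\<^esub> v"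
  proof (rule formal_sum_eqI)
    fix h assume h: "h \<in> carrier A \<rightarrow> carrier K"
    have "pairing K (w \<otimes>\<^bsub>KA\<^esub> (u \<oplus>\<^bsub>KA\<^esub> v)) h
        = pairing K w (\<lambda>a. pairing K u (\<lambda>b. h (a \<otimes>\<^bsub>A\<^esub> b)) \<oplus>\<^bsub>K\<^esub> pairing K v (\<lambda>b. h (a \<otimes>\<^bsub>A\<^esub> b)))"
      unfolding pairing_mult[OF w add_closed[OF u v] h]
      using h by (intro pairing_cong w) (simp_all add: pairing_add u v pairing_closed Pi_iff)
    also have "\<dots> = pairing K (w \<otimes>\<^bsub>KA\<^esub> u) h \<oplus>\<^bsub>K\<^esub> pairing K (w \<otimes>\<^bsub>KA\<^esub> v) h"
      unfolding pairing_mult[OF w u h] pairing_mult[OF w v h]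
      using h by (intro pairing_fun_add w) (simp_all add: u v pairing_closed Pi_iff)
    also have "\<dots> = pairing K (w \<otimes>\<^bsub>KA\<^esub> u \<oplus>\<^bsub>KA\<^esub> w \<otimes>\<^bsub>KA\<^esub> v) h"
      by (simp add: pairing_add mult_closed u v w h)
    finally show "pairing K (w \<otimes>\<^bsub>KA\<^esub> (u \<oplus>\<^bsub>KA\<^esub> v)) h = pairing K (w \<otimes>\<^bsub>KA\<^esub> u \<oplus>\<^bsub>KA\<^esub> w \<otimes>\<^bsub>KA\<^esub> v) h" .
  qed (simp_all add: u v w mult_closed add_closed)
qed

end

section \<open>Extension of scalars, seen through semilinear functionals\<close>

text \<open>For a homomorphism \<open>\<iota> : F \<rightarrow> K\<close> of fields these are the restrictions to \<open>A\<close> of the \<open>K\<close>-linear forms on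
  \<open>A \<otimes>\<^sub>F K\<close>.\<close>

definition semilinear :: "'f ring \<Rightarrow> 'k ring \<Rightarrow> ('f \<Rightarrow> 'k) \<Rightarrow> ('f, 'a) module \<Rightarrow> ('a \<Rightarrow> 'k) set" where
  "semilinear F K \<iota> A = {l \<in> carrier A \<rightarrow> carrier K.
     (\<forall>x \<in> carrier A. \<forall>y \<in> carrier A. l (x \<oplus>\<^bsub>A\<^esub> y) = l x \<oplus>\<^bsub>K\<^esub> l y) \<and>
     (\<forall>c \<in> carrier F. \<forall>x \<in> carrier A. l (c \<odot>\<^bsub>A\<^esub> x) = \<iota> c \<otimes>\<^bsub>K\<^esub> l x)}"

abbreviation functionals :: "'f ring \<Rightarrow> ('f, 'a) module \<Rightarrow> ('a \<Rightarrow> 'f) set" where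
  "functionals F V \<equiv> semilinear F F (\<lambda>x. x) V"

lemma semilinear_fun: "l \<in> semilinear F K \<iota> A \<Longrightarrow> l \<in> carrier A \<rightarrow> carrier K"
  and semilinear_closed: "l \<in> semilinear F K \<iota> A \<Longrightarrow> x \<in> carrier A \<Longrightarrow> l x \<in> carrier K"
  and semilinear_add: "l \<in> semilinear F K \<iota> A \<Longrightarrow> x \<in> carrier A \<Longrightarrow> y \<in> carrier A \<Longrightarrow> l (x \<oplus>\<^bsub>A\<^esub> y) = l x \<oplus>\<^bsub>K\<^esub> l y"
  and semilinear_smult: "l \<in> semilinear F K \<iota> A \<Longrightarrow> c \<in> carrier F \<Longrightarrow> x \<in> carrier A \<Longrightarrow> l (c \<odot>\<^bsub>A\<^esub> x) = \<iota> c \<otimes>\<^bsub>K\<^esub> l x"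
  by (auto simp: semilinear_def)

lemma semilinearI:
  assumes "\<And>x. x \<in> carrier A \<Longrightarrow> l x \<in> carrier K"
    and "\<And>x y. x \<in> carrier A \<Longrightarrow> y \<in> carrier A \<Longrightarrow> l (x \<oplus>\<^bsub>A\<^esub> y) = l x \<oplus>\<^bsub>K\<^esub> l y"
    and "\<And>c x. c \<in> carrier F \<Longrightarrow> x \<in> carrier A \<Longrightarrow> l (c \<odot>\<^bsub>A\<^esub> x) = \<iota> c \<otimes>\<^bsub>K\<^esub> l x"
  shows "l \<in> semilinear F K \<iota> A"
  using assms by (auto simp: semilinear_def)

lemma module_homI:
  assumes "\<And>x. x \<in> carrier A \<Longrightarrow> l x \<in> carrier B"
    and "\<And>x y. x \<in> carrier A \<Longrightarrow> y \<in> carrier A \<Longrightarrow> l (x \<oplus>\<^bsub>A\<^esub> y) = l x \<oplus>\<^bsub>B\<^esub> l y"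
    and "\<And>c x. c \<in> carrier F \<Longrightarrow> x \<in> carrier A \<Longrightarrow> l (c \<odot>\<^bsub>A\<^esub> x) = c \<odot>\<^bsub>B\<^esub> l x"
  shows "l \<in> module_hom F A B"
  using assms by (auto simp: module_hom_def)

lemma module_hom_mem: "f \<in> module_hom F A B \<Longrightarrow> x \<in> carrier A \<Longrightarrow> f x \<in> carrier B"
  by (auto simp: module_hom_def)

lemma semilinear_comp:
  assumes "l \<in> semilinear F K \<iota> B" "\<phi> \<in> module_hom F A B"
  shows "(\<lambda>a. l (\<phi> a)) \<in> semilinear F K \<iota> A"
  by (rule semilinearI) (use assms in \<open>auto simp: semilinear_closed semilinear_add semilinear_smult
        module_hom_add module_hom_smult module_hom_mem\<close>)

text \<open>A dual basis without the condition of independence. In contrast to a basis it passes to a corner: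
  if the \<open>d k\<close> belong to a frame of \<open>A\<close>, then the \<open>e (d k) e\<close> belong to a frame of \<open>eAe\<close>.\<close>

definition finite_frame :: "'f ring \<Rightarrow> ('f, 'a) module \<Rightarrow> bool" where
  "finite_frame F A \<longleftrightarrow> (\<exists>(N :: nat) d c.
     (\<forall>k < N. d k \<in> carrier A \<and> c k \<in> functionals F A) \<and>
     (\<forall>x \<in> carrier A. x = (\<Oplus>\<^bsub>A\<^esub>k \<in> {..<N}. c k x \<odot>\<^bsub>A\<^esub> d k)))"

locale scalar_extension = A: field_algebra F A + K: field K
  for F :: "'f ring" and A :: "('f, 'a) module" and K :: "'k ring" +
  fixes \<iota> :: "'f \<Rightarrow> 'k"
  assumes iota: "\<iota> \<in> ring_hom F K"
    and frame: "finite_frame F A"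
begin

sublocale formal_sums K A
  by unfold_locales

abbreviation AK where "AK \<equiv> base_change F K \<iota> A"
abbreviation J where "J \<equiv> tensor_ideal F K \<iota> A"
abbreviation dual where "dual \<equiv> semilinear F K \<iota> A"

lemma iota_closed: "c \<in> carrier F \<Longrightarrow> \<iota> c \<in> carrier K"
  using iota by (rule ring_hom_closed)

lemma monoid_alg_module: "module K KA"
proof (rule moduleI)
  show "abelian_group KA" using monoid_alg_ring by (rule ring.is_abelian_group)
  show "k \<odot>\<^bsub>KA\<^esub> u \<in> carrier KA" if "k \<in> carrier K" "u \<in> carrier KA" for k u using that by (rule smult_closed)
qed (auto simp: formal_sum_simps K.is_cring formal_sum_iff K.l_distr K.r_distr K.m_assoc)

sublocale KA: ring KA by (rule monoid_alg_ring)
sublocale KAm: module K KA by (rule monoid_alg_module)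

lemma formal_sum_induct [consumes 1, case_names zero add]:
  assumes "u \<in> carrier KA" and "P \<zero>\<^bsub>KA\<^esub>"
    and add: "\<And>v k a. v \<in> carrier KA \<Longrightarrow> P v \<Longrightarrow> k \<in> carrier K \<Longrightarrow> a \<in> carrier A \<Longrightarrow> P (k \<odot>\<^bsub>KA\<^esub> gen K a \<oplus>\<^bsub>KA\<^esub> v)"
  shows "P u"
  using assms(1)
proof (induction "card {a. u a \<noteq> \<zero>\<^bsub>K\<^esub>}" arbitrary: u)
  case 0
  then have "u = \<zero>\<^bsub>KA\<^esub>" by (auto simp: formal_sum_iff formal_sum_simps)
  then show ?case using assms(2) by simp
next
  case (Suc n)
  then have fin: "finite {a. u a \<noteq> \<zero>\<^bsub>K\<^esub>}" by (simp add: formal_sum_iff)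
  from Suc(2) obtain a where a: "u a \<noteq> \<zero>\<^bsub>K\<^esub>"
    by (metis (mono_tags, lifting) Collect_empty_eq card.empty nat.distinct(1))
  define v where "v = u(a := \<zero>\<^bsub>K\<^esub>)"
  have sv: "{b. v b \<noteq> \<zero>\<^bsub>K\<^esub>} = {b. u b \<noteq> \<zero>\<^bsub>K\<^esub>} - {a}" by (auto simp: v_def)
  have v: "v \<in> carrier KA" using Suc(3) fin unfolding formal_sum_iff sv by (auto simp: v_def)
  have "P v" using Suc(2) fin a v by (intro Suc(1)) (simp_all add: sv card_Diff_singleton)
  moreover have "a \<in> carrier A" "u a \<in> carrier K" using Suc(3) a by (auto simp: formal_sum_iff)
  moreover have "u = u a \<odot>\<^bsub>KA\<^esub> gen K a \<oplus>\<^bsub>KA\<^esub> v"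
    using Suc(3) by (auto simp: v_def formal_sum_simps gen_def formal_sum_iff)
  ultimately show ?case using add[OF v] by metis
qed

text \<open>The following closure properties of the dual make its annihilator in \<open>K[A]\<close> a two-sided ideal
  and allow iterated evaluation.\<close>

lemma dual_mult_left: "l \<in> dual \<Longrightarrow> a \<in> carrier A \<Longrightarrow> (\<lambda>b. l (a \<otimes>\<^bsub>A\<^esub> b)) \<in> dual"
  by (rule semilinearI) (auto simp: semilinear_closed semilinear_add semilinear_smult A.r_distr A.smult_mult_right)

lemma dual_mult_right: "l \<in> dual \<Longrightarrow> b \<in> carrier A \<Longrightarrow> (\<lambda>a. l (a \<otimes>\<^bsub>A\<^esub> b)) \<in> dual"
  by (rule semilinearI) (auto simp: semilinear_closed semilinear_add semilinear_smult A.l_distr A.smult_mult_left)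

lemma dual_pairing:
  assumes B: "ring B" and v: "v \<in> carrier (monoid_alg K B)"
    and H: "\<And>b. b \<in> carrier B \<Longrightarrow> (\<lambda>a. H a b) \<in> dual"
  shows "(\<lambda>a. pairing K v (H a)) \<in> dual"
proof -
  interpret B: formal_sums K B using B by (intro formal_sums.intro K.is_cring)
  have Hc: "H a b \<in> carrier K" if "a \<in> carrier A" "b \<in> carrier B" for a b
    using semilinear_closed[OF H[OF that(2)] that(1)] .
  then have Hf: "H a \<in> carrier B \<rightarrow> carrier K" if "a \<in> carrier A" for a using that by auto
  show ?thesis
  proof (rule semilinearI)
    fix x y assume x: "x \<in> carrier A" and y: "y \<in> carrier A"
    have "pairing K v (H (x \<oplus>\<^bsub>A\<^esub> y)) = pairing K v (\<lambda>b. H x b \<oplus>\<^bsub>K\<^esub> H y b)"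
      using x y by (intro B.pairing_cong v) (auto simp: semilinear_add[OF H] Hc)
    then show "pairing K v (H (x \<oplus>\<^bsub>A\<^esub> y)) = pairing K v (H x) \<oplus>\<^bsub>K\<^esub> pairing K v (H y)"
      using x y by (simp add: B.pairing_fun_add v Hf)
  next
    fix c x assume c: "c \<in> carrier F" and x: "x \<in> carrier A"
    have "pairing K v (H (c \<odot>\<^bsub>A\<^esub> x)) = pairing K v (\<lambda>b. \<iota> c \<otimes>\<^bsub>K\<^esub> H x b)"
      using x c by (intro B.pairing_cong v) (auto simp: semilinear_smult[OF H] Hc iota_closed)
    then show "pairing K v (H (c \<odot>\<^bsub>A\<^esub> x)) = \<iota> c \<otimes>\<^bsub>K\<^esub> pairing K v (H x)"
      using x c by (simp add: B.pairing_fun_smult v Hf iota_closed)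
  qed (simp add: B.pairing_closed v Hf)
qed

lemma dual_iota:
  assumes "c \<in> functionals F A" shows "(\<lambda>a. \<iota> (c a)) \<in> dual"
  by (rule semilinearI) (use assms in \<open>auto simp: semilinear_closed semilinear_add semilinear_smult
        ring_hom_add[OF iota] ring_hom_mult[OF iota] iota_closed\<close>)

abbreviation relations where
  "relations \<equiv> {gen K (a \<oplus>\<^bsub>A\<^esub> b) \<ominus>\<^bsub>KA\<^esub> (gen K a \<oplus>\<^bsub>KA\<^esub> gen K b) | a b. a \<in> carrier A \<and> b \<in> carrier A} \<union>
      {gen K (c \<odot>\<^bsub>A\<^esub> a) \<ominus>\<^bsub>KA\<^esub> (\<iota> c \<odot>\<^bsub>KA\<^esub> gen K a) | c a. c \<in> carrier F \<and> a \<in> carrier A}"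

lemma relations_closed: "relations \<subseteq> carrier KA"
  by (auto intro!: KA.minus_closed gen_closed KA.a_closed smult_closed iota_closed)

lemma ideal_J: "ideal J KA"
  unfolding tensor_ideal_def by (rule KA.genideal_ideal[OF relations_closed])

sublocale J: ideal J KA by (rule ideal_J)

lemma relations_J: "relations \<subseteq> J"
  unfolding tensor_ideal_def by (rule KA.genideal_self[OF relations_closed])

lemma pairing_minus:
  assumes "u \<in> carrier KA" "v \<in> carrier KA" "h \<in> carrier A \<rightarrow> carrier K"
  shows "pairing K (u \<ominus>\<^bsub>KA\<^esub> v) h = pairing K u h \<ominus>\<^bsub>K\<^esub> pairing K v h"
proof -
  have "pairing K (u \<ominus>\<^bsub>KA\<^esub> v) h \<oplus>\<^bsub>K\<^esub> pairing K v h = pairing K u h"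
    using assms by (simp add: pairing_add[symmetric] KA.minus_eq KA.a_assoc KA.l_neg)
  then show ?thesis using assms
    by (metis K.minus_closed K.minus_eq K.add.inv_solve_right pairing_closed KA.minus_closed)
qed

text \<open>Semilinear functionals vanish on the defining relations of \<open>A \<otimes>\<^sub>F K\<close>. Their common kernel is a
  two-sided ideal, as \<open>l(a _)\<close> and \<open>l(_ b)\<close> are functionals whenever \<open>l\<close> is one, and hence contains the
  ideal generated by the relations.\<close>

lemma J_annihilated:
  assumes "u \<in> J" "l \<in> dual"
  shows "pairing K u l = \<zero>\<^bsub>K\<^esub>"
proof -
  let ?N = "{u \<in> carrier KA. \<forall>l \<in> dual. pairing K u l = \<zero>\<^bsub>K\<^esub>}"
  have "ideal ?N KA"
  proof (rule idealI)
    show "ring KA" by (rule monoid_alg_ring)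
    show "subgroup ?N (add_monoid KA)"
    proof (rule KA.add.subgroupI)
      show "?N \<noteq> {}" using pairing_zero KA.zero_closed by blast
      show "\<ominus>\<^bsub>KA\<^esub> u \<in> ?N" if u: "u \<in> ?N" for u
      proof -
        have "pairing K (\<ominus>\<^bsub>KA\<^esub> u) l = \<zero>\<^bsub>K\<^esub>" if l: "l \<in> dual" for l
        proof -
          have "\<ominus>\<^bsub>KA\<^esub> u = \<zero>\<^bsub>KA\<^esub> \<ominus>\<^bsub>KA\<^esub> u" using u by (simp add: KA.minus_eq)
          then show ?thesis using u l pairing_minus[of "\<zero>\<^bsub>KA\<^esub>" u l] pairing_zero semilinear_fun[OF l]
            by (simp add: K.minus_eq)
        qed
        then show ?thesis using u by auto
      qed
      show "u \<oplus>\<^bsub>KA\<^esub> v \<in> ?N" if "u \<in> ?N" "v \<in> ?N" for u v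
        using that by (auto simp: pairing_add[OF _ _ semilinear_fun])
    qed auto
  next
    fix u v assume u: "u \<in> ?N" and v: "v \<in> carrier KA"
    have "pairing K (v \<otimes>\<^bsub>KA\<^esub> u) l = \<zero>\<^bsub>K\<^esub>" if l: "l \<in> dual" for l
    proof -
      have "pairing K (v \<otimes>\<^bsub>KA\<^esub> u) l = pairing K v (\<lambda>a. \<zero>\<^bsub>K\<^esub>)"
        using u v l semilinear_fun[OF l] dual_mult_left[OF l]
        by (subst pairing_mult) (auto intro!: pairing_cong)
      then show ?thesis using pairing_const_zero[OF v] by simp
    qed
    then show "v \<otimes>\<^bsub>KA\<^esub> u \<in> ?N" using u v by auto
    have "pairing K (u \<otimes>\<^bsub>KA\<^esub> v) l = \<zero>\<^bsub>K\<^esub>" if l: "l \<in> dual" for l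
    proof -
      have "(\<lambda>a. pairing K v (\<lambda>b. l (a \<otimes>\<^bsub>A\<^esub> b))) \<in> dual"
        by (rule dual_pairing[OF A.ring_axioms v dual_mult_right[OF l]])
      then show ?thesis using u v l semilinear_fun[OF l] by (subst pairing_mult) auto
    qed
    then show "u \<otimes>\<^bsub>KA\<^esub> v \<in> ?N" using u v by auto
  qed
  moreover have "relations \<subseteq> ?N"
  proof
    fix u assume u: "u \<in> relations"
    then have "pairing K u l = \<zero>\<^bsub>K\<^esub>" if l: "l \<in> dual" for l
      using semilinear_fun[OF l] semilinear_closed[OF l]
      by (auto simp: pairing_minus pairing_add pairing_smult pairing_gen gen_closed smult_closed iota_closed
          semilinear_add[OF l] semilinear_smult[OF l] K.minus_eq K.r_neg)
    then show "u \<in> ?N" using u relations_closed by blast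
  qed
  ultimately have "J \<subseteq> ?N" unfolding tensor_ideal_def by (rule KA.genideal_minimal)
  then show ?thesis using assms by blast
qed

lemma smult_eq_mult:
  assumes k: "k \<in> carrier K" and u: "u \<in> carrier KA"
  shows "k \<odot>\<^bsub>KA\<^esub> u = (k \<odot>\<^bsub>KA\<^esub> \<one>\<^bsub>KA\<^esub>) \<otimes>\<^bsub>KA\<^esub> u"
proof (rule formal_sum_eqI)
  fix h assume h: "h \<in> carrier A \<rightarrow> carrier K"
  have one: "gen K \<one>\<^bsub>A\<^esub> \<in> carrier KA" by (simp add: gen_closed)
  have "pairing K ((k \<odot>\<^bsub>KA\<^esub> \<one>\<^bsub>KA\<^esub>) \<otimes>\<^bsub>KA\<^esub> u) h = k \<otimes>\<^bsub>K\<^esub> pairing K u (\<lambda>b. h (\<one>\<^bsub>A\<^esub> \<otimes>\<^bsub>A\<^esub> b))"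
    using k u h one by (simp add: pairing_mult pairing_smult smult_closed pairing_closed Pi_iff pairing_gen formal_sum_simps(1))
  also have "pairing K u (\<lambda>b. h (\<one>\<^bsub>A\<^esub> \<otimes>\<^bsub>A\<^esub> b)) = pairing K u h"
    using u h by (intro pairing_cong) auto
  finally show "pairing K (k \<odot>\<^bsub>KA\<^esub> u) h = pairing K ((k \<odot>\<^bsub>KA\<^esub> \<one>\<^bsub>KA\<^esub>) \<otimes>\<^bsub>KA\<^esub> u) h"
    using k u h by (simp add: pairing_smult)
qed (use assms in \<open>auto simp: smult_closed mult_closed\<close>)

lemma J_smult: "k \<in> carrier K \<Longrightarrow> u \<in> J \<Longrightarrow> k \<odot>\<^bsub>KA\<^esub> u \<in> J"
  using smult_eq_mult[of k u] by (simp add: J.I_l_closed J.a_Hcarr smult_closed)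

definition proj :: "('a \<Rightarrow> 'k) \<Rightarrow> ('a \<Rightarrow> 'k) set" where
  "proj u = J +>\<^bsub>KA\<^esub> u"

lemma proj_eq_J:
  assumes u: "u \<in> carrier KA" and v: "v \<in> carrier KA"
  shows "proj u = proj v \<longleftrightarrow> u \<ominus>\<^bsub>KA\<^esub> v \<in> J"
proof
  {
    assume "proj u = proj v"
    then obtain j where j: "j \<in> J" "u = j \<oplus>\<^bsub>KA\<^esub> v"
      using J.a_rcos_self[OF u] by (auto simp: proj_def a_r_coset_def')
    then show "u \<ominus>\<^bsub>KA\<^esub> v \<in> J" using v J.a_Hcarr[OF j(1)] by (simp add: KA.minus_eq KA.a_assoc KA.r_neg)
  }
  assume uv: "u \<ominus>\<^bsub>KA\<^esub> v \<in> J"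
  have "u = (u \<ominus>\<^bsub>KA\<^esub> v) \<oplus>\<^bsub>KA\<^esub> v" using u v by (simp add: KA.minus_eq KA.a_assoc KA.l_neg)
  then have "u \<in> J +>\<^bsub>KA\<^esub> v" using uv by (auto simp: a_r_coset_def')
  then show "proj u = proj v" unfolding proj_def using KA.a_repr_independence[OF _ v] J.a_subgroup by blast
qed

lemma AK_simps:
  "carrier AK = proj ` carrier KA" "\<one>\<^bsub>AK\<^esub> = proj \<one>\<^bsub>KA\<^esub>" "\<zero>\<^bsub>AK\<^esub> = proj \<zero>\<^bsub>KA\<^esub>"
  "u \<in> carrier KA \<Longrightarrow> v \<in> carrier KA \<Longrightarrow> proj u \<otimes>\<^bsub>AK\<^esub> proj v = proj (u \<otimes>\<^bsub>KA\<^esub> v)"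
  "u \<in> carrier KA \<Longrightarrow> v \<in> carrier KA \<Longrightarrow> proj u \<oplus>\<^bsub>AK\<^esub> proj v = proj (u \<oplus>\<^bsub>KA\<^esub> v)"
proof -
  show "carrier AK = proj ` carrier KA"
    by (auto simp: base_change_def FactRing_def A_RCOSETS_def' proj_def Let_def)
  show "\<one>\<^bsub>AK\<^esub> = proj \<one>\<^bsub>KA\<^esub>" by (simp add: base_change_def FactRing_def proj_def Let_def)
  show "\<zero>\<^bsub>AK\<^esub> = proj \<zero>\<^bsub>KA\<^esub>"
    by (simp add: base_change_def FactRing_def proj_def Let_def KA.a_coset_add_zero J.a_subset)
  show "u \<in> carrier KA \<Longrightarrow> v \<in> carrier KA \<Longrightarrow> proj u \<otimes>\<^bsub>AK\<^esub> proj v = proj (u \<otimes>\<^bsub>KA\<^esub> v)"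
    by (simp add: base_change_def FactRing_def proj_def Let_def J.rcoset_mult_add)
  show "u \<in> carrier KA \<Longrightarrow> v \<in> carrier KA \<Longrightarrow> proj u \<oplus>\<^bsub>AK\<^esub> proj v = proj (u \<oplus>\<^bsub>KA\<^esub> v)"
    by (simp add: base_change_def FactRing_def proj_def Let_def J.a_rcos_sum)
qed

lemma proj_smult_aux:
  assumes k: "k \<in> carrier K" and u: "u \<in> carrier KA" and v: "v \<in> proj u"
  shows "v \<in> carrier KA" "proj (k \<odot>\<^bsub>KA\<^esub> v) = proj (k \<odot>\<^bsub>KA\<^esub> u)"
proof -
  obtain j where j: "j \<in> J" "v = j \<oplus>\<^bsub>KA\<^esub> u" using v by (auto simp: proj_def a_r_coset_def')
  have jc: "j \<in> carrier KA" using j J.a_Hcarr by blast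
  then show vc: "v \<in> carrier KA" using j u by simp
  have "k \<odot>\<^bsub>KA\<^esub> v = k \<odot>\<^bsub>KA\<^esub> j \<oplus>\<^bsub>KA\<^esub> k \<odot>\<^bsub>KA\<^esub> u"
    unfolding j(2) using k jc u by (simp add: KAm.smult_r_distr)
  then have "k \<odot>\<^bsub>KA\<^esub> v \<ominus>\<^bsub>KA\<^esub> k \<odot>\<^bsub>KA\<^esub> u = k \<odot>\<^bsub>KA\<^esub> j"
    using k jc u by (simp add: KA.minus_eq KA.a_assoc KA.r_neg smult_closed)
  then show "proj (k \<odot>\<^bsub>KA\<^esub> v) = proj (k \<odot>\<^bsub>KA\<^esub> u)"
    using J_smult[OF k j(1)] k vc u by (simp add: proj_eq_J smult_closed)
qed

lemma proj_self: "u \<in> carrier KA \<Longrightarrow> u \<in> proj u"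
  unfolding proj_def by (rule J.a_rcos_self)

lemma AK_smult:
  assumes k: "k \<in> carrier K" and u: "u \<in> carrier KA"
  shows "k \<odot>\<^bsub>AK\<^esub> proj u = proj (k \<odot>\<^bsub>KA\<^esub> u)"
proof -
  have "k \<odot>\<^bsub>AK\<^esub> proj u = (\<Union>v \<in> proj u. proj (k \<odot>\<^bsub>KA\<^esub> v))"
    by (simp add: base_change_def Let_def proj_def)
  also have "\<dots> = (\<Union>v \<in> proj u. proj (k \<odot>\<^bsub>KA\<^esub> u))"
    using proj_smult_aux(2)[OF k u] by (intro SUP_cong refl)
  also have "\<dots> = proj (k \<odot>\<^bsub>KA\<^esub> u)" using proj_self[OF u] by auto
  finally show ?thesis .
qed

lemma AK_cases: assumes "x \<in> carrier AK" obtains u where "u \<in> carrier KA" "x = proj u"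
  using assms by (auto simp: AK_simps)

lemma base_change_field_algebra: "field_algebra K AK"
proof -
  note sim = AK_simps(2-) AK_smult KA.a_closed KA.m_closed smult_closed
  have mem: "proj u \<in> carrier AK" if "u \<in> carrier KA" for u using that by (auto simp: AK_simps(1))
  have R: "ring AK"
  proof (rule ringI)
    show "abelian_group AK"
    proof (rule abelian_groupI)
      fix x assume "x \<in> carrier AK"
      then obtain u where u: "u \<in> carrier KA" "x = proj u" by (rule AK_cases)
      then have "proj (\<ominus>\<^bsub>KA\<^esub> u) \<oplus>\<^bsub>AK\<^esub> x = \<zero>\<^bsub>AK\<^esub>" by (simp add: sim KA.l_neg)
      then show "\<exists>y\<in>carrier AK. y \<oplus>\<^bsub>AK\<^esub> x = \<zero>\<^bsub>AK\<^esub>" using mem[of "\<ominus>\<^bsub>KA\<^esub> u"] u(1) by auto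
    qed (auto elim!: AK_cases simp: sim mem KA.a_ac)
    show "Group.monoid AK"
      by (rule monoidI) (auto elim!: AK_cases simp: sim mem KA.m_assoc)
  qed (auto elim!: AK_cases simp: sim mem KA.l_distr KA.r_distr)
  have M: "module K AK"
  proof (rule moduleI)
    show "abelian_group AK" using R by (rule ring.is_abelian_group)
  qed (auto elim!: AK_cases simp: sim mem K.is_cring KAm.smult_l_distr KAm.smult_r_distr KAm.smult_assoc1)
  have assoc: "k \<odot>\<^bsub>KA\<^esub> u \<otimes>\<^bsub>KA\<^esub> v = k \<odot>\<^bsub>KA\<^esub> (u \<otimes>\<^bsub>KA\<^esub> v)"
    if "k \<in> carrier K" "u \<in> carrier KA" "v \<in> carrier KA" for k u v
    using that smult_eq_mult[of k u] smult_eq_mult[of k "u \<otimes>\<^bsub>KA\<^esub> v"] by (simp add: KA.m_assoc smult_closed)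
  have comm: "u \<otimes>\<^bsub>KA\<^esub> (k \<odot>\<^bsub>KA\<^esub> v) = k \<odot>\<^bsub>KA\<^esub> (u \<otimes>\<^bsub>KA\<^esub> v)"
    if "k \<in> carrier K" "u \<in> carrier KA" "v \<in> carrier KA" for k u v
  proof (rule formal_sum_eqI)
    fix h assume h: "h \<in> carrier A \<rightarrow> carrier K"
    have "pairing K (u \<otimes>\<^bsub>KA\<^esub> (k \<odot>\<^bsub>KA\<^esub> v)) h = pairing K u (\<lambda>a. k \<otimes>\<^bsub>K\<^esub> pairing K v (\<lambda>b. h (a \<otimes>\<^bsub>A\<^esub> b)))"
      using that h by (subst pairing_mult) (auto simp: smult_closed pairing_smult pairing_closed Pi_iff intro!: pairing_cong)
    also have "\<dots> = k \<otimes>\<^bsub>K\<^esub> pairing K (u \<otimes>\<^bsub>KA\<^esub> v) h"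
      using that h by (simp add: pairing_fun_smult pairing_mult pairing_closed Pi_iff)
    finally show "pairing K (u \<otimes>\<^bsub>KA\<^esub> (k \<odot>\<^bsub>KA\<^esub> v)) h = pairing K (k \<odot>\<^bsub>KA\<^esub> (u \<otimes>\<^bsub>KA\<^esub> v)) h"
      using that h by (simp add: pairing_smult)
  qed (use that in \<open>auto simp: smult_closed\<close>)
  interpret M: module K AK by (rule M)
  interpret R: ring AK by (rule R)
  show ?thesis
    by unfold_locales (auto elim!: AK_cases simp: sim assoc comm)
qed

end

text \<open>The linear extension of \<open>l\<close> at an element of \<open>A \<otimes>\<^sub>F K\<close>, which is a coset of formal sums. By
  \<open>J_annihilated\<close> the choice of the representative does not matter if \<open>l\<close> is semilinear.\<close>

definition ev :: "'k ring \<Rightarrow> ('a \<Rightarrow> 'k) set \<Rightarrow> ('a \<Rightarrow> 'k) \<Rightarrow> 'k" where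
  "ev K x l = pairing K (SOME u. u \<in> x) l"

lemma (in module) finsum_smult_zero:
  assumes "\<And>k. k \<in> S \<Longrightarrow> c k = \<zero>\<^bsub>R\<^esub>" "\<And>k. k \<in> S \<Longrightarrow> d k \<in> carrier M"
  shows "(\<Oplus>\<^bsub>M\<^esub>k\<in>S. c k \<odot>\<^bsub>M\<^esub> d k) = \<zero>\<^bsub>M\<^esub>"
  using assms by (intro M.add.finprod_one_eqI) simp

context scalar_extension
begin

sublocale AK: field_algebra K AK by (rule base_change_field_algebra)

abbreviation incl where "incl \<equiv> base_incl F K \<iota> A"

lemma incl_proj: "incl a = proj (gen K a)" by (simp add: base_incl_def proj_def)

lemma proj_closed: "u \<in> carrier KA \<Longrightarrow> proj u \<in> carrier AK" by (simp add: AK_simps)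

lemma incl_closed [simp]: "a \<in> carrier A \<Longrightarrow> incl a \<in> carrier AK"
  by (simp add: incl_proj proj_closed gen_closed)

lemma incl_add: "a \<in> carrier A \<Longrightarrow> b \<in> carrier A \<Longrightarrow> incl (a \<oplus>\<^bsub>A\<^esub> b) = incl a \<oplus>\<^bsub>AK\<^esub> incl b"
proof -
  assume a: "a \<in> carrier A" and b: "b \<in> carrier A"
  then have "gen K (a \<oplus>\<^bsub>A\<^esub> b) \<ominus>\<^bsub>KA\<^esub> (gen K a \<oplus>\<^bsub>KA\<^esub> gen K b) \<in> J"
    by (intro subsetD[OF relations_J]) blast
  then show ?thesis using a b by (simp add: incl_proj AK_simps gen_closed proj_eq_J)
qed

lemma incl_smult: "c \<in> carrier F \<Longrightarrow> a \<in> carrier A \<Longrightarrow> incl (c \<odot>\<^bsub>A\<^esub> a) = \<iota> c \<odot>\<^bsub>AK\<^esub> incl a"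
proof -
  assume c: "c \<in> carrier F" and a: "a \<in> carrier A"
  then have "gen K (c \<odot>\<^bsub>A\<^esub> a) \<ominus>\<^bsub>KA\<^esub> (\<iota> c \<odot>\<^bsub>KA\<^esub> gen K a) \<in> J"
    by (intro subsetD[OF relations_J]) blast
  then show ?thesis using a c by (simp add: incl_proj AK_smult gen_closed proj_eq_J smult_closed iota_closed)
qed

lemma incl_zero: "incl \<zero>\<^bsub>A\<^esub> = \<zero>\<^bsub>AK\<^esub>"
  using incl_add[of "\<zero>\<^bsub>A\<^esub>" "\<zero>\<^bsub>A\<^esub>"] incl_closed[OF A.zero_closed] AK.add.l_cancel_one' by simp

lemma incl_lincomb:
  assumes "finite S" "\<And>k. k \<in> S \<Longrightarrow> d k \<in> carrier A" "\<And>k. k \<in> S \<Longrightarrow> c k \<in> carrier F"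
  shows "incl (\<Oplus>\<^bsub>A\<^esub>k\<in>S. c k \<odot>\<^bsub>A\<^esub> d k) = (\<Oplus>\<^bsub>AK\<^esub>k\<in>S. \<iota> (c k) \<odot>\<^bsub>AK\<^esub> incl (d k))"
  using assms
proof (induction S rule: finite_induct)
  case (insert s S)
  then show ?case
    by (subst A.finsum_insert AK.finsum_insert)
      (auto simp: incl_add incl_smult iota_closed intro!: A.finsum_closed)
qed (simp add: incl_zero)

lemma pairing_proj:
  assumes u: "u \<in> carrier KA" and v: "v \<in> proj u" and l: "l \<in> dual"
  shows "pairing K v l = pairing K u l"
proof -
  obtain j where j: "j \<in> J" "v = j \<oplus>\<^bsub>KA\<^esub> u" using v by (auto simp: proj_def a_r_coset_def')
  then show ?thesis
    using J_annihilated[OF j(1) l] u l J.a_Hcarr[OF j(1)] by (simp add: pairing_add semilinear_fun pairing_closed)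
qed

lemma ev_proj: "u \<in> carrier KA \<Longrightarrow> l \<in> dual \<Longrightarrow> ev K (proj u) l = pairing K u l"
  unfolding ev_def using pairing_proj proj_self by (metis someI)

lemma ev_closed [simp]: "x \<in> carrier AK \<Longrightarrow> l \<in> dual \<Longrightarrow> ev K x l \<in> carrier K"
  by (auto elim!: AK_cases simp: ev_proj pairing_closed semilinear_fun)

lemma ev_incl: "a \<in> carrier A \<Longrightarrow> l \<in> dual \<Longrightarrow> ev K (incl a) l = l a"
  by (simp add: incl_proj ev_proj gen_closed pairing_gen semilinear_fun)

lemma ev_add: "x \<in> carrier AK \<Longrightarrow> y \<in> carrier AK \<Longrightarrow> l \<in> dual \<Longrightarrow> ev K (x \<oplus>\<^bsub>AK\<^esub> y) l = ev K x l \<oplus>\<^bsub>K\<^esub> ev K y l"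
  by (auto elim!: AK_cases simp: AK_simps ev_proj pairing_add semilinear_fun)

lemma ev_smult: "k \<in> carrier K \<Longrightarrow> x \<in> carrier AK \<Longrightarrow> l \<in> dual \<Longrightarrow> ev K (k \<odot>\<^bsub>AK\<^esub> x) l = k \<otimes>\<^bsub>K\<^esub> ev K x l"
  by (auto elim!: AK_cases simp: AK_smult ev_proj pairing_smult smult_closed semilinear_fun)

lemma ev_zero: "l \<in> dual \<Longrightarrow> ev K \<zero>\<^bsub>AK\<^esub> l = \<zero>\<^bsub>K\<^esub>"
  by (simp add: AK_simps ev_proj pairing_zero)

lemma ev_one: "l \<in> dual \<Longrightarrow> ev K \<one>\<^bsub>AK\<^esub> l = l \<one>\<^bsub>A\<^esub>"
  by (simp add: AK_simps ev_proj formal_sum_simps gen_closed pairing_gen semilinear_fun)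

lemma ev_semilinear: "l \<in> dual \<Longrightarrow> (\<lambda>x. ev K x l) \<in> functionals K AK"
  by (rule semilinearI) (simp_all add: ev_add ev_smult)

lemma ev_finsum:
  assumes "finite S" "\<And>k. k \<in> S \<Longrightarrow> f k \<in> carrier AK" "l \<in> dual"
  shows "ev K (\<Oplus>\<^bsub>AK\<^esub>k\<in>S. f k) l = (\<Oplus>\<^bsub>K\<^esub>k\<in>S. ev K (f k) l)"
  using assms
proof (induction S rule: finite_induct)
  case (insert s S)
  then show ?case
    by (subst AK.finsum_insert K.finsum_insert) (auto simp: ev_add intro!: AK.finsum_closed)
qed (simp add: ev_zero)

lemma dual_cong:
  assumes l: "l \<in> dual" and eq: "\<And>a. a \<in> carrier A \<Longrightarrow> l a = l' a"
  shows "l' \<in> dual"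
proof (rule semilinearI)
  show "l' x \<in> carrier K" if "x \<in> carrier A" for x
    using semilinear_closed[OF l that] eq[OF that] by simp
  show "l' (x \<oplus>\<^bsub>A\<^esub> y) = l' x \<oplus>\<^bsub>K\<^esub> l' y" if "x \<in> carrier A" "y \<in> carrier A" for x y
    using semilinear_add[OF l that] eq that by simp
  show "l' (c \<odot>\<^bsub>A\<^esub> x) = \<iota> c \<otimes>\<^bsub>K\<^esub> l' x" if "c \<in> carrier F" "x \<in> carrier A" for c x
    using semilinear_smult[OF l that] eq that by simp
qed

lemma ev_cong:
  assumes x: "x \<in> carrier AK" and l: "l \<in> dual" and eq: "\<And>a. a \<in> carrier A \<Longrightarrow> l a = l' a"
  shows "ev K x l = ev K x l'"
proof -
  have l': "l' \<in> dual" using l eq by (rule dual_cong)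
  obtain u where u: "u \<in> carrier KA" "x = proj u" using x by (rule AK_cases)
  show ?thesis unfolding u(2) ev_proj[OF u(1) l] ev_proj[OF u(1) l']
    using eq semilinear_fun[OF l'] by (intro pairing_cong u)
qed

lemma ev_mult:
  assumes x: "x \<in> carrier AK" and y: "y \<in> carrier AK" and l: "l \<in> dual"
  shows "ev K (x \<otimes>\<^bsub>AK\<^esub> y) l = ev K x (\<lambda>a. ev K y (\<lambda>b. l (a \<otimes>\<^bsub>A\<^esub> b)))"
    and dual_ev_mult: "(\<lambda>a. ev K y (\<lambda>b. l (a \<otimes>\<^bsub>A\<^esub> b))) \<in> dual"
proof -
  obtain u where u: "u \<in> carrier KA" "x = proj u" using x by (rule AK_cases)
  obtain v where v: "v \<in> carrier KA" "y = proj v" using y by (rule AK_cases)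
  have eq: "ev K y (\<lambda>b. l (a \<otimes>\<^bsub>A\<^esub> b)) = pairing K v (\<lambda>b. l (a \<otimes>\<^bsub>A\<^esub> b))" if "a \<in> carrier A" for a
    unfolding v(2) by (rule ev_proj[OF v(1) dual_mult_left[OF l that]])
  have D: "(\<lambda>a. pairing K v (\<lambda>b. l (a \<otimes>\<^bsub>A\<^esub> b))) \<in> dual"
    by (rule dual_pairing[OF A.ring_axioms v(1) dual_mult_right[OF l]])
  then show D': "(\<lambda>a. ev K y (\<lambda>b. l (a \<otimes>\<^bsub>A\<^esub> b))) \<in> dual"
    by (rule dual_cong) (simp add: eq)
  have "ev K (x \<otimes>\<^bsub>AK\<^esub> y) l = pairing K u (\<lambda>a. pairing K v (\<lambda>b. l (a \<otimes>\<^bsub>A\<^esub> b)))"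
    using u v l by (simp add: AK_simps ev_proj pairing_mult semilinear_fun)
  also have "\<dots> = ev K x (\<lambda>a. pairing K v (\<lambda>b. l (a \<otimes>\<^bsub>A\<^esub> b)))"
    unfolding u(2) by (rule ev_proj[OF u(1) D, symmetric])
  also have "\<dots> = ev K x (\<lambda>a. ev K y (\<lambda>b. l (a \<otimes>\<^bsub>A\<^esub> b)))"
    by (rule ev_cong[OF x D]) (simp add: eq)
  finally show "ev K (x \<otimes>\<^bsub>AK\<^esub> y) l = ev K x (\<lambda>a. ev K y (\<lambda>b. l (a \<otimes>\<^bsub>A\<^esub> b)))" .
qed

text \<open>Both sides are additive and \<open>K\<close>-homogeneous in \<open>x\<close>, so that the expansion of the elements
  \<open>a \<otimes> 1\<close> suffices.\<close>

lemma frame_expansion: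
  assumes S: "finite S" and d: "\<And>k. k \<in> S \<Longrightarrow> d k \<in> carrier A"
    and c: "\<And>k. k \<in> S \<Longrightarrow> c k \<in> functionals F A"
    and exp: "\<And>a. a \<in> carrier A \<Longrightarrow> a = (\<Oplus>\<^bsub>A\<^esub>k \<in> S. c k a \<odot>\<^bsub>A\<^esub> d k)"
    and x: "x \<in> carrier AK"
  shows "x = (\<Oplus>\<^bsub>AK\<^esub>k \<in> S. ev K x (\<lambda>a. \<iota> (c k a)) \<odot>\<^bsub>AK\<^esub> incl (d k))"
proof -
  have l: "(\<lambda>a. \<iota> (c k a)) \<in> dual" if "k \<in> S" for k using dual_iota c that by blast
  have gen: "incl a = (\<Oplus>\<^bsub>AK\<^esub>k \<in> S. \<iota> (c k a) \<odot>\<^bsub>AK\<^esub> incl (d k))" if a: "a \<in> carrier A" for a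
    using incl_lincomb[OF S, of d "\<lambda>k. c k a"] exp[OF a] d semilinear_closed[OF c a] by simp
  have "proj u = (\<Oplus>\<^bsub>AK\<^esub>k \<in> S. ev K (proj u) (\<lambda>a. \<iota> (c k a)) \<odot>\<^bsub>AK\<^esub> incl (d k))" if "u \<in> carrier KA" for u
    using that
  proof (induction u rule: formal_sum_induct)
    case zero
    then show ?case
      unfolding AK_simps(3)[symmetric] using l d by (intro AK.finsum_smult_zero[symmetric]) (auto simp: ev_zero)
  next
    case (add v k a)
    let ?l = "\<lambda>i a. \<iota> (c i a)"
    have [simp]: "proj v \<in> carrier AK" using add by (simp add: proj_closed)
    have "proj (k \<odot>\<^bsub>KA\<^esub> gen K a \<oplus>\<^bsub>KA\<^esub> v) = k \<odot>\<^bsub>AK\<^esub> incl a \<oplus>\<^bsub>AK\<^esub> proj v"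
      using add by (simp add: AK_simps AK_smult incl_proj smult_closed gen_closed)
    moreover have "k \<odot>\<^bsub>AK\<^esub> incl a \<oplus>\<^bsub>AK\<^esub> proj v = (\<Oplus>\<^bsub>AK\<^esub>i \<in> S. ev K (k \<odot>\<^bsub>AK\<^esub> incl a \<oplus>\<^bsub>AK\<^esub> proj v) (?l i) \<odot>\<^bsub>AK\<^esub> incl (d i))"
    proof -
      have "(\<Oplus>\<^bsub>AK\<^esub>i \<in> S. ev K (k \<odot>\<^bsub>AK\<^esub> incl a \<oplus>\<^bsub>AK\<^esub> proj v) (?l i) \<odot>\<^bsub>AK\<^esub> incl (d i))
          = (\<Oplus>\<^bsub>AK\<^esub>i \<in> S. k \<odot>\<^bsub>AK\<^esub> (\<iota> (c i a) \<odot>\<^bsub>AK\<^esub> incl (d i)) \<oplus>\<^bsub>AK\<^esub> ev K (proj v) (?l i) \<odot>\<^bsub>AK\<^esub> incl (d i))"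
        using add l d semilinear_closed[OF c]
        by (intro AK.finsum_cong' refl)
          (auto simp: ev_add ev_smult ev_incl AK.smult_l_distr AK.smult_assoc1 iota_closed)
      also have "\<dots> = (\<Oplus>\<^bsub>AK\<^esub>i \<in> S. k \<odot>\<^bsub>AK\<^esub> (\<iota> (c i a) \<odot>\<^bsub>AK\<^esub> incl (d i))) \<oplus>\<^bsub>AK\<^esub> (\<Oplus>\<^bsub>AK\<^esub>i \<in> S. ev K (proj v) (?l i) \<odot>\<^bsub>AK\<^esub> incl (d i))"
        using add l d semilinear_closed[OF c] by (intro AK.finsum_addf) (auto simp: iota_closed)
      also have "(\<Oplus>\<^bsub>AK\<^esub>i \<in> S. k \<odot>\<^bsub>AK\<^esub> (\<iota> (c i a) \<odot>\<^bsub>AK\<^esub> incl (d i))) = k \<odot>\<^bsub>AK\<^esub> (\<Oplus>\<^bsub>AK\<^esub>i \<in> S. \<iota> (c i a) \<odot>\<^bsub>AK\<^esub> incl (d i))"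
        using add d semilinear_closed[OF c] S by (intro AK.finsum_smult[symmetric]) (auto simp: iota_closed)
      finally show ?thesis using add gen[of a] by simp
    qed
    ultimately show ?case by simp
  qed
  then show ?thesis using x by (auto elim!: AK_cases)
qed

text \<open>By \<open>frame_expansion\<close> an element is determined by its values at the functionals of a frame.\<close>

lemma AK_eqI:
  assumes x: "x \<in> carrier AK" and y: "y \<in> carrier AK" and eq: "\<And>l. l \<in> dual \<Longrightarrow> ev K x l = ev K y l"
  shows "x = y"
proof -
  obtain N :: nat and d c where
    dc: "\<forall>k < N. d k \<in> carrier A \<and> c k \<in> functionals F A"
    and exp: "\<forall>a \<in> carrier A. a = (\<Oplus>\<^bsub>A\<^esub>k \<in> {..<N}. c k a \<odot>\<^bsub>A\<^esub> d k)"
    using frame unfolding finite_frame_def by (elim exE conjE)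
  have d: "d k \<in> carrier A" and c: "c k \<in> functionals F A" if "k < N" for k
    using dc that by simp_all
  have *: "z = (\<Oplus>\<^bsub>AK\<^esub>k \<in> {..<N}. ev K z (\<lambda>a. \<iota> (c k a)) \<odot>\<^bsub>AK\<^esub> incl (d k))" if "z \<in> carrier AK" for z
    by (rule frame_expansion[OF _ d c bspec[OF exp] that]) auto
  have "(\<Oplus>\<^bsub>AK\<^esub>k \<in> {..<N}. ev K x (\<lambda>a. \<iota> (c k a)) \<odot>\<^bsub>AK\<^esub> incl (d k))
      = (\<Oplus>\<^bsub>AK\<^esub>k \<in> {..<N}. ev K y (\<lambda>a. \<iota> (c k a)) \<odot>\<^bsub>AK\<^esub> incl (d k))"
    using y d dual_iota[OF c] by (intro AK.finsum_cong' refl) (auto simp: eq)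
  then show ?thesis using *[OF x] *[OF y] by simp
qed

lemma incl_mult:
  assumes a: "a \<in> carrier A" and b: "b \<in> carrier A"
  shows "incl (a \<otimes>\<^bsub>A\<^esub> b) = incl a \<otimes>\<^bsub>AK\<^esub> incl b"
proof (rule AK_eqI)
  fix l assume l: "l \<in> dual"
  have "ev K (incl a \<otimes>\<^bsub>AK\<^esub> incl b) l = ev K (incl a) (\<lambda>a. ev K (incl b) (\<lambda>b. l (a \<otimes>\<^bsub>A\<^esub> b)))"
    by (rule ev_mult[OF incl_closed[OF a] incl_closed[OF b] l])
  also have "\<dots> = ev K (incl b) (\<lambda>b. l (a \<otimes>\<^bsub>A\<^esub> b))"
    by (rule ev_incl[OF a dual_ev_mult[OF incl_closed[OF a] incl_closed[OF b] l]])
  also have "\<dots> = l (a \<otimes>\<^bsub>A\<^esub> b)" by (rule ev_incl[OF b dual_mult_left[OF l a]])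
  finally show "ev K (incl (a \<otimes>\<^bsub>A\<^esub> b)) l = ev K (incl a \<otimes>\<^bsub>AK\<^esub> incl b) l"
    using a b l by (simp add: ev_incl)
qed (use a b in simp_all)

lemma incl_one: "incl \<one>\<^bsub>A\<^esub> = \<one>\<^bsub>AK\<^esub>"
  by (rule AK_eqI) (simp_all add: ev_incl ev_one)

end

locale scalar_extension_hom = A: scalar_extension F A K \<iota> + B: scalar_extension F B K \<iota>
  for F :: "'f ring" and A :: "('f, 'a) module" and B :: "('f, 'b) module" and K :: "'k ring" and \<iota> +
  fixes \<phi> :: "'a \<Rightarrow> 'b"
  assumes hom: "\<phi> \<in> module_hom F A B"
begin

abbreviation \<phi>K where "\<phi>K \<equiv> base_change_map F K \<iota> A B \<phi>"

lemma dual_comp: "l \<in> B.dual \<Longrightarrow> (\<lambda>a. l (\<phi> a)) \<in> A.dual"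
  using hom by (rule semilinear_comp[rotated])

text \<open>The sums \<open>\<Sum>\<^sub>a u(a) (\<phi>(a) \<otimes> 1)\<close> for the representatives \<open>u\<close> of \<open>x\<close> all take the value
  \<open>ev K x (l \<circ> \<phi>)\<close> at \<open>l\<close>. So they are equal, and the definite description in
  \<^const>\<open>base_change_map\<close> denotes their common value.\<close>

lemma base_change_map_ev:
  assumes x: "x \<in> carrier A.AK"
  shows base_change_map_closed: "\<phi>K x \<in> carrier B.AK"
    and ev_base_change_map: "l \<in> B.dual \<Longrightarrow> ev K (\<phi>K x) l = ev K x (\<lambda>a. l (\<phi> a))"
proof -
  define val where "val u = (\<Oplus>\<^bsub>B.AK\<^esub>a \<in> {a. u a \<noteq> \<zero>\<^bsub>K\<^esub>}. u a \<odot>\<^bsub>B.AK\<^esub> B.incl (\<phi> a))" for u :: "'a \<Rightarrow> 'k"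
  obtain u where u: "u \<in> carrier A.KA" "x = A.proj u" using x by (rule A.AK_cases)
  have C: "v \<in> carrier A.KA" if "v \<in> x" for v
    using that u A.proj_smult_aux(1)[of "\<one>\<^bsub>K\<^esub>" u v] by simp
  have mem: "\<phi> a \<in> carrier B" "v a \<in> carrier K" if "v \<in> carrier A.KA" "v a \<noteq> \<zero>\<^bsub>K\<^esub>" for v a
    using that module_hom_mem[OF hom] by (auto simp: A.formal_sum_iff)
  have val_closed: "val v \<in> carrier B.AK" if "v \<in> carrier A.KA" for v
    unfolding val_def using mem[OF that] by (intro B.AK.finsum_closed) auto
  have val_ev: "ev K (val v) l = pairing K v (\<lambda>a. l (\<phi> a))" if v: "v \<in> carrier A.KA" and l: "l \<in> B.dual" for v l
  proof -
    have fin: "finite {a. v a \<noteq> \<zero>\<^bsub>K\<^esub>}" using v by (simp add: A.formal_sum_iff)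
    have "ev K (val v) l = (\<Oplus>\<^bsub>K\<^esub>a \<in> {a. v a \<noteq> \<zero>\<^bsub>K\<^esub>}. ev K (v a \<odot>\<^bsub>B.AK\<^esub> B.incl (\<phi> a)) l)"
      unfolding val_def using mem[OF v] by (intro B.ev_finsum fin l) auto
    also have "\<dots> = pairing K v (\<lambda>a. l (\<phi> a))"
      unfolding pairing_def using mem[OF v] l
      by (intro A.K.finsum_cong' refl) (auto simp: B.ev_smult B.ev_incl semilinear_closed)
    finally show ?thesis .
  qed
  have const: "val v = val u" if v: "v \<in> x" for v
  proof (rule B.AK_eqI)
    fix l assume l: "l \<in> B.dual"
    show "ev K (val v) l = ev K (val u) l"
      unfolding val_ev[OF C[OF v] l] val_ev[OF u(1) l]
      using A.pairing_proj[OF u(1) _ dual_comp[OF l]] v u(2) by blast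
  qed (use C v u val_closed in auto)
  have ux: "u \<in> x" using A.proj_self[OF u(1)] u(2) by simp
  have "(THE y. \<forall>v \<in> x. y = val v) = val u"
  proof (rule the_equality)
    show "\<forall>v \<in> x. val u = val v" using const[symmetric] by (rule ballI)
    show "y = val u" if "\<forall>v \<in> x. y = val v" for y using bspec[OF that ux] .
  qed
  then have "\<phi>K x = val u" by (simp only: base_change_map_def Let_def val_def)
  then show "\<phi>K x \<in> carrier B.AK" "l \<in> B.dual \<Longrightarrow> ev K (\<phi>K x) l = ev K x (\<lambda>a. l (\<phi> a))"
    using val_closed[OF u(1)] val_ev[OF u(1)] A.ev_proj[OF u(1) dual_comp] u(2) by auto
qed

lemma base_change_map_add:
  "x \<in> carrier A.AK \<Longrightarrow> y \<in> carrier A.AK \<Longrightarrow> \<phi>K (x \<oplus>\<^bsub>A.AK\<^esub> y) = \<phi>K x \<oplus>\<^bsub>B.AK\<^esub> \<phi>K y"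
  by (rule B.AK_eqI) (simp_all add: base_change_map_closed ev_base_change_map A.ev_add B.ev_add dual_comp)

lemma base_change_map_smult:
  "k \<in> carrier K \<Longrightarrow> x \<in> carrier A.AK \<Longrightarrow> \<phi>K (k \<odot>\<^bsub>A.AK\<^esub> x) = k \<odot>\<^bsub>B.AK\<^esub> \<phi>K x"
  by (rule B.AK_eqI) (simp_all add: base_change_map_closed ev_base_change_map A.ev_smult B.ev_smult dual_comp)

lemma base_change_map_incl: "a \<in> carrier A \<Longrightarrow> \<phi>K (A.incl a) = B.incl (\<phi> a)"
  by (rule B.AK_eqI) (simp_all add: base_change_map_closed ev_base_change_map A.ev_incl B.ev_incl dual_comp module_hom_mem[OF hom])

lemma ev_mult_images:
  assumes x: "x \<in> carrier A.AK" and y: "y \<in> carrier A.AK" and l: "l \<in> B.dual"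
  shows "ev K (\<phi>K x \<otimes>\<^bsub>B.AK\<^esub> \<phi>K y) l = ev K x (\<lambda>a. ev K y (\<lambda>b. l (\<phi> a \<otimes>\<^bsub>B\<^esub> \<phi> b)))"
    and "(\<lambda>a. ev K y (\<lambda>b. l (\<phi> a \<otimes>\<^bsub>B\<^esub> \<phi> b))) \<in> A.dual"
proof -
  note X = base_change_map_closed[OF x] and Y = base_change_map_closed[OF y]
  have inner: "ev K (\<phi>K y) (\<lambda>b. l (\<phi> a \<otimes>\<^bsub>B\<^esub> b)) = ev K y (\<lambda>b. l (\<phi> a \<otimes>\<^bsub>B\<^esub> \<phi> b))" if "a \<in> carrier A" for a
    by (rule ev_base_change_map[OF y B.dual_mult_left[OF l module_hom_mem[OF hom that]]])
  have D: "(\<lambda>a. ev K (\<phi>K y) (\<lambda>b. l (\<phi> a \<otimes>\<^bsub>B\<^esub> b))) \<in> A.dual"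
    by (rule dual_comp[OF B.dual_ev_mult[OF X Y l]])
  show "(\<lambda>a. ev K y (\<lambda>b. l (\<phi> a \<otimes>\<^bsub>B\<^esub> \<phi> b))) \<in> A.dual"
    by (rule A.dual_cong[OF D inner])
  have "ev K (\<phi>K x \<otimes>\<^bsub>B.AK\<^esub> \<phi>K y) l = ev K x (\<lambda>a. ev K (\<phi>K y) (\<lambda>b. l (\<phi> a \<otimes>\<^bsub>B\<^esub> b)))"
    unfolding B.ev_mult[OF X Y l] by (rule ev_base_change_map[OF x B.dual_ev_mult[OF X Y l]])
  also have "\<dots> = ev K x (\<lambda>a. ev K y (\<lambda>b. l (\<phi> a \<otimes>\<^bsub>B\<^esub> \<phi> b)))"
    by (rule A.ev_cong[OF x D inner])
  finally show "ev K (\<phi>K x \<otimes>\<^bsub>B.AK\<^esub> \<phi>K y) l = ev K x (\<lambda>a. ev K y (\<lambda>b. l (\<phi> a \<otimes>\<^bsub>B\<^esub> \<phi> b)))" .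
qed

lemma base_change_map_mult:
  assumes mult: "\<And>a b. a \<in> carrier A \<Longrightarrow> b \<in> carrier A \<Longrightarrow> \<phi> (a \<otimes>\<^bsub>A\<^esub> b) = \<phi> a \<otimes>\<^bsub>B\<^esub> \<phi> b"
    and x: "x \<in> carrier A.AK" and y: "y \<in> carrier A.AK"
  shows "\<phi>K (x \<otimes>\<^bsub>A.AK\<^esub> y) = \<phi>K x \<otimes>\<^bsub>B.AK\<^esub> \<phi>K y"
proof (rule B.AK_eqI)
  fix l assume l: "l \<in> B.dual"
  have "ev K (\<phi>K (x \<otimes>\<^bsub>A.AK\<^esub> y)) l = ev K (x \<otimes>\<^bsub>A.AK\<^esub> y) (\<lambda>a. l (\<phi> a))"
    using x y l by (intro ev_base_change_map A.AK.m_closed)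
  also have "\<dots> = ev K x (\<lambda>a. ev K y (\<lambda>b. l (\<phi> (a \<otimes>\<^bsub>A\<^esub> b))))"
    by (rule A.ev_mult[OF x y dual_comp[OF l]])
  also have "\<dots> = ev K x (\<lambda>a. ev K y (\<lambda>b. l (\<phi> a \<otimes>\<^bsub>B\<^esub> \<phi> b)))"
    by (rule A.ev_cong[OF x A.dual_ev_mult[OF x y dual_comp[OF l]]],
        rule A.ev_cong[OF y A.dual_mult_left[OF dual_comp[OF l]]]) (simp_all add: mult)
  also have "\<dots> = ev K (\<phi>K x \<otimes>\<^bsub>B.AK\<^esub> \<phi>K y) l" by (rule ev_mult_images(1)[OF x y l, symmetric])
  finally show "ev K (\<phi>K (x \<otimes>\<^bsub>A.AK\<^esub> y)) l = ev K (\<phi>K x \<otimes>\<^bsub>B.AK\<^esub> \<phi>K y) l" .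
qed (use x y in \<open>simp_all add: base_change_map_closed\<close>)

end

text \<open>An anti-homomorphism reverses the order in which the two factors of a product are evaluated. The
  reversal amounts to interchanging two finite sums.\<close>

lemma (in scalar_extension) ev_swap:
  assumes x: "x \<in> carrier AK" and y: "y \<in> carrier AK"
    and H1: "\<And>a. a \<in> carrier A \<Longrightarrow> (\<lambda>b. H a b) \<in> dual" and H2: "\<And>b. b \<in> carrier A \<Longrightarrow> (\<lambda>a. H a b) \<in> dual"
  shows "ev K x (\<lambda>a. ev K y (\<lambda>b. H a b)) = ev K y (\<lambda>b. ev K x (\<lambda>a. H a b))"
    and "(\<lambda>a. ev K y (\<lambda>b. H a b)) \<in> dual"
proof -
  have half: "ev K x (\<lambda>a. ev K y (\<lambda>b. H a b)) = pairing K u (\<lambda>a. pairing K v (\<lambda>b. H a b)) \<and> (\<lambda>a. ev K y (\<lambda>b. H a b)) \<in> dual"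
    if u: "u \<in> carrier KA" "x = proj u" and v: "v \<in> carrier KA" "y = proj v"
      and H1: "\<And>a. a \<in> carrier A \<Longrightarrow> (\<lambda>b. H a b) \<in> dual" and H2: "\<And>b. b \<in> carrier A \<Longrightarrow> (\<lambda>a. H a b) \<in> dual"
    for u v x y H
  proof -
    have eq: "ev K y (\<lambda>b. H a b) = pairing K v (\<lambda>b. H a b)" if "a \<in> carrier A" for a
      unfolding v(2) by (rule ev_proj[OF v(1) H1[OF that]])
    have D: "(\<lambda>a. pairing K v (\<lambda>b. H a b)) \<in> dual"
      by (rule dual_pairing[OF A.ring_axioms v(1) H2])
    then have D': "(\<lambda>a. ev K y (\<lambda>b. H a b)) \<in> dual" by (rule dual_cong) (simp add: eq)
    have "ev K x (\<lambda>a. ev K y (\<lambda>b. H a b)) = ev K x (\<lambda>a. pairing K v (\<lambda>b. H a b))"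
      using proj_closed u by (intro ev_cong D' eq) auto
    also have "\<dots> = pairing K u (\<lambda>a. pairing K v (\<lambda>b. H a b))" unfolding u(2) by (rule ev_proj[OF u(1) D])
    finally show ?thesis using D' by blast
  qed
  obtain u where u: "u \<in> carrier KA" "x = proj u" using x by (rule AK_cases)
  obtain v where v: "v \<in> carrier KA" "y = proj v" using y by (rule AK_cases)
  have "pairing K u (\<lambda>a. pairing K v (H a)) = pairing K v (\<lambda>b. pairing K u (\<lambda>a. H a b))"
    by (rule pairing_swap[OF u(1) v(1) A.ring_axioms semilinear_closed[OF H1]])
  then show "ev K x (\<lambda>a. ev K y (\<lambda>b. H a b)) = ev K y (\<lambda>b. ev K x (\<lambda>a. H a b))"
    using half[OF u v H1 H2] half[OF v u H2 H1] by simp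
  show "(\<lambda>a. ev K y (\<lambda>b. H a b)) \<in> dual" using half[OF u v H1 H2] by simp
qed

lemma (in scalar_extension_hom) base_change_map_antimult:
  assumes anti: "\<And>a b. a \<in> carrier A \<Longrightarrow> b \<in> carrier A \<Longrightarrow> \<phi> (a \<otimes>\<^bsub>A\<^esub> b) = \<phi> b \<otimes>\<^bsub>B\<^esub> \<phi> a"
    and x: "x \<in> carrier A.AK" and y: "y \<in> carrier A.AK"
  shows "\<phi>K (x \<otimes>\<^bsub>A.AK\<^esub> y) = \<phi>K y \<otimes>\<^bsub>B.AK\<^esub> \<phi>K x"
proof (rule B.AK_eqI)
  fix l assume l: "l \<in> B.dual"
  note h = module_hom_mem[OF hom]
  have H1: "(\<lambda>b. l (\<phi> b \<otimes>\<^bsub>B\<^esub> \<phi> a)) \<in> A.dual" if "a \<in> carrier A" for a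
    by (rule dual_comp[OF B.dual_mult_right[OF l h[OF that]]])
  have H2: "(\<lambda>a. l (\<phi> b \<otimes>\<^bsub>B\<^esub> \<phi> a)) \<in> A.dual" if "b \<in> carrier A" for b
    by (rule dual_comp[OF B.dual_mult_left[OF l h[OF that]]])
  have "ev K (\<phi>K (x \<otimes>\<^bsub>A.AK\<^esub> y)) l = ev K (x \<otimes>\<^bsub>A.AK\<^esub> y) (\<lambda>a. l (\<phi> a))"
    using x y l by (intro ev_base_change_map A.AK.m_closed)
  also have "\<dots> = ev K x (\<lambda>a. ev K y (\<lambda>b. l (\<phi> (a \<otimes>\<^bsub>A\<^esub> b))))"
    by (rule A.ev_mult[OF x y dual_comp[OF l]])
  also have "\<dots> = ev K x (\<lambda>a. ev K y (\<lambda>b. l (\<phi> b \<otimes>\<^bsub>B\<^esub> \<phi> a)))"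
    by (rule A.ev_cong[OF x A.dual_ev_mult[OF x y dual_comp[OF l]]],
        rule A.ev_cong[OF y A.dual_mult_left[OF dual_comp[OF l]]]) (simp_all add: anti)
  also have "\<dots> = ev K y (\<lambda>b. ev K x (\<lambda>a. l (\<phi> b \<otimes>\<^bsub>B\<^esub> \<phi> a)))"
    by (rule A.ev_swap(1)[OF x y H1 H2])
  also have "\<dots> = ev K (\<phi>K y \<otimes>\<^bsub>B.AK\<^esub> \<phi>K x) l" by (rule ev_mult_images(1)[OF y x l, symmetric])
  finally show "ev K (\<phi>K (x \<otimes>\<^bsub>A.AK\<^esub> y)) l = ev K (\<phi>K y \<otimes>\<^bsub>B.AK\<^esub> \<phi>K x) l" .
qed (use x y in \<open>simp_all add: base_change_map_closed\<close>)

lemma base_change_map_comp: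
  assumes \<phi>: "scalar_extension_hom F A B K \<iota> \<phi>" and \<psi>: "scalar_extension_hom F B C K \<iota> \<psi>"
    and \<chi>: "scalar_extension_hom F A C K \<iota> \<chi>"
    and eq: "\<And>a. a \<in> carrier A \<Longrightarrow> \<chi> a = \<psi> (\<phi> a)"
    and x: "x \<in> carrier (base_change F K \<iota> A)"
  shows "base_change_map F K \<iota> A C \<chi> x = base_change_map F K \<iota> B C \<psi> (base_change_map F K \<iota> A B \<phi> x)"
proof -
  interpret \<phi>: scalar_extension_hom F A B K \<iota> \<phi> by fact
  interpret \<psi>: scalar_extension_hom F B C K \<iota> \<psi> by fact
  interpret \<chi>: scalar_extension_hom F A C K \<iota> \<chi> by fact
  note cl = \<phi>.base_change_map_closed[OF x]
  show ?thesis
  proof (rule \<psi>.B.AK_eqI)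
    fix l assume l: "l \<in> \<psi>.B.dual"
    have "ev K (\<chi>.\<phi>K x) l = ev K x (\<lambda>a. l (\<psi> (\<phi> a)))"
      unfolding \<chi>.ev_base_change_map[OF x l]
      by (rule \<phi>.A.ev_cong[OF x \<chi>.dual_comp[OF l]]) (simp add: eq)
    then show "ev K (\<chi>.\<phi>K x) l = ev K (\<psi>.\<phi>K (\<phi>.\<phi>K x)) l"
      unfolding \<psi>.ev_base_change_map[OF cl l] \<phi>.ev_base_change_map[OF x \<psi>.dual_comp[OF l]] .
  qed (use x cl \<chi>.base_change_map_closed \<psi>.base_change_map_closed in auto)
qed

lemma (in scalar_extension) base_change_map_id:
  assumes "\<And>a. a \<in> carrier A \<Longrightarrow> \<phi> a = a" and x: "x \<in> carrier AK"
  shows "base_change_map F K \<iota> A A \<phi> x = x"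
proof -
  interpret \<phi>: scalar_extension_hom F A A K \<iota> \<phi>
    by unfold_locales (rule module_homI; simp add: assms(1))
  show ?thesis
  proof (rule AK_eqI)
    fix l assume l: "l \<in> dual"
    show "ev K (base_change_map F K \<iota> A A \<phi> x) l = ev K x l"
      unfolding \<phi>.ev_base_change_map[OF x l]
      by (rule ev_cong[OF x \<phi>.dual_comp[OF l]]) (simp add: assms(1))
  qed (use x \<phi>.base_change_map_closed in auto)
qed

lemma (in scalar_extension) base_change_map_two_sided_mult:
  assumes e: "e \<in> carrier A" and x: "x \<in> carrier AK"
  shows "base_change_map F K \<iota> A A (\<lambda>a. e \<otimes>\<^bsub>A\<^esub> a \<otimes>\<^bsub>A\<^esub> e) x = incl e \<otimes>\<^bsub>AK\<^esub> x \<otimes>\<^bsub>AK\<^esub> incl e"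
proof -
  interpret \<phi>: scalar_extension_hom F A A K \<iota> "\<lambda>a. e \<otimes>\<^bsub>A\<^esub> a \<otimes>\<^bsub>A\<^esub> e"
    by unfold_locales (rule module_homI; simp add: e A.l_distr A.r_distr A.smult_mult_left A.smult_mult_right)
  show ?thesis
  proof (rule AK_eqI)
    fix l assume l: "l \<in> dual"
    note ie = incl_closed[OF e]
    have ex: "incl e \<otimes>\<^bsub>AK\<^esub> x \<in> carrier AK" using ie x by simp
    have D: "(\<lambda>a. l (a \<otimes>\<^bsub>A\<^esub> e)) \<in> dual" by (rule dual_mult_right[OF l e])
    have "ev K (incl e \<otimes>\<^bsub>AK\<^esub> x \<otimes>\<^bsub>AK\<^esub> incl e) l = ev K (incl e \<otimes>\<^bsub>AK\<^esub> x) (\<lambda>a. ev K (incl e) (\<lambda>b. l (a \<otimes>\<^bsub>A\<^esub> b)))"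
      by (rule ev_mult[OF ex ie l])
    also have "\<dots> = ev K (incl e \<otimes>\<^bsub>AK\<^esub> x) (\<lambda>a. l (a \<otimes>\<^bsub>A\<^esub> e))"
      by (rule ev_cong[OF ex dual_ev_mult[OF ex ie l]]) (rule ev_incl[OF e dual_mult_left[OF l]])
    also have "\<dots> = ev K (incl e) (\<lambda>a. ev K x (\<lambda>b. l (a \<otimes>\<^bsub>A\<^esub> b \<otimes>\<^bsub>A\<^esub> e)))"
      by (rule ev_mult[OF ie x D])
    also have "\<dots> = ev K x (\<lambda>b. l (e \<otimes>\<^bsub>A\<^esub> b \<otimes>\<^bsub>A\<^esub> e))"
      by (rule ev_incl[OF e dual_ev_mult[OF ie x D]])
    finally show "ev K (\<phi>.\<phi>K x) l = ev K (incl e \<otimes>\<^bsub>AK\<^esub> x \<otimes>\<^bsub>AK\<^esub> incl e) l"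
      by (simp add: \<phi>.ev_base_change_map[OF x l])
  qed (use e x \<phi>.base_change_map_closed in auto)
qed

section \<open>Corners\<close>

lemma corner_simps:
  "\<one>\<^bsub>corner A e\<^esub> = e" "\<zero>\<^bsub>corner A e\<^esub> = \<zero>\<^bsub>A\<^esub>" "x \<otimes>\<^bsub>corner A e\<^esub> y = x \<otimes>\<^bsub>A\<^esub> y"
  "x \<oplus>\<^bsub>corner A e\<^esub> y = x \<oplus>\<^bsub>A\<^esub> y" "c \<odot>\<^bsub>corner A e\<^esub> x = c \<odot>\<^bsub>A\<^esub> x"
  by (simp_all add: corner_def)

locale corner_idempotent = A: field_algebra F A
  for F :: "'f ring" and A :: "('f, 'a) module" (structure) +
  fixes e
  assumes e: "e \<in> carrier A" "e \<otimes> e = e"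
begin

lemma corner_iff: "x \<in> carrier (corner A e) \<longleftrightarrow> x \<in> carrier A \<and> e \<otimes> x \<otimes> e = x"
proof
  assume "x \<in> carrier (corner A e)"
  then obtain y where y: "y \<in> carrier A" "x = e \<otimes> y \<otimes> e" by (auto simp: corner_def)
  have "e \<otimes> x \<otimes> e = (e \<otimes> e) \<otimes> y \<otimes> (e \<otimes> e)" using y e(1) by (simp only: A.m_assoc A.m_closed)
  then show "x \<in> carrier A \<and> e \<otimes> x \<otimes> e = x" using y e by simp
qed (auto simp: corner_def intro: exI[of _ x])

lemma corner_unit:
  assumes "x \<in> carrier (corner A e)" shows "e \<otimes> x = x" "x \<otimes> e = x"
proof -
  have x: "x \<in> carrier A" "x = e \<otimes> x \<otimes> e" using assms corner_iff by auto
  have "e \<otimes> x = e \<otimes> (e \<otimes> x \<otimes> e)" by (rule arg_cong[OF x(2)])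
  also have "\<dots> = (e \<otimes> e) \<otimes> x \<otimes> e" using x(1) e(1) by (simp only: A.m_assoc A.m_closed)
  finally show "e \<otimes> x = x" unfolding e(2) x(2)[symmetric] .
  have "x \<otimes> e = (e \<otimes> x \<otimes> e) \<otimes> e" by (rule arg_cong[OF x(2)])
  also have "\<dots> = e \<otimes> x \<otimes> (e \<otimes> e)" using x(1) e(1) by (simp only: A.m_assoc A.m_closed)
  finally show "x \<otimes> e = x" unfolding e(2) x(2)[symmetric] .
qed

lemma cornerI: "x \<in> carrier A \<Longrightarrow> e \<otimes> x = x \<Longrightarrow> x \<otimes> e = x \<Longrightarrow> x \<in> carrier (corner A e)"
  by (simp add: corner_iff)

lemma corner_field_algebra: "field_algebra F (corner A e)"
proof -
  have sub: "x \<in> carrier A" if "x \<in> carrier (corner A e)" for x using that corner_iff by blast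
  note sim = corner_simps sub corner_unit
  have add: "x \<oplus> y \<in> carrier (corner A e)" if "x \<in> carrier (corner A e)" "y \<in> carrier (corner A e)" for x y
    using that e by (intro cornerI) (simp_all add: sim A.l_distr A.r_distr)
  have mult: "x \<otimes> y \<in> carrier (corner A e)" if xy: "x \<in> carrier (corner A e)" "y \<in> carrier (corner A e)" for x y
  proof (rule cornerI)
    show "e \<otimes> (x \<otimes> y) = x \<otimes> y" using xy e corner_unit(1)[OF xy(1)] A.m_assoc[of e x y] sub by simp
    show "(x \<otimes> y) \<otimes> e = x \<otimes> y" using xy e corner_unit(2)[OF xy(2)] A.m_assoc[of x y e] sub by simp
  qed (use xy sub in simp)
  have smult: "c \<odot> x \<in> carrier (corner A e)" if "c \<in> carrier F" "x \<in> carrier (corner A e)" for c x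
    using that e by (intro cornerI) (simp_all add: sim A.smult_mult_left A.smult_mult_right)
  have zero: "\<zero> \<in> carrier (corner A e)" using e by (intro cornerI) simp_all
  have one: "e \<in> carrier (corner A e)" using e by (intro cornerI) simp_all
  have ag: "abelian_group (corner A e)"
  proof (rule abelian_groupI)
    fix x assume x: "x \<in> carrier (corner A e)"
    have "\<ominus> x \<in> carrier (corner A e)"
      using x e by (intro cornerI) (simp_all add: sim A.l_minus A.r_minus)
    then show "\<exists>y\<in>carrier (corner A e). y \<oplus>\<^bsub>corner A e\<^esub> x = \<zero>\<^bsub>corner A e\<^esub>"
      using A.l_neg[OF sub[OF x]] by (intro bexI[of _ "\<ominus> x"]) (simp_all add: corner_simps)
  qed (simp_all add: sim add zero A.a_ac)
  have R: "ring (corner A e)"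
  proof (rule ringI[OF ag])
    show "Group.monoid (corner A e)"
      by (rule monoidI) (simp_all add: sim mult one A.m_assoc)
  qed (simp_all add: sim A.l_distr A.r_distr)
  have M: "module F (corner A e)"
    by (rule moduleI[OF A.R.is_cring ag])
      (simp_all add: sim smult A.smult_l_distr A.smult_r_distr A.smult_assoc1)
  interpret M: module F "corner A e" by (rule M)
  interpret R': ring "corner A e" by (rule R)
  show ?thesis
    by unfold_locales (simp_all add: sim A.smult_mult_left A.smult_mult_right)
qed

lemma corner_finsum:
  assumes "finite S" "\<And>k. k \<in> S \<Longrightarrow> f k \<in> carrier (corner A e)"
  shows "(\<Oplus>\<^bsub>corner A e\<^esub>k\<in>S. f k) = (\<Oplus>k\<in>S. f k)"
proof -
  interpret C: field_algebra F "corner A e" by (rule corner_field_algebra)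
  show ?thesis
    using assms
  proof (induction S rule: finite_induct)
    case (insert s S)
    then have "f k \<in> carrier A" if "k \<in> insert s S" for k using that corner_iff by blast
    then show ?case using insert by (subst C.finsum_insert A.finsum_insert) (auto simp: corner_simps)
  qed (simp add: corner_simps)
qed

lemma corner_inclusion_hom: "(\<lambda>a. a) \<in> module_hom F (corner A e) A"
  by (rule module_homI) (auto simp: corner_iff corner_simps)

text \<open>The extension of this retraction identifies \<open>e A\<^sub>K e\<close> with \<open>(eAe)\<^sub>K\<close>.\<close>

lemma corner_retraction_hom: "(\<lambda>a. e \<otimes> a \<otimes> e) \<in> module_hom F A (corner A e)"
  by (rule module_homI)
    (auto simp: corner_def e A.l_distr A.r_distr A.smult_mult_left A.smult_mult_right)

lemma corner_finite_frame:
  assumes "finite_frame F A" shows "finite_frame F (corner A e)"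
proof -
  obtain N :: nat and d c where
    dc: "\<forall>k < N. d k \<in> carrier A \<and> c k \<in> functionals F A"
    and exp: "\<forall>a \<in> carrier A. a = (\<Oplus>k \<in> {..<N}. c k a \<odot> d k)"
    using assms unfolding finite_frame_def by (elim exE conjE)
  have d: "d k \<in> carrier A" and c: "c k \<in> functionals F A" if "k < N" for k
    using dc that by simp_all
  let ?d = "\<lambda>k. e \<otimes> d k \<otimes> e"
  have dC: "?d k \<in> carrier (corner A e)" if "k < N" for k using d[OF that] by (auto simp: corner_def)
  have cC: "c k \<in> functionals F (corner A e)" if "k < N" for k
    by (rule semilinear_comp[OF c[OF that] corner_inclusion_hom])
  have "a = (\<Oplus>\<^bsub>corner A e\<^esub>k \<in> {..<N}. c k a \<odot>\<^bsub>corner A e\<^esub> ?d k)" if a: "a \<in> carrier (corner A e)" for a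
  proof -
    interpret C: field_algebra F "corner A e" by (rule corner_field_algebra)
    have aA: "a \<in> carrier A" and ae: "a = e \<otimes> a \<otimes> e" using a corner_iff by auto
    have cl: "c k a \<in> carrier F" if "k < N" for k using semilinear_closed[OF c[OF that] aA] .
    have "a = e \<otimes> a \<otimes> e" by (rule ae)
    also have "\<dots> = e \<otimes> (\<Oplus>k \<in> {..<N}. c k a \<odot> d k) \<otimes> e"
      by (rule arg_cong[where f = "\<lambda>z. e \<otimes> z \<otimes> e"]) (rule bspec[OF exp aA])
    also have "\<dots> = (\<Oplus>k \<in> {..<N}. e \<otimes> (c k a \<odot> d k) \<otimes> e)"
      using d cl e by (simp add: A.finsum_rdistr A.finsum_ldistr)
    also have "\<dots> = (\<Oplus>k \<in> {..<N}. c k a \<odot> ?d k)"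
      using d cl e by (intro A.finsum_cong' refl) (auto simp: A.smult_mult_left A.smult_mult_right)
    also have "\<dots> = (\<Oplus>\<^bsub>corner A e\<^esub>k \<in> {..<N}. c k a \<odot>\<^bsub>corner A e\<^esub> ?d k)"
      using dC cl C.smult_closed
      by (subst corner_finsum) (auto simp: corner_simps)
    finally show ?thesis .
  qed
  then show ?thesis
    unfolding finite_frame_def using dC cC by (intro exI[of _ N] exI[of _ ?d] exI[of _ c]) simp
qed

end

section \<open>Involutions on a corner after extension of scalars\<close>

lemma involutionD:
  assumes "involution F A \<sigma>"
  shows "\<sigma> \<in> module_hom F A A"
    and "x \<in> carrier A \<Longrightarrow> y \<in> carrier A \<Longrightarrow> \<sigma> (x \<otimes>\<^bsub>A\<^esub> y) = \<sigma> y \<otimes>\<^bsub>A\<^esub> \<sigma> x"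
    and "x \<in> carrier A \<Longrightarrow> \<sigma> (\<sigma> x) = x"
    and "x \<in> carrier A \<Longrightarrow> \<sigma> x \<in> carrier A"
  using assms by (auto simp: involution_def module_hom_def)

locale corner_isomorphism = A: scalar_extension F A K \<iota> + B: scalar_extension F B K \<iota>
  for F :: "'f ring" and A :: "('f, 'a) module" and B :: "('f, 'b) module" and K :: "'k ring" and \<iota> +
  fixes \<sigma> :: "'a \<Rightarrow> 'a" and e :: 'a and \<Psi> :: "'a \<Rightarrow> 'b"
  assumes \<sigma>: "involution F A \<sigma>" and e: "symmetric_idempotent A \<sigma> e"
    and \<Psi>: "\<Psi> \<in> alg_iso F (corner A e) B"
begin

abbreviation C where "C \<equiv> corner A e"
abbreviation CK where "CK \<equiv> base_change F K \<iota> C"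
abbreviation inclK where "inclK \<equiv> base_change_map F K \<iota> C A (\<lambda>a. a)"
abbreviation \<sigma>K where "\<sigma>K \<equiv> base_change_map F K \<iota> A A \<sigma>"
abbreviation \<Psi>K where "\<Psi>K \<equiv> base_change_map F K \<iota> C B \<Psi>"
abbreviation eK where "eK \<equiv> base_incl F K \<iota> A e"
abbreviation \<Psi>inv where "\<Psi>inv \<equiv> inv_into (carrier C) \<Psi>"

text \<open>\<open>\<Psi>\<close> is an isomorphism of algebras with involution from the corner to \<open>(B, \<tau>)\<close> if and only if this
  involution coincides with \<open>\<tau>\<close>.\<close>

definition \<tau>' :: "'b \<Rightarrow> 'b" where "\<tau>' b = \<Psi> (\<sigma> (\<Psi>inv b))"

sublocale C: corner_idempotent F A e
  using e by unfold_locales (auto simp: symmetric_idempotent_def)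

lemma \<sigma>e: "\<sigma> e = e" using e by (simp add: symmetric_idempotent_def)

lemma corner_extension: "scalar_extension F C K \<iota>"
proof -
  interpret Calg: field_algebra F C by (rule C.corner_field_algebra)
  show ?thesis
    by unfold_locales (simp_all add: A.iota C.corner_finite_frame A.frame)
qed

sublocale Cx: scalar_extension F C K \<iota> by (rule corner_extension)

lemma \<Psi>D:
  "x \<in> carrier C \<Longrightarrow> \<Psi> x \<in> carrier B"
  "x \<in> carrier C \<Longrightarrow> y \<in> carrier C \<Longrightarrow> \<Psi> (x \<oplus>\<^bsub>A\<^esub> y) = \<Psi> x \<oplus>\<^bsub>B\<^esub> \<Psi> y"
  "x \<in> carrier C \<Longrightarrow> y \<in> carrier C \<Longrightarrow> \<Psi> (x \<otimes>\<^bsub>A\<^esub> y) = \<Psi> x \<otimes>\<^bsub>B\<^esub> \<Psi> y"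
  "c \<in> carrier F \<Longrightarrow> x \<in> carrier C \<Longrightarrow> \<Psi> (c \<odot>\<^bsub>A\<^esub> x) = c \<odot>\<^bsub>B\<^esub> \<Psi> x"
  using \<Psi> by (auto simp: alg_iso_def ring_iso_def ring_hom_def corner_simps)

lemma \<Psi>_bij: "bij_betw \<Psi> (carrier C) (carrier B)"
  using \<Psi> by (auto simp: alg_iso_def ring_iso_def)

lemma \<Psi>inv:
  "b \<in> carrier B \<Longrightarrow> \<Psi>inv b \<in> carrier C" "b \<in> carrier B \<Longrightarrow> \<Psi> (\<Psi>inv b) = b"
  "x \<in> carrier C \<Longrightarrow> \<Psi>inv (\<Psi> x) = x"
  using \<Psi>_bij by (auto simp: bij_betw_def inv_into_into f_inv_into_f)

lemma C_subset: "x \<in> carrier C \<Longrightarrow> x \<in> carrier A" by (simp add: C.corner_iff)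

lemma C_closed:
  "x \<in> carrier C \<Longrightarrow> y \<in> carrier C \<Longrightarrow> x \<oplus>\<^bsub>A\<^esub> y \<in> carrier C"
  "x \<in> carrier C \<Longrightarrow> y \<in> carrier C \<Longrightarrow> x \<otimes>\<^bsub>A\<^esub> y \<in> carrier C"
  "c \<in> carrier F \<Longrightarrow> x \<in> carrier C \<Longrightarrow> c \<odot>\<^bsub>A\<^esub> x \<in> carrier C"
  using Cx.A.a_closed[of x y] Cx.A.m_closed[of x y] Cx.A.smult_closed[of c x] by (simp_all only: corner_simps)

lemma \<sigma>_corner: assumes x: "x \<in> carrier C" shows "\<sigma> x \<in> carrier C"
proof (rule C.cornerI)
  note s = involutionD[OF \<sigma>]
  show "\<sigma> x \<in> carrier A" using s(4) C_subset[OF x] .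
  show "e \<otimes>\<^bsub>A\<^esub> \<sigma> x = \<sigma> x"
    using s(2)[of x e] C.corner_unit(2)[OF x] C_subset[OF x] C.e(1) by (simp add: \<sigma>e)
  show "\<sigma> x \<otimes>\<^bsub>A\<^esub> e = \<sigma> x"
    using s(2)[of e x] C.corner_unit(1)[OF x] C_subset[OF x] C.e(1) by (simp add: \<sigma>e)
qed

lemma module_homs:
  "\<sigma> \<in> module_hom F C C" "\<Psi> \<in> module_hom F C B" "\<Psi>inv \<in> module_hom F B C"
  "(\<lambda>a. \<Psi> (\<sigma> a)) \<in> module_hom F C B" "\<tau>' \<in> module_hom F B B" "\<sigma> \<in> module_hom F C A"
proof -
  note s = involutionD[OF \<sigma>]
  have sl: "x \<in> carrier C \<Longrightarrow> y \<in> carrier C \<Longrightarrow> \<sigma> (x \<oplus>\<^bsub>A\<^esub> y) = \<sigma> x \<oplus>\<^bsub>A\<^esub> \<sigma> y"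
    "c \<in> carrier F \<Longrightarrow> x \<in> carrier C \<Longrightarrow> \<sigma> (c \<odot>\<^bsub>A\<^esub> x) = c \<odot>\<^bsub>A\<^esub> \<sigma> x" for x y c
    using module_hom_add[OF s(1)] module_hom_smult[OF s(1)] C_subset by auto
  have il: "\<Psi>inv (x \<oplus>\<^bsub>B\<^esub> y) = \<Psi>inv x \<oplus>\<^bsub>A\<^esub> \<Psi>inv y" if "x \<in> carrier B" "y \<in> carrier B" for x y
    using \<Psi>inv(3)[of "\<Psi>inv x \<oplus>\<^bsub>A\<^esub> \<Psi>inv y"] that \<Psi>inv(1,2) by (simp add: C_closed \<Psi>D)
  have im: "\<Psi>inv (c \<odot>\<^bsub>B\<^esub> x) = c \<odot>\<^bsub>A\<^esub> \<Psi>inv x" if "x \<in> carrier B" "c \<in> carrier F" for x c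
    using \<Psi>inv(3)[of "c \<odot>\<^bsub>A\<^esub> \<Psi>inv x"] that \<Psi>inv(1,2) by (simp add: C_closed \<Psi>D)
  show "\<sigma> \<in> module_hom F C C" by (rule module_homI) (simp_all add: corner_simps \<sigma>_corner sl)
  show "\<sigma> \<in> module_hom F C A" by (rule module_homI) (simp_all add: corner_simps \<sigma>_corner sl C_subset)
  show "\<Psi> \<in> module_hom F C B" by (rule module_homI) (simp_all add: corner_simps \<Psi>D)
  show "\<Psi>inv \<in> module_hom F B C" by (rule module_homI) (simp_all add: corner_simps \<Psi>inv il im)
  show "(\<lambda>a. \<Psi> (\<sigma> a)) \<in> module_hom F C B"
    by (rule module_homI) (simp_all add: corner_simps \<sigma>_corner sl \<Psi>D)
  show "\<tau>' \<in> module_hom F B B"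
    by (rule module_homI) (simp_all add: \<tau>'_def \<sigma>_corner sl \<Psi>D \<Psi>inv il im)
qed

lemma \<tau>'_\<Psi>: "x \<in> carrier C \<Longrightarrow> \<tau>' (\<Psi> x) = \<Psi> (\<sigma> x)"
  by (simp add: \<tau>'_def \<Psi>inv)

lemma \<tau>'_antimult:
  assumes x: "x \<in> carrier B" and y: "y \<in> carrier B"
  shows "\<tau>' (x \<otimes>\<^bsub>B\<^esub> y) = \<tau>' y \<otimes>\<^bsub>B\<^esub> \<tau>' x"
proof -
  have "\<Psi>inv (x \<otimes>\<^bsub>B\<^esub> y) = \<Psi>inv x \<otimes>\<^bsub>A\<^esub> \<Psi>inv y"
    using \<Psi>inv(3)[of "\<Psi>inv x \<otimes>\<^bsub>A\<^esub> \<Psi>inv y"] x y \<Psi>inv(1,2) by (simp add: C_closed \<Psi>D)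
  then show ?thesis
    using x y by (simp add: \<tau>'_def \<Psi>inv involutionD(2)[OF \<sigma>] C_subset \<Psi>D \<sigma>_corner)
qed

sublocale inc: scalar_extension_hom F C A K \<iota> "\<lambda>a. a"
  by unfold_locales (rule C.corner_inclusion_hom)
sublocale ret: scalar_extension_hom F A C K \<iota> "\<lambda>a. e \<otimes>\<^bsub>A\<^esub> a \<otimes>\<^bsub>A\<^esub> e"
  by unfold_locales (rule C.corner_retraction_hom)
sublocale idC: scalar_extension_hom F C C K \<iota> "\<lambda>a. a"
  by unfold_locales (rule module_homI; simp)
sublocale idB: scalar_extension_hom F B B K \<iota> "\<lambda>a. a"
  by unfold_locales (rule module_homI; simp)
sublocale idA: scalar_extension_hom F A A K \<iota> "\<lambda>a. a"
  by unfold_locales (rule module_homI; simp)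
sublocale \<sigma>: scalar_extension_hom F A A K \<iota> \<sigma>
  by unfold_locales (rule involutionD(1)[OF \<sigma>])
sublocale \<sigma>C: scalar_extension_hom F C C K \<iota> \<sigma> by unfold_locales (rule module_homs)
sublocale \<sigma>CA: scalar_extension_hom F C A K \<iota> \<sigma> by unfold_locales (rule module_homs)
sublocale \<Psi>: scalar_extension_hom F C B K \<iota> \<Psi> by unfold_locales (rule module_homs)
sublocale \<Psi>inv: scalar_extension_hom F B C K \<iota> \<Psi>inv by unfold_locales (rule module_homs)
sublocale \<Psi>\<sigma>: scalar_extension_hom F C B K \<iota> "\<lambda>a. \<Psi> (\<sigma> a)" by unfold_locales (rule module_homs)
sublocale \<tau>': scalar_extension_hom F B B K \<iota> \<tau>' by unfold_locales (rule module_homs)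
sublocale two_sided: scalar_extension_hom F A A K \<iota> "\<lambda>a. e \<otimes>\<^bsub>A\<^esub> a \<otimes>\<^bsub>A\<^esub> e"
  by unfold_locales (rule module_homI; simp add: C.e A.A.A.l_distr A.A.A.r_distr A.A.smult_mult_left A.A.smult_mult_right)

text \<open>By this lemma and \<open>incl_ret\<close> the extended inclusion \<open>(eAe)\<^sub>K \<rightarrow> A\<^sub>K\<close> is injective with image
  \<open>e A\<^sub>K e\<close>. Hence the definite
  description in \<^const>\<open>corner_base_change_map\<close> denotes the preimage under the inclusion.\<close>

lemma ret_incl: "h \<in> carrier CK \<Longrightarrow> ret.\<phi>K (inclK h) = h"
  using base_change_map_comp[OF inc.scalar_extension_hom_axioms ret.scalar_extension_hom_axioms idC.scalar_extension_hom_axioms, of h]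
    Cx.base_change_map_id[of "\<lambda>a. a" h] by (simp add: C.corner_iff)

lemma incl_ret: "x \<in> carrier A.AK \<Longrightarrow> inclK (ret.\<phi>K x) = eK \<otimes>\<^bsub>A.AK\<^esub> x \<otimes>\<^bsub>A.AK\<^esub> eK"
  using base_change_map_comp[OF ret.scalar_extension_hom_axioms inc.scalar_extension_hom_axioms two_sided.scalar_extension_hom_axioms, of x]
    A.base_change_map_two_sided_mult[OF C.e(1), of x] by simp

lemma corner_map_incl: "h \<in> carrier CK \<Longrightarrow> corner_base_change_map F K \<iota> A e B \<Psi> (inclK h) = \<Psi>K h"
proof -
  assume h: "h \<in> carrier CK"
  have "(THE h'. h' \<in> carrier CK \<and> inclK h' = inclK h) = h"
    using h ret_incl by (intro the_equality) metis+
  then show ?thesis by (simp add: corner_base_change_map_def)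
qed

lemma \<sigma>_incl: "h \<in> carrier CK \<Longrightarrow> \<sigma>K (inclK h) = inclK (\<sigma>C.\<phi>K h)"
  using base_change_map_comp[OF inc.scalar_extension_hom_axioms \<sigma>.scalar_extension_hom_axioms \<sigma>CA.scalar_extension_hom_axioms, of h]
    base_change_map_comp[OF \<sigma>C.scalar_extension_hom_axioms inc.scalar_extension_hom_axioms \<sigma>CA.scalar_extension_hom_axioms, of h]
  by simp

lemma incl_mult: "h \<in> carrier CK \<Longrightarrow> h' \<in> carrier CK \<Longrightarrow> inclK (h \<otimes>\<^bsub>CK\<^esub> h') = inclK h \<otimes>\<^bsub>A.AK\<^esub> inclK h'"
  by (rule inc.base_change_map_mult) (simp add: corner_simps)

lemma eK_incl: "h \<in> carrier CK \<Longrightarrow> eK \<otimes>\<^bsub>A.AK\<^esub> inclK h = inclK h"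
  "h \<in> carrier CK \<Longrightarrow> inclK h \<otimes>\<^bsub>A.AK\<^esub> eK = inclK h"
proof -
  have e1: "eK = inclK \<one>\<^bsub>CK\<^esub>"
    using inc.base_change_map_incl[of e] Cx.incl_one C.e by (simp add: corner_simps C.corner_iff)
  assume h: "h \<in> carrier CK"
  show "eK \<otimes>\<^bsub>A.AK\<^esub> inclK h = inclK h" "inclK h \<otimes>\<^bsub>A.AK\<^esub> eK = inclK h"
    unfolding e1 using incl_mult[of "\<one>\<^bsub>CK\<^esub>" h] incl_mult[of h "\<one>\<^bsub>CK\<^esub>"] h by simp_all
qed

lemma \<sigma>K_involution:
  "x \<in> carrier A.AK \<Longrightarrow> \<sigma>K (\<sigma>K x) = x"
  "x \<in> carrier A.AK \<Longrightarrow> y \<in> carrier A.AK \<Longrightarrow> \<sigma>K (x \<otimes>\<^bsub>A.AK\<^esub> y) = \<sigma>K y \<otimes>\<^bsub>A.AK\<^esub> \<sigma>K x"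
  "\<sigma>K eK = eK"
proof -
  note s = involutionD[OF \<sigma>]
  show "x \<in> carrier A.AK \<Longrightarrow> \<sigma>K (\<sigma>K x) = x"
    using base_change_map_comp[OF \<sigma>.scalar_extension_hom_axioms \<sigma>.scalar_extension_hom_axioms idA.scalar_extension_hom_axioms, of x]
      A.base_change_map_id[of "\<lambda>a. a" x] by (simp add: s)
  show "x \<in> carrier A.AK \<Longrightarrow> y \<in> carrier A.AK \<Longrightarrow> \<sigma>K (x \<otimes>\<^bsub>A.AK\<^esub> y) = \<sigma>K y \<otimes>\<^bsub>A.AK\<^esub> \<sigma>K x"
    by (rule \<sigma>.base_change_map_antimult) (simp add: s)
  show "\<sigma>K eK = eK" using \<sigma>.base_change_map_incl[OF C.e(1)] by (simp add: \<sigma>e)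
qed

lemma \<Psi>K_\<sigma>: "h \<in> carrier CK \<Longrightarrow> \<tau>'.\<phi>K (\<Psi>K h) = \<Psi>K (\<sigma>C.\<phi>K h)"
  using base_change_map_comp[OF \<sigma>C.scalar_extension_hom_axioms \<Psi>.scalar_extension_hom_axioms \<Psi>\<sigma>.scalar_extension_hom_axioms, of h]
    base_change_map_comp[OF \<Psi>.scalar_extension_hom_axioms \<tau>'.scalar_extension_hom_axioms \<Psi>\<sigma>.scalar_extension_hom_axioms, of h]
  by (simp add: \<tau>'_\<Psi>)

text \<open>\<open>e \<sigma>(f) f e\<close> is \<open>\<sigma>\<close>-symmetric because \<open>e\<close> is, and \<open>\<Psi>\<close> turns \<open>\<sigma>\<close> into \<open>\<tau>'\<close>.\<close>

lemma hermitian_square_fixed: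
  assumes f: "f \<in> carrier A.AK"
    and s: "s = corner_base_change_map F K \<iota> A e B \<Psi> (eK \<otimes>\<^bsub>A.AK\<^esub> \<sigma>K f \<otimes>\<^bsub>A.AK\<^esub> f \<otimes>\<^bsub>A.AK\<^esub> eK)"
  shows "\<tau>'.\<phi>K s = s"
proof -
  define y where "y = eK \<otimes>\<^bsub>A.AK\<^esub> (\<sigma>K f \<otimes>\<^bsub>A.AK\<^esub> f) \<otimes>\<^bsub>A.AK\<^esub> eK"
  define h where "h = ret.\<phi>K (\<sigma>K f \<otimes>\<^bsub>A.AK\<^esub> f)"
  have eKc: "eK \<in> carrier A.AK" using C.e by simp
  have \<sigma>f: "\<sigma>K f \<in> carrier A.AK" using f by (rule \<sigma>.base_change_map_closed)
  have h: "h \<in> carrier CK" unfolding h_def using f \<sigma>f by (intro ret.base_change_map_closed) simp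
  have y: "inclK h = y" unfolding h_def y_def using f \<sigma>f by (intro incl_ret) simp
  have "eK \<otimes>\<^bsub>A.AK\<^esub> \<sigma>K f \<otimes>\<^bsub>A.AK\<^esub> f \<otimes>\<^bsub>A.AK\<^esub> eK = y"
    unfolding y_def using eKc f \<sigma>f by (simp add: A.AK.A.m_assoc)
  then have s': "s = \<Psi>K h" using s corner_map_incl[OF h] y by simp
  have "\<sigma>K y = y"
    unfolding y_def using eKc f \<sigma>f by (simp add: \<sigma>K_involution A.AK.A.m_assoc)
  then have "inclK (\<sigma>C.\<phi>K h) = inclK h" using \<sigma>_incl[OF h] y by simp
  then have "\<sigma>C.\<phi>K h = h" using ret_incl h \<sigma>C.base_change_map_closed[OF h] by metis
  then show ?thesis unfolding s' \<Psi>K_\<sigma>[OF h] by simp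
qed

text \<open>The preimage of \<open>g\<close> under \<open>\<Psi>\<^sub>K\<close> serves as \<open>f\<close>: it lies in the corner, so that multiplication by
  \<open>e\<close> does not affect it.\<close>

lemma hermitian_square_represented:
  assumes g: "g \<in> carrier B.AK" and \<tau>: "\<tau> \<in> module_hom F B B"
    and comm: "\<And>x. x \<in> carrier C \<Longrightarrow> \<Psi> (\<sigma> x) = \<tau> (\<Psi> x)"
  shows "\<exists>f \<in> carrier A.AK. corner_base_change_map F K \<iota> A e B \<Psi> (eK \<otimes>\<^bsub>A.AK\<^esub> \<sigma>K f \<otimes>\<^bsub>A.AK\<^esub> f \<otimes>\<^bsub>A.AK\<^esub> eK)
      = base_change_map F K \<iota> B B \<tau> g \<otimes>\<^bsub>B.AK\<^esub> g"
proof
  interpret \<tau>: scalar_extension_hom F B B K \<iota> \<tau> using \<tau> by unfold_locales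
  define h where "h = \<Psi>inv.\<phi>K g"
  have h: "h \<in> carrier CK" unfolding h_def using g by (rule \<Psi>inv.base_change_map_closed)
  have \<sigma>h: "\<sigma>C.\<phi>K h \<in> carrier CK" using h by (rule \<sigma>C.base_change_map_closed)
  have g': "\<Psi>K h = g"
    unfolding h_def using g
      base_change_map_comp[OF \<Psi>inv.scalar_extension_hom_axioms \<Psi>.scalar_extension_hom_axioms idB.scalar_extension_hom_axioms, of g]
      B.base_change_map_id[of "\<lambda>a. a" g] by (simp add: \<Psi>inv)
  show f: "inclK h \<in> carrier A.AK" using h by (rule inc.base_change_map_closed)
  have "eK \<otimes>\<^bsub>A.AK\<^esub> \<sigma>K (inclK h) \<otimes>\<^bsub>A.AK\<^esub> inclK h \<otimes>\<^bsub>A.AK\<^esub> eK = inclK (\<sigma>C.\<phi>K h \<otimes>\<^bsub>CK\<^esub> h)"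
    using h \<sigma>h by (simp add: \<sigma>_incl eK_incl incl_mult[symmetric])
  moreover have "\<Psi>K (\<sigma>C.\<phi>K h \<otimes>\<^bsub>CK\<^esub> h) = \<Psi>K (\<sigma>C.\<phi>K h) \<otimes>\<^bsub>B.AK\<^esub> \<Psi>K h"
    using h \<sigma>h by (intro \<Psi>.base_change_map_mult) (simp_all add: corner_simps \<Psi>D)
  moreover have "\<Psi>K (\<sigma>C.\<phi>K h) = \<tau>.\<phi>K (\<Psi>K h)"
    using base_change_map_comp[OF \<sigma>C.scalar_extension_hom_axioms \<Psi>.scalar_extension_hom_axioms \<Psi>\<sigma>.scalar_extension_hom_axioms, of h]
      base_change_map_comp[OF \<Psi>.scalar_extension_hom_axioms \<tau>.scalar_extension_hom_axioms \<Psi>\<sigma>.scalar_extension_hom_axioms, of h]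
      h by (simp add: comm)
  ultimately show "corner_base_change_map F K \<iota> A e B \<Psi> (eK \<otimes>\<^bsub>A.AK\<^esub> \<sigma>K (inclK h) \<otimes>\<^bsub>A.AK\<^esub> inclK h \<otimes>\<^bsub>A.AK\<^esub> eK)
      = \<tau>.\<phi>K g \<otimes>\<^bsub>B.AK\<^esub> g"
    using corner_map_incl[of "\<sigma>C.\<phi>K h \<otimes>\<^bsub>CK\<^esub> h"] h \<sigma>h by (simp add: g')
qed

end

section \<open>Linear algebra over a field\<close>

text \<open>Gaussian elimination: an unknown with a nonzero coefficient in one of the equations is eliminated
  together with that equation.\<close>

lemma (in field) homogeneous_system_solvable:
  assumes "finite J" "finite I" "card J < card I"
    and "\<And>j i. j \<in> J \<Longrightarrow> i \<in> I \<Longrightarrow> M j i \<in> carrier R"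
  shows "\<exists>c. (\<forall>i \<in> I. c i \<in> carrier R) \<and> (\<exists>i \<in> I. c i \<noteq> \<zero>) \<and> (\<forall>j \<in> J. (\<Oplus>i \<in> I. M j i \<otimes> c i) = \<zero>)"
  using assms
proof (induction J arbitrary: I M rule: finite_induct)
  case empty
  then have "I \<noteq> {}" by auto
  then show ?case using one_not_zero by (intro exI[of _ "\<lambda>_. \<one>"]) auto
next
  case (insert j0 J)
  show ?case
  proof (cases "\<forall>i \<in> I. M j0 i = \<zero>")
    case True
    have "card J < card I" using insert by simp
    then have "\<exists>c. (\<forall>i \<in> I. c i \<in> carrier R) \<and> (\<exists>i \<in> I. c i \<noteq> \<zero>) \<and> (\<forall>j \<in> J. (\<Oplus>i \<in> I. M j i \<otimes> c i) = \<zero>)"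
      using insert.prems by (intro insert.IH[of I M]) simp_all
    then obtain c where c: "\<forall>i \<in> I. c i \<in> carrier R" "\<exists>i \<in> I. c i \<noteq> \<zero>"
      "\<forall>j \<in> J. (\<Oplus>i \<in> I. M j i \<otimes> c i) = \<zero>"
      by (elim exE conjE)
    moreover have "(\<Oplus>i \<in> I. M j0 i \<otimes> c i) = \<zero>"
      using True c by (intro add.finprod_one_eqI) auto
    ultimately show ?thesis by (intro exI[of _ c]) simp
  next
    case False
    then obtain i0 where i0: "i0 \<in> I" "M j0 i0 \<noteq> \<zero>" by auto
    define m where "m = inv (M j0 i0)"
    have m0: "M j0 i0 \<in> carrier R" using insert.prems i0 by simp
    have m: "m \<in> carrier R" "M j0 i0 \<otimes> m = \<one>"
      using i0 m0 field_Units by (auto simp: m_def)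
    let ?I = "I - {i0}"
    have fin: "finite ?I" using insert.prems by simp
    define M' where "M' j i = M j i \<ominus> M j i0 \<otimes> m \<otimes> M j0 i" for j i
    have Mc: "M j i \<in> carrier R" if "j \<in> insert j0 J" "i \<in> I" for j i using insert.prems that by blast
    have M'c: "M' j i \<in> carrier R" if "j \<in> J" "i \<in> ?I" for j i
      unfolding M'_def using Mc that i0 m by simp
    have "card J < card ?I" using insert.prems insert.hyps i0 by (simp add: card_Diff_singleton)
    then have "\<exists>c. (\<forall>i \<in> ?I. c i \<in> carrier R) \<and> (\<exists>i \<in> ?I. c i \<noteq> \<zero>) \<and> (\<forall>j \<in> J. (\<Oplus>i \<in> ?I. M' j i \<otimes> c i) = \<zero>)"
      using fin M'c by (intro insert.IH[of ?I M'])
    then obtain c where c: "\<forall>i \<in> ?I. c i \<in> carrier R" "\<exists>i \<in> ?I. c i \<noteq> \<zero>"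
      "\<forall>j \<in> J. (\<Oplus>i \<in> ?I. M' j i \<otimes> c i) = \<zero>"
      by (elim exE conjE)
    define S where "S j = (\<Oplus>i \<in> ?I. M j i \<otimes> c i)" for j
    have Sc: "S j \<in> carrier R" if "j \<in> insert j0 J" for j
      unfolding S_def using Mc that c by (intro finsum_closed) auto
    define c' where "c' = c(i0 := \<ominus> (m \<otimes> S j0))"
    have c'0: "c' i0 \<in> carrier R" unfolding c'_def using m Sc by simp
    have c'c: "\<forall>i \<in> I. c' i \<in> carrier R" using c c'0 by (auto simp: c'_def)
    have split: "(\<Oplus>i \<in> I. M j i \<otimes> c' i) = M j i0 \<otimes> c' i0 \<oplus> S j" if j: "j \<in> insert j0 J" for j
    proof -
      have "I = insert i0 ?I" using i0 by auto
      then have "(\<Oplus>i \<in> I. M j i \<otimes> c' i) = (\<Oplus>i \<in> insert i0 ?I. M j i \<otimes> c' i)" by simp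
      also have "\<dots> = M j i0 \<otimes> c' i0 \<oplus> (\<Oplus>i \<in> ?I. M j i \<otimes> c' i)"
        using fin Mc[OF j] c'c i0 by (intro finsum_insert) auto
      also have "(\<Oplus>i \<in> ?I. M j i \<otimes> c' i) = S j"
        unfolding S_def using Mc[OF j] c by (intro finsum_cong') (auto simp: c'_def)
      finally show ?thesis .
    qed
    have "(\<Oplus>i \<in> I. M j0 i \<otimes> c' i) = \<zero>"
    proof -
      have "M j0 i0 \<otimes> c' i0 = \<ominus> (M j0 i0 \<otimes> (m \<otimes> S j0))"
        using m m0 Sc by (simp add: c'_def r_minus)
      also have "M j0 i0 \<otimes> (m \<otimes> S j0) = M j0 i0 \<otimes> m \<otimes> S j0"
        using m m0 Sc by (intro m_assoc[symmetric]) auto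
      also have "M j0 i0 \<otimes> m \<otimes> S j0 = S j0" using m Sc by simp
      finally show ?thesis unfolding split[OF insertI1] using m Sc by (simp add: l_neg)
    qed
    moreover have "(\<Oplus>i \<in> I. M j i \<otimes> c' i) = \<zero>" if j: "j \<in> J" for j
    proof -
      have j': "j \<in> insert j0 J" using j by simp
      have Mj: "M j i0 \<in> carrier R" using Mc[OF j'] i0 by simp
      have "\<zero> = (\<Oplus>i \<in> ?I. M' j i \<otimes> c i)" using c j by simp
      also have "\<dots> = (\<Oplus>i \<in> ?I. M j i \<otimes> c i \<oplus> (\<ominus> (M j i0 \<otimes> m)) \<otimes> (M j0 i \<otimes> c i))"
        using Mc[OF j'] Mc[of j0] c m Mj
        by (intro finsum_cong' refl) (auto simp: M'_def minus_eq l_distr l_minus m_assoc)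
      also have "\<dots> = S j \<oplus> (\<Oplus>i \<in> ?I. (\<ominus> (M j i0 \<otimes> m)) \<otimes> (M j0 i \<otimes> c i))"
        unfolding S_def using Mc[OF j'] Mc[of j0] c m Mj by (intro finsum_addf) auto
      also have "(\<Oplus>i \<in> ?I. (\<ominus> (M j i0 \<otimes> m)) \<otimes> (M j0 i \<otimes> c i)) = (\<ominus> (M j i0 \<otimes> m)) \<otimes> S j0"
        unfolding S_def using Mc[of j0] c m Mj fin by (intro finsum_rdistr[symmetric]) auto
      also have "\<dots> = M j i0 \<otimes> c' i0"
        unfolding c'_def using m Mj Sc by (simp add: l_minus r_minus m_assoc)
      finally show ?thesis unfolding split[OF j'] using Sc[OF j'] c'0 Mj by (simp add: a_comm)
    qed
    moreover have "\<exists>i \<in> I. c' i \<noteq> \<zero>" using c(2) by (auto simp: c'_def)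
    ultimately show ?thesis using c'c by (intro exI[of _ c']) auto
  qed
qed

lemma semilinear_lincomb:
  assumes "module F V" "ring K" and l: "l \<in> semilinear F K \<iota> V" and "finite S"
    and "\<And>k. k \<in> S \<Longrightarrow> a k \<in> carrier F" "\<And>k. k \<in> S \<Longrightarrow> b k \<in> carrier V"
    and \<iota>: "\<And>x. x \<in> carrier F \<Longrightarrow> \<iota> x \<in> carrier K"
  shows "l (\<Oplus>\<^bsub>V\<^esub>k\<in>S. a k \<odot>\<^bsub>V\<^esub> b k) = (\<Oplus>\<^bsub>K\<^esub>k\<in>S. \<iota> (a k) \<otimes>\<^bsub>K\<^esub> l (b k))"
proof -
  interpret V: module F V by fact
  interpret K: ring K by fact
  have "l \<zero>\<^bsub>V\<^esub> \<oplus>\<^bsub>K\<^esub> l \<zero>\<^bsub>V\<^esub> = l \<zero>\<^bsub>V\<^esub>" using semilinear_add[OF l, of "\<zero>\<^bsub>V\<^esub>" "\<zero>\<^bsub>V\<^esub>"] by simp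
  then have l0: "l \<zero>\<^bsub>V\<^esub> = \<zero>\<^bsub>K\<^esub>"
    using semilinear_closed[OF l V.zero_closed] by (metis K.add.l_cancel_one')
  show ?thesis
    using assms(4,5,6)
  proof (induction S rule: finite_induct)
    case (insert s S)
    have c: "a k \<odot>\<^bsub>V\<^esub> b k \<in> carrier V" "\<iota> (a k) \<otimes>\<^bsub>K\<^esub> l (b k) \<in> carrier K" if "k \<in> insert s S" for k
      using insert.prems[OF that] \<iota> semilinear_closed[OF l] by auto
    have sum: "(\<Oplus>\<^bsub>V\<^esub>k\<in>S. a k \<odot>\<^bsub>V\<^esub> b k) \<in> carrier V" using c by (intro V.finsum_closed) auto
    have "l (\<Oplus>\<^bsub>V\<^esub>k\<in>insert s S. a k \<odot>\<^bsub>V\<^esub> b k) = l (a s \<odot>\<^bsub>V\<^esub> b s \<oplus>\<^bsub>V\<^esub> (\<Oplus>\<^bsub>V\<^esub>k\<in>S. a k \<odot>\<^bsub>V\<^esub> b k))"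
      using insert.hyps c by (subst V.finsum_insert) auto
    also have "\<dots> = \<iota> (a s) \<otimes>\<^bsub>K\<^esub> l (b s) \<oplus>\<^bsub>K\<^esub> l (\<Oplus>\<^bsub>V\<^esub>k\<in>S. a k \<odot>\<^bsub>V\<^esub> b k)"
      using semilinear_add[OF l c(1) sum, of s] semilinear_smult[OF l, of "a s" "b s"] insert.prems by simp
    also have "\<dots> = (\<Oplus>\<^bsub>K\<^esub>k\<in>insert s S. \<iota> (a k) \<otimes>\<^bsub>K\<^esub> l (b k))"
      using insert c by (subst K.finsum_insert) auto
    finally show ?case .
  qed (simp add: l0)
qed

lemma functional_lincomb:
  assumes "module F V" "l \<in> functionals F V" "finite S"
    and "\<And>k. k \<in> S \<Longrightarrow> a k \<in> carrier F" "\<And>k. k \<in> S \<Longrightarrow> b k \<in> carrier V"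
  shows "l (\<Oplus>\<^bsub>V\<^esub>k\<in>S. a k \<odot>\<^bsub>V\<^esub> b k) = (\<Oplus>\<^bsub>F\<^esub>k\<in>S. a k \<otimes>\<^bsub>F\<^esub> l (b k))"
  using semilinear_lincomb[OF assms(1) _ assms(2-5)] assms(1) by (simp add: module_def cring.axioms)

text \<open>A square system with trivial kernel is solvable for every right-hand side. The right-hand side \<open>y\<close> is
  treated as one further column, so that the system has a nontrivial relation between \<open>n + 1\<close>
  columns; triviality of the kernel makes the coefficient of \<open>y\<close> in it nonzero.\<close>

lemma functionals_surjective:
  assumes F: "field F" and V: "module F V" and d: "\<And>j. j < n \<Longrightarrow> d j \<in> carrier V"
    and P: "\<And>s. s < n \<Longrightarrow> P s \<in> functionals F V"
    and inj: "\<And>a. (\<And>j. j < n \<Longrightarrow> a j \<in> carrier F) \<Longrightarrow>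
        (\<And>s. s < n \<Longrightarrow> P s (\<Oplus>\<^bsub>V\<^esub>j\<in>{..<n}. a j \<odot>\<^bsub>V\<^esub> d j) = \<zero>\<^bsub>F\<^esub>) \<Longrightarrow> (\<forall>j < n. a j = \<zero>\<^bsub>F\<^esub>)"
    and y: "\<And>s. s < n \<Longrightarrow> y s \<in> carrier F"
  shows "\<exists>a. (\<forall>j < n. a j \<in> carrier F) \<and> (\<forall>s < n. P s (\<Oplus>\<^bsub>V\<^esub>j\<in>{..<n :: nat}. a j \<odot>\<^bsub>V\<^esub> d j) = y s)"
proof -
  interpret F: field F by fact
  define M where "M s j = (if j < n then P s (d j) else y s)" for s j
  have Pc: "P s (d j) \<in> carrier F" if "s < n" "j < n" for s j
    by (rule semilinear_closed[OF P[OF that(1)] d[OF that(2)]])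
  have "\<exists>c. (\<forall>i \<in> {..n}. c i \<in> carrier F) \<and> (\<exists>i \<in> {..n}. c i \<noteq> \<zero>\<^bsub>F\<^esub>) \<and> (\<forall>s \<in> {..<n}. (\<Oplus>\<^bsub>F\<^esub>i \<in> {..n}. M s i \<otimes>\<^bsub>F\<^esub> c i) = \<zero>\<^bsub>F\<^esub>)"
    using Pc y by (intro F.homogeneous_system_solvable) (auto simp: M_def)
  then obtain c where c: "\<And>i. i \<le> n \<Longrightarrow> c i \<in> carrier F" and nz: "\<exists>i \<le> n. c i \<noteq> \<zero>\<^bsub>F\<^esub>"
    and sol: "\<And>s. s < n \<Longrightarrow> (\<Oplus>\<^bsub>F\<^esub>i \<in> {..n}. M s i \<otimes>\<^bsub>F\<^esub> c i) = \<zero>\<^bsub>F\<^esub>" by auto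
  have val: "P s (\<Oplus>\<^bsub>V\<^esub>j\<in>{..<n}. a j \<odot>\<^bsub>V\<^esub> d j) = (\<Oplus>\<^bsub>F\<^esub>j\<in>{..<n}. a j \<otimes>\<^bsub>F\<^esub> P s (d j))"
    if "\<And>j. j < n \<Longrightarrow> a j \<in> carrier F" "s < n" for a s
    using that d by (intro functional_lincomb[OF V P]) auto
  have rel: "P s (\<Oplus>\<^bsub>V\<^esub>j\<in>{..<n}. c j \<odot>\<^bsub>V\<^esub> d j) \<oplus>\<^bsub>F\<^esub> c n \<otimes>\<^bsub>F\<^esub> y s = \<zero>\<^bsub>F\<^esub>" if s: "s < n" for s
  proof -
    have "{..n} = insert n {..<n}" by auto
    then have "\<zero>\<^bsub>F\<^esub> = (\<Oplus>\<^bsub>F\<^esub>i \<in> insert n {..<n}. M s i \<otimes>\<^bsub>F\<^esub> c i)" using sol[OF s] by (simp only:)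
    also have "\<dots> = y s \<otimes>\<^bsub>F\<^esub> c n \<oplus>\<^bsub>F\<^esub> (\<Oplus>\<^bsub>F\<^esub>i \<in> {..<n}. M s i \<otimes>\<^bsub>F\<^esub> c i)"
      using Pc[OF s] y[OF s] c by (subst F.finsum_insert) (auto simp: M_def)
    also have "(\<Oplus>\<^bsub>F\<^esub>i \<in> {..<n}. M s i \<otimes>\<^bsub>F\<^esub> c i) = (\<Oplus>\<^bsub>F\<^esub>j\<in>{..<n}. c j \<otimes>\<^bsub>F\<^esub> P s (d j))"
      using Pc[OF s] c by (intro F.finsum_cong' refl) (auto simp: M_def F.m_comm)
    also have "\<dots> = P s (\<Oplus>\<^bsub>V\<^esub>j\<in>{..<n}. c j \<odot>\<^bsub>V\<^esub> d j)" using c s by (intro val[symmetric]) auto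
    finally have *: "\<zero>\<^bsub>F\<^esub> = y s \<otimes>\<^bsub>F\<^esub> c n \<oplus>\<^bsub>F\<^esub> P s (\<Oplus>\<^bsub>V\<^esub>j\<in>{..<n}. c j \<odot>\<^bsub>V\<^esub> d j)" .
    interpret V: module F V by fact
    have "P s (\<Oplus>\<^bsub>V\<^esub>j\<in>{..<n}. c j \<odot>\<^bsub>V\<^esub> d j) \<in> carrier F"
      using c d by (intro semilinear_closed[OF P[OF s]] V.finsum_closed) auto
    then show ?thesis using * y[OF s] c[of n] by (simp add: F.a_comm F.m_comm)
  qed
  have cn: "c n \<noteq> \<zero>\<^bsub>F\<^esub>"
  proof
    assume 0: "c n = \<zero>\<^bsub>F\<^esub>"
    interpret V: module F V by fact
    have "P s (\<Oplus>\<^bsub>V\<^esub>j\<in>{..<n}. c j \<odot>\<^bsub>V\<^esub> d j) = \<zero>\<^bsub>F\<^esub>" if s: "s < n" for s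
    proof -
      have "P s (\<Oplus>\<^bsub>V\<^esub>j\<in>{..<n}. c j \<odot>\<^bsub>V\<^esub> d j) \<in> carrier F"
        using c d by (intro semilinear_closed[OF P[OF s]] V.finsum_closed) auto
      then show ?thesis using rel[OF s] y[OF s] 0 by simp
    qed
    then have "\<forall>j < n. c j = \<zero>\<^bsub>F\<^esub>" using c by (intro inj) auto
    then show False using nz 0 by (metis le_neq_implies_less)
  qed
  define m where "m = \<ominus>\<^bsub>F\<^esub> (inv\<^bsub>F\<^esub> (c n))"
  have ci: "inv\<^bsub>F\<^esub> (c n) \<in> carrier F" "inv\<^bsub>F\<^esub> (c n) \<otimes>\<^bsub>F\<^esub> c n = \<one>\<^bsub>F\<^esub>"
    using cn c[of n] F.field_Units by auto
  have m: "m \<in> carrier F" unfolding m_def using ci by simp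
  interpret V: module F V by fact
  have "P s (\<Oplus>\<^bsub>V\<^esub>j\<in>{..<n}. (m \<otimes>\<^bsub>F\<^esub> c j) \<odot>\<^bsub>V\<^esub> d j) = y s" if s: "s < n" for s
  proof -
    let ?x = "\<Oplus>\<^bsub>V\<^esub>j\<in>{..<n}. c j \<odot>\<^bsub>V\<^esub> d j"
    have x: "?x \<in> carrier V" using c d by (intro V.finsum_closed) auto
    have "(\<Oplus>\<^bsub>V\<^esub>j\<in>{..<n}. (m \<otimes>\<^bsub>F\<^esub> c j) \<odot>\<^bsub>V\<^esub> d j) = (\<Oplus>\<^bsub>V\<^esub>j\<in>{..<n}. m \<odot>\<^bsub>V\<^esub> (c j \<odot>\<^bsub>V\<^esub> d j))"
      using c d m by (intro V.finsum_cong' refl) (auto simp: V.smult_assoc1)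
    also have "\<dots> = m \<odot>\<^bsub>V\<^esub> ?x"
      using c d m by (intro V.finsum_smult[symmetric]) auto
    finally have "P s (\<Oplus>\<^bsub>V\<^esub>j\<in>{..<n}. (m \<otimes>\<^bsub>F\<^esub> c j) \<odot>\<^bsub>V\<^esub> d j) = m \<otimes>\<^bsub>F\<^esub> P s ?x"
      using semilinear_smult[OF P[OF s] m x] by simp
    also have "P s ?x = \<ominus>\<^bsub>F\<^esub> (c n \<otimes>\<^bsub>F\<^esub> y s)"
      using F.minus_equality[OF rel[OF s]] semilinear_closed[OF P[OF s] x] c[of n] y[OF s] by simp
    also have "m \<otimes>\<^bsub>F\<^esub> \<dots> = inv\<^bsub>F\<^esub> (c n) \<otimes>\<^bsub>F\<^esub> (c n \<otimes>\<^bsub>F\<^esub> y s)"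
      unfolding m_def using ci(1) c[of n] y[OF s] by (simp add: F.l_minus F.r_minus)
    also have "\<dots> = inv\<^bsub>F\<^esub> (c n) \<otimes>\<^bsub>F\<^esub> c n \<otimes>\<^bsub>F\<^esub> y s"
      using ci(1) c[of n] y[OF s] by (intro F.m_assoc[symmetric]) auto
    also have "\<dots> = y s" using ci y[OF s] by simp
    finally show ?thesis .
  qed
  then show ?thesis using m c by (intro exI[of _ "\<lambda>j. m \<otimes>\<^bsub>F\<^esub> c j"]) auto
qed

text \<open>Think of \<open>p\<close> and \<open>q\<close> as linear maps \<open>V \<rightarrow> F\<^sup>n\<close> with \<open>p\<close> injective: the maps \<open>r p + q\<close> are injective up
  to finitely many exceptional \<open>r\<close>. As with eigenvectors, kernel vectors for distinct \<open>r\<close> are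
  independent, and there are at most \<open>n\<close> independent vectors because \<open>p\<close> is injective.\<close>

lemma finite_eigenvalues:
  assumes F: "field F" and V: "module F V"
    and p: "\<And>s. s < n \<Longrightarrow> p s \<in> functionals F V" and q: "\<And>s. s < n \<Longrightarrow> q s \<in> functionals F V"
    and inj: "\<And>x. x \<in> carrier V \<Longrightarrow> (\<And>s. s < n \<Longrightarrow> p s x = \<zero>\<^bsub>F\<^esub>) \<Longrightarrow> x = \<zero>\<^bsub>V\<^esub>"
  shows "finite {r \<in> carrier F. \<exists>x \<in> carrier V. x \<noteq> \<zero>\<^bsub>V\<^esub> \<and> (\<forall>s < (n :: nat). r \<otimes>\<^bsub>F\<^esub> p s x \<oplus>\<^bsub>F\<^esub> q s x = \<zero>\<^bsub>F\<^esub>)}" (is "finite ?R")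
proof (rule ccontr)
  interpret F: field F by fact
  interpret V: module F V by fact
  assume "infinite ?R"
  then obtain T where T: "finite T" "card T = Suc n" "T \<subseteq> ?R"
    by (rule infinite_arbitrarily_large[THEN exE]) (elim conjE)
  have "\<forall>r \<in> T. \<exists>x. x \<in> carrier V \<and> x \<noteq> \<zero>\<^bsub>V\<^esub> \<and> (\<forall>s < n. r \<otimes>\<^bsub>F\<^esub> p s x \<oplus>\<^bsub>F\<^esub> q s x = \<zero>\<^bsub>F\<^esub>)"
    using T by auto
  then obtain x where "\<forall>r \<in> T. x r \<in> carrier V \<and> x r \<noteq> \<zero>\<^bsub>V\<^esub> \<and> (\<forall>s < n. r \<otimes>\<^bsub>F\<^esub> p s (x r) \<oplus>\<^bsub>F\<^esub> q s (x r) = \<zero>\<^bsub>F\<^esub>)"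
    by (rule bchoice[THEN exE])
  then have x: "\<And>r. r \<in> T \<Longrightarrow> x r \<in> carrier V" and x0: "\<And>r. r \<in> T \<Longrightarrow> x r \<noteq> \<zero>\<^bsub>V\<^esub>"
    and ker: "\<And>r s. r \<in> T \<Longrightarrow> s < n \<Longrightarrow> r \<otimes>\<^bsub>F\<^esub> p s (x r) \<oplus>\<^bsub>F\<^esub> q s (x r) = \<zero>\<^bsub>F\<^esub>" by auto
  have Tc: "r \<in> carrier F" if "r \<in> T" for r using T that by auto
  have pq: "p s (x r) \<in> carrier F" "q s (x r) \<in> carrier F" if "r \<in> T" "s < n" for r s
    using semilinear_closed[OF p[OF that(2)] x[OF that(1)]] semilinear_closed[OF q[OF that(2)] x[OF that(1)]] .
  have indep: "(\<Oplus>\<^bsub>V\<^esub>r\<in>T'. c r \<odot>\<^bsub>V\<^esub> x r) = \<zero>\<^bsub>V\<^esub> \<Longrightarrow> \<forall>r \<in> T'. c r = \<zero>\<^bsub>F\<^esub>"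
    if "finite T'" "T' \<subseteq> T" "\<And>r. r \<in> T' \<Longrightarrow> c r \<in> carrier F" for T' c
    using that
  proof (induction T' arbitrary: c rule: finite_induct)
    case (insert r0 T')
    have c: "c r \<in> carrier F" "r \<in> carrier F" "x r \<in> carrier V" if "r \<in> insert r0 T'" for r
      using insert.prems that Tc x by auto
    have sub: "T' \<subseteq> T" "r0 \<in> T" using insert.prems by auto
    let ?y = "\<Oplus>\<^bsub>V\<^esub>r\<in>insert r0 T'. (c r \<otimes>\<^bsub>F\<^esub> r) \<odot>\<^bsub>V\<^esub> x r"
    have y: "?y \<in> carrier V" using c by (intro V.finsum_closed) auto
    have py: "p s ?y = \<zero>\<^bsub>F\<^esub>" if s: "s < n" for s
    proof -
      have "p s ?y = (\<Oplus>\<^bsub>F\<^esub>r\<in>insert r0 T'. (c r \<otimes>\<^bsub>F\<^esub> r) \<otimes>\<^bsub>F\<^esub> p s (x r))"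
        using c insert.hyps by (intro functional_lincomb[OF V p[OF s]]) auto
      also have "\<dots> = (\<Oplus>\<^bsub>F\<^esub>r\<in>insert r0 T'. (\<ominus>\<^bsub>F\<^esub> \<one>\<^bsub>F\<^esub>) \<otimes>\<^bsub>F\<^esub> (c r \<otimes>\<^bsub>F\<^esub> q s (x r)))"
      proof (intro F.finsum_cong' refl)
        show "(\<lambda>r. (\<ominus>\<^bsub>F\<^esub> \<one>\<^bsub>F\<^esub>) \<otimes>\<^bsub>F\<^esub> (c r \<otimes>\<^bsub>F\<^esub> q s (x r))) \<in> insert r0 T' \<rightarrow> carrier F"
          using c pq s insert.prems by auto
        fix r assume r: "r \<in> insert r0 T'"
        then have rT: "r \<in> T" using insert.prems by auto
        have "r \<otimes>\<^bsub>F\<^esub> p s (x r) = \<ominus>\<^bsub>F\<^esub> q s (x r)"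
          using F.minus_equality[OF ker[OF rT s]] pq[OF rT s] c[OF r] by simp
        then show "(c r \<otimes>\<^bsub>F\<^esub> r) \<otimes>\<^bsub>F\<^esub> p s (x r) = (\<ominus>\<^bsub>F\<^esub> \<one>\<^bsub>F\<^esub>) \<otimes>\<^bsub>F\<^esub> (c r \<otimes>\<^bsub>F\<^esub> q s (x r))"
          using pq[OF rT s] c[OF r] by (simp add: F.m_assoc F.r_minus F.l_minus)
      qed
      also have "\<dots> = (\<ominus>\<^bsub>F\<^esub> \<one>\<^bsub>F\<^esub>) \<otimes>\<^bsub>F\<^esub> (\<Oplus>\<^bsub>F\<^esub>r\<in>insert r0 T'. c r \<otimes>\<^bsub>F\<^esub> q s (x r))"
        using insert.hyps c pq s insert.prems by (intro F.finsum_rdistr[symmetric]) auto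
      also have "(\<Oplus>\<^bsub>F\<^esub>r\<in>insert r0 T'. c r \<otimes>\<^bsub>F\<^esub> q s (x r)) = q s (\<Oplus>\<^bsub>V\<^esub>r\<in>insert r0 T'. c r \<odot>\<^bsub>V\<^esub> x r)"
        using c insert.hyps by (intro functional_lincomb[OF V q[OF s], symmetric]) auto
      also have "\<dots> = \<zero>\<^bsub>F\<^esub>"
        using insert.prems functional_lincomb[OF V q[OF s], of "{}"] by simp
      finally show ?thesis by simp
    qed
    have y0: "?y = \<zero>\<^bsub>V\<^esub>" by (rule inj[OF y py])
    have "(\<Oplus>\<^bsub>V\<^esub>r\<in>T'. (c r \<otimes>\<^bsub>F\<^esub> (r \<ominus>\<^bsub>F\<^esub> r0)) \<odot>\<^bsub>V\<^esub> x r) = \<zero>\<^bsub>V\<^esub>"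
    proof -
      have "(\<Oplus>\<^bsub>V\<^esub>r\<in>insert r0 T'. (c r \<otimes>\<^bsub>F\<^esub> (r \<ominus>\<^bsub>F\<^esub> r0)) \<odot>\<^bsub>V\<^esub> x r)
          = (\<Oplus>\<^bsub>V\<^esub>r\<in>insert r0 T'. (c r \<otimes>\<^bsub>F\<^esub> r) \<odot>\<^bsub>V\<^esub> x r \<oplus>\<^bsub>V\<^esub> (\<ominus>\<^bsub>F\<^esub> r0) \<odot>\<^bsub>V\<^esub> (c r \<odot>\<^bsub>V\<^esub> x r))"
        using c by (intro V.finsum_cong' refl)
          (auto simp: F.minus_eq F.r_distr F.m_comm V.smult_l_distr V.smult_assoc1[symmetric])
      also have "\<dots> = ?y \<oplus>\<^bsub>V\<^esub> (\<Oplus>\<^bsub>V\<^esub>r\<in>insert r0 T'. (\<ominus>\<^bsub>F\<^esub> r0) \<odot>\<^bsub>V\<^esub> (c r \<odot>\<^bsub>V\<^esub> x r))"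
        using c by (intro V.finsum_addf) auto
      also have "(\<Oplus>\<^bsub>V\<^esub>r\<in>insert r0 T'. (\<ominus>\<^bsub>F\<^esub> r0) \<odot>\<^bsub>V\<^esub> (c r \<odot>\<^bsub>V\<^esub> x r)) = (\<ominus>\<^bsub>F\<^esub> r0) \<odot>\<^bsub>V\<^esub> (\<Oplus>\<^bsub>V\<^esub>r\<in>insert r0 T'. c r \<odot>\<^bsub>V\<^esub> x r)"
        using c by (intro V.finsum_smult[symmetric]) auto
      finally have "(\<Oplus>\<^bsub>V\<^esub>r\<in>insert r0 T'. (c r \<otimes>\<^bsub>F\<^esub> (r \<ominus>\<^bsub>F\<^esub> r0)) \<odot>\<^bsub>V\<^esub> x r) = \<zero>\<^bsub>V\<^esub>"
        using y0 insert.prems c[of r0] by simp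
      moreover have "(\<Oplus>\<^bsub>V\<^esub>r\<in>insert r0 T'. (c r \<otimes>\<^bsub>F\<^esub> (r \<ominus>\<^bsub>F\<^esub> r0)) \<odot>\<^bsub>V\<^esub> x r)
          = (c r0 \<otimes>\<^bsub>F\<^esub> (r0 \<ominus>\<^bsub>F\<^esub> r0)) \<odot>\<^bsub>V\<^esub> x r0 \<oplus>\<^bsub>V\<^esub> (\<Oplus>\<^bsub>V\<^esub>r\<in>T'. (c r \<otimes>\<^bsub>F\<^esub> (r \<ominus>\<^bsub>F\<^esub> r0)) \<odot>\<^bsub>V\<^esub> x r)"
        using c insert.hyps by (intro V.finsum_insert) auto
      moreover have "(\<Oplus>\<^bsub>V\<^esub>r\<in>T'. (c r \<otimes>\<^bsub>F\<^esub> (r \<ominus>\<^bsub>F\<^esub> r0)) \<odot>\<^bsub>V\<^esub> x r) \<in> carrier V"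
        using c by (intro V.finsum_closed) auto
      moreover have "(c r0 \<otimes>\<^bsub>F\<^esub> (r0 \<ominus>\<^bsub>F\<^esub> r0)) \<odot>\<^bsub>V\<^esub> x r0 = \<zero>\<^bsub>V\<^esub>"
        using c[of r0] by (simp add: F.minus_eq F.r_neg)
      ultimately show ?thesis by (simp only: V.M.l_zero)
    qed
    then have z: "\<forall>r \<in> T'. c r \<otimes>\<^bsub>F\<^esub> (r \<ominus>\<^bsub>F\<^esub> r0) = \<zero>\<^bsub>F\<^esub>"
      using sub c by (intro insert.IH) auto
    have cT: "c r = \<zero>\<^bsub>F\<^esub>" if r: "r \<in> T'" for r
    proof -
      have "r \<noteq> r0" using insert.hyps r by auto
      then have "r \<ominus>\<^bsub>F\<^esub> r0 \<noteq> \<zero>\<^bsub>F\<^esub>" using c r by (simp add: F.r_right_minus_eq)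
      then show ?thesis using z r c F.integral_iff by auto
    qed
    have "(\<Oplus>\<^bsub>V\<^esub>r\<in>T'. c r \<odot>\<^bsub>V\<^esub> x r) = \<zero>\<^bsub>V\<^esub>"
      using cT c by (intro V.add.finprod_one_eqI) auto
    moreover have "(\<Oplus>\<^bsub>V\<^esub>r\<in>insert r0 T'. c r \<odot>\<^bsub>V\<^esub> x r) = c r0 \<odot>\<^bsub>V\<^esub> x r0 \<oplus>\<^bsub>V\<^esub> (\<Oplus>\<^bsub>V\<^esub>r\<in>T'. c r \<odot>\<^bsub>V\<^esub> x r)"
      using c insert.hyps by (intro V.finsum_insert) auto
    moreover have "c r0 \<odot>\<^bsub>V\<^esub> x r0 \<in> carrier V" using c[of r0] by simp
    ultimately have "c r0 \<odot>\<^bsub>V\<^esub> x r0 = \<zero>\<^bsub>V\<^esub>" using insert.prems(1) by (simp only: V.M.r_zero)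
    moreover have "c r0 = \<zero>\<^bsub>F\<^esub>" if "c r0 \<odot>\<^bsub>V\<^esub> x r0 = \<zero>\<^bsub>V\<^esub>"
    proof (rule ccontr)
      assume "c r0 \<noteq> \<zero>\<^bsub>F\<^esub>"
      then have i: "inv\<^bsub>F\<^esub> (c r0) \<in> carrier F" "inv\<^bsub>F\<^esub> (c r0) \<otimes>\<^bsub>F\<^esub> c r0 = \<one>\<^bsub>F\<^esub>"
        using c[of r0] F.field_Units by auto
      have "x r0 = inv\<^bsub>F\<^esub> (c r0) \<odot>\<^bsub>V\<^esub> (c r0 \<odot>\<^bsub>V\<^esub> x r0)"
        using i c[of r0] by (simp add: V.smult_assoc1[symmetric])
      then show False using that i x0[OF sub(2)] by simp
    qed
    ultimately show ?case using cT by auto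
  qed simp
  have "\<exists>c. (\<forall>r \<in> T. c r \<in> carrier F) \<and> (\<exists>r \<in> T. c r \<noteq> \<zero>\<^bsub>F\<^esub>) \<and> (\<forall>s \<in> {..<n}. (\<Oplus>\<^bsub>F\<^esub>r \<in> T. p s (x r) \<otimes>\<^bsub>F\<^esub> c r) = \<zero>\<^bsub>F\<^esub>)"
    using T pq by (intro F.homogeneous_system_solvable) auto
  then obtain c where c: "\<And>r. r \<in> T \<Longrightarrow> c r \<in> carrier F" and nz: "\<exists>r \<in> T. c r \<noteq> \<zero>\<^bsub>F\<^esub>"
    and sol: "\<And>s. s < n \<Longrightarrow> (\<Oplus>\<^bsub>F\<^esub>r \<in> T. p s (x r) \<otimes>\<^bsub>F\<^esub> c r) = \<zero>\<^bsub>F\<^esub>" by auto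
  have ps: "p s (\<Oplus>\<^bsub>V\<^esub>r\<in>T. c r \<odot>\<^bsub>V\<^esub> x r) = \<zero>\<^bsub>F\<^esub>" if s: "s < n" for s
  proof -
    have "p s (\<Oplus>\<^bsub>V\<^esub>r\<in>T. c r \<odot>\<^bsub>V\<^esub> x r) = (\<Oplus>\<^bsub>F\<^esub>r\<in>T. c r \<otimes>\<^bsub>F\<^esub> p s (x r))"
      using c x T by (intro functional_lincomb[OF V p[OF s]]) auto
    also have "\<dots> = (\<Oplus>\<^bsub>F\<^esub>r \<in> T. p s (x r) \<otimes>\<^bsub>F\<^esub> c r)"
      using c pq s by (intro F.finsum_cong' refl) (auto simp: F.m_comm)
    finally show ?thesis using sol[OF s] by simp
  qed
  have "(\<Oplus>\<^bsub>V\<^esub>r\<in>T. c r \<odot>\<^bsub>V\<^esub> x r) \<in> carrier V" using c x by (intro V.finsum_closed) auto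
  then have "(\<Oplus>\<^bsub>V\<^esub>r\<in>T. c r \<odot>\<^bsub>V\<^esub> x r) = \<zero>\<^bsub>V\<^esub>" using ps by (rule inj)
  with T(1) subset_refl c have "\<forall>r \<in> T. c r = \<zero>\<^bsub>F\<^esub>" by (rule indep[of T c])
  then show False using nz by blast
qed

text \<open>All elements are squares. On a finite set squaring would then be injective, although
  \<open>1\<^sup>2 = (- 1)\<^sup>2\<close>.\<close>

lemma (in algebraically_closed) infinite_carrier:
  assumes "\<one> \<oplus> \<one> \<noteq> \<zero>"
  shows "infinite (carrier L)"
proof
  assume fin: "finite (carrier L)"
  have "c \<in> (\<lambda>x. x \<otimes> x) ` carrier L" if c: "c \<in> carrier L" for c
  proof -
    have p: "[\<one>, \<zero>, \<ominus> c] \<in> carrier (poly_ring L)"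
      using c one_not_zero by (simp add: univ_poly_carrier[symmetric] polynomial_def)
    have "size (roots [\<one>, \<zero>, \<ominus> c]) = 2"
      using roots_over_carrier[OF p] by (simp add: splitted_def)
    then have "roots [\<one>, \<zero>, \<ominus> c] \<noteq> {#}" by (metis size_empty zero_neq_numeral)
    then obtain x where "x \<in># roots [\<one>, \<zero>, \<ominus> c]" by (metis multiset_nonemptyE)
    then have "is_root [\<one>, \<zero>, \<ominus> c] x" using roots_mem_iff_is_root[OF p] by blast
    then have x: "x \<in> carrier L" "eval [\<one>, \<zero>, \<ominus> c] x = \<zero>" unfolding is_root_def by blast+
    then have "x \<otimes> x \<oplus> \<ominus> c = \<zero>" using c by simp
    then have "x \<otimes> x = c" using r_right_minus_eq[OF m_closed[OF x(1) x(1)] c] unfolding minus_eq by blast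
    then show ?thesis using x(1) by (intro image_eqI[of _ _ x]) simp_all
  qed
  then have "carrier L \<subseteq> (\<lambda>x. x \<otimes> x) ` carrier L" by (rule subsetI)
  then have "(\<lambda>x. x \<otimes> x) ` carrier L = carrier L" by (intro equalityI image_subsetI m_closed)
  then have "inj_on (\<lambda>x. x \<otimes> x) (carrier L)" using fin by (intro eq_card_imp_inj_on) simp_all
  then have "\<one> = \<ominus> \<one>" by (rule inj_onD) (simp_all add: l_minus r_minus)
  then have "\<one> \<oplus> \<one> = \<one> \<oplus> \<ominus> \<one>" by (rule arg_cong[where f = "\<lambda>x. \<one> \<oplus> x"])
  then show False using assms r_neg[OF one_closed] by (simp only:)
qed

text \<open>A basis together with its dual basis. The index set is arbitrary because matrix units are indexed by
  pairs.\<close>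

definition coordinate_system ::
  "'f ring \<Rightarrow> ('f, 'a) module \<Rightarrow> 'i set \<Rightarrow> ('i \<Rightarrow> 'a) \<Rightarrow> ('i \<Rightarrow> 'a \<Rightarrow> 'f) \<Rightarrow> bool" where
  "coordinate_system F V S b c \<longleftrightarrow> finite S \<and> (\<forall>i \<in> S. b i \<in> carrier V \<and> c i \<in> functionals F V) \<and>
     (\<forall>i \<in> S. \<forall>k \<in> S. c k (b i) = (if i = k then \<one>\<^bsub>F\<^esub> else \<zero>\<^bsub>F\<^esub>)) \<and>
     (\<forall>x \<in> carrier V. x = (\<Oplus>\<^bsub>V\<^esub>k\<in>S. c k x \<odot>\<^bsub>V\<^esub> b k))"

lemma coordinate_systemD:
  assumes "coordinate_system F V S b c"
  shows "finite S" "i \<in> S \<Longrightarrow> b i \<in> carrier V" "i \<in> S \<Longrightarrow> c i \<in> functionals F V"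
    "i \<in> S \<Longrightarrow> k \<in> S \<Longrightarrow> c k (b i) = (if i = k then \<one>\<^bsub>F\<^esub> else \<zero>\<^bsub>F\<^esub>)"
    "x \<in> carrier V \<Longrightarrow> x = (\<Oplus>\<^bsub>V\<^esub>k\<in>S. c k x \<odot>\<^bsub>V\<^esub> b k)"
  using assms unfolding coordinate_system_def by blast+

lemma coordinate_lincomb:
  assumes V: "module F V" and cs: "coordinate_system F V S b c" and k: "k \<in> S"
    and a: "\<And>i. i \<in> S \<Longrightarrow> a i \<in> carrier F"
  shows "c k (\<Oplus>\<^bsub>V\<^esub>i\<in>S. a i \<odot>\<^bsub>V\<^esub> b i) = a k"
proof -
  interpret V: module F V by fact
  note D = coordinate_systemD[OF cs]
  have "c k (\<Oplus>\<^bsub>V\<^esub>i\<in>S. a i \<odot>\<^bsub>V\<^esub> b i) = (\<Oplus>\<^bsub>F\<^esub>i\<in>S. a i \<otimes>\<^bsub>F\<^esub> c k (b i))"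
    using a D k by (intro functional_lincomb[OF V]) auto
  also have "\<dots> = (\<Oplus>\<^bsub>F\<^esub>i\<in>S. if i = k then a i else \<zero>\<^bsub>F\<^esub>)"
    using a D(4) k by (intro V.R.finsum_cong' refl) auto
  also have "\<dots> = a k" using a k D(1) by (intro V.R.finsum_delta) auto
  finally show ?thesis .
qed

lemma coordinate_system_dim:
  assumes V: "vectorspace F V" and cs: "coordinate_system F V S b c"
  shows "vectorspace.dim F V = card S"
proof -
  interpret V: vectorspace F V by fact
  note D = coordinate_systemD[OF cs]
  have inj: "inj_on b S"
  proof (rule inj_onI)
    fix i k assume ik: "i \<in> S" "k \<in> S" "b i = b k"
    then have "c k (b i) = c k (b k)" by simp
    then show "i = k" using D(4)[OF ik(1,2)] D(4)[OF ik(2,2)] V.one_not_zero by (simp split: if_splits)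
  qed
  have sub: "b ` S \<subseteq> carrier V" using D(2) by blast
  have reindex: "V.lincomb a (b ` S) = (\<Oplus>\<^bsub>V\<^esub>i\<in>S. a (b i) \<odot>\<^bsub>V\<^esub> b i)" if "a \<in> b ` S \<rightarrow> carrier F" for a
    unfolding V.lincomb_def using that sub D(2) by (intro V.finsum_reindex inj) auto
  have "V.basis (b ` S)"
    unfolding V.basis_def
  proof (intro conjI sub)
    show "V.lin_indpt (b ` S)"
    proof (rule V.finite_lin_indpt2)
      fix a assume a: "a \<in> b ` S \<rightarrow> carrier F" "V.lincomb a (b ` S) = \<zero>\<^bsub>V\<^esub>"
      have "a (b k) = \<zero>\<^bsub>F\<^esub>" if k: "k \<in> S" for k
      proof -
        have "a (b k) = c k (V.lincomb a (b ` S))"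
          unfolding reindex[OF a(1)] using a by (intro coordinate_lincomb[OF V.module_axioms cs k, symmetric]) auto
        also have "\<dots> = c k (\<Oplus>\<^bsub>V\<^esub>i\<in>S. \<zero>\<^bsub>F\<^esub> \<odot>\<^bsub>V\<^esub> b i)"
          unfolding a(2) using D(2) by (subst V.finsum_smult_zero) auto
        also have "\<dots> = \<zero>\<^bsub>F\<^esub>" using k by (intro coordinate_lincomb[OF V.module_axioms cs]) auto
        finally show ?thesis .
      qed
      then show "\<forall>v \<in> b ` S. a v = \<zero>\<^bsub>F\<^esub>" by blast
    qed (use D(1) sub in auto)
    show "V.span (b ` S) = carrier V"
    proof (intro equalityI V.span_is_subset2 sub subsetI)
      fix x assume x: "x \<in> carrier V"
      define a where "a v = c (inv_into S b v) x" for v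
      have ab: "a (b k) = c k x" if "k \<in> S" for k using that inj by (simp add: a_def)
      have cx: "c k x \<in> carrier F" if "k \<in> S" for k using semilinear_closed[OF D(3)[OF that] x] .
      then have aF: "a \<in> b ` S \<rightarrow> carrier F" using ab by auto
      have "V.lincomb a (b ` S) = (\<Oplus>\<^bsub>V\<^esub>k\<in>S. c k x \<odot>\<^bsub>V\<^esub> b k)"
        unfolding reindex[OF aF] using ab cx D(2) by (intro V.finsum_cong' refl) auto
      then have "x = V.lincomb a (b ` S)" using D(5)[OF x] by simp
      then show "x \<in> V.span (b ` S)" unfolding V.span_def using aF D(1) by blast
    qed
  qed
  then show ?thesis using V.dim_basis[of "b ` S"] D(1) card_image[OF inj] by simp
qed

lemma basis_coordinate_system:
  assumes V: "vectorspace F V" and S: "finite S" "inj_on b S" "vectorspace.basis F V (b ` S)"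
  shows "\<exists>c. coordinate_system F V S b c"
proof -
  interpret V: vectorspace F V by fact
  have sub: "b ` S \<subseteq> carrier V" and gen: "V.span (b ` S) = carrier V" using S(3) by (auto simp: V.basis_def)
  have bS: "b i \<in> carrier V" if "i \<in> S" for i using sub that by blast
  have uniq: "\<exists>!a. a \<in> b ` S \<rightarrow>\<^sub>E carrier F \<and> V.lincomb a (b ` S) = x" if "x \<in> carrier V" for x
    using V.basis_criterion[of "b ` S"] S sub that by simp
  define a where "a x = (THE a. a \<in> b ` S \<rightarrow>\<^sub>E carrier F \<and> V.lincomb a (b ` S) = x)" for x
  have a: "a x \<in> b ` S \<rightarrow>\<^sub>E carrier F" "V.lincomb (a x) (b ` S) = x" if "x \<in> carrier V" for x
    using theI'[OF uniq[OF that]] by (auto simp: a_def)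
  define c where "c k x = a x (b k)" for k x
  have reindex: "V.lincomb f (b ` S) = (\<Oplus>\<^bsub>V\<^esub>i\<in>S. f (b i) \<odot>\<^bsub>V\<^esub> b i)" if "f \<in> b ` S \<rightarrow> carrier F" for f
    unfolding V.lincomb_def using that sub bS by (intro V.finsum_reindex S) auto
  have cF: "c k x \<in> carrier F" if "k \<in> S" "x \<in> carrier V" for k x
    using a(1)[OF that(2)] that(1) by (auto simp: c_def)
  have exp: "x = (\<Oplus>\<^bsub>V\<^esub>k\<in>S. c k x \<odot>\<^bsub>V\<^esub> b k)" if "x \<in> carrier V" for x
    using a(2)[OF that] reindex[of "a x"] a(1)[OF that] by (simp add: c_def PiE_def)
  have unique: "c k x = f k" if x: "x \<in> carrier V" and f: "\<And>i. i \<in> S \<Longrightarrow> f i \<in> carrier F"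
    and xf: "x = (\<Oplus>\<^bsub>V\<^esub>i\<in>S. f i \<odot>\<^bsub>V\<^esub> b i)" and k: "k \<in> S" for k x f
  proof -
    define g where "g = restrict (\<lambda>v. f (inv_into S b v)) (b ` S)"
    have gb: "g (b i) = f i" if "i \<in> S" for i using that S(2) by (simp add: g_def)
    have g: "g \<in> b ` S \<rightarrow>\<^sub>E carrier F" using f gb by (auto simp: g_def)
    have "V.lincomb g (b ` S) = (\<Oplus>\<^bsub>V\<^esub>i\<in>S. f i \<odot>\<^bsub>V\<^esub> b i)"
      using g f gb bS by (subst reindex) (auto intro!: V.finsum_cong')
    then have "a x = g" using uniq[OF x] a[OF x] g xf by metis
    then show ?thesis using gb k by (simp add: c_def)
  qed
  have "coordinate_system F V S b c"
    unfolding coordinate_system_def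
  proof (intro conjI ballI S(1))
    show "b i \<in> carrier V" if "i \<in> S" for i using bS that .
    show "c k \<in> functionals F V" if k: "k \<in> S" for k
    proof (rule semilinearI)
      fix x y assume xy: "x \<in> carrier V" "y \<in> carrier V"
      have "x \<oplus>\<^bsub>V\<^esub> y = (\<Oplus>\<^bsub>V\<^esub>k\<in>S. c k x \<odot>\<^bsub>V\<^esub> b k) \<oplus>\<^bsub>V\<^esub> (\<Oplus>\<^bsub>V\<^esub>k\<in>S. c k y \<odot>\<^bsub>V\<^esub> b k)"
        using exp xy by simp
      also have "\<dots> = (\<Oplus>\<^bsub>V\<^esub>k\<in>S. c k x \<odot>\<^bsub>V\<^esub> b k \<oplus>\<^bsub>V\<^esub> c k y \<odot>\<^bsub>V\<^esub> b k)"
        using cF xy bS by (intro V.finsum_addf[symmetric]) auto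
      also have "\<dots> = (\<Oplus>\<^bsub>V\<^esub>k\<in>S. (c k x \<oplus>\<^bsub>F\<^esub> c k y) \<odot>\<^bsub>V\<^esub> b k)"
        using cF xy bS by (intro V.finsum_cong' refl) (auto simp: V.smult_l_distr)
      finally have e: "x \<oplus>\<^bsub>V\<^esub> y = (\<Oplus>\<^bsub>V\<^esub>k\<in>S. (c k x \<oplus>\<^bsub>F\<^esub> c k y) \<odot>\<^bsub>V\<^esub> b k)" .
      show "c k (x \<oplus>\<^bsub>V\<^esub> y) = c k x \<oplus>\<^bsub>F\<^esub> c k y"
        by (rule unique[OF _ _ e k]) (use cF xy in simp_all)
    next
      fix r x assume r: "r \<in> carrier F" and x: "x \<in> carrier V"
      have "r \<odot>\<^bsub>V\<^esub> x = r \<odot>\<^bsub>V\<^esub> (\<Oplus>\<^bsub>V\<^esub>k\<in>S. c k x \<odot>\<^bsub>V\<^esub> b k)" using exp x by simp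
      also have "\<dots> = (\<Oplus>\<^bsub>V\<^esub>k\<in>S. r \<odot>\<^bsub>V\<^esub> (c k x \<odot>\<^bsub>V\<^esub> b k))"
        using cF x bS r by (intro V.finsum_smult) auto
      also have "\<dots> = (\<Oplus>\<^bsub>V\<^esub>k\<in>S. (r \<otimes>\<^bsub>F\<^esub> c k x) \<odot>\<^bsub>V\<^esub> b k)"
        using cF x bS r by (intro V.finsum_cong' refl) (auto simp: V.smult_assoc1)
      finally have e: "r \<odot>\<^bsub>V\<^esub> x = (\<Oplus>\<^bsub>V\<^esub>k\<in>S. (r \<otimes>\<^bsub>F\<^esub> c k x) \<odot>\<^bsub>V\<^esub> b k)" .
      show "c k (r \<odot>\<^bsub>V\<^esub> x) = r \<otimes>\<^bsub>F\<^esub> c k x"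
        by (rule unique[OF _ _ e k]) (use cF x r in simp_all)
    qed (use cF k in auto)
    show "c k (b i) = (if i = k then \<one>\<^bsub>F\<^esub> else \<zero>\<^bsub>F\<^esub>)" if i: "i \<in> S" and k: "k \<in> S" for i k
    proof (rule unique[OF bS[OF i] _ _ k])
      have "b i = (\<Oplus>\<^bsub>V\<^esub>j\<in>S. if j = i then b j else \<zero>\<^bsub>V\<^esub>)"
        using S(1) i bS by (intro V.finsum_delta[symmetric]) auto
      also have "\<dots> = (\<Oplus>\<^bsub>V\<^esub>j\<in>S. (if i = j then \<one>\<^bsub>F\<^esub> else \<zero>\<^bsub>F\<^esub>) \<odot>\<^bsub>V\<^esub> b j)"
        using bS by (intro V.finsum_cong' refl) auto
      finally show "b i = (\<Oplus>\<^bsub>V\<^esub>j\<in>S. (if i = j then \<one>\<^bsub>F\<^esub> else \<zero>\<^bsub>F\<^esub>) \<odot>\<^bsub>V\<^esub> b j)" .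
    qed simp
    show "x = (\<Oplus>\<^bsub>V\<^esub>k\<in>S. c k x \<odot>\<^bsub>V\<^esub> b k)" if "x \<in> carrier V" for x using exp that .
  qed
  then show ?thesis by blast
qed

lemma coordinate_system_frame:
  assumes "coordinate_system F A {..<N :: nat} b c" shows "finite_frame F A"
  unfolding finite_frame_def using coordinate_systemD[OF assms]
  by (intro exI[of _ N] exI[of _ b] exI[of _ c]) blast

lemma finite_dimensional_frame:
  assumes V: "vectorspace F V" and fd: "vectorspace.fin_dim F V" shows "finite_frame F V"
proof -
  interpret V: vectorspace F V by fact
  obtain \<beta> where \<beta>: "finite \<beta>" "V.basis \<beta>" using V.finite_basis_exists[OF fd] by blast
  obtain b where b: "bij_betw b {0..<card \<beta>} \<beta>" using ex_bij_betw_nat_finite[OF \<beta>(1)] by blast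
  then have "inj_on b {..<card \<beta>}" "b ` {..<card \<beta>} = \<beta>" by (auto simp: bij_betw_def atLeast0LessThan)
  then obtain c where "coordinate_system F V {..<card \<beta>} b c"
    using basis_coordinate_system[OF V, of "{..<card \<beta>}" b] \<beta>(2) by auto
  then show ?thesis by (rule coordinate_system_frame)
qed

section \<open>Involutions adjoint to a symmetric bilinear form\<close>

text \<open>This describes \<open>M\<^sub>n(L)\<close> with the involution \<open>x \<mapsto> G\<^sup>-\<^sup>1 x\<^sup>T G\<close> without mentioning entries: \<open>t\<close> is the
  transposition, \<open>H\<close> is the inverse of the symmetric matrix \<open>G\<close>, and \<open>E\<close> is the matrix unit in the
  corner. An element \<open>x\<close> with \<open>E x = x\<close> is called a row, and one with \<open>x E = x\<close> a column. A
  scalar \<open>c\<close> appears as \<open>c E\<close>, and \<open>faithful\<close> says that the matrices act faithfully on columns.\<close>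

locale split_involution = field_algebra L R
  for L :: "'l ring" and R :: "('l, 'r) module" (structure) +
  fixes E G H :: 'r and t :: "'r \<Rightarrow> 'r"
  assumes E: "E \<in> carrier R" "E \<otimes> E = E" "E \<noteq> \<zero>"
    and ERE: "x \<in> carrier R \<Longrightarrow> \<exists>c \<in> carrier L. E \<otimes> x \<otimes> E = c \<odot> E"
    and faithful: "x \<in> carrier R \<Longrightarrow> x \<noteq> \<zero> \<Longrightarrow> \<exists>a \<in> carrier R. x \<otimes> a \<otimes> E \<noteq> \<zero>"
    and t_hom: "t \<in> module_hom L R R"
    and t_antimult: "x \<in> carrier R \<Longrightarrow> y \<in> carrier R \<Longrightarrow> t (x \<otimes> y) = t y \<otimes> t x"
    and t_t: "x \<in> carrier R \<Longrightarrow> t (t x) = x"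
    and t_E: "t E = E"
    and GH: "G \<in> carrier R" "H \<in> carrier R" "G \<otimes> H = \<one>" "H \<otimes> G = \<one>" and t_G: "t G = G"
    and char: "\<one>\<^bsub>L\<^esub> \<oplus>\<^bsub>L\<^esub> \<one>\<^bsub>L\<^esub> \<noteq> \<zero>\<^bsub>L\<^esub>"
begin

definition \<tau> where "\<tau> x = H \<otimes> t x \<otimes> G"

lemma t_closed [simp]: "x \<in> carrier R \<Longrightarrow> t x \<in> carrier R"
  by (rule module_hom_mem[OF t_hom])

lemma t_add: "x \<in> carrier R \<Longrightarrow> y \<in> carrier R \<Longrightarrow> t (x \<oplus> y) = t x \<oplus> t y"
  by (rule module_hom_add[OF t_hom])

lemma t_smult: "c \<in> carrier L \<Longrightarrow> x \<in> carrier R \<Longrightarrow> t (c \<odot> x) = c \<odot> t x"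
  by (rule module_hom_smult[OF t_hom])

lemma t_zero: "t \<zero> = \<zero>"
  using t_smult[of "\<zero>\<^bsub>L\<^esub>" \<zero>] by simp

lemma t_nonzero: "x \<in> carrier R \<Longrightarrow> x \<noteq> \<zero> \<Longrightarrow> t x \<noteq> \<zero>"
  using t_t t_zero by metis

lemma t_H: "t H = H"
proof -
  have "t \<one> = \<one>" using t_antimult[of "t \<one>" \<one>] t_t[of \<one>] by simp
  then have "G \<otimes> t H = \<one>" using t_antimult[of H G] GH t_G by simp
  then have "H \<otimes> (G \<otimes> t H) = H" using GH by simp
  then show ?thesis using GH by (simp add: A.m_assoc[symmetric])
qed

lemma smult_cancel:
  assumes "c \<in> carrier L" "c \<noteq> \<zero>\<^bsub>L\<^esub>" "x \<in> carrier R" "y \<in> carrier R" "c \<odot> x = c \<odot> y" shows "x = y"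
proof -
  have i: "inv\<^bsub>L\<^esub> c \<in> carrier L" "inv\<^bsub>L\<^esub> c \<otimes>\<^bsub>L\<^esub> c = \<one>\<^bsub>L\<^esub>" using assms field_Units by auto
  then have "x = inv\<^bsub>L\<^esub> c \<odot> (c \<odot> x)" "y = inv\<^bsub>L\<^esub> c \<odot> (c \<odot> y)" using assms(1-4) by (simp_all add: smult_assoc1[symmetric])
  then show ?thesis using assms(5) by simp
qed

lemma row_col_scalar:
  assumes "x \<in> carrier R" "E \<otimes> x = x" "y \<in> carrier R" "y \<otimes> E = y"
  shows "\<exists>c \<in> carrier L. x \<otimes> y = c \<odot> E"
proof -
  have "x \<otimes> y = (E \<otimes> x) \<otimes> (y \<otimes> E)" using assms by simp
  also have "\<dots> = E \<otimes> (x \<otimes> y) \<otimes> E" using assms(1,3) E by (simp only: A.m_assoc A.m_closed)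
  finally show ?thesis using ERE[of "x \<otimes> y"] assms(1,3) by simp
qed

lemma t_col: "x \<in> carrier R \<Longrightarrow> x \<otimes> E = x \<Longrightarrow> E \<otimes> t x = t x"
  using t_antimult[of x E] E t_E by simp

lemma t_row: "x \<in> carrier R \<Longrightarrow> E \<otimes> x = x \<Longrightarrow> t x \<otimes> E = t x"
  using t_antimult[of E x] E t_E by simp

lemma row_right_unit:
  assumes x: "x \<in> carrier R" "E \<otimes> x = x" "x \<noteq> \<zero>"
  shows "\<exists>y \<in> carrier R. y \<otimes> E = y \<and> x \<otimes> y = E"
proof -
  obtain a where a: "a \<in> carrier R" "x \<otimes> a \<otimes> E \<noteq> \<zero>" using faithful x by blast
  have aE: "a \<otimes> E \<in> carrier R" "a \<otimes> E \<otimes> E = a \<otimes> E" using a E by (simp_all add: A.m_assoc)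
  obtain c where c: "c \<in> carrier L" "x \<otimes> (a \<otimes> E) = c \<odot> E" using row_col_scalar[OF x(1,2) aE] by blast
  have "c \<noteq> \<zero>\<^bsub>L\<^esub>"
  proof
    assume "c = \<zero>\<^bsub>L\<^esub>"
    then have "x \<otimes> (a \<otimes> E) = \<zero>" using c(2) E by simp
    then show False using a x E by (simp add: A.m_assoc)
  qed
  then have i: "inv\<^bsub>L\<^esub> c \<in> carrier L" "inv\<^bsub>L\<^esub> c \<otimes>\<^bsub>L\<^esub> c = \<one>\<^bsub>L\<^esub>" using c field_Units by auto
  have "x \<otimes> (inv\<^bsub>L\<^esub> c \<odot> (a \<otimes> E)) = inv\<^bsub>L\<^esub> c \<odot> (c \<odot> E)"
    using c i x aE by (simp add: smult_mult_right)
  also have "\<dots> = E" using c i E by (simp add: smult_assoc1[symmetric])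
  finally have "x \<otimes> (inv\<^bsub>L\<^esub> c \<odot> (a \<otimes> E)) = E" .
  then show ?thesis using i aE E by (intro bexI[of _ "inv\<^bsub>L\<^esub> c \<odot> (a \<otimes> E)"]) (auto simp: smult_mult_left)
qed

lemma col_left_unit:
  assumes x: "x \<in> carrier R" "x \<otimes> E = x" "x \<noteq> \<zero>"
  shows "\<exists>y \<in> carrier R. E \<otimes> y = y \<and> y \<otimes> x = E"
proof -
  obtain y where y: "y \<in> carrier R" "y \<otimes> E = y" "t x \<otimes> y = E"
    using row_right_unit[of "t x"] x t_col t_nonzero by auto
  have "t y \<otimes> x = t (t x \<otimes> y)" using x(1) y(1) by (simp add: t_antimult t_t)
  then show ?thesis using y t_col[of y] t_E by (intro bexI[of _ "t y"]) simp_all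
qed

lemma eq_zero_by_cols:
  assumes D: "D \<in> carrier R" and z: "\<And>w. w \<in> carrier R \<Longrightarrow> w \<otimes> E = w \<Longrightarrow> D \<otimes> w = \<zero>"
  shows "D = \<zero>"
proof (rule ccontr)
  assume "D \<noteq> \<zero>"
  then obtain a where a: "a \<in> carrier R" "D \<otimes> a \<otimes> E \<noteq> \<zero>" using faithful D by blast
  have "D \<otimes> (a \<otimes> E) = \<zero>" using a E by (intro z) (simp_all add: A.m_assoc)
  then show False using a D E by (simp add: A.m_assoc)
qed

abbreviation q where "q x y \<equiv> H \<otimes> t x \<otimes> y"

text \<open>For a row \<open>x\<close> the hypothesis says that \<open>\<tau>'\<close> fixes \<open>\<beta> q(x, x)\<close>, hence \<open>q(x, x)\<close>, where
  \<open>q(x, y) = G\<^sup>-\<^sup>1 x\<^sup>T y\<close>. Applying \<open>\<tau>'\<close> to the product \<open>q(x, x) q(y, y) = (x G\<^sup>-\<^sup>1 y\<^sup>T) q(x, y)\<close> gives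
  \<open>\<tau>'(q(x, y)) = q(y, x)\<close> if the scalar \<open>x G\<^sup>-\<^sup>1 y\<^sup>T\<close> is nonzero, and in general by additivity. Now \<open>q(y, y) z = q(y, y z)\<close> is mapped by \<open>\<tau>'\<close> to
  \<open>q(y z, y) = \<tau>(z) q(y, y)\<close> and also to \<open>\<tau>'(z) q(y, y)\<close>. So \<open>(\<tau>'(z) - \<tau>(z)) G\<^sup>-\<^sup>1\<close> annihilates all
  columns \<open>y\<^sup>T\<close>.\<close>

lemma adjoint_determined:
  assumes v: "v \<in> carrier R" "v \<otimes> E = v"
    and \<beta>: "\<beta> \<in> carrier L" "\<beta> \<noteq> \<zero>\<^bsub>L\<^esub>" "t v \<otimes> G \<otimes> v = \<beta> \<odot> E"
    and \<tau>'_hom: "\<tau>' \<in> module_hom L R R"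
    and \<tau>'_antimult: "\<And>x y. x \<in> carrier R \<Longrightarrow> y \<in> carrier R \<Longrightarrow> \<tau>' (x \<otimes> y) = \<tau>' y \<otimes> \<tau>' x"
    and fixed: "\<And>x. x \<in> carrier R \<Longrightarrow> \<tau>' (\<tau> (v \<otimes> x) \<otimes> (v \<otimes> x)) = \<tau> (v \<otimes> x) \<otimes> (v \<otimes> x)"
    and z: "z \<in> carrier R"
  shows "\<tau>' z = \<tau> z"
proof -
  note [simp] = GH(1,2) E(1)
  note \<tau>'_closed [simp] = module_hom_mem[OF \<tau>'_hom]
  note \<tau>'_add = module_hom_add[OF \<tau>'_hom] and \<tau>'_smult = module_hom_smult[OF \<tau>'_hom]
  have qc [simp]: "q x y \<in> carrier R" if "x \<in> carrier R" "y \<in> carrier R" for x y using that by simp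
  have fix1: "\<tau>' (q x x) = q x x" if x: "x \<in> carrier R" "E \<otimes> x = x" for x
  proof -
    have "\<tau> (v \<otimes> x) \<otimes> (v \<otimes> x) = H \<otimes> t x \<otimes> (t v \<otimes> G \<otimes> v) \<otimes> x"
      using x(1) v(1) by (simp add: \<tau>_def t_antimult A.m_assoc)
    also have "\<dots> = \<beta> \<odot> (H \<otimes> t x \<otimes> E \<otimes> x)"
      unfolding \<beta>(3) using x(1) \<beta>(1) by (simp add: smult_mult_left smult_mult_right)
    also have "H \<otimes> t x \<otimes> E \<otimes> x = q x x" using x by (simp add: A.m_assoc)
    finally have s: "\<tau> (v \<otimes> x) \<otimes> (v \<otimes> x) = \<beta> \<odot> q x x" .
    have e: "\<beta> \<odot> \<tau>' (q x x) = \<beta> \<odot> q x x"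
      using fixed[OF x(1)] x(1) \<beta>(1) unfolding s by (simp add: \<tau>'_smult)
    show ?thesis by (rule smult_cancel[OF \<beta>(1,2) _ _ e]) (use x(1) in simp_all)
  qed
  (* the product of two fixed elements is a multiple of q x y, here by a nonzero scalar *)
  have swap1: "\<tau>' (q x y) = q y x"
    if x: "x \<in> carrier R" "E \<otimes> x = x" and y: "y \<in> carrier R" "E \<otimes> y = y" and nz: "x \<otimes> H \<otimes> t y \<noteq> \<zero>" for x y
  proof -
    have "E \<otimes> (x \<otimes> H) = x \<otimes> H" using x by (simp add: A.m_assoc[symmetric])
    then obtain c where c: "c \<in> carrier L" "x \<otimes> H \<otimes> t y = c \<odot> E"
      using row_col_scalar[of "x \<otimes> H" "t y"] x(1) y(1) t_row[OF y] by auto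
    have c0: "c \<noteq> \<zero>\<^bsub>L\<^esub>" using nz c by auto
    have "t (x \<otimes> H \<otimes> t y) = c \<odot> E" unfolding c(2) using c(1) by (simp add: t_smult t_E)
    then have c': "y \<otimes> H \<otimes> t x = c \<odot> E" using x(1) y(1) by (simp add: t_antimult t_t t_H A.m_assoc)
    have mult: "q x x \<otimes> q y y = c \<odot> q x y" if "x \<in> carrier R" "y \<in> carrier R" "E \<otimes> y = y" "x \<otimes> H \<otimes> t y = c \<odot> E" for x y
    proof -
      have "q x x \<otimes> q y y = H \<otimes> t x \<otimes> (x \<otimes> H \<otimes> t y) \<otimes> y" using that(1,2) by (simp add: A.m_assoc)
      also have "\<dots> = c \<odot> (H \<otimes> t x \<otimes> (E \<otimes> y))"
        unfolding that(4) using that(1,2) c(1) by (simp add: smult_mult_left smult_mult_right A.m_assoc)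
      finally show ?thesis using that(3) by simp
    qed
    have "c \<odot> \<tau>' (q x y) = \<tau>' (q x x \<otimes> q y y)"
      using mult[OF x(1) y(1,2) c(2)] x(1) y(1) c(1) by (simp add: \<tau>'_smult)
    also have "\<dots> = \<tau>' (q y y) \<otimes> \<tau>' (q x x)" using x(1) y(1) by (intro \<tau>'_antimult) simp_all
    also have "\<dots> = q y y \<otimes> q x x" using fix1[OF x] fix1[OF y] by simp
    also have "\<dots> = c \<odot> q y x" by (rule mult[OF y(1) x(1,2) c'])
    finally have e: "c \<odot> \<tau>' (q x y) = c \<odot> q y x" .
    show ?thesis by (rule smult_cancel[OF c(1) c0 _ _ e]) (use x(1) y(1) in simp_all)
  qed
  (* if x and y are orthogonal, add to x a row x' that is not orthogonal to y, and subtract *)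
  have swap: "\<tau>' (q x y) = q y x"
    if x: "x \<in> carrier R" "E \<otimes> x = x" and y: "y \<in> carrier R" "E \<otimes> y = y" for x y
  proof (cases "y = \<zero>")
    case True
    then show ?thesis using x(1) module_hom_smult[OF \<tau>'_hom, of "\<zero>\<^bsub>L\<^esub>" \<zero>] by (simp add: t_zero)
  next
    case False
    have Hy: "H \<otimes> t y \<in> carrier R" "H \<otimes> t y \<otimes> E = H \<otimes> t y" using y t_row[OF y] by (simp_all add: A.m_assoc)
    have "H \<otimes> t y \<noteq> \<zero>"
    proof
      assume "H \<otimes> t y = \<zero>"
      then have "G \<otimes> (H \<otimes> t y) = \<zero>" by simp
      then have "t y = \<zero>" using GH y by (simp add: A.m_assoc[symmetric])
      then show False using t_nonzero[OF y(1) False] by simp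
    qed
    then obtain x' where x': "x' \<in> carrier R" "E \<otimes> x' = x'" "x' \<otimes> (H \<otimes> t y) = E"
      using col_left_unit[OF Hy] by blast
    have nz': "x' \<otimes> H \<otimes> t y \<noteq> \<zero>" using x' y(1) E by (simp add: A.m_assoc)
    show ?thesis
    proof (cases "x \<otimes> H \<otimes> t y = \<zero>")
      case False
      then show ?thesis using swap1 x y by blast
    next
      case True
      have xx: "x \<oplus> x' \<in> carrier R" "E \<otimes> (x \<oplus> x') = x \<oplus> x'" using x x' by (simp_all add: A.r_distr)
      have "(x \<oplus> x') \<otimes> H \<otimes> t y = x' \<otimes> H \<otimes> t y" using x(1) x'(1) y(1) True by (simp add: A.l_distr)
      then have "\<tau>' (q (x \<oplus> x') y) = q y (x \<oplus> x')" using swap1[OF xx y] nz' by simp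
      moreover have "q (x \<oplus> x') y = q x y \<oplus> q x' y" using x(1) x'(1) y(1) by (simp add: t_add A.l_distr A.r_distr)
      moreover have "q y (x \<oplus> x') = q y x \<oplus> q y x'" using x(1) x'(1) y(1) by (simp add: A.r_distr)
      ultimately have "\<tau>' (q x y) \<oplus> q y x' = q y x \<oplus> q y x'"
        using x(1) x'(1) y(1) swap1[OF x'(1,2) y nz'] by (simp add: \<tau>'_add)
      then show ?thesis using x(1) x'(1) y(1) by (simp add: M.add.right_cancel)
    qed
  qed
  define D where "D = \<tau>' z \<ominus> \<tau> z"
  have \<tau>z: "\<tau> z \<in> carrier R" using z by (simp add: \<tau>_def)
  have Dc: "D \<in> carrier R" unfolding D_def using z \<tau>z by simp
  have Dq: "D \<otimes> q y y = \<zero>" if y: "y \<in> carrier R" "E \<otimes> y = y" for y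
  proof -
    have yz: "y \<otimes> z \<in> carrier R" "E \<otimes> (y \<otimes> z) = y \<otimes> z" using y z by (simp_all add: A.m_assoc[symmetric])
    have "\<tau>' z \<otimes> q y y = \<tau>' z \<otimes> \<tau>' (q y y)" using fix1[OF y] by simp
    also have "\<dots> = \<tau>' (q y y \<otimes> z)" using y(1) z by (intro \<tau>'_antimult[symmetric]) simp_all
    also have "q y y \<otimes> z = q y (y \<otimes> z)" using y(1) z by (simp add: A.m_assoc)
    also have "\<tau>' \<dots> = q (y \<otimes> z) y" by (rule swap[OF y yz])
    also have "\<dots> = H \<otimes> t z \<otimes> (G \<otimes> H) \<otimes> t y \<otimes> y" using y(1) z GH(3) by (simp add: t_antimult A.m_assoc)
    also have "\<dots> = \<tau> z \<otimes> q y y" using y(1) z by (simp add: \<tau>_def A.m_assoc)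
    finally have "\<tau>' z \<otimes> q y y = \<tau> z \<otimes> q y y" .
    then show ?thesis unfolding D_def using y(1) z \<tau>z by (simp add: M.minus_eq A.l_distr A.l_minus M.r_neg)
  qed
  have "D \<otimes> H = \<zero>"
  proof (rule eq_zero_by_cols)
    fix w assume w: "w \<in> carrier R" "w \<otimes> E = w"
    define y where "y = t w"
    have y: "y \<in> carrier R" "E \<otimes> y = y" "t y = w" unfolding y_def using w t_col t_t by auto
    show "D \<otimes> H \<otimes> w = \<zero>"
    proof (cases "y = \<zero>")
      case True
      have "w = \<zero>" using y(3) unfolding True t_zero by simp
      then show ?thesis using Dc by simp
    next
      case False
      then obtain a where a: "a \<in> carrier R" "y \<otimes> a = E" using row_right_unit[OF y(1,2) False] by blast
      have "D \<otimes> H \<otimes> w = D \<otimes> H \<otimes> (w \<otimes> (y \<otimes> a))" unfolding a(2) w(2) ..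
      also have "\<dots> = D \<otimes> (H \<otimes> w \<otimes> y) \<otimes> a" using a(1) w(1) y(1) Dc by (simp add: A.m_assoc)
      also have "\<dots> = D \<otimes> q y y \<otimes> a" unfolding y(3) ..
      finally show ?thesis using Dq[OF y(1,2)] a(1) by simp
    qed
  qed (simp add: Dc)
  then have "D \<otimes> H \<otimes> G = \<zero>" by simp
  then have "D = \<zero>" using Dc GH by (simp add: A.m_assoc)
  then show ?thesis unfolding D_def using z \<tau>z by (simp add: A.r_right_minus_eq)
qed

text \<open>If \<open>v0\<close> is isotropic, choose a column \<open>u\<close> with \<open>v0\<^sup>T G u = 1\<close> and consider \<open>v = r v0 + u\<close>. Then
  \<open>v\<^sup>T G v = 2 r + u\<^sup>T G u\<close> vanishes for one \<open>r\<close> only. The functionals \<open>P s\<close>, which later express that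
  a right ideal lies in a chart, separate the elements \<open>v0 y\<close> for rows \<open>y\<close> by hypothesis; by
  \<open>finite_eigenvalues\<close> they separate the elements \<open>v y\<close> for all but finitely many \<open>r\<close>.\<close>

lemma perturbation_to_anisotropic:
  fixes P :: "nat \<Rightarrow> 'r \<Rightarrow> 'l"
  assumes inf: "infinite (carrier L)"
    and v0: "v0 \<in> carrier R" "v0 \<otimes> E = v0" "v0 \<noteq> \<zero>"
    and P: "\<And>s. s < n \<Longrightarrow> P s \<in> functionals L R"
    and inj: "\<And>x. x \<in> carrier R \<Longrightarrow> (\<And>s. s < n \<Longrightarrow> P s (v0 \<otimes> x) = \<zero>\<^bsub>L\<^esub>) \<Longrightarrow> v0 \<otimes> x = \<zero>"
  shows "\<exists>v \<in> carrier R. v \<otimes> E = v \<and> (\<exists>\<beta> \<in> carrier L. \<beta> \<noteq> \<zero>\<^bsub>L\<^esub> \<and> t v \<otimes> G \<otimes> v = \<beta> \<odot> E) \<and>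
    (\<forall>y \<in> carrier R. E \<otimes> y = y \<longrightarrow> (\<forall>s < n. P s (v \<otimes> y) = \<zero>\<^bsub>L\<^esub>) \<longrightarrow> y = \<zero>)"
proof -
  note [simp] = GH(1,2) E(1) v0(1)
  obtain w0 where w0: "w0 \<in> carrier R" "w0 \<otimes> v0 = E" using col_left_unit[OF v0] by blast
  have inj0: "y = \<zero>" if y: "y \<in> carrier R" "E \<otimes> y = y" and z: "\<And>s. s < n \<Longrightarrow> P s (v0 \<otimes> y) = \<zero>\<^bsub>L\<^esub>" for y
  proof -
    have "y = w0 \<otimes> (v0 \<otimes> y)" using y w0 by (simp add: A.m_assoc[symmetric])
    also have "v0 \<otimes> y = \<zero>" using inj y z by blast
    finally show ?thesis using w0 by simp
  qed
  have b: "\<exists>c \<in> carrier L. t x \<otimes> G \<otimes> y = c \<odot> E" if "x \<in> carrier R" "x \<otimes> E = x" "y \<in> carrier R" "y \<otimes> E = y" for x y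
  proof (rule row_col_scalar)
    show "E \<otimes> (t x \<otimes> G) = t x \<otimes> G" using that t_col[of x] by (simp add: A.m_assoc[symmetric])
  qed (use that in simp_all)
  obtain c0 where c0: "c0 \<in> carrier L" "t v0 \<otimes> G \<otimes> v0 = c0 \<odot> E" using b v0 by blast
  show ?thesis
  proof (cases "c0 = \<zero>\<^bsub>L\<^esub>")
    case False
    then show ?thesis using v0 c0 inj0 by (intro bexI[of _ v0]) auto
  next
    case True
    have "t v0 \<otimes> G \<noteq> \<zero>"
    proof
      assume "t v0 \<otimes> G = \<zero>"
      then have "t v0 \<otimes> G \<otimes> H = \<zero>" by simp
      then have "t v0 = \<zero>" using GH by (simp add: A.m_assoc)
      then show False using t_nonzero[OF v0(1,3)] by simp
    qed
    moreover have "E \<otimes> (t v0 \<otimes> G) = t v0 \<otimes> G" using t_col[OF v0(1,2)] by (simp add: A.m_assoc[symmetric])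
    ultimately obtain u where u: "u \<in> carrier R" "u \<otimes> E = u" "t v0 \<otimes> G \<otimes> u = E"
      using row_right_unit[of "t v0 \<otimes> G"] by auto
    note [simp] = u(1)
    have "t (t v0 \<otimes> G \<otimes> u) = E" unfolding u(3) by (rule t_E)
    then have u': "t u \<otimes> G \<otimes> v0 = E" by (simp add: t_antimult t_t t_G A.m_assoc)
    obtain c2 where c2: "c2 \<in> carrier L" "t u \<otimes> G \<otimes> u = c2 \<odot> E" using b u by blast
    define v where "v r = r \<odot> v0 \<oplus> u" for r
    have v: "v r \<in> carrier R" "v r \<otimes> E = v r" if "r \<in> carrier L" for r
      unfolding v_def using that v0(2) u(2) by (simp_all add: A.l_distr smult_mult_left)
    let ?d = "\<lambda>r. r \<oplus>\<^bsub>L\<^esub> r \<oplus>\<^bsub>L\<^esub> c2"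
    have vv: "t (v r) \<otimes> G \<otimes> v r = ?d r \<odot> E" if r: "r \<in> carrier L" for r
    proof -
      have "t (v r) \<otimes> G \<otimes> v r = (r \<odot> (t v0 \<otimes> G) \<oplus> t u \<otimes> G) \<otimes> (r \<odot> v0 \<oplus> u)"
        unfolding v_def using r by (simp add: t_add t_smult A.l_distr smult_mult_left)
      also have "\<dots> = r \<odot> (t v0 \<otimes> G \<otimes> (r \<odot> v0 \<oplus> u)) \<oplus> t u \<otimes> G \<otimes> (r \<odot> v0 \<oplus> u)"
        using r by (simp add: A.l_distr smult_mult_left)
      also have "t v0 \<otimes> G \<otimes> (r \<odot> v0 \<oplus> u) = r \<odot> (t v0 \<otimes> G \<otimes> v0) \<oplus> t v0 \<otimes> G \<otimes> u"
        using r by (simp add: A.r_distr smult_mult_right)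
      also have "t u \<otimes> G \<otimes> (r \<odot> v0 \<oplus> u) = r \<odot> (t u \<otimes> G \<otimes> v0) \<oplus> t u \<otimes> G \<otimes> u"
        using r by (simp add: A.r_distr smult_mult_right)
      finally have "t (v r) \<otimes> G \<otimes> v r = r \<odot> E \<oplus> (r \<odot> E \<oplus> c2 \<odot> E)"
        unfolding u(3) u' c2(2) c0(2) True using r c2(1) by simp
      then show ?thesis using r c2(1) by (simp add: smult_l_distr M.a_assoc)
    qed
    have fin1: "finite {r \<in> carrier L. ?d r = \<zero>\<^bsub>L\<^esub>}"
    proof (rule finite_subset)
      show "finite {SOME r. r \<in> carrier L \<and> ?d r = \<zero>\<^bsub>L\<^esub>}" by simp
      have uniq: "r = r'" if r: "r \<in> carrier L" "?d r = \<zero>\<^bsub>L\<^esub>" and r': "r' \<in> carrier L" "?d r' = \<zero>\<^bsub>L\<^esub>" for r r'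
      proof -
        have "r \<oplus>\<^bsub>L\<^esub> r = r' \<oplus>\<^bsub>L\<^esub> r'" using r r' c2(1) R.add.right_cancel[of c2 "r \<oplus>\<^bsub>L\<^esub> r" "r' \<oplus>\<^bsub>L\<^esub> r'"] by simp
        then have "(\<one>\<^bsub>L\<^esub> \<oplus>\<^bsub>L\<^esub> \<one>\<^bsub>L\<^esub>) \<otimes>\<^bsub>L\<^esub> r = (\<one>\<^bsub>L\<^esub> \<oplus>\<^bsub>L\<^esub> \<one>\<^bsub>L\<^esub>) \<otimes>\<^bsub>L\<^esub> r'"
          using r(1) r'(1) by (simp add: R.l_distr)
        then show ?thesis using m_lcancel[of "\<one>\<^bsub>L\<^esub> \<oplus>\<^bsub>L\<^esub> \<one>\<^bsub>L\<^esub>" r r'] char r(1) r'(1) by simp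
      qed
      show "{r \<in> carrier L. ?d r = \<zero>\<^bsub>L\<^esub>} \<subseteq> {SOME r. r \<in> carrier L \<and> ?d r = \<zero>\<^bsub>L\<^esub>}"
      proof
        fix r assume "r \<in> {r \<in> carrier L. ?d r = \<zero>\<^bsub>L\<^esub>}"
        then have r: "r \<in> carrier L \<and> ?d r = \<zero>\<^bsub>L\<^esub>" by simp
        then have "(SOME r. r \<in> carrier L \<and> ?d r = \<zero>\<^bsub>L\<^esub>) \<in> carrier L \<and> ?d (SOME r. r \<in> carrier L \<and> ?d r = \<zero>\<^bsub>L\<^esub>) = \<zero>\<^bsub>L\<^esub>"
          by (rule someI)
        then show "r \<in> {SOME r. r \<in> carrier L \<and> ?d r = \<zero>\<^bsub>L\<^esub>}" using uniq r by blast
      qed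
    qed
    let ?V = "R\<lparr>carrier := {y \<in> carrier R. E \<otimes> y = y}\<rparr>"
    have sub: "LinearCombinations.submodule L {y \<in> carrier R. E \<otimes> y = y} R"
      by (intro submodule.intro module_axioms) (auto simp: A.r_distr smult_mult_right)
    have V: "module L ?V" by (rule submodule_is_module[OF sub])
    have fin2: "finite {r \<in> carrier L. \<exists>y \<in> carrier ?V. y \<noteq> \<zero>\<^bsub>?V\<^esub> \<and> (\<forall>s < n. r \<otimes>\<^bsub>L\<^esub> P s (v0 \<otimes> y) \<oplus>\<^bsub>L\<^esub> P s (u \<otimes> y) = \<zero>\<^bsub>L\<^esub>)}"
    proof (rule finite_eigenvalues[OF field_axioms V])
      show "(\<lambda>y. P s (v0 \<otimes> y)) \<in> functionals L ?V" if "s < n" for s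
        by (rule semilinearI) (use P[OF that] in \<open>auto simp: semilinear_closed A.r_distr semilinear_add smult_mult_right semilinear_smult\<close>)
      show "(\<lambda>y. P s (u \<otimes> y)) \<in> functionals L ?V" if "s < n" for s
        by (rule semilinearI) (use P[OF that] in \<open>auto simp: semilinear_closed A.r_distr semilinear_add smult_mult_right semilinear_smult\<close>)
      show "y = \<zero>\<^bsub>?V\<^esub>" if "y \<in> carrier ?V" "\<And>s. s < n \<Longrightarrow> P s (v0 \<otimes> y) = \<zero>\<^bsub>L\<^esub>" for y
        using inj0[of y] that by simp
    qed
    obtain r where r: "r \<in> carrier L" and r1: "?d r \<noteq> \<zero>\<^bsub>L\<^esub>"
      and r2: "\<not> (\<exists>y \<in> carrier ?V. y \<noteq> \<zero>\<^bsub>?V\<^esub> \<and> (\<forall>s < n. r \<otimes>\<^bsub>L\<^esub> P s (v0 \<otimes> y) \<oplus>\<^bsub>L\<^esub> P s (u \<otimes> y) = \<zero>\<^bsub>L\<^esub>))"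
    proof -
      have "\<not> carrier L \<subseteq> {r \<in> carrier L. ?d r = \<zero>\<^bsub>L\<^esub>} \<union> {r \<in> carrier L. \<exists>y \<in> carrier ?V. y \<noteq> \<zero>\<^bsub>?V\<^esub> \<and> (\<forall>s < n. r \<otimes>\<^bsub>L\<^esub> P s (v0 \<otimes> y) \<oplus>\<^bsub>L\<^esub> P s (u \<otimes> y) = \<zero>\<^bsub>L\<^esub>)}"
        using finite_subset[OF _ finite_UnI[OF fin1 fin2]] inf by blast
      then show ?thesis using that by blast
    qed
    have "y = \<zero>" if y: "y \<in> carrier R" "E \<otimes> y = y" and z: "\<forall>s < n. P s (v r \<otimes> y) = \<zero>\<^bsub>L\<^esub>" for y
    proof (rule ccontr)
      assume "y \<noteq> \<zero>"
      moreover have "r \<otimes>\<^bsub>L\<^esub> P s (v0 \<otimes> y) \<oplus>\<^bsub>L\<^esub> P s (u \<otimes> y) = \<zero>\<^bsub>L\<^esub>" if s: "s < n" for s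
      proof -
        have "v r \<otimes> y = r \<odot> (v0 \<otimes> y) \<oplus> u \<otimes> y" unfolding v_def using r y(1) by (simp add: A.l_distr smult_mult_left)
        then show ?thesis using z s semilinear_add[OF P[OF s], of "r \<odot> (v0 \<otimes> y)" "u \<otimes> y"]
            semilinear_smult[OF P[OF s], of r "v0 \<otimes> y"] r y(1) by simp
      qed
      ultimately show False using r2 y by auto
    qed
    then show ?thesis using v[OF r] vv[OF r] r1 r c2(1) by (intro bexI[of _ "v r"]) auto
  qed
qed

end

section \<open>Matrix algebras\<close>

text \<open>\<open>M\<^sub>n(L)\<close> given by its entry functionals, so that an isomorphism with the matrix algebra need not be
  applied explicitly.\<close>

locale matrix_entries = field_algebra L R
  for L :: "'l ring" and R :: "('l, 'r) module" (structure) +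
  fixes n :: nat and ent :: "nat \<times> nat \<Rightarrow> 'r \<Rightarrow> 'l"
  assumes n: "0 < n"
    and ent_functional: "i < n \<Longrightarrow> j < n \<Longrightarrow> ent (i, j) \<in> functionals L R"
    and ent_eqI: "x \<in> carrier R \<Longrightarrow> y \<in> carrier R \<Longrightarrow>
      (\<And>i j. i < n \<Longrightarrow> j < n \<Longrightarrow> ent (i, j) x = ent (i, j) y) \<Longrightarrow> x = y"
    and ent_surj: "(\<And>i j. i < n \<Longrightarrow> j < n \<Longrightarrow> f (i, j) \<in> carrier L) \<Longrightarrow>
      \<exists>x \<in> carrier R. \<forall>i < n. \<forall>j < n. ent (i, j) x = f (i, j)"
    and ent_mult: "x \<in> carrier R \<Longrightarrow> y \<in> carrier R \<Longrightarrow> i < n \<Longrightarrow> j < n \<Longrightarrow>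
      ent (i, j) (x \<otimes> y) = (\<Oplus>\<^bsub>L\<^esub>k \<in> {..<n}. ent (i, k) x \<otimes>\<^bsub>L\<^esub> ent (k, j) y)"
begin

definition mat :: "(nat \<times> nat \<Rightarrow> 'l) \<Rightarrow> 'r" where
  "mat f = (SOME x. x \<in> carrier R \<and> (\<forall>i < n. \<forall>j < n. ent (i, j) x = f (i, j)))"

lemma mat:
  assumes "\<And>i j. i < n \<Longrightarrow> j < n \<Longrightarrow> f (i, j) \<in> carrier L"
  shows "mat f \<in> carrier R" and "i < n \<Longrightarrow> j < n \<Longrightarrow> ent (i, j) (mat f) = f (i, j)"
proof -
  have "\<exists>x. x \<in> carrier R \<and> (\<forall>i < n. \<forall>j < n. ent (i, j) x = f (i, j))"
    using ent_surj[of f, OF assms] by (simp only: Bex_def)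
  then have "mat f \<in> carrier R \<and> (\<forall>i < n. \<forall>j < n. ent (i, j) (mat f) = f (i, j))"
    unfolding mat_def by (rule someI_ex)
  then show "mat f \<in> carrier R" "i < n \<Longrightarrow> j < n \<Longrightarrow> ent (i, j) (mat f) = f (i, j)" by auto
qed

lemma ent_closed [simp]: "i < n \<Longrightarrow> j < n \<Longrightarrow> x \<in> carrier R \<Longrightarrow> ent (i, j) x \<in> carrier L"
  using semilinear_closed[OF ent_functional] .

lemma ent_add: "i < n \<Longrightarrow> j < n \<Longrightarrow> x \<in> carrier R \<Longrightarrow> y \<in> carrier R \<Longrightarrow> ent (i, j) (x \<oplus> y) = ent (i, j) x \<oplus>\<^bsub>L\<^esub> ent (i, j) y"
  using semilinear_add[OF ent_functional] .

lemma ent_smult: "i < n \<Longrightarrow> j < n \<Longrightarrow> c \<in> carrier L \<Longrightarrow> x \<in> carrier R \<Longrightarrow> ent (i, j) (c \<odot> x) = c \<otimes>\<^bsub>L\<^esub> ent (i, j) x"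
  using semilinear_smult[OF ent_functional] .

lemma ent_zero: "i < n \<Longrightarrow> j < n \<Longrightarrow> ent (i, j) \<zero> = \<zero>\<^bsub>L\<^esub>"
  using ent_smult[of i j "\<zero>\<^bsub>L\<^esub>" \<zero>] by simp

definition unit :: "nat \<Rightarrow> nat \<Rightarrow> 'r" where
  "unit a b = mat (\<lambda>p. if p = (a, b) then \<one>\<^bsub>L\<^esub> else \<zero>\<^bsub>L\<^esub>)"

lemma unit_closed [simp]: "unit a b \<in> carrier R"
  and ent_unit: "i < n \<Longrightarrow> j < n \<Longrightarrow> ent (i, j) (unit a b) = (if i = a \<and> j = b then \<one>\<^bsub>L\<^esub> else \<zero>\<^bsub>L\<^esub>)"
  unfolding unit_def using mat[of "\<lambda>p. if p = (a, b) then \<one>\<^bsub>L\<^esub> else \<zero>\<^bsub>L\<^esub>"] by auto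

lemma ent_mult_unit:
  assumes "x \<in> carrier R" "i < n" "j < n" "a < n"
  shows "ent (i, j) (x \<otimes> unit a b) = (if j = b then ent (i, a) x else \<zero>\<^bsub>L\<^esub>)"
proof -
  have "ent (i, j) (x \<otimes> unit a b) = (\<Oplus>\<^bsub>L\<^esub>k \<in> {..<n}. if k = a then (if j = b then ent (i, k) x else \<zero>\<^bsub>L\<^esub>) else \<zero>\<^bsub>L\<^esub>)"
    unfolding ent_mult[OF assms(1) unit_closed assms(2,3)]
    using assms by (intro R.finsum_cong' refl) (auto simp: ent_unit)
  also have "\<dots> = (if j = b then ent (i, a) x else \<zero>\<^bsub>L\<^esub>)"
    using assms by (intro R.finsum_delta) auto
  finally show ?thesis .
qed

lemma ent_unit_mult:
  assumes "x \<in> carrier R" "i < n" "j < n" "b < n"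
  shows "ent (i, j) (unit a b \<otimes> x) = (if i = a then ent (b, j) x else \<zero>\<^bsub>L\<^esub>)"
proof -
  have "ent (i, j) (unit a b \<otimes> x) = (\<Oplus>\<^bsub>L\<^esub>k \<in> {..<n}. if k = b then (if i = a then ent (k, j) x else \<zero>\<^bsub>L\<^esub>) else \<zero>\<^bsub>L\<^esub>)"
    unfolding ent_mult[OF unit_closed assms(1) assms(2,3)]
    using assms by (intro R.finsum_cong' refl) (auto simp: ent_unit)
  also have "\<dots> = (if i = a then ent (b, j) x else \<zero>\<^bsub>L\<^esub>)"
    using assms by (intro R.finsum_delta) auto
  finally show ?thesis .
qed

definition tr :: "'r \<Rightarrow> 'r" where "tr x = mat (\<lambda>(i, j). ent (j, i) x)"

lemma tr_closed [simp]: "x \<in> carrier R \<Longrightarrow> tr x \<in> carrier R"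
  and ent_tr: "x \<in> carrier R \<Longrightarrow> i < n \<Longrightarrow> j < n \<Longrightarrow> ent (i, j) (tr x) = ent (j, i) x"
  unfolding tr_def using mat[of "\<lambda>(i, j). ent (j, i) x"] by auto

lemma matrix_coordinate_system:
  "coordinate_system L R ({..<n} \<times> {..<n}) (\<lambda>(a, b). unit a b) ent"
  unfolding coordinate_system_def
proof (intro conjI ballI)
  fix x assume x: "x \<in> carrier R"
  let ?S = "{..<n} \<times> {..<n}"
  let ?y = "\<Oplus>p \<in> ?S. ent p x \<odot> (\<lambda>(a, b). unit a b) p"
  have y: "?y \<in> carrier R" using x by (intro finsum_closed) auto
  show "x = ?y"
  proof (rule ent_eqI[OF x y])
    fix i j assume ij: "i < n" "j < n"
    have "ent (i, j) ?y = (\<Oplus>\<^bsub>L\<^esub>p \<in> ?S. ent p x \<otimes>\<^bsub>L\<^esub> ent (i, j) ((\<lambda>(a, b). unit a b) p))"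
      using x ij by (intro functional_lincomb[OF module_axioms ent_functional]) auto
    also have "\<dots> = (\<Oplus>\<^bsub>L\<^esub>p \<in> ?S. if p = (i, j) then ent p x else \<zero>\<^bsub>L\<^esub>)"
      using x ij by (intro R.finsum_cong' refl) (auto simp: ent_unit split: if_split_asm)
    also have "\<dots> = ent (i, j) x" using x ij by (intro R.finsum_delta) auto
    finally show "ent (i, j) x = ent (i, j) ?y" by simp
  qed
qed (auto simp: ent_functional ent_unit split: if_split_asm)

lemma matrix_dim: "vectorspace.dim L R = n\<^sup>2"
  using coordinate_system_dim[OF vectorspace_axioms matrix_coordinate_system]
  by (simp add: card_cartesian_product power2_eq_square)

lemma row_units_independent:
  assumes a: "\<And>j. j < n \<Longrightarrow> a j \<in> carrier L"
    and z: "(\<Oplus>j \<in> {..<n}. a j \<odot> unit 0 j) = \<zero>" and j: "j < n"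
  shows "a j = \<zero>\<^bsub>L\<^esub>"
proof -
  have "\<zero>\<^bsub>L\<^esub> = ent (0, j) (\<Oplus>j \<in> {..<n}. a j \<odot> unit 0 j)" unfolding z using ent_zero j n by simp
  also have "\<dots> = (\<Oplus>\<^bsub>L\<^esub>k \<in> {..<n}. a k \<otimes>\<^bsub>L\<^esub> ent (0, j) (unit 0 k))"
    using a j n by (intro functional_lincomb[OF module_axioms ent_functional]) auto
  also have "\<dots> = (\<Oplus>\<^bsub>L\<^esub>k \<in> {..<n}. if k = j then a k else \<zero>\<^bsub>L\<^esub>)"
    using a j n by (intro R.finsum_cong' refl) (auto simp: ent_unit)
  also have "\<dots> = a j" using a j by (intro R.finsum_delta) auto
  finally show ?thesis by simp
qed

lemma matrix_split_involution:
  assumes GH: "G \<in> carrier R" "H \<in> carrier R" "G \<otimes> H = \<one>" "H \<otimes> G = \<one>" and G: "tr G = G"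
    and char: "\<one>\<^bsub>L\<^esub> \<oplus>\<^bsub>L\<^esub> \<one>\<^bsub>L\<^esub> \<noteq> \<zero>\<^bsub>L\<^esub>"
  shows "split_involution L R (unit 0 0) G H tr"
proof
  show "unit 0 0 \<in> carrier R" by simp
  show "unit 0 0 \<otimes> unit 0 0 = unit 0 0"
    using n by (intro ent_eqI) (auto simp: ent_mult_unit ent_unit)
  show "unit 0 0 \<noteq> \<zero>"
  proof
    assume "unit 0 0 = \<zero>"
    then have "ent (0, 0) (unit 0 0) = \<zero>\<^bsub>L\<^esub>" using n ent_zero by simp
    then show False using n by (simp add: ent_unit)
  qed
  show "\<exists>c \<in> carrier L. unit 0 0 \<otimes> x \<otimes> unit 0 0 = c \<odot> unit 0 0" if x: "x \<in> carrier R" for x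
  proof
    show "ent (0, 0) x \<in> carrier L" using x n by simp
    show "unit 0 0 \<otimes> x \<otimes> unit 0 0 = ent (0, 0) x \<odot> unit 0 0"
      using x n by (intro ent_eqI) (auto simp: ent_mult_unit ent_unit_mult ent_smult ent_unit)
  qed
  show "\<exists>a \<in> carrier R. x \<otimes> a \<otimes> unit 0 0 \<noteq> \<zero>" if x: "x \<in> carrier R" "x \<noteq> \<zero>" for x
  proof -
    obtain i j where ij: "i < n" "j < n" "ent (i, j) x \<noteq> \<zero>\<^bsub>L\<^esub>"
      using x ent_eqI[OF x(1) zero_closed] ent_zero by metis
    have "ent (i, 0) (x \<otimes> unit j 0 \<otimes> unit 0 0) = ent (i, j) x"
      using x ij n by (simp add: ent_mult_unit)
    then have "x \<otimes> unit j 0 \<otimes> unit 0 0 \<noteq> \<zero>" using ij n ent_zero by auto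
    then show ?thesis by (intro bexI[of _ "unit j 0"]) simp_all
  qed
  show "tr \<in> module_hom L R R"
    by (rule module_homI) (auto simp: ent_tr ent_add ent_smult intro!: ent_eqI)
  show "tr (x \<otimes> y) = tr y \<otimes> tr x" if x: "x \<in> carrier R" and y: "y \<in> carrier R" for x y
  proof (rule ent_eqI)
    fix i j assume ij: "i < n" "j < n"
    have "ent (i, j) (tr (x \<otimes> y)) = (\<Oplus>\<^bsub>L\<^esub>k \<in> {..<n}. ent (j, k) x \<otimes>\<^bsub>L\<^esub> ent (k, i) y)"
      using x y ij by (simp add: ent_tr ent_mult)
    also have "\<dots> = (\<Oplus>\<^bsub>L\<^esub>k \<in> {..<n}. ent (i, k) (tr y) \<otimes>\<^bsub>L\<^esub> ent (k, j) (tr x))"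
      using x y ij by (intro R.finsum_cong' refl) (auto simp: ent_tr R.m_comm)
    also have "\<dots> = ent (i, j) (tr y \<otimes> tr x)" using x y ij by (simp add: ent_mult)
    finally show "ent (i, j) (tr (x \<otimes> y)) = ent (i, j) (tr y \<otimes> tr x)" .
  qed (use x y in simp_all)
  show "tr (tr x) = x" if "x \<in> carrier R" for x using that by (intro ent_eqI) (simp_all add: ent_tr)
  show "tr (unit 0 0) = unit 0 0" by (intro ent_eqI) (auto simp: ent_tr ent_unit)
qed (use GH G char in auto)

end

lemma self_alg_finsum: "finsum (self_alg L) f S = finsum L f S"
  by (simp add: finsum_def finprod_def self_alg_def)

lemma matrix_alg_entries:
  assumes R: "field_algebra L R" and nontriv: "\<one>\<^bsub>R\<^esub> \<noteq> \<zero>\<^bsub>R\<^esub>" and \<Phi>: "\<Phi> \<in> alg_iso L R (matrix_alg n (self_alg L))"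
  shows "matrix_entries L R n (\<lambda>p x. \<Phi> x p)"
proof -
  interpret R: field_algebra L R by fact
  let ?S = "{..<n} \<times> {..<n}" and ?M = "matrix_alg n (self_alg L)"
  have hom: "\<Phi> x \<in> carrier ?M" "\<Phi> (x \<otimes>\<^bsub>R\<^esub> y) = \<Phi> x \<otimes>\<^bsub>?M\<^esub> \<Phi> y" "\<Phi> (x \<oplus>\<^bsub>R\<^esub> y) = \<Phi> x \<oplus>\<^bsub>?M\<^esub> \<Phi> y"
    if "x \<in> carrier R" "y \<in> carrier R" for x y
    using \<Phi> that by (auto simp: alg_iso_def ring_iso_def ring_hom_def)
  have sm: "\<Phi> (c \<odot>\<^bsub>R\<^esub> x) = c \<odot>\<^bsub>?M\<^esub> \<Phi> x" if "c \<in> carrier L" "x \<in> carrier R" for c x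
    using \<Phi> that by (auto simp: alg_iso_def)
  have bij: "bij_betw \<Phi> (carrier R) (carrier ?M)" using \<Phi> by (auto simp: alg_iso_def ring_iso_def)
  have car: "carrier ?M = ?S \<rightarrow>\<^sub>E carrier L" by (simp add: matrix_alg_def self_alg_def)
  have ent: "\<Phi> x \<in> ?S \<rightarrow>\<^sub>E carrier L" if "x \<in> carrier R" for x using hom(1)[OF that that] car by simp
  have n: "0 < n"
  proof (rule ccontr)
    assume "\<not> 0 < n"
    then have "carrier ?M = {\<lambda>_. undefined}" unfolding car by simp
    then have "\<Phi> \<one>\<^bsub>R\<^esub> = \<Phi> \<zero>\<^bsub>R\<^esub>" using hom(1) by (metis R.A.one_closed R.zero_closed singletonD)
    then show False using bij nontriv by (auto simp: bij_betw_def dest: inj_onD)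
  qed
  show ?thesis
  proof
    show "0 < n" by (rule n)
    show "(\<lambda>x. \<Phi> x (i, j)) \<in> functionals L R" if ij: "i < n" "j < n" for i j
    proof (rule semilinearI)
      show "\<Phi> x (i, j) \<in> carrier L" if "x \<in> carrier R" for x using PiE_mem[OF ent[OF that]] ij by auto
      show "\<Phi> (x \<oplus>\<^bsub>R\<^esub> y) (i, j) = \<Phi> x (i, j) \<oplus>\<^bsub>L\<^esub> \<Phi> y (i, j)" if "x \<in> carrier R" "y \<in> carrier R" for x y
        using hom(3)[OF that] ij by (simp add: matrix_alg_def self_alg_def)
      show "\<Phi> (c \<odot>\<^bsub>R\<^esub> x) (i, j) = c \<otimes>\<^bsub>L\<^esub> \<Phi> x (i, j)" if "c \<in> carrier L" "x \<in> carrier R" for c x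
        using sm[OF that] ij by (simp add: matrix_alg_def self_alg_def)
    qed
    show "x = y" if x: "x \<in> carrier R" and y: "y \<in> carrier R"
      and eq: "\<And>i j. i < n \<Longrightarrow> j < n \<Longrightarrow> \<Phi> x (i, j) = \<Phi> y (i, j)" for x y
    proof -
      have "\<Phi> x = \<Phi> y" by (rule PiE_ext[OF ent[OF x] ent[OF y]]) (use eq in auto)
      then show ?thesis using bij x y by (auto simp: bij_betw_def dest: inj_onD)
    qed
    show "\<exists>x \<in> carrier R. \<forall>i < n. \<forall>j < n. \<Phi> x (i, j) = f (i, j)"
      if f: "\<And>i j. i < n \<Longrightarrow> j < n \<Longrightarrow> f (i, j) \<in> carrier L" for f
    proof -
      have "restrict f ?S \<in> carrier ?M" unfolding car using f by auto
      then have "restrict f ?S \<in> \<Phi> ` carrier R" using bij by (simp only: bij_betw_def)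
      then obtain x where "x \<in> carrier R" "\<Phi> x = restrict f ?S" by (elim imageE) simp
      then show ?thesis by (intro bexI[of _ x]) auto
    qed
    show "\<Phi> (x \<otimes>\<^bsub>R\<^esub> y) (i, j) = (\<Oplus>\<^bsub>L\<^esub>k \<in> {..<n}. \<Phi> x (i, k) \<otimes>\<^bsub>L\<^esub> \<Phi> y (k, j))"
      if "x \<in> carrier R" "y \<in> carrier R" "i < n" "j < n" for x y i j
      using hom(2)[OF that(1,2)] that(3,4) by (simp add: matrix_alg_def self_alg_finsum) (simp add: self_alg_def)
  qed
qed

text \<open>With \<open>E\<close> the matrix unit at \<open>(0, 0)\<close>, the elements \<open>\<epsilon> j\<close> are the matrix units at \<open>(0, j)\<close>. They
  are independent rows, as many as the reduced dimension of a right ideal requires.\<close>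

lemma adjoint_involution_split:
  assumes R: "field_algebra L R" and nontriv: "\<one>\<^bsub>R\<^esub> \<noteq> \<zero>\<^bsub>R\<^esub>" and \<Phi>: "\<Phi> \<in> alg_iso L R (matrix_alg n (self_alg L))"
    and G0: "G0 \<in> Units (matrix_alg n (self_alg L))" "mat_transpose n G0 = G0"
    and \<sigma>: "\<And>x. x \<in> carrier R \<Longrightarrow> \<sigma> x \<in> carrier R"
    and adj: "\<And>x. x \<in> carrier R \<Longrightarrow> mat_transpose n (\<Phi> x) \<otimes>\<^bsub>matrix_alg n (self_alg L)\<^esub> G0
        = G0 \<otimes>\<^bsub>matrix_alg n (self_alg L)\<^esub> \<Phi> (\<sigma> x)"
    and char: "\<one>\<^bsub>L\<^esub> \<oplus>\<^bsub>L\<^esub> \<one>\<^bsub>L\<^esub> \<noteq> \<zero>\<^bsub>L\<^esub>"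
  shows "\<exists>E G H t \<epsilon>. split_involution L R E G H t \<and> (\<forall>x \<in> carrier R. \<sigma> x = H \<otimes>\<^bsub>R\<^esub> t x \<otimes>\<^bsub>R\<^esub> G) \<and>
      (\<forall>j < n. \<epsilon> j \<in> carrier R \<and> E \<otimes>\<^bsub>R\<^esub> \<epsilon> j = \<epsilon> j) \<and>
      (\<forall>a. (\<forall>j < n. a j \<in> carrier L) \<longrightarrow> (\<Oplus>\<^bsub>R\<^esub>j \<in> {..<n}. a j \<odot>\<^bsub>R\<^esub> \<epsilon> j) = \<zero>\<^bsub>R\<^esub> \<longrightarrow> (\<forall>j < n. a j = \<zero>\<^bsub>L\<^esub>))"
    and "vectorspace.dim L R = n\<^sup>2" and "0 < n"
proof -
  let ?M = "matrix_alg n (self_alg L)" and ?S = "{..<n} \<times> {..<n}"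
  interpret M: matrix_entries L R n "\<lambda>p x. \<Phi> x p" by (rule matrix_alg_entries[OF R nontriv \<Phi>])
  show "vectorspace.dim L R = n\<^sup>2" by (rule M.matrix_dim)
  show "0 < n" by (rule M.n)
  have hom: "\<Phi> x \<in> carrier ?M" "\<Phi> (x \<otimes>\<^bsub>R\<^esub> y) = \<Phi> x \<otimes>\<^bsub>?M\<^esub> \<Phi> y" "\<Phi> \<one>\<^bsub>R\<^esub> = \<one>\<^bsub>?M\<^esub>"
    if "x \<in> carrier R" "y \<in> carrier R" for x y
    using \<Phi> that by (auto simp: alg_iso_def ring_iso_def ring_hom_def)
  have bij: "bij_betw \<Phi> (carrier R) (carrier ?M)" using \<Phi> by (auto simp: alg_iso_def ring_iso_def)
  have car: "carrier ?M = ?S \<rightarrow>\<^sub>E carrier L" by (simp add: matrix_alg_def self_alg_def)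
  have inj: "x = y" if "x \<in> carrier R" "y \<in> carrier R" "\<Phi> x = \<Phi> y" for x y
    using bij that by (auto simp: bij_betw_def dest: inj_onD)
  obtain H0 where H0: "H0 \<in> carrier ?M" "G0 \<otimes>\<^bsub>?M\<^esub> H0 = \<one>\<^bsub>?M\<^esub>" "H0 \<otimes>\<^bsub>?M\<^esub> G0 = \<one>\<^bsub>?M\<^esub>" and G0c: "G0 \<in> carrier ?M"
    using G0(1) by (auto simp: Units_def)
  have "G0 \<in> \<Phi> ` carrier R" "H0 \<in> \<Phi> ` carrier R" using bij G0c H0(1) by (simp_all only: bij_betw_def)
  then obtain G H where G: "G \<in> carrier R" "\<Phi> G = G0" and H: "H \<in> carrier R" "\<Phi> H = H0"
    by (elim imageE) simp
  have GH: "G \<otimes>\<^bsub>R\<^esub> H = \<one>\<^bsub>R\<^esub>" "H \<otimes>\<^bsub>R\<^esub> G = \<one>\<^bsub>R\<^esub>"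
    using G H H0 hom(2,3)[OF G(1) H(1)] hom(2)[OF H(1) G(1)] by (auto intro!: inj)
  have tr: "\<Phi> (M.tr x) = mat_transpose n (\<Phi> x)" if x: "x \<in> carrier R" for x
  proof (rule PiE_ext)
    show "\<Phi> (M.tr x) \<in> ?S \<rightarrow>\<^sub>E carrier L" using hom(1)[OF M.tr_closed[OF x] x] car by simp
    show "mat_transpose n (\<Phi> x) \<in> ?S \<rightarrow>\<^sub>E carrier L" using M.ent_closed x by (auto simp: mat_transpose_def)
  qed (use x M.ent_tr in \<open>auto simp: mat_transpose_def\<close>)
  have trG: "M.tr G = G" using tr[OF G(1)] G G0(2) by (intro inj) simp_all
  have split: "split_involution L R (M.unit 0 0) G H M.tr"
    by (rule M.matrix_split_involution[OF G(1) H(1) GH trG char])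
  have adj': "\<sigma> x = H \<otimes>\<^bsub>R\<^esub> M.tr x \<otimes>\<^bsub>R\<^esub> G" if x: "x \<in> carrier R" for x
  proof -
    have "\<Phi> (M.tr x \<otimes>\<^bsub>R\<^esub> G) = \<Phi> (G \<otimes>\<^bsub>R\<^esub> \<sigma> x)"
      using hom(2)[OF M.tr_closed[OF x] G(1)] hom(2)[OF G(1) \<sigma>[OF x]] tr[OF x] adj[OF x] G(2) by simp
    then have e: "M.tr x \<otimes>\<^bsub>R\<^esub> G = G \<otimes>\<^bsub>R\<^esub> \<sigma> x" using x G(1) \<sigma>[OF x] by (intro inj) simp_all
    have "H \<otimes>\<^bsub>R\<^esub> M.tr x \<otimes>\<^bsub>R\<^esub> G = H \<otimes>\<^bsub>R\<^esub> (M.tr x \<otimes>\<^bsub>R\<^esub> G)" using x G(1) H(1) by (simp add: M.A.m_assoc)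
    also have "\<dots> = H \<otimes>\<^bsub>R\<^esub> G \<otimes>\<^bsub>R\<^esub> \<sigma> x" unfolding e using \<sigma>[OF x] G(1) H(1) by (simp add: M.A.m_assoc)
    also have "\<dots> = \<sigma> x" unfolding GH using \<sigma>[OF x] by simp
    finally show ?thesis by simp
  qed
  have eps: "M.unit 0 0 \<otimes>\<^bsub>R\<^esub> M.unit 0 j = M.unit 0 j" if "j < n" for j
    using M.n that by (intro M.ent_eqI) (auto simp: M.ent_unit_mult M.ent_unit)
  show "\<exists>E G H t \<epsilon>. split_involution L R E G H t \<and> (\<forall>x \<in> carrier R. \<sigma> x = H \<otimes>\<^bsub>R\<^esub> t x \<otimes>\<^bsub>R\<^esub> G) \<and>
      (\<forall>j < n. \<epsilon> j \<in> carrier R \<and> E \<otimes>\<^bsub>R\<^esub> \<epsilon> j = \<epsilon> j) \<and>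
      (\<forall>a. (\<forall>j < n. a j \<in> carrier L) \<longrightarrow> (\<Oplus>\<^bsub>R\<^esub>j \<in> {..<n}. a j \<odot>\<^bsub>R\<^esub> \<epsilon> j) = \<zero>\<^bsub>R\<^esub> \<longrightarrow> (\<forall>j < n. a j = \<zero>\<^bsub>L\<^esub>))"
    using split adj' eps M.row_units_independent
    by (intro exI[of _ "M.unit 0 0"] exI[of _ G] exI[of _ H] exI[of _ M.tr] exI[of _ "M.unit 0"] conjI) auto
qed

section \<open>Polynomials and their values\<close>

locale polynomial_values = F: ring F + K: cring K
  for F :: "'f ring" and K :: "'k ring" +
  fixes \<iota> :: "'f \<Rightarrow> 'k" and V :: "'v set" and x :: "'v \<Rightarrow> 'k"
  assumes iota: "\<iota> \<in> ring_hom F K" and x: "\<And>v. v \<in> V \<Longrightarrow> x v \<in> carrier K"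
begin

abbreviation polys where "polys \<equiv> F.indexed_pset V (carrier F)"
abbreviation val where "val p \<equiv> poly_value F K \<iota> p x"

definition mon :: "'v multiset \<Rightarrow> 'k" where
  "mon m = (\<Otimes>\<^bsub>K\<^esub>v \<in> set_mset m. x v [^]\<^bsub>K\<^esub> count m v)"

lemma iota_zero: "\<iota> \<zero>\<^bsub>F\<^esub> = \<zero>\<^bsub>K\<^esub>"
  by (rule ring_hom_zero[OF iota F.ring_axioms K.ring_axioms])

lemma mon_superset:
  assumes "finite S" "set_mset m \<subseteq> S" "S \<subseteq> V"
  shows "mon m = (\<Otimes>\<^bsub>K\<^esub>v \<in> S. x v [^]\<^bsub>K\<^esub> count m v)"
  unfolding mon_def using assms x
  by (intro K.finprod_mono_neutral_cong_left) (auto simp: not_in_iff subset_iff)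

lemma mon_closed: "set_mset m \<subseteq> V \<Longrightarrow> mon m \<in> carrier K"
  unfolding mon_def using x by (intro K.finprod_closed) auto

lemma mon_add_mset:
  assumes i: "i \<in> V" and m: "set_mset m \<subseteq> V"
  shows "mon (add_mset i m) = mon m \<otimes>\<^bsub>K\<^esub> x i"
proof -
  let ?S = "insert i (set_mset m)"
  have S: "finite ?S" "?S \<subseteq> V" using i m by auto
  have xS: "x v \<in> carrier K" if "v \<in> ?S" for v using S that x by blast
  have "mon (add_mset i m) = (\<Otimes>\<^bsub>K\<^esub>v \<in> ?S. x v [^]\<^bsub>K\<^esub> count (add_mset i m) v)"
    using S by (intro mon_superset) auto
  also have "\<dots> = (\<Otimes>\<^bsub>K\<^esub>v \<in> ?S. x v [^]\<^bsub>K\<^esub> count m v \<otimes>\<^bsub>K\<^esub> (if i = v then x v else \<one>\<^bsub>K\<^esub>))"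
    using xS by (intro K.finprod_cong' refl) auto
  also have "\<dots> = (\<Otimes>\<^bsub>K\<^esub>v \<in> ?S. x v [^]\<^bsub>K\<^esub> count m v) \<otimes>\<^bsub>K\<^esub> (\<Otimes>\<^bsub>K\<^esub>v \<in> ?S. if i = v then x v else \<one>\<^bsub>K\<^esub>)"
    using xS by (intro K.finprod_multf) auto
  also have "(\<Otimes>\<^bsub>K\<^esub>v \<in> ?S. x v [^]\<^bsub>K\<^esub> count m v) = mon m"
    using S by (intro mon_superset[symmetric]) auto
  also have "(\<Otimes>\<^bsub>K\<^esub>v \<in> ?S. if i = v then x v else \<one>\<^bsub>K\<^esub>) = x i"
    using xS by (intro K.finprod_singleton) auto
  finally show ?thesis .
qed

text \<open>Polynomials are functions on monomials. Finiteness of the support is what allows their values to be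
  calculated by sums over larger finite sets.\<close>

definition supported :: "('v multiset \<Rightarrow> 'f) \<Rightarrow> bool" where
  "supported p \<longleftrightarrow> finite {m. p m \<noteq> \<zero>\<^bsub>F\<^esub>} \<and> (\<forall>m. p m \<in> carrier F) \<and> (\<forall>m. p m \<noteq> \<zero>\<^bsub>F\<^esub> \<longrightarrow> set_mset m \<subseteq> V)"

lemma polys_supported: "p \<in> polys \<Longrightarrow> supported p"
proof (induction p rule: F.indexed_pset.induct)
  case (indexed_const k)
  have "{m. F.indexed_const k m \<noteq> \<zero>\<^bsub>F\<^esub>} \<subseteq> {{#}}" by (auto simp: F.indexed_const_def)
  then show ?case
    using indexed_const finite_subset[of "{m. F.indexed_const k m \<noteq> \<zero>\<^bsub>F\<^esub>}" "{{#}}"]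
    by (auto simp: supported_def F.indexed_const_def)
next
  case (indexed_padd p q)
  have "{m. F.indexed_padd p q m \<noteq> \<zero>\<^bsub>F\<^esub>} \<subseteq> {m. p m \<noteq> \<zero>\<^bsub>F\<^esub>} \<union> {m. q m \<noteq> \<zero>\<^bsub>F\<^esub>}"
    by (auto simp: F.indexed_padd_def)
  moreover have "finite ({m. p m \<noteq> \<zero>\<^bsub>F\<^esub>} \<union> {m. q m \<noteq> \<zero>\<^bsub>F\<^esub>})" using indexed_padd by (simp add: supported_def)
  ultimately have "finite {m. F.indexed_padd p q m \<noteq> \<zero>\<^bsub>F\<^esub>}" by (rule finite_subset)
  moreover have "set_mset m \<subseteq> V" if m: "F.indexed_padd p q m \<noteq> \<zero>\<^bsub>F\<^esub>" for m
  proof -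
    have "p m \<noteq> \<zero>\<^bsub>F\<^esub> \<or> q m \<noteq> \<zero>\<^bsub>F\<^esub>" using m by (auto simp: F.indexed_padd_def)
    then show ?thesis using indexed_padd by (auto simp: supported_def)
  qed
  moreover have "F.indexed_padd p q m \<in> carrier F" for m
    using indexed_padd by (auto simp: supported_def F.indexed_padd_def)
  ultimately show ?case by (simp add: supported_def)
next
  case (indexed_pmult p i)
  have sub: "{m. F.indexed_pmult p i m \<noteq> \<zero>\<^bsub>F\<^esub>} \<subseteq> add_mset i ` {m. p m \<noteq> \<zero>\<^bsub>F\<^esub>}"
  proof
    fix m assume m: "m \<in> {m. F.indexed_pmult p i m \<noteq> \<zero>\<^bsub>F\<^esub>}"
    then have "i \<in># m" "p (m - {#i#}) \<noteq> \<zero>\<^bsub>F\<^esub>" by (auto simp: F.indexed_pmult_def split: if_splits)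
    then show "m \<in> add_mset i ` {m. p m \<noteq> \<zero>\<^bsub>F\<^esub>}" by (intro image_eqI[of _ _ "m - {#i#}"]) simp_all
  qed
  moreover have "finite (add_mset i ` {m. p m \<noteq> \<zero>\<^bsub>F\<^esub>})" using indexed_pmult by (simp add: supported_def)
  ultimately have "finite {m. F.indexed_pmult p i m \<noteq> \<zero>\<^bsub>F\<^esub>}" by (rule finite_subset)
  moreover have "set_mset m \<subseteq> V" if m: "F.indexed_pmult p i m \<noteq> \<zero>\<^bsub>F\<^esub>" for m
  proof -
    obtain m' where "m = add_mset i m'" "p m' \<noteq> \<zero>\<^bsub>F\<^esub>" using sub m by blast
    then show ?thesis using indexed_pmult by (auto simp: supported_def)
  qed
  moreover have "F.indexed_pmult p i m \<in> carrier F" for m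
    using indexed_pmult by (auto simp: supported_def F.indexed_pmult_def)
  ultimately show ?case by (simp add: supported_def)
qed

lemma term_closed:
  assumes "supported p" "set_mset m \<subseteq> V" shows "\<iota> (p m) \<otimes>\<^bsub>K\<^esub> mon m \<in> carrier K"
  using assms mon_closed ring_hom_closed[OF iota] by (auto simp: supported_def)

lemma val_superset:
  assumes p: "supported p" and S: "finite S" "{m. p m \<noteq> \<zero>\<^bsub>F\<^esub>} \<subseteq> S" "\<And>m. m \<in> S \<Longrightarrow> set_mset m \<subseteq> V"
  shows "val p = (\<Oplus>\<^bsub>K\<^esub>m \<in> S. \<iota> (p m) \<otimes>\<^bsub>K\<^esub> mon m)"
  unfolding poly_value_def mon_def[symmetric]
proof (rule K.add.finprod_mono_neutral_cong_left)
  show "\<iota> (p m) \<otimes>\<^bsub>K\<^esub> mon m = \<zero>\<^bsub>K\<^esub>" if "m \<in> S - {m. p m \<noteq> \<zero>\<^bsub>F\<^esub>}" for m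
    using that S mon_closed by (auto simp: iota_zero)
  show "(\<lambda>m. \<iota> (p m) \<otimes>\<^bsub>K\<^esub> mon m) \<in> S \<rightarrow> carrier K" using term_closed[OF p] S by auto
qed (use S in auto)

lemma val_closed: "p \<in> polys \<Longrightarrow> val p \<in> carrier K"
proof -
  assume "p \<in> polys"
  then have p: "supported p" by (rule polys_supported)
  show ?thesis
    unfolding poly_value_def mon_def[symmetric]
    using term_closed[OF p] p by (intro K.finsum_closed) (auto simp: supported_def)
qed

lemma val_const: "k \<in> carrier F \<Longrightarrow> val (F.indexed_const k) = \<iota> k"
proof -
  assume k: "k \<in> carrier F"
  have "F.indexed_const k \<in> polys" using k by (rule F.indexed_pset.indexed_const)
  then have "val (F.indexed_const k) = (\<Oplus>\<^bsub>K\<^esub>m \<in> {{#}}. \<iota> (F.indexed_const k m) \<otimes>\<^bsub>K\<^esub> mon m)"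
    by (intro val_superset polys_supported) (auto simp: F.indexed_const_def)
  then show ?thesis using ring_hom_closed[OF iota k] by (simp add: F.indexed_const_def mon_def)
qed

lemma val_padd:
  assumes p: "p \<in> polys" and q: "q \<in> polys"
  shows "val (F.indexed_padd p q) = val p \<oplus>\<^bsub>K\<^esub> val q"
proof -
  let ?S = "{m. p m \<noteq> \<zero>\<^bsub>F\<^esub>} \<union> {m. q m \<noteq> \<zero>\<^bsub>F\<^esub>}"
  have sp: "supported p" "supported q" "supported (F.indexed_padd p q)"
    by (rule polys_supported[OF p], rule polys_supported[OF q], rule polys_supported[OF F.indexed_pset.indexed_padd[OF p q]])
  have S: "finite ?S" "\<And>m. m \<in> ?S \<Longrightarrow> set_mset m \<subseteq> V" using sp by (auto simp: supported_def)
  have c: "p m \<in> carrier F" "q m \<in> carrier F" for m using sp by (auto simp: supported_def)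
  have "{m. F.indexed_padd p q m \<noteq> \<zero>\<^bsub>F\<^esub>} \<subseteq> ?S" by (auto simp: F.indexed_padd_def)
  then have "val (F.indexed_padd p q) = (\<Oplus>\<^bsub>K\<^esub>m \<in> ?S. \<iota> (F.indexed_padd p q m) \<otimes>\<^bsub>K\<^esub> mon m)"
    by (intro val_superset sp S)
  also have "\<dots> = (\<Oplus>\<^bsub>K\<^esub>m \<in> ?S. \<iota> (p m) \<otimes>\<^bsub>K\<^esub> mon m \<oplus>\<^bsub>K\<^esub> \<iota> (q m) \<otimes>\<^bsub>K\<^esub> mon m)"
    using term_closed[OF sp(1)] term_closed[OF sp(2)] S(2) c mon_closed
    by (intro K.finsum_cong' refl)
      (auto simp: F.indexed_padd_def ring_hom_add[OF iota] K.l_distr ring_hom_closed[OF iota])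
  also have "\<dots> = (\<Oplus>\<^bsub>K\<^esub>m \<in> ?S. \<iota> (p m) \<otimes>\<^bsub>K\<^esub> mon m) \<oplus>\<^bsub>K\<^esub> (\<Oplus>\<^bsub>K\<^esub>m \<in> ?S. \<iota> (q m) \<otimes>\<^bsub>K\<^esub> mon m)"
    using term_closed[OF sp(1)] term_closed[OF sp(2)] S(2) by (intro K.finsum_addf) blast+
  also have "(\<Oplus>\<^bsub>K\<^esub>m \<in> ?S. \<iota> (p m) \<otimes>\<^bsub>K\<^esub> mon m) = val p" by (intro val_superset[symmetric] sp S) auto
  also have "(\<Oplus>\<^bsub>K\<^esub>m \<in> ?S. \<iota> (q m) \<otimes>\<^bsub>K\<^esub> mon m) = val q" by (intro val_superset[symmetric] sp S) auto
  finally show ?thesis .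
qed

lemma val_pmult:
  assumes p: "p \<in> polys" and i: "i \<in> V"
  shows "val (F.indexed_pmult p i) = val p \<otimes>\<^bsub>K\<^esub> x i"
proof -
  let ?S = "{m. p m \<noteq> \<zero>\<^bsub>F\<^esub>}"
  have sp: "supported p" "supported (F.indexed_pmult p i)"
    by (rule polys_supported[OF p], rule polys_supported[OF F.indexed_pset.indexed_pmult[OF p i]])
  have S: "finite ?S" "\<And>m. m \<in> ?S \<Longrightarrow> set_mset m \<subseteq> V" and c: "\<And>m. p m \<in> carrier F"
    using sp by (auto simp: supported_def)
  have shift: "F.indexed_pmult p i (add_mset i m) = p m" for m by (simp add: F.indexed_pmult_def)
  have sub: "{m. F.indexed_pmult p i m \<noteq> \<zero>\<^bsub>F\<^esub>} \<subseteq> add_mset i ` ?S"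
  proof
    fix m assume m: "m \<in> {m. F.indexed_pmult p i m \<noteq> \<zero>\<^bsub>F\<^esub>}"
    then have "i \<in># m" "p (m - {#i#}) \<noteq> \<zero>\<^bsub>F\<^esub>" by (auto simp: F.indexed_pmult_def split: if_splits)
    then show "m \<in> add_mset i ` ?S" by (intro image_eqI[of _ _ "m - {#i#}"]) simp_all
  qed
  have V': "set_mset m \<subseteq> V" if mem: "m \<in> add_mset i ` ?S" for m
  proof -
    obtain m' where m': "m' \<in> ?S" "m = add_mset i m'" using mem by blast
    show ?thesis using S(2)[OF m'(1)] i unfolding m'(2) by simp
  qed
  have "val (F.indexed_pmult p i) = (\<Oplus>\<^bsub>K\<^esub>m \<in> add_mset i ` ?S. \<iota> (F.indexed_pmult p i m) \<otimes>\<^bsub>K\<^esub> mon m)"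
    using S(1) by (intro val_superset sp sub V') auto
  also have "\<dots> = (\<Oplus>\<^bsub>K\<^esub>m \<in> ?S. \<iota> (F.indexed_pmult p i (add_mset i m)) \<otimes>\<^bsub>K\<^esub> mon (add_mset i m))"
    using term_closed[OF sp(2) V'] by (intro K.finsum_reindex) (auto simp: inj_on_def)
  also have "\<dots> = (\<Oplus>\<^bsub>K\<^esub>m \<in> ?S. \<iota> (p m) \<otimes>\<^bsub>K\<^esub> mon m \<otimes>\<^bsub>K\<^esub> x i)"
    using S(2) i c mon_closed x
    by (intro K.finsum_cong' refl) (auto simp: shift mon_add_mset K.m_assoc ring_hom_closed[OF iota])
  also have "\<dots> = (\<Oplus>\<^bsub>K\<^esub>m \<in> ?S. \<iota> (p m) \<otimes>\<^bsub>K\<^esub> mon m) \<otimes>\<^bsub>K\<^esub> x i"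
    using S term_closed[OF sp(1)] x[OF i] by (intro K.finsum_ldistr[symmetric]) auto
  also have "(\<Oplus>\<^bsub>K\<^esub>m \<in> ?S. \<iota> (p m) \<otimes>\<^bsub>K\<^esub> mon m) = val p" by (intro val_superset[symmetric] sp S) auto
  finally show ?thesis .
qed

end

text \<open>An element of \<open>K\<close> and a function on a set \<open>Y\<close> of points over \<open>L\<close> form a polynomial pair if the same
  polynomial over \<open>F\<close> yields both, the former as its value at \<open>x\<close>. Pairs can be added and
  multiplied by variables, so the polynomial itself never has to be written down.\<close>

locale polynomial_transfer = F: field F + K: field K + L: field L
  for F :: "'f ring" and K :: "'k ring" and L :: "'l ring" +
  fixes \<iota> :: "'f \<Rightarrow> 'k" and j :: "'f \<Rightarrow> 'l" and V :: "'v set" and x :: "'v \<Rightarrow> 'k" and Y :: "('v \<Rightarrow> 'l) set"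
  assumes iota: "\<iota> \<in> ring_hom F K" and jota: "j \<in> ring_hom F L"
    and x: "\<And>v. v \<in> V \<Longrightarrow> x v \<in> carrier K" and Y: "\<And>y v. y \<in> Y \<Longrightarrow> v \<in> V \<Longrightarrow> y v \<in> carrier L"
begin

definition polynomial_pair :: "'k \<Rightarrow> (('v \<Rightarrow> 'l) \<Rightarrow> 'l) \<Rightarrow> bool" where
  "polynomial_pair f g \<longleftrightarrow> (\<exists>p \<in> F.indexed_pset V (carrier F). poly_value F K \<iota> p x = f \<and>
      (\<forall>y \<in> Y. poly_value F L j p y = g y))"

sublocale X: polynomial_values F K \<iota> V x
  by unfold_locales (use iota x in auto)

lemma values_at: "y \<in> Y \<Longrightarrow> polynomial_values F L j V y"
  by unfold_locales (use jota Y in auto)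

lemma polynomial_pair_const: "c \<in> carrier F \<Longrightarrow> polynomial_pair (\<iota> c) (\<lambda>y. j c)"
  unfolding polynomial_pair_def
  by (intro bexI[of _ "F.indexed_const c"] conjI ballI X.val_const polynomial_values.val_const[OF values_at]
      F.indexed_pset.indexed_const)

lemma polynomial_pair_add:
  assumes "polynomial_pair f g" "polynomial_pair f' g'"
  shows "polynomial_pair (f \<oplus>\<^bsub>K\<^esub> f') (\<lambda>y. g y \<oplus>\<^bsub>L\<^esub> g' y)"
proof -
  obtain p where p: "p \<in> F.indexed_pset V (carrier F)" "poly_value F K \<iota> p x = f" "\<forall>y \<in> Y. poly_value F L j p y = g y"
    using assms(1) by (auto simp: polynomial_pair_def)
  obtain p' where p': "p' \<in> F.indexed_pset V (carrier F)" "poly_value F K \<iota> p' x = f'" "\<forall>y \<in> Y. poly_value F L j p' y = g' y"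
    using assms(2) by (auto simp: polynomial_pair_def)
  show ?thesis
    unfolding polynomial_pair_def
    using p p' by (intro bexI[of _ "F.indexed_padd p p'"])
      (auto simp: X.val_padd polynomial_values.val_padd[OF values_at] intro: F.indexed_pset.indexed_padd)
qed

lemma polynomial_pair_mult_var:
  assumes "polynomial_pair f g" and v: "v \<in> V"
  shows "polynomial_pair (f \<otimes>\<^bsub>K\<^esub> x v) (\<lambda>y. g y \<otimes>\<^bsub>L\<^esub> y v)"
proof -
  obtain p where p: "p \<in> F.indexed_pset V (carrier F)" "poly_value F K \<iota> p x = f" "\<forall>y \<in> Y. poly_value F L j p y = g y"
    using assms(1) by (auto simp: polynomial_pair_def)
  show ?thesis
    unfolding polynomial_pair_def
    using p v by (intro bexI[of _ "F.indexed_pmult p v"])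
      (auto simp: X.val_pmult polynomial_values.val_pmult[OF values_at] intro: F.indexed_pset.indexed_pmult)
qed

lemma polynomial_pair_cong:
  "polynomial_pair f g \<Longrightarrow> f = f' \<Longrightarrow> (\<And>y. y \<in> Y \<Longrightarrow> g y = g' y) \<Longrightarrow> polynomial_pair f' g'"
  unfolding polynomial_pair_def by auto

lemma polynomial_pair_closed: "polynomial_pair f g \<Longrightarrow> f \<in> carrier K" "polynomial_pair f g \<Longrightarrow> y \<in> Y \<Longrightarrow> g y \<in> carrier L"
proof -
  show "polynomial_pair f g \<Longrightarrow> f \<in> carrier K"
    unfolding polynomial_pair_def using X.val_closed by blast
  assume "polynomial_pair f g" and y: "y \<in> Y"
  then obtain p where "p \<in> F.indexed_pset V (carrier F)" "poly_value F L j p y = g y"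
    unfolding polynomial_pair_def by blast
  then show "g y \<in> carrier L" using polynomial_values.val_closed[OF values_at[OF y], of p] by simp
qed

lemma polynomial_pair_zero: "polynomial_pair \<zero>\<^bsub>K\<^esub> (\<lambda>y. \<zero>\<^bsub>L\<^esub>)"
  using polynomial_pair_const[OF F.zero_closed] ring_hom_zero[OF iota F.ring_axioms K.ring_axioms]
    ring_hom_zero[OF jota F.ring_axioms L.ring_axioms] by simp

lemma polynomial_pair_sum:
  assumes "finite S" "\<And>s. s \<in> S \<Longrightarrow> polynomial_pair (f s) (g s)"
  shows "polynomial_pair (\<Oplus>\<^bsub>K\<^esub>s\<in>S. f s) (\<lambda>y. \<Oplus>\<^bsub>L\<^esub>s\<in>S. g s y)"
  using assms
proof (induction S rule: finite_induct)
  case (insert s S)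
  have A: "polynomial_pair (f s \<oplus>\<^bsub>K\<^esub> (\<Oplus>\<^bsub>K\<^esub>s\<in>S. f s)) (\<lambda>y. g s y \<oplus>\<^bsub>L\<^esub> (\<Oplus>\<^bsub>L\<^esub>s\<in>S. g s y))"
    using insert by (intro polynomial_pair_add) auto
  have B: "(\<Oplus>\<^bsub>K\<^esub>s\<in>insert s S. f s) = f s \<oplus>\<^bsub>K\<^esub> (\<Oplus>\<^bsub>K\<^esub>s\<in>S. f s)"
    using insert polynomial_pair_closed(1) by (intro K.finsum_insert) auto
  have C: "(\<Oplus>\<^bsub>L\<^esub>s\<in>insert s S. g s y) = g s y \<oplus>\<^bsub>L\<^esub> (\<Oplus>\<^bsub>L\<^esub>s\<in>S. g s y)" if "y \<in> Y" for y
    using insert polynomial_pair_closed(2)[OF _ that] by (intro L.finsum_insert) auto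
  show ?case by (rule polynomial_pair_cong[OF A B[symmetric]]) (rule C[symmetric])
qed (simp add: polynomial_pair_zero)

end

section \<open>Charts of the Brauer--Severi variety\<close>

text \<open>The \<open>i\<close>-th coordinate of the spanning vector \<open>b\<^sub>s + \<Sum>\<^sub>t y\<^bsub>s,t\<^esub> b\<^sub>t\<close> of a subspace in the chart.\<close>

definition chart_coord :: "'k ring \<Rightarrow> nat \<Rightarrow> (nat \<times> nat \<Rightarrow> 'k) \<Rightarrow> nat \<Rightarrow> nat \<Rightarrow> 'k" where
  "chart_coord K n y s i = (if i < n then if i = s then \<one>\<^bsub>K\<^esub> else \<zero>\<^bsub>K\<^esub> else y (s, i))"

lemma submodule_finsum:
  assumes sub: "LinearCombinations.submodule K W V" and "finite S" and "\<And>k. k \<in> S \<Longrightarrow> f k \<in> W"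
  shows "(\<Oplus>\<^bsub>V\<lparr>carrier := W\<rparr>\<^esub>k\<in>S. f k) = (\<Oplus>\<^bsub>V\<^esub>k\<in>S. f k)"
proof -
  interpret V: module K V using sub by (simp add: submodule_def)
  interpret W: module K "V\<lparr>carrier := W\<rparr>" by (rule V.submodule_is_module[OF sub])
  have WV: "W \<subseteq> carrier V" using sub by (simp add: submodule_def)
  show ?thesis
    using assms(2,3)
  proof (induction S rule: finite_induct)
    case (insert s S)
    have fW: "f k \<in> W" "f k \<in> carrier V" if "k \<in> insert s S" for k using insert.prems that WV by auto
    have "(\<Oplus>\<^bsub>V\<lparr>carrier := W\<rparr>\<^esub>k\<in>insert s S. f k) = f s \<oplus>\<^bsub>V\<lparr>carrier := W\<rparr>\<^esub> (\<Oplus>\<^bsub>V\<lparr>carrier := W\<rparr>\<^esub>k\<in>S. f k)"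
      using insert.hyps fW by (intro W.finsum_insert) auto
    moreover have "(\<Oplus>\<^bsub>V\<^esub>k\<in>insert s S. f k) = f s \<oplus>\<^bsub>V\<^esub> (\<Oplus>\<^bsub>V\<^esub>k\<in>S. f k)"
      using insert.hyps fW by (intro V.finsum_insert) auto
    ultimately show ?case using insert by simp
  qed simp
qed

text \<open>A basis \<open>b\<close> of \<open>B\<close> and its coordinates \<open>c\<close> extend to \<open>B\<^sub>K\<close>. The span \<open>I y\<close> of the vectors \<open>w y s\<close> is the
  subspace with chart coordinates \<open>y\<close>.\<close>

locale chart = scalar_extension F B K \<iota>
  for F :: "'f ring" and B :: "('f, 'b) module" and K :: "'k ring" and \<iota> +
  fixes b :: "nat \<Rightarrow> 'b" and c :: "nat \<Rightarrow> 'b \<Rightarrow> 'f" and N n :: nat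
  assumes csF: "coordinate_system F B {..<N} b c"
    and nN: "n \<le> N"
begin

definition b' where "b' i = incl (b i)"
definition cK where "cK k x = ev K x (\<lambda>a. \<iota> (c k a))"
definition w where "w y s = b' s \<oplus>\<^bsub>AK\<^esub> (\<Oplus>\<^bsub>AK\<^esub>t \<in> {n..<N}. y (s, t) \<odot>\<^bsub>AK\<^esub> b' t)"
definition I where "I y = AK.span (w y ` {..<n})"

lemma dual_c: "k < N \<Longrightarrow> (\<lambda>a. \<iota> (c k a)) \<in> dual"
  using coordinate_systemD(3)[OF csF] by (intro dual_iota) simp

lemma b_closed: "i < N \<Longrightarrow> b i \<in> carrier B" using coordinate_systemD(2)[OF csF] by simp

lemma cK_functional: "k < N \<Longrightarrow> cK k \<in> functionals K AK"
  unfolding cK_def by (rule ev_semilinear[OF dual_c])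

lemma cK_incl: "k < N \<Longrightarrow> a \<in> carrier B \<Longrightarrow> cK k (incl a) = \<iota> (c k a)"
  unfolding cK_def by (rule ev_incl[OF _ dual_c])

lemma csK: "coordinate_system K AK {..<N} b' cK"
  unfolding coordinate_system_def
proof (intro conjI ballI)
  note D = coordinate_systemD[OF csF]
  show "cK k (b' i) = (if i = k then \<one>\<^bsub>K\<^esub> else \<zero>\<^bsub>K\<^esub>)" if "i \<in> {..<N}" "k \<in> {..<N}" for i k
    using that D(4)[OF that] ring_hom_one[OF iota] ring_hom_zero[OF iota A.R.ring_axioms K.ring_axioms]
    by (simp add: b'_def cK_incl b_closed)
  show "x = (\<Oplus>\<^bsub>AK\<^esub>k \<in> {..<N}. cK k x \<odot>\<^bsub>AK\<^esub> b' k)" if "x \<in> carrier AK" for x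
    unfolding cK_def b'_def by (rule frame_expansion[OF D(1,2,3,5) that])
qed (auto simp: b'_def cK_functional b_closed)

lemmas csKD = coordinate_systemD[OF csK, simplified]

lemma b'_closed [simp]: "i < N \<Longrightarrow> b' i \<in> carrier AK" by (rule csKD(2))
lemma cK_closed [simp]: "k < N \<Longrightarrow> x \<in> carrier AK \<Longrightarrow> cK k x \<in> carrier K"
  by (rule semilinear_closed[OF cK_functional])

lemma cK_zero: "k < N \<Longrightarrow> cK k \<zero>\<^bsub>AK\<^esub> = \<zero>\<^bsub>K\<^esub>"
  using semilinear_smult[OF cK_functional, of k "\<zero>\<^bsub>K\<^esub>" "\<zero>\<^bsub>AK\<^esub>"] by simp

lemma coord_eqI:
  assumes x: "x \<in> carrier AK" and y: "y \<in> carrier AK" and eq: "\<And>k. k < N \<Longrightarrow> cK k x = cK k y"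
  shows "x = y"
proof -
  have "(\<Oplus>\<^bsub>AK\<^esub>k \<in> {..<N}. cK k x \<odot>\<^bsub>AK\<^esub> b' k) = (\<Oplus>\<^bsub>AK\<^esub>k \<in> {..<N}. cK k y \<odot>\<^bsub>AK\<^esub> b' k)"
    using y by (intro AK.finsum_cong' refl) (auto simp: eq)
  then show ?thesis using csKD(5)[OF x] csKD(5)[OF y] by simp
qed

lemma w_expansion:
  assumes s: "s < n" and y: "\<And>t. n \<le> t \<Longrightarrow> t < N \<Longrightarrow> y (s, t) \<in> carrier K"
  shows "w y s = (\<Oplus>\<^bsub>AK\<^esub>i \<in> {..<N}. chart_coord K n y s i \<odot>\<^bsub>AK\<^esub> b' i)"
proof -
  let ?f = "\<lambda>i. chart_coord K n y s i \<odot>\<^bsub>AK\<^esub> b' i"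
  have f: "?f i \<in> carrier AK" if "i < N" for i using y that by (auto simp: chart_coord_def)
  have split: "{..<N} = {..<n} \<union> {n..<N}" using nN by auto
  have "(\<Oplus>\<^bsub>AK\<^esub>i \<in> {..<N}. ?f i) = (\<Oplus>\<^bsub>AK\<^esub>i \<in> {..<n}. ?f i) \<oplus>\<^bsub>AK\<^esub> (\<Oplus>\<^bsub>AK\<^esub>i \<in> {n..<N}. ?f i)"
    unfolding split using f nN by (intro AK.finsum_Un_disjoint) auto
  also have "(\<Oplus>\<^bsub>AK\<^esub>i \<in> {..<n}. ?f i) = (\<Oplus>\<^bsub>AK\<^esub>i \<in> {..<n}. if i = s then b' i else \<zero>\<^bsub>AK\<^esub>)"
    using s nN by (intro AK.finsum_cong' refl) (auto simp: chart_coord_def)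
  also have "\<dots> = b' s" using s nN by (intro AK.finsum_delta) auto
  also have "(\<Oplus>\<^bsub>AK\<^esub>i \<in> {n..<N}. ?f i) = (\<Oplus>\<^bsub>AK\<^esub>t \<in> {n..<N}. y (s, t) \<odot>\<^bsub>AK\<^esub> b' t)"
    using y by (intro AK.finsum_cong' refl) (auto simp: chart_coord_def)
  finally show ?thesis by (simp add: w_def)
qed

lemma w_closed:
  assumes "s < n" "\<And>t. n \<le> t \<Longrightarrow> t < N \<Longrightarrow> y (s, t) \<in> carrier K" shows "w y s \<in> carrier AK"
  unfolding w_def using assms nN by (intro AK.a_closed AK.finsum_closed) auto

lemma cK_w:
  assumes "s < n" "i < N" and y: "\<And>t. n \<le> t \<Longrightarrow> t < N \<Longrightarrow> y (s, t) \<in> carrier K"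
  shows "cK i (w y s) = chart_coord K n y s i"
proof -
  have e: "w y s = (\<Oplus>\<^bsub>AK\<^esub>i \<in> {..<N}. chart_coord K n y s i \<odot>\<^bsub>AK\<^esub> b' i)"
    using assms(1) y by (rule w_expansion)
  show ?thesis
    unfolding e by (rule coordinate_lincomb[OF AK.module_axioms csK]) (use assms in \<open>auto simp: chart_coord_def\<close>)
qed

context
  fixes y :: "nat \<times> nat \<Rightarrow> 'k"
  assumes y: "\<And>s t. s < n \<Longrightarrow> n \<le> t \<Longrightarrow> t < N \<Longrightarrow> y (s, t) \<in> carrier K"
begin

lemma I_submodule: "LinearCombinations.submodule K (I y) AK"
  unfolding I_def using w_closed y by (intro AK.span_is_submodule) auto

lemma w_in_I: "s < n \<Longrightarrow> w y s \<in> I y"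
  unfolding I_def using w_closed y AK.in_own_span[of "w y ` {..<n}"] by blast

lemma I_least: "LinearCombinations.submodule K M AK \<Longrightarrow> (\<And>s. s < n \<Longrightarrow> w y s \<in> M) \<Longrightarrow> I y \<subseteq> M"
  unfolding I_def by (intro AK.span_is_subset) auto

lemma I_subset: "x \<in> I y \<Longrightarrow> x \<in> carrier AK"
  using I_submodule by (auto simp: submodule_def)

lemma I_lincomb:
  assumes M: "LinearCombinations.submodule K M AK" and "\<And>s. s < n \<Longrightarrow> a s \<in> carrier K" "\<And>s. s < n \<Longrightarrow> z s \<in> M"
  shows "(\<Oplus>\<^bsub>AK\<^esub>s \<in> {..<n}. a s \<odot>\<^bsub>AK\<^esub> z s) \<in> M"
proof -
  interpret M: module K "AK\<lparr>carrier := M\<rparr>" by (rule AK.submodule_is_module[OF M])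
  have az: "a s \<odot>\<^bsub>AK\<^esub> z s \<in> M" if "s < n" for s using M assms that by (auto simp: submodule_def)
  then have "(\<Oplus>\<^bsub>AK\<lparr>carrier := M\<rparr>\<^esub>s \<in> {..<n}. a s \<odot>\<^bsub>AK\<^esub> z s) \<in> M"
    using M.finsum_closed[of "\<lambda>s. a s \<odot>\<^bsub>AK\<^esub> z s" "{..<n}"] by simp
  then show ?thesis using submodule_finsum[OF M, of "{..<n}" "\<lambda>s. a s \<odot>\<^bsub>AK\<^esub> z s"] az by simp
qed

text \<open>The first \<open>n\<close> coordinates of \<open>w y s\<close> are those of a unit vector, so they are the coefficients of an
  element of \<open>I y\<close> with respect to the spanning vectors.\<close>

lemma I_expansion:
  assumes "x \<in> I y" shows "x = (\<Oplus>\<^bsub>AK\<^esub>s \<in> {..<n}. cK s x \<odot>\<^bsub>AK\<^esub> w y s)"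
proof -
  let ?f = "\<lambda>x. \<Oplus>\<^bsub>AK\<^esub>s \<in> {..<n}. cK s x \<odot>\<^bsub>AK\<^esub> w y s"
  let ?M = "{x \<in> carrier AK. x = ?f x}"
  have wc: "w y s \<in> carrier AK" if "s < n" for s using w_closed y that by blast
  have c: "cK s x \<in> carrier K" if "s < n" "x \<in> carrier AK" for s x using that nN by simp
  have fadd: "?f (x \<oplus>\<^bsub>AK\<^esub> x') = ?f x \<oplus>\<^bsub>AK\<^esub> ?f x'" if x: "x \<in> carrier AK" "x' \<in> carrier AK" for x x'
  proof -
    have "?f (x \<oplus>\<^bsub>AK\<^esub> x') = (\<Oplus>\<^bsub>AK\<^esub>s \<in> {..<n}. cK s x \<odot>\<^bsub>AK\<^esub> w y s \<oplus>\<^bsub>AK\<^esub> cK s x' \<odot>\<^bsub>AK\<^esub> w y s)"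
      using x wc nN by (intro AK.finsum_cong' refl) (auto simp: semilinear_add[OF cK_functional] AK.smult_l_distr)
    then show ?thesis using x wc nN by (subst (asm) AK.finsum_addf) auto
  qed
  have fsm: "?f (r \<odot>\<^bsub>AK\<^esub> x) = r \<odot>\<^bsub>AK\<^esub> ?f x" if x: "x \<in> carrier AK" "r \<in> carrier K" for x r
  proof -
    have "?f (r \<odot>\<^bsub>AK\<^esub> x) = (\<Oplus>\<^bsub>AK\<^esub>s \<in> {..<n}. r \<odot>\<^bsub>AK\<^esub> (cK s x \<odot>\<^bsub>AK\<^esub> w y s))"
      using x wc nN by (intro AK.finsum_cong' refl) (auto simp: semilinear_smult[OF cK_functional] AK.smult_assoc1)
    then show ?thesis using x wc nN by (subst (asm) AK.finsum_smult[symmetric]) auto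
  qed
  have "?f (\<zero>\<^bsub>K\<^esub> \<odot>\<^bsub>AK\<^esub> \<zero>\<^bsub>AK\<^esub>) = \<zero>\<^bsub>K\<^esub> \<odot>\<^bsub>AK\<^esub> ?f \<zero>\<^bsub>AK\<^esub>" by (rule fsm) simp_all
  moreover have "?f \<zero>\<^bsub>AK\<^esub> \<in> carrier AK" using wc c by (intro AK.finsum_closed) auto
  ultimately have fz: "?f \<zero>\<^bsub>AK\<^esub> = \<zero>\<^bsub>AK\<^esub>" by simp
  have "LinearCombinations.submodule K ?M AK"
  proof (rule submodule.intro)
    show "\<zero>\<^bsub>AK\<^esub> \<in> ?M" using fz by simp
    show "x \<oplus>\<^bsub>AK\<^esub> x' \<in> ?M" if "x \<in> ?M" "x' \<in> ?M" for x x' using that fadd[of x x'] by simp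
    show "r \<odot>\<^bsub>AK\<^esub> x \<in> ?M" if "r \<in> carrier K" "x \<in> ?M" for r x using that fsm[of x r] by simp
  qed (use AK.module_axioms in auto)
  moreover have "w y s \<in> ?M" if s: "s < n" for s
  proof -
    have "?f (w y s) = (\<Oplus>\<^bsub>AK\<^esub>s' \<in> {..<n}. if s' = s then w y s' else \<zero>\<^bsub>AK\<^esub>)"
      using wc s y nN by (intro AK.finsum_cong' refl) (auto simp: cK_w chart_coord_def)
    also have "\<dots> = w y s" using wc s by (intro AK.finsum_delta) auto
    finally show ?thesis using wc[OF s] by simp
  qed
  ultimately have "I y \<subseteq> ?M" by (rule I_least)
  then have "x \<in> ?M" using assms by (rule subsetD)
  then show ?thesis by (elim CollectE conjE)
qed

lemma I_eq_zero:
  assumes x: "x \<in> I y" and z: "\<And>s. s < n \<Longrightarrow> cK s x = \<zero>\<^bsub>K\<^esub>" shows "x = \<zero>\<^bsub>AK\<^esub>"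
proof -
  have "(\<Oplus>\<^bsub>AK\<^esub>s \<in> {..<n}. cK s x \<odot>\<^bsub>AK\<^esub> w y s) = \<zero>\<^bsub>AK\<^esub>"
    using z w_closed y by (intro AK.finsum_smult_zero) auto
  then show ?thesis using I_expansion[OF x] by simp
qed

end

end

section \<open>The polarised symmetry condition\<close>

text \<open>The bilinear map \<open>defect\<close> is the polarisation of \<open>g \<mapsto> \<tau>'(\<tau>(g) g) - \<tau>(g) g\<close>. If 2 is invertible,
  it vanishes on a subspace if and only if \<open>\<tau>'\<close> fixes \<open>\<tau>(g) g\<close> for all \<open>g\<close> in the subspace. As it is
  already defined over \<open>F\<close>, its coordinates are given by polynomials with coefficients in \<open>F\<close> in the
  coordinates of its arguments.\<close>

locale symmetry_defect = chart F B K \<iota> b c N n +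
    \<tau>: scalar_extension_hom F B B K \<iota> \<tau> + \<tau>': scalar_extension_hom F B B K \<iota> \<tau>'
  for F :: "'f ring" and B :: "('f, 'b) module" and K :: "'k ring" and \<iota> and b c N n
    and \<tau> \<tau>' :: "'b \<Rightarrow> 'b"
begin

abbreviation \<tau>K where "\<tau>K \<equiv> base_change_map F K \<iota> B B \<tau>"
abbreviation \<tau>'K where "\<tau>'K \<equiv> base_change_map F K \<iota> B B \<tau>'"

definition sym where "sym g h = \<tau>K g \<otimes>\<^bsub>AK\<^esub> h \<oplus>\<^bsub>AK\<^esub> \<tau>K h \<otimes>\<^bsub>AK\<^esub> g"
definition defect where "defect g h = \<tau>'K (sym g h) \<ominus>\<^bsub>AK\<^esub> sym g h"
definition symF where "symF g h = \<tau> g \<otimes>\<^bsub>B\<^esub> h \<oplus>\<^bsub>B\<^esub> \<tau> h \<otimes>\<^bsub>B\<^esub> g"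
definition defectF where "defectF g h = \<tau>' (symF g h) \<ominus>\<^bsub>B\<^esub> symF g h"

lemma base_changes_closed [simp]: "x \<in> carrier AK \<Longrightarrow> \<tau>K x \<in> carrier AK" "x \<in> carrier AK \<Longrightarrow> \<tau>'K x \<in> carrier AK"
  by (rule \<tau>.base_change_map_closed \<tau>'.base_change_map_closed; assumption)+

lemma maps_closed [simp]: "x \<in> carrier B \<Longrightarrow> \<tau> x \<in> carrier B" "x \<in> carrier B \<Longrightarrow> \<tau>' x \<in> carrier B"
  using \<tau>.hom \<tau>'.hom by (auto intro: module_hom_mem)

lemma sym_closed [simp]: "g \<in> carrier AK \<Longrightarrow> h \<in> carrier AK \<Longrightarrow> sym g h \<in> carrier AK"
  by (simp add: sym_def)

lemma defect_closed [simp]: "g \<in> carrier AK \<Longrightarrow> h \<in> carrier AK \<Longrightarrow> defect g h \<in> carrier AK"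
  by (simp add: defect_def)

lemma defectF_closed [simp]: "g \<in> carrier B \<Longrightarrow> h \<in> carrier B \<Longrightarrow> defectF g h \<in> carrier B"
  by (simp add: defectF_def symF_def)

lemma defect_commute: "g \<in> carrier AK \<Longrightarrow> h \<in> carrier AK \<Longrightarrow> defect g h = defect h g"
  by (simp add: defect_def sym_def AK.a_comm)

lemma defect_hom:
  assumes h: "h \<in> carrier AK" shows "(\<lambda>g. defect g h) \<in> module_hom K AK AK"
proof (rule module_homI)
  fix g g' assume g: "g \<in> carrier AK" "g' \<in> carrier AK"
  have "sym (g \<oplus>\<^bsub>AK\<^esub> g') h = sym g h \<oplus>\<^bsub>AK\<^esub> sym g' h"
    using g h by (simp add: sym_def \<tau>.base_change_map_add AK.A.l_distr AK.A.r_distr AK.a_ac)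
  then show "defect (g \<oplus>\<^bsub>AK\<^esub> g') h = defect g h \<oplus>\<^bsub>AK\<^esub> defect g' h"
    using g h by (simp add: defect_def \<tau>'.base_change_map_add AK.M.minus_eq AK.minus_add AK.a_ac)
next
  fix k g assume k: "k \<in> carrier K" and g: "g \<in> carrier AK"
  have "sym (k \<odot>\<^bsub>AK\<^esub> g) h = k \<odot>\<^bsub>AK\<^esub> sym g h"
    using k g h by (simp add: sym_def \<tau>.base_change_map_smult AK.smult_r_distr AK.smult_mult_left AK.smult_mult_right)
  then show "defect (k \<odot>\<^bsub>AK\<^esub> g) h = k \<odot>\<^bsub>AK\<^esub> defect g h"
    using k g h by (simp add: defect_def \<tau>'.base_change_map_smult AK.M.minus_eq AK.smult_r_distr AK.smult_r_minus)
qed (use h in simp)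

lemma defect_incl:
  assumes "g \<in> carrier B" "h \<in> carrier B" shows "defect (incl g) (incl h) = incl (defectF g h)"
proof -
  have s: "symF g h \<in> carrier B" using assms by (simp add: symF_def)
  have "sym (incl g) (incl h) = incl (symF g h)"
    using assms by (simp add: sym_def symF_def \<tau>.base_change_map_incl incl_add incl_mult)
  moreover have "incl (x \<ominus>\<^bsub>B\<^esub> y) = incl x \<ominus>\<^bsub>AK\<^esub> incl y" if "x \<in> carrier B" "y \<in> carrier B" for x y
  proof -
    have "incl (x \<ominus>\<^bsub>B\<^esub> y) \<oplus>\<^bsub>AK\<^esub> incl y = incl x"
      using that incl_add[of "x \<ominus>\<^bsub>B\<^esub> y" y] by (simp add: A.M.minus_eq A.M.a_assoc A.M.l_neg)
    then have "incl x \<ominus>\<^bsub>AK\<^esub> incl y = incl (x \<ominus>\<^bsub>B\<^esub> y) \<oplus>\<^bsub>AK\<^esub> incl y \<ominus>\<^bsub>AK\<^esub> incl y" by simp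
    then show ?thesis using that by (simp add: AK.M.minus_eq AK.M.a_assoc AK.M.r_neg)
  qed
  ultimately show ?thesis
    using s by (simp add: defect_def defectF_def \<tau>'.base_change_map_incl)
qed

lemma defect_coordinates:
  assumes g: "g \<in> carrier AK" and h: "h \<in> carrier AK" and k: "k < N"
  shows "cK k (defect g h) = (\<Oplus>\<^bsub>K\<^esub>i \<in> {..<N}. cK i g \<otimes>\<^bsub>K\<^esub> (\<Oplus>\<^bsub>K\<^esub>j \<in> {..<N}. cK j h \<otimes>\<^bsub>K\<^esub> \<iota> (c k (defectF (b i) (b j)))))"
proof -
  have lin: "(\<lambda>g. cK k (defect g h)) \<in> functionals K AK" if "h \<in> carrier AK" for h
    by (rule semilinear_comp[OF cK_functional[OF k] defect_hom[OF that]])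
  have expand: "cK k (defect g h) = (\<Oplus>\<^bsub>K\<^esub>i \<in> {..<N}. cK i g \<otimes>\<^bsub>K\<^esub> cK k (defect (b' i) h))"
    if "g \<in> carrier AK" "h \<in> carrier AK" for g h
  proof -
    have "cK k (defect (\<Oplus>\<^bsub>AK\<^esub>i \<in> {..<N}. cK i g \<odot>\<^bsub>AK\<^esub> b' i) h) = (\<Oplus>\<^bsub>K\<^esub>i \<in> {..<N}. cK i g \<otimes>\<^bsub>K\<^esub> cK k (defect (b' i) h))"
      using that by (intro functional_lincomb[OF AK.module_axioms lin]) auto
    then show ?thesis using csKD(5)[OF that(1)] by simp
  qed
  have "cK k (defect g h) = (\<Oplus>\<^bsub>K\<^esub>i \<in> {..<N}. cK i g \<otimes>\<^bsub>K\<^esub> cK k (defect (b' i) h))" by (rule expand[OF g h])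
  also have "\<dots> = (\<Oplus>\<^bsub>K\<^esub>i \<in> {..<N}. cK i g \<otimes>\<^bsub>K\<^esub> (\<Oplus>\<^bsub>K\<^esub>j \<in> {..<N}. cK j h \<otimes>\<^bsub>K\<^esub> \<iota> (c k (defectF (b i) (b j)))))"
  proof (intro K.finsum_cong' refl)
    have dF: "defectF (b i) (b j) \<in> carrier B" if "i < N" "j < N" for i j
      using b_closed that by simp
    have cc: "\<iota> (c k (defectF (b i) (b j))) \<in> carrier K" if "i < N" "j < N" for i j
      using semilinear_closed[OF dual_c[OF k] dF[OF that]] .
    show "(\<lambda>i. cK i g \<otimes>\<^bsub>K\<^esub> (\<Oplus>\<^bsub>K\<^esub>j \<in> {..<N}. cK j h \<otimes>\<^bsub>K\<^esub> \<iota> (c k (defectF (b i) (b j))))) \<in> {..<N} \<rightarrow> carrier K"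
      using g h cc by (intro Pi_I K.m_closed K.finsum_closed) auto
    fix i assume i: "i \<in> {..<N}"
    have "cK k (defect (b' i) h) = cK k (defect h (b' i))" using i h by (simp add: defect_commute)
    also have "\<dots> = (\<Oplus>\<^bsub>K\<^esub>j \<in> {..<N}. cK j h \<otimes>\<^bsub>K\<^esub> cK k (defect (b' j) (b' i)))"
      using i h by (intro expand) auto
    also have "\<dots> = (\<Oplus>\<^bsub>K\<^esub>j \<in> {..<N}. cK j h \<otimes>\<^bsub>K\<^esub> \<iota> (c k (defectF (b i) (b j))))"
    proof (intro K.finsum_cong' refl)
      show "(\<lambda>j. cK j h \<otimes>\<^bsub>K\<^esub> \<iota> (c k (defectF (b i) (b j)))) \<in> {..<N} \<rightarrow> carrier K" using i h cc by auto
      fix j assume j: "j \<in> {..<N}"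
      have "defect (b' j) (b' i) = incl (defectF (b i) (b j))"
        using i j defect_commute[of "b' j" "b' i"] defect_incl[of "b i" "b j"] b_closed by (simp add: b'_def)
      then show "cK j h \<otimes>\<^bsub>K\<^esub> cK k (defect (b' j) (b' i)) = cK j h \<otimes>\<^bsub>K\<^esub> \<iota> (c k (defectF (b i) (b j)))"
        using i j k dF by (simp add: cK_incl)
    qed
    finally show "cK i g \<otimes>\<^bsub>K\<^esub> cK k (defect (b' i) h) = cK i g \<otimes>\<^bsub>K\<^esub> (\<Oplus>\<^bsub>K\<^esub>j \<in> {..<N}. cK j h \<otimes>\<^bsub>K\<^esub> \<iota> (c k (defectF (b i) (b j))))"
      by simp
  qed
  finally show ?thesis .
qed

lemma defect_w_coordinates:
  assumes y: "\<And>s t. s < n \<Longrightarrow> n \<le> t \<Longrightarrow> t < N \<Longrightarrow> y (s, t) \<in> carrier K"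
    and s: "s < n" "s' < n" and k: "k < N"
  shows "cK k (defect (w y s) (w y s')) = (\<Oplus>\<^bsub>K\<^esub>i \<in> {..<N}. chart_coord K n y s i \<otimes>\<^bsub>K\<^esub>
    (\<Oplus>\<^bsub>K\<^esub>j \<in> {..<N}. chart_coord K n y s' j \<otimes>\<^bsub>K\<^esub> \<iota> (c k (defectF (b i) (b j)))))"
proof -
  have wc: "w y s \<in> carrier AK" if "s < n" for s using w_closed[of s y] y that by blast
  have cw: "cK i (w y s) = chart_coord K n y s i" if "s < n" "i < N" for s i using cK_w[of s i y] y that by blast
  have cc: "chart_coord K n y s i \<in> carrier K" if "s < n" "i < N" for s i using y that by (auto simp: chart_coord_def)
  have dc: "\<iota> (c k (defectF (b i) (b j))) \<in> carrier K" if "i < N" "j < N" for i j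
    using b_closed that by (intro semilinear_closed[OF dual_c[OF k]]) simp
  show ?thesis
    unfolding defect_coordinates[OF wc[OF s(1)] wc[OF s(2)] k]
  proof (intro K.finsum_cong' refl)
    show "(\<lambda>i. chart_coord K n y s i \<otimes>\<^bsub>K\<^esub> (\<Oplus>\<^bsub>K\<^esub>j \<in> {..<N}. chart_coord K n y s' j \<otimes>\<^bsub>K\<^esub> \<iota> (c k (defectF (b i) (b j)))))
        \<in> {..<N} \<rightarrow> carrier K"
      using cc dc s by (intro Pi_I K.m_closed K.finsum_closed) auto
    fix i assume i: "i \<in> {..<N}"
    have "(\<Oplus>\<^bsub>K\<^esub>j \<in> {..<N}. cK j (w y s') \<otimes>\<^bsub>K\<^esub> \<iota> (c k (defectF (b i) (b j))))
        = (\<Oplus>\<^bsub>K\<^esub>j \<in> {..<N}. chart_coord K n y s' j \<otimes>\<^bsub>K\<^esub> \<iota> (c k (defectF (b i) (b j))))"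
      using i s cc dc by (intro K.finsum_cong' refl) (auto simp: cw)
    then show "cK i (w y s) \<otimes>\<^bsub>K\<^esub> (\<Oplus>\<^bsub>K\<^esub>j \<in> {..<N}. cK j (w y s') \<otimes>\<^bsub>K\<^esub> \<iota> (c k (defectF (b i) (b j))))
        = chart_coord K n y s i \<otimes>\<^bsub>K\<^esub> (\<Oplus>\<^bsub>K\<^esub>j \<in> {..<N}. chart_coord K n y s' j \<otimes>\<^bsub>K\<^esub> \<iota> (c k (defectF (b i) (b j))))"
      using i s by (simp add: cw)
  qed
qed

lemma defect_span:
  assumes y: "\<And>s t. s < n \<Longrightarrow> n \<le> t \<Longrightarrow> t < N \<Longrightarrow> y (s, t) \<in> carrier K"
    and zero: "\<And>s s'. s < n \<Longrightarrow> s' < n \<Longrightarrow> defect (w y s) (w y s') = \<zero>\<^bsub>AK\<^esub>"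
    and g: "g \<in> I y" and h: "h \<in> I y"
  shows "defect g h = \<zero>\<^bsub>AK\<^esub>"
proof -
  have ker: "LinearCombinations.submodule K {g \<in> carrier AK. defect g h = \<zero>\<^bsub>AK\<^esub>} AK" if h: "h \<in> carrier AK" for h
  proof -
    interpret D: mod_hom K AK AK "\<lambda>g. defect g h"
      by unfold_locales (rule defect_hom[OF h])
    show ?thesis using D.ker_is_submodule by (simp add: D.ker_def)
  qed
  have wc: "w y s \<in> carrier AK" if "s < n" for s using w_closed y that by blast
  note least = I_least[of y, OF y] and sub = I_subset[of y, OF y]
  have 1: "defect g (w y s') = \<zero>\<^bsub>AK\<^esub>" if g: "g \<in> I y" and s': "s' < n" for g s'
  proof -
    have "I y \<subseteq> {g \<in> carrier AK. defect g (w y s') = \<zero>\<^bsub>AK\<^esub>}"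
      by (rule least[OF _ _ _ ker[OF wc[OF s']]]) (use zero s' wc in simp_all)
    then show ?thesis using g by blast
  qed
  have "I y \<subseteq> {h' \<in> carrier AK. defect h' g = \<zero>\<^bsub>AK\<^esub>}"
    by (rule least[OF _ _ _ ker[OF sub[OF _ _ _ g]]])
      (use 1[OF g] wc sub[OF _ _ _ g] defect_commute in auto)
  then have "defect h g = \<zero>\<^bsub>AK\<^esub>" using h by blast
  then show ?thesis using defect_commute[of g h] sub g h by simp
qed

lemma fixed_imp_defect_zero:
  assumes fixed: "\<And>g. g \<in> M \<Longrightarrow> \<tau>'K (\<tau>K g \<otimes>\<^bsub>AK\<^esub> g) = \<tau>K g \<otimes>\<^bsub>AK\<^esub> g"
    and M: "LinearCombinations.submodule K M AK" and g: "g \<in> M" and h: "h \<in> M"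
  shows "defect g h = \<zero>\<^bsub>AK\<^esub>"
proof -
  have gh: "g \<oplus>\<^bsub>AK\<^esub> h \<in> M" and gc: "g \<in> carrier AK" and hc: "h \<in> carrier AK"
    using M g h by (auto simp: submodule_def)
  let ?a = "\<tau>K g \<otimes>\<^bsub>AK\<^esub> g" and ?b = "\<tau>K h \<otimes>\<^bsub>AK\<^esub> h"
  have ab: "?a \<in> carrier AK" "?b \<in> carrier AK" using gc hc by auto
  have e: "\<tau>K (g \<oplus>\<^bsub>AK\<^esub> h) \<otimes>\<^bsub>AK\<^esub> (g \<oplus>\<^bsub>AK\<^esub> h) = sym g h \<oplus>\<^bsub>AK\<^esub> (?a \<oplus>\<^bsub>AK\<^esub> ?b)"
    using gc hc by (simp add: sym_def \<tau>.base_change_map_add AK.A.l_distr AK.A.r_distr AK.a_ac)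
  have "\<tau>'K (sym g h) \<oplus>\<^bsub>AK\<^esub> (?a \<oplus>\<^bsub>AK\<^esub> ?b) = sym g h \<oplus>\<^bsub>AK\<^esub> (?a \<oplus>\<^bsub>AK\<^esub> ?b)"
    using fixed[OF gh] fixed[OF g] fixed[OF h] ab gc hc unfolding e
    by (simp add: \<tau>'.base_change_map_add)
  then have "\<tau>'K (sym g h) = sym g h" using gc hc ab by (simp add: AK.M.add.right_cancel)
  then show ?thesis unfolding defect_def using gc hc by (simp add: AK.M.minus_eq AK.M.r_neg)
qed

lemma defect_zero_imp_fixed:
  assumes char: "\<one>\<^bsub>K\<^esub> \<oplus>\<^bsub>K\<^esub> \<one>\<^bsub>K\<^esub> \<noteq> \<zero>\<^bsub>K\<^esub>" and g: "g \<in> carrier AK" and z: "defect g g = \<zero>\<^bsub>AK\<^esub>"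
  shows "\<tau>'K (\<tau>K g \<otimes>\<^bsub>AK\<^esub> g) = \<tau>K g \<otimes>\<^bsub>AK\<^esub> g"
proof -
  let ?a = "\<tau>K g \<otimes>\<^bsub>AK\<^esub> g" and ?two = "\<one>\<^bsub>K\<^esub> \<oplus>\<^bsub>K\<^esub> \<one>\<^bsub>K\<^esub>"
  have a: "?a \<in> carrier AK" using g by simp
  have s: "sym g g = ?two \<odot>\<^bsub>AK\<^esub> ?a" using a by (simp add: sym_def AK.smult_l_distr)
  have "\<tau>'K (sym g g) = sym g g" using z g unfolding defect_def by (simp add: AK.A.r_right_minus_eq)
  then have "?two \<odot>\<^bsub>AK\<^esub> \<tau>'K ?a = ?two \<odot>\<^bsub>AK\<^esub> ?a" unfolding s using a by (simp add: \<tau>'.base_change_map_smult)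
  then have "inv\<^bsub>K\<^esub> ?two \<odot>\<^bsub>AK\<^esub> (?two \<odot>\<^bsub>AK\<^esub> \<tau>'K ?a) = inv\<^bsub>K\<^esub> ?two \<odot>\<^bsub>AK\<^esub> (?two \<odot>\<^bsub>AK\<^esub> ?a)" by simp
  moreover have "inv\<^bsub>K\<^esub> ?two \<in> carrier K" "inv\<^bsub>K\<^esub> ?two \<otimes>\<^bsub>K\<^esub> ?two = \<one>\<^bsub>K\<^esub>" using char K.field_Units by auto
  ultimately show ?thesis using a by (simp add: AK.smult_assoc1[symmetric])
qed

end

section \<open>Anisotropic right ideals in a chart\<close>

lemma alg_degree_eq: "vectorspace.dim F A = m\<^sup>2 \<Longrightarrow> alg_degree F A = m"
  unfolding alg_degree_def by (rule the_equality) (auto simp: power2_eq_iff_nonneg)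

lemma field_hom_eq_zero:
  assumes "field F" "field K" and \<iota>: "\<iota> \<in> ring_hom F K" and a: "a \<in> carrier F" "\<iota> a = \<zero>\<^bsub>K\<^esub>"
  shows "a = \<zero>\<^bsub>F\<^esub>"
proof -
  interpret F: field F by fact
  interpret K: field K by fact
  have "inj_on \<iota> (carrier F)" using non_trivial_field_hom_is_inj[OF \<iota> assms(1,2)] .
  moreover have "\<iota> a = \<iota> \<zero>\<^bsub>F\<^esub>" using a(2) ring_hom_zero[OF \<iota> F.ring_axioms K.ring_axioms] by simp
  ultimately show ?thesis using a(1) by (auto dest: inj_onD)
qed

lemma ring_hom_two_nonzero:
  assumes "field F" "field K" and \<iota>: "\<iota> \<in> ring_hom F K" and two: "\<one>\<^bsub>F\<^esub> \<oplus>\<^bsub>F\<^esub> \<one>\<^bsub>F\<^esub> \<noteq> \<zero>\<^bsub>F\<^esub>"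
  shows "\<one>\<^bsub>K\<^esub> \<oplus>\<^bsub>K\<^esub> \<one>\<^bsub>K\<^esub> \<noteq> \<zero>\<^bsub>K\<^esub>"
proof
  interpret F: field F by fact
  assume "\<one>\<^bsub>K\<^esub> \<oplus>\<^bsub>K\<^esub> \<one>\<^bsub>K\<^esub> = \<zero>\<^bsub>K\<^esub>"
  then have "\<iota> (\<one>\<^bsub>F\<^esub> \<oplus>\<^bsub>F\<^esub> \<one>\<^bsub>F\<^esub>) = \<zero>\<^bsub>K\<^esub>" using ring_hom_add[OF \<iota>] ring_hom_one[OF \<iota>] by simp
  then show False using field_hom_eq_zero[OF assms(1,2) \<iota>] two by simp
qed

text \<open>The variables are the chart coordinates. Coordinates of bilinear expressions in the spanning vectors
  of a subspace in the chart are polynomial in them.\<close>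

locale chart_polynomial_transfer = polynomial_transfer F K L \<iota> j "{..<n} \<times> {n..<N}" x Y
  for F :: "'f ring" and K :: "'k ring" and L :: "'l ring" and \<iota> j and n N :: nat and x Y
begin

lemma polynomial_pair_chart_coord:
  assumes "polynomial_pair f g" and "s < n" "i < N"
  shows "polynomial_pair (chart_coord K n x s i \<otimes>\<^bsub>K\<^esub> f) (\<lambda>y. chart_coord L n y s i \<otimes>\<^bsub>L\<^esub> g y)"
proof (cases "i < n")
  case True
  note cl = polynomial_pair_closed[OF assms(1)]
  show ?thesis
  proof (cases "i = s")
    case True
    show ?thesis
      by (rule polynomial_pair_cong[OF assms(1)]) (use True \<open>i < n\<close> cl in \<open>simp_all add: chart_coord_def\<close>)
  next
    case False
    show ?thesis
      by (rule polynomial_pair_cong[OF polynomial_pair_zero]) (use False \<open>i < n\<close> cl in \<open>simp_all add: chart_coord_def\<close>)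
  qed
next
  case False
  then have v: "(s, i) \<in> {..<n} \<times> {n..<N}" using assms by simp
  note cl = polynomial_pair_closed[OF assms(1)]
  show ?thesis
    by (rule polynomial_pair_cong[OF polynomial_pair_mult_var[OF assms(1) v]])
      (use False cl x[OF v] Y[OF _ v] in \<open>simp_all add: chart_coord_def K.m_comm L.m_comm\<close>)
qed

lemma polynomial_pair_bilinear:
  assumes s: "s < n" "s' < n"
    and d: "\<And>i k. i < N \<Longrightarrow> k < N \<Longrightarrow> d i k \<in> carrier F"
  shows "polynomial_pair
    (\<Oplus>\<^bsub>K\<^esub>i \<in> {..<N}. chart_coord K n x s i \<otimes>\<^bsub>K\<^esub> (\<Oplus>\<^bsub>K\<^esub>k \<in> {..<N}. chart_coord K n x s' k \<otimes>\<^bsub>K\<^esub> \<iota> (d i k)))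
    (\<lambda>y. \<Oplus>\<^bsub>L\<^esub>i \<in> {..<N}. chart_coord L n y s i \<otimes>\<^bsub>L\<^esub> (\<Oplus>\<^bsub>L\<^esub>k \<in> {..<N}. chart_coord L n y s' k \<otimes>\<^bsub>L\<^esub> j (d i k)))"
proof (rule polynomial_pair_sum)
  fix i assume i: "i \<in> {..<N}"
  show "polynomial_pair (chart_coord K n x s i \<otimes>\<^bsub>K\<^esub> (\<Oplus>\<^bsub>K\<^esub>k \<in> {..<N}. chart_coord K n x s' k \<otimes>\<^bsub>K\<^esub> \<iota> (d i k)))
    (\<lambda>y. chart_coord L n y s i \<otimes>\<^bsub>L\<^esub> (\<Oplus>\<^bsub>L\<^esub>k \<in> {..<N}. chart_coord L n y s' k \<otimes>\<^bsub>L\<^esub> j (d i k)))"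
  proof (rule polynomial_pair_chart_coord[OF _ s(1)])
    show "polynomial_pair (\<Oplus>\<^bsub>K\<^esub>k \<in> {..<N}. chart_coord K n x s' k \<otimes>\<^bsub>K\<^esub> \<iota> (d i k))
        (\<lambda>y. \<Oplus>\<^bsub>L\<^esub>k \<in> {..<N}. chart_coord L n y s' k \<otimes>\<^bsub>L\<^esub> j (d i k))"
    proof (rule polynomial_pair_sum)
      fix k assume k: "k \<in> {..<N}"
      show "polynomial_pair (chart_coord K n x s' k \<otimes>\<^bsub>K\<^esub> \<iota> (d i k)) (\<lambda>y. chart_coord L n y s' k \<otimes>\<^bsub>L\<^esub> j (d i k))"
        by (rule polynomial_pair_chart_coord[OF polynomial_pair_const s(2)]) (use d i k in auto)
    qed simp
  qed (use i in simp)
qed simp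

end

lemma (in chart) chart_subspace_I:
  assumes "n = alg_degree F B" "N = vectorspace.dim F B"
  shows "chart_subspace F B b K \<iota> y = I y"
  unfolding chart_subspace_def Let_def assms[symmetric] I_def w_def b'_def ..

text \<open>A nonzero column \<open>v0\<close> in the right ideal of the given point is perturbed to an anisotropic column \<open>v\<close>
  for which the first \<open>n\<close> coordinates still separate the elements \<open>v x\<close>. Then the right ideal
  consisting of these elements has a basis in echelon form, and so it belongs to the chart.\<close>

lemma (in chart) exists_anisotropic_chart_point:
  assumes n: "n = alg_degree F B" "0 < n" and N: "N = vectorspace.dim F B" "N = n\<^sup>2"
    and split: "split_involution K AK E G H t"
    and eps: "\<forall>i < n. \<epsilon> i \<in> carrier AK \<and> E \<otimes>\<^bsub>AK\<^esub> \<epsilon> i = \<epsilon> i"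
    and indep: "\<forall>a. (\<forall>i < n. a i \<in> carrier K) \<longrightarrow> (\<Oplus>\<^bsub>AK\<^esub>i \<in> {..<n}. a i \<odot>\<^bsub>AK\<^esub> \<epsilon> i) = \<zero>\<^bsub>AK\<^esub> \<longrightarrow> (\<forall>i < n. a i = \<zero>\<^bsub>K\<^esub>)"
    and inf: "infinite (carrier K)"
    and y0: "y0 \<in> chart_points F B b K \<iota>"
  shows "\<exists>y \<in> chart_points F B b K \<iota>. \<exists>v \<in> carrier AK. v \<otimes>\<^bsub>AK\<^esub> E = v \<and>
    (\<exists>\<beta> \<in> carrier K. \<beta> \<noteq> \<zero>\<^bsub>K\<^esub> \<and> t v \<otimes>\<^bsub>AK\<^esub> G \<otimes>\<^bsub>AK\<^esub> v = \<beta> \<odot>\<^bsub>AK\<^esub> E) \<and> (\<forall>x \<in> carrier AK. v \<otimes>\<^bsub>AK\<^esub> x \<in> I y)"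
proof -
  interpret S: split_involution K AK E G H t by (rule split)
  note nN = nN and cs_I = chart_subspace_I[OF n(1) N(1)]
  have idx: "chart_index F B = {..<n} \<times> {n..<N}" by (simp add: chart_index_def n(1) N(1))
  have y0c: "y0 (s, t') \<in> carrier K" if "s < n" "n \<le> t'" "t' < N" for s t'
    using y0 that unfolding chart_points_def idx by auto
  have ri: "right_ideal (I y0) AK"
    using y0 by (simp add: chart_points_def brauer_severi_points_def cs_I)
  have I0_mult: "x \<otimes>\<^bsub>AK\<^esub> a \<in> I y0" if "x \<in> I y0" "a \<in> carrier AK" for x a
    using ri that by (auto simp: right_ideal_def)
  (* w y0 0 is a nonzero element of the given right ideal; some multiple of it is a nonzero column *)
  have w0: "w y0 0 \<in> I y0" "w y0 0 \<in> carrier AK"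
    using w_in_I[of y0, OF y0c n(2)] w_closed[of 0 y0] y0c n(2) by auto
  have "w y0 0 \<noteq> \<zero>\<^bsub>AK\<^esub>"
  proof
    assume "w y0 0 = \<zero>\<^bsub>AK\<^esub>"
    moreover have "cK 0 (w y0 0) = \<one>\<^bsub>K\<^esub>" using cK_w[of 0 0 y0] y0c n(2) nN by (simp add: chart_coord_def)
    moreover have "cK 0 \<zero>\<^bsub>AK\<^esub> = \<zero>\<^bsub>K\<^esub>"
      using semilinear_smult[OF cK_functional, of 0 "\<zero>\<^bsub>K\<^esub>" "\<zero>\<^bsub>AK\<^esub>"] n(2) nN by simp
    ultimately show False by simp
  qed
  then obtain a where a: "a \<in> carrier AK" "w y0 0 \<otimes>\<^bsub>AK\<^esub> a \<otimes>\<^bsub>AK\<^esub> E \<noteq> \<zero>\<^bsub>AK\<^esub>"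
    using S.faithful w0(2) by blast
  define v0 where "v0 = w y0 0 \<otimes>\<^bsub>AK\<^esub> a \<otimes>\<^bsub>AK\<^esub> E"
  have v0: "v0 \<in> carrier AK" "v0 \<otimes>\<^bsub>AK\<^esub> E = v0" "v0 \<noteq> \<zero>\<^bsub>AK\<^esub>" "v0 \<in> I y0"
    using w0 a S.E I0_mult by (simp_all add: v0_def AK.A.m_assoc)
  have "\<exists>v \<in> carrier AK. v \<otimes>\<^bsub>AK\<^esub> E = v \<and> (\<exists>\<beta> \<in> carrier K. \<beta> \<noteq> \<zero>\<^bsub>K\<^esub> \<and> t v \<otimes>\<^bsub>AK\<^esub> G \<otimes>\<^bsub>AK\<^esub> v = \<beta> \<odot>\<^bsub>AK\<^esub> E) \<and>
    (\<forall>y \<in> carrier AK. E \<otimes>\<^bsub>AK\<^esub> y = y \<longrightarrow> (\<forall>s < n. cK s (v \<otimes>\<^bsub>AK\<^esub> y) = \<zero>\<^bsub>K\<^esub>) \<longrightarrow> y = \<zero>\<^bsub>AK\<^esub>)"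
  proof (rule S.perturbation_to_anisotropic[OF inf v0(1-3)])
    show "cK s \<in> functionals K AK" if "s < n" for s using that nN by (intro cK_functional) simp
    show "v0 \<otimes>\<^bsub>AK\<^esub> x = \<zero>\<^bsub>AK\<^esub>" if x: "x \<in> carrier AK" "\<And>s. s < n \<Longrightarrow> cK s (v0 \<otimes>\<^bsub>AK\<^esub> x) = \<zero>\<^bsub>K\<^esub>" for x
      by (rule I_eq_zero[of y0, OF y0c I0_mult[OF v0(4) x(1)] x(2)])
  qed
  then obtain v where v: "v \<in> carrier AK"
    and v': "v \<otimes>\<^bsub>AK\<^esub> E = v \<and> (\<exists>\<beta> \<in> carrier K. \<beta> \<noteq> \<zero>\<^bsub>K\<^esub> \<and> t v \<otimes>\<^bsub>AK\<^esub> G \<otimes>\<^bsub>AK\<^esub> v = \<beta> \<odot>\<^bsub>AK\<^esub> E) \<and>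
      (\<forall>y \<in> carrier AK. E \<otimes>\<^bsub>AK\<^esub> y = y \<longrightarrow> (\<forall>s < n. cK s (v \<otimes>\<^bsub>AK\<^esub> y) = \<zero>\<^bsub>K\<^esub>) \<longrightarrow> y = \<zero>\<^bsub>AK\<^esub>)"
    by (rule bexE)
  note vE = v'[THEN conjunct1] and beta = v'[THEN conjunct2, THEN conjunct1]
  note inj = v'[THEN conjunct2, THEN conjunct2, rule_format]
  note v = v vE
  define M where "M = {v \<otimes>\<^bsub>AK\<^esub> x | x. x \<in> carrier AK}"
  have M_mem: "v \<otimes>\<^bsub>AK\<^esub> x \<in> M" if "x \<in> carrier AK" for x using that by (auto simp: M_def)
  have M_sub: "M \<subseteq> carrier AK" using v by (auto simp: M_def)
  have M: "LinearCombinations.submodule K M AK"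
  proof (rule submodule.intro)
    show "x \<oplus>\<^bsub>AK\<^esub> y \<in> M" if xy: "x \<in> M" "y \<in> M" for x y
    proof -
      obtain x' y' where "x' \<in> carrier AK" "y' \<in> carrier AK" "x = v \<otimes>\<^bsub>AK\<^esub> x'" "y = v \<otimes>\<^bsub>AK\<^esub> y'" using xy by (auto simp: M_def)
      then show ?thesis using M_mem[of "x' \<oplus>\<^bsub>AK\<^esub> y'"] v by (simp add: AK.A.r_distr)
    qed
    show "r \<odot>\<^bsub>AK\<^esub> x \<in> M" if r: "r \<in> carrier K" and x: "x \<in> M" for r x
    proof -
      obtain x' where "x' \<in> carrier AK" "x = v \<otimes>\<^bsub>AK\<^esub> x'" using x by (auto simp: M_def)
      then show ?thesis using M_mem[of "r \<odot>\<^bsub>AK\<^esub> x'"] v r by (simp add: AK.smult_mult_right)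
    qed
    show "\<zero>\<^bsub>AK\<^esub> \<in> M" using M_mem[of "\<zero>\<^bsub>AK\<^esub>"] v by simp
  qed (use AK.module_axioms M_sub in auto)
  have M_inj: "x = \<zero>\<^bsub>AK\<^esub>" if x: "x \<in> M" and z: "\<And>s. s < n \<Longrightarrow> cK s x = \<zero>\<^bsub>K\<^esub>" for x
  proof -
    obtain x' where x': "x' \<in> carrier AK" "x = v \<otimes>\<^bsub>AK\<^esub> x'" using x by (auto simp: M_def)
    have e: "v \<otimes>\<^bsub>AK\<^esub> (E \<otimes>\<^bsub>AK\<^esub> x') = x" using x' v S.E by (simp add: AK.A.m_assoc[symmetric])
    have "E \<otimes>\<^bsub>AK\<^esub> (E \<otimes>\<^bsub>AK\<^esub> x') = E \<otimes>\<^bsub>AK\<^esub> x'" using x' S.E by (simp add: AK.A.m_assoc[symmetric])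
    then have "E \<otimes>\<^bsub>AK\<^esub> x' = \<zero>\<^bsub>AK\<^esub>" using z x' S.E by (intro inj) (simp_all add: e)
    then show ?thesis using e v by simp
  qed
  (* M has a basis in echelon form, because the rows \<epsilon> i give n independent elements v \<epsilon> i *)
  have "\<exists>z. z \<in> M \<and> (\<forall>k < n. cK k z = (if s = k then \<one>\<^bsub>K\<^esub> else \<zero>\<^bsub>K\<^esub>))" if s: "s < n" for s
  proof -
    have sum: "(\<Oplus>\<^bsub>AK\<^esub>i \<in> {..<n}. a i \<odot>\<^bsub>AK\<^esub> (v \<otimes>\<^bsub>AK\<^esub> \<epsilon> i)) = v \<otimes>\<^bsub>AK\<^esub> (\<Oplus>\<^bsub>AK\<^esub>i \<in> {..<n}. a i \<odot>\<^bsub>AK\<^esub> \<epsilon> i)"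
      if a: "\<And>i. i < n \<Longrightarrow> a i \<in> carrier K" for a
    proof -
      have "v \<otimes>\<^bsub>AK\<^esub> (\<Oplus>\<^bsub>AK\<^esub>i \<in> {..<n}. a i \<odot>\<^bsub>AK\<^esub> \<epsilon> i) = (\<Oplus>\<^bsub>AK\<^esub>i \<in> {..<n}. v \<otimes>\<^bsub>AK\<^esub> (a i \<odot>\<^bsub>AK\<^esub> \<epsilon> i))"
        using a v eps by (intro AK.A.finsum_rdistr) auto
      also have "\<dots> = (\<Oplus>\<^bsub>AK\<^esub>i \<in> {..<n}. a i \<odot>\<^bsub>AK\<^esub> (v \<otimes>\<^bsub>AK\<^esub> \<epsilon> i))"
        using a v eps by (intro AK.finsum_cong' refl) (auto simp: AK.smult_mult_right)
      finally show ?thesis by simp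
    qed
    have "\<exists>a. (\<forall>i < n. a i \<in> carrier K) \<and>
        (\<forall>k < n. cK k (\<Oplus>\<^bsub>AK\<^esub>i \<in> {..<n}. a i \<odot>\<^bsub>AK\<^esub> (v \<otimes>\<^bsub>AK\<^esub> \<epsilon> i)) = (if s = k then \<one>\<^bsub>K\<^esub> else \<zero>\<^bsub>K\<^esub>))"
    proof (rule functionals_surjective[OF K.field_axioms AK.module_axioms])
      fix a :: "nat \<Rightarrow> 'k"
      assume a: "\<And>i. i < n \<Longrightarrow> a i \<in> carrier K"
        and z: "\<And>k. k < n \<Longrightarrow> cK k (\<Oplus>\<^bsub>AK\<^esub>i \<in> {..<n}. a i \<odot>\<^bsub>AK\<^esub> (v \<otimes>\<^bsub>AK\<^esub> \<epsilon> i)) = \<zero>\<^bsub>K\<^esub>"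
      let ?y = "\<Oplus>\<^bsub>AK\<^esub>i \<in> {..<n}. a i \<odot>\<^bsub>AK\<^esub> \<epsilon> i"
      have y: "?y \<in> carrier AK" using a eps by (intro AK.finsum_closed) auto
      have "E \<otimes>\<^bsub>AK\<^esub> ?y = (\<Oplus>\<^bsub>AK\<^esub>i \<in> {..<n}. E \<otimes>\<^bsub>AK\<^esub> (a i \<odot>\<^bsub>AK\<^esub> \<epsilon> i))"
        using a S.E eps by (intro AK.A.finsum_rdistr) auto
      also have "\<dots> = ?y" using a S.E eps by (intro AK.finsum_cong' refl) (auto simp: AK.smult_mult_right)
      finally have "?y = \<zero>\<^bsub>AK\<^esub>" using y z sum[OF a] by (intro inj) simp_all
      then show "\<forall>i < n. a i = \<zero>\<^bsub>K\<^esub>" using indep a by blast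
    qed (use v eps nN cK_functional in auto)
    then obtain a where a: "\<forall>i < n. a i \<in> carrier K"
      and val: "\<forall>k < n. cK k (\<Oplus>\<^bsub>AK\<^esub>i \<in> {..<n}. a i \<odot>\<^bsub>AK\<^esub> (v \<otimes>\<^bsub>AK\<^esub> \<epsilon> i)) = (if s = k then \<one>\<^bsub>K\<^esub> else \<zero>\<^bsub>K\<^esub>)"
      by (elim exE conjE)
    have "(\<Oplus>\<^bsub>AK\<^esub>i \<in> {..<n}. a i \<odot>\<^bsub>AK\<^esub> \<epsilon> i) \<in> carrier AK" using a eps by (intro AK.finsum_closed) auto
    then have "(\<Oplus>\<^bsub>AK\<^esub>i \<in> {..<n}. a i \<odot>\<^bsub>AK\<^esub> (v \<otimes>\<^bsub>AK\<^esub> \<epsilon> i)) \<in> M" using sum[of a] a M_mem by simp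
    then show ?thesis using val by (intro exI conjI)
  qed
  then have "\<forall>s. \<exists>z. s < n \<longrightarrow> z \<in> M \<and> (\<forall>k < n. cK k z = (if s = k then \<one>\<^bsub>K\<^esub> else \<zero>\<^bsub>K\<^esub>))" by blast
  then obtain z where "\<forall>s. s < n \<longrightarrow> z s \<in> M \<and> (\<forall>k < n. cK k (z s) = (if s = k then \<one>\<^bsub>K\<^esub> else \<zero>\<^bsub>K\<^esub>))"
    by (rule choice[THEN exE])
  then have zM: "z s \<in> M" and zc: "k < n \<Longrightarrow> cK k (z s) = (if s = k then \<one>\<^bsub>K\<^esub> else \<zero>\<^bsub>K\<^esub>)" if "s < n" for s k
    using that by auto
  have zA: "z s \<in> carrier AK" if "s < n" for s using zM[OF that] M_sub by blast
  (* the chart coordinates of M are the remaining coordinates of the echelon basis *)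
  define y where "y = restrict (\<lambda>(s, k). cK k (z s)) ({..<n} \<times> {n..<N})"
  have yc: "y (s, k) \<in> carrier K" if "s < n" "n \<le> k" "k < N" for s k using that zA by (simp add: y_def)
  have wz: "w y s = z s" if s: "s < n" for s
  proof (rule coord_eqI)
    show "w y s \<in> carrier AK" using w_closed[of s y] yc s by blast
    fix k assume k: "k < N"
    have "cK k (w y s) = chart_coord K n y s k" using cK_w[of s k y] yc s k by blast
    also have "\<dots> = cK k (z s)" using zc[OF s, of k] s k by (auto simp: chart_coord_def y_def)
    finally show "cK k (w y s) = cK k (z s)" .
  qed (rule zA[OF s])
  have M_exp: "x = (\<Oplus>\<^bsub>AK\<^esub>s \<in> {..<n}. cK s x \<odot>\<^bsub>AK\<^esub> z s)" if x: "x \<in> M" for x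
  proof -
    let ?x = "\<Oplus>\<^bsub>AK\<^esub>s \<in> {..<n}. cK s x \<odot>\<^bsub>AK\<^esub> z s"
    have xA: "x \<in> carrier AK" using x M_sub by blast
    have cx: "cK s x \<in> carrier K" if "s < n" for s using that xA nN by simp
    have x'M: "?x \<in> M" using cx zM by (intro I_lincomb[of y, OF yc M]) auto
    have x'A: "?x \<in> carrier AK" using x'M M_sub by blast
    have ck: "cK k ?x = cK k x" if k: "k < n" for k
    proof -
      have "cK k ?x = (\<Oplus>\<^bsub>K\<^esub>s \<in> {..<n}. cK s x \<otimes>\<^bsub>K\<^esub> cK k (z s))"
        using cx zA k nN by (intro functional_lincomb[OF AK.module_axioms cK_functional]) auto
      also have "\<dots> = (\<Oplus>\<^bsub>K\<^esub>s \<in> {..<n}. if s = k then cK s x else \<zero>\<^bsub>K\<^esub>)"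
        using cx zc k by (intro K.finsum_cong' refl) auto
      also have "\<dots> = cK k x" using cx k by (intro K.finsum_delta) auto
      finally show ?thesis .
    qed
    let ?d = "x \<oplus>\<^bsub>AK\<^esub> (\<ominus>\<^bsub>K\<^esub> \<one>\<^bsub>K\<^esub>) \<odot>\<^bsub>AK\<^esub> ?x"
    have "?d \<in> M" using M x x'M by (auto simp: submodule_def)
    moreover have "cK k ?d = \<zero>\<^bsub>K\<^esub>" if k: "k < n" for k
    proof -
      have kN: "k < N" using k nN by simp
      have "cK k ?d = cK k x \<oplus>\<^bsub>K\<^esub> (\<ominus>\<^bsub>K\<^esub> \<one>\<^bsub>K\<^esub>) \<otimes>\<^bsub>K\<^esub> cK k ?x"
        using xA x'A by (simp add: semilinear_add[OF cK_functional[OF kN]] semilinear_smult[OF cK_functional[OF kN]])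
      then show ?thesis unfolding ck[OF k] using cx[OF k] by (simp add: K.l_minus K.r_neg)
    qed
    ultimately have "?d = \<zero>\<^bsub>AK\<^esub>" by (rule M_inj)
    then have "x \<ominus>\<^bsub>AK\<^esub> ?x = \<zero>\<^bsub>AK\<^esub>" using xA x'A by (simp add: AK.M.minus_eq AK.smult_l_minus)
    then show ?thesis using xA x'A by (simp add: AK.A.r_right_minus_eq)
  qed
  have IM: "I y = M"
  proof
    show "I y \<subseteq> M" by (rule I_least[of y, OF yc M]) (simp_all add: wz zM)
    show "M \<subseteq> I y"
    proof
      fix x assume x: "x \<in> M"
      have "(\<Oplus>\<^bsub>AK\<^esub>s \<in> {..<n}. cK s x \<odot>\<^bsub>AK\<^esub> z s) \<in> I y"
        using x M_sub nN w_in_I[of y, OF yc] wz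
        by (intro I_lincomb[of y, OF yc I_submodule[of y, OF yc]]) (auto simp: subset_iff)
      then show "x \<in> I y" using M_exp[OF x] by simp
    qed
  qed
  have "right_ideal M AK"
    unfolding right_ideal_def
  proof (intro conjI ballI)
    have "module K (AK\<lparr>carrier := M\<rparr>)" by (rule AK.submodule_is_module[OF M])
    then interpret MM: module K "AK\<lparr>carrier := M\<rparr>" .
    show "additive_subgroup M AK"
    proof (rule additive_subgroupI, rule AK.add.subgroupI)
      show "\<ominus>\<^bsub>AK\<^esub> x \<in> M" if x: "x \<in> M" for x
      proof -
        have "(\<ominus>\<^bsub>K\<^esub> \<one>\<^bsub>K\<^esub>) \<odot>\<^bsub>AK\<^esub> x \<in> M" using M x by (auto simp: submodule_def)
        moreover have "x \<in> carrier AK" using x M_sub by blast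
        ultimately show ?thesis by (simp add: AK.smult_l_minus)
      qed
    qed (use M M_sub in \<open>auto simp: submodule_def\<close>)
    show "x \<otimes>\<^bsub>AK\<^esub> a \<in> M" if x: "x \<in> M" and a: "a \<in> carrier AK" for x a
    proof -
      obtain x' where "x' \<in> carrier AK" "x = v \<otimes>\<^bsub>AK\<^esub> x'" using x by (auto simp: M_def)
      then show ?thesis using M_mem[of "x' \<otimes>\<^bsub>AK\<^esub> a"] a v by (simp add: AK.A.m_assoc)
    qed
  qed
  moreover have "reduced_dim K AK M = 1"
  proof -
    have V: "vectorspace K (AK\<lparr>carrier := M\<rparr>)"
      by (intro vectorspace.intro AK.submodule_is_module[OF M] K.field_axioms)
    have "coordinate_system K (AK\<lparr>carrier := M\<rparr>) {..<n} z cK"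
      unfolding coordinate_system_def
    proof (intro conjI ballI)
      show "cK s \<in> functionals K (AK\<lparr>carrier := M\<rparr>)" if "s \<in> {..<n}" for s
        using cK_functional[of s] that nN M_sub by (intro semilinearI) (auto simp: semilinear_def subset_iff)
      show "x = (\<Oplus>\<^bsub>AK\<lparr>carrier := M\<rparr>\<^esub>k \<in> {..<n}. cK k x \<odot>\<^bsub>AK\<lparr>carrier := M\<rparr>\<^esub> z k)" if x: "x \<in> carrier (AK\<lparr>carrier := M\<rparr>)" for x
      proof -
        have xM: "x \<in> M" using x by simp
        have "cK k x \<odot>\<^bsub>AK\<^esub> z k \<in> M" if k: "k < n" for k
        proof -
          have "cK k x \<in> carrier K" using k nN xM M_sub by auto
          then show ?thesis using M zM[OF k] by (auto simp: submodule_def)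
        qed
        then show ?thesis using submodule_finsum[OF M, of "{..<n}" "\<lambda>k. cK k x \<odot>\<^bsub>AK\<^esub> z k"] M_exp[OF xM] by simp
      qed
    qed (use zM zc in auto)
    then have "vectorspace.dim K (AK\<lparr>carrier := M\<rparr>) = n" using coordinate_system_dim[OF V] by fastforce
    moreover have "alg_degree K AK = n"
      using coordinate_system_dim[OF AK.vectorspace_axioms csK] N(2) by (intro alg_degree_eq) simp
    ultimately show ?thesis using n(2) by (simp add: reduced_dim_def)
  qed
  ultimately have "M \<in> brauer_severi_points F B K \<iota>" by (simp add: brauer_severi_points_def)
  then have "y \<in> chart_points F B b K \<iota>"
    unfolding chart_points_def idx using yc cs_I IM by (auto simp: y_def)
  then show ?thesis
    using v beta M_mem IM by (intro bexI[of _ y] bexI[of _ v] conjI) simp_all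
qed

section \<open>From the generic point to the algebraic closure\<close>

lemma (in scalar_extension) incl_inj:
  assumes a: "a \<in> carrier A" "a' \<in> carrier A" and eq: "incl a = incl a'" shows "a = a'"
proof -
  obtain N :: nat and d c where
    dc: "\<And>k. k < N \<Longrightarrow> d k \<in> carrier A" "\<And>k. k < N \<Longrightarrow> c k \<in> functionals F A"
    and exp: "\<And>x. x \<in> carrier A \<Longrightarrow> x = (\<Oplus>\<^bsub>A\<^esub>k \<in> {..<N}. c k x \<odot>\<^bsub>A\<^esub> d k)"
    using frame unfolding finite_frame_def by blast
  have inj: "inj_on \<iota> (carrier F)"
    using non_trivial_field_hom_is_inj[OF iota A.field_axioms K.field_axioms] .
  have "c k a = c k a'" if k: "k < N" for k
  proof -
    have "\<iota> (c k a) = \<iota> (c k a')"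
      using ev_incl[OF a(1) dual_iota[OF dc(2)[OF k]]] ev_incl[OF a(2) dual_iota[OF dc(2)[OF k]]] eq by simp
    then show ?thesis
      using inj semilinear_closed[OF dc(2)[OF k] a(1)] semilinear_closed[OF dc(2)[OF k] a(2)] by (auto dest: inj_onD)
  qed
  then have "(\<Oplus>\<^bsub>A\<^esub>k \<in> {..<N}. c k a \<odot>\<^bsub>A\<^esub> d k) = (\<Oplus>\<^bsub>A\<^esub>k \<in> {..<N}. c k a' \<odot>\<^bsub>A\<^esub> d k)"
    using a dc semilinear_closed[OF dc(2)] by (intro A.finsum_cong' refl) auto
  then show ?thesis using exp[OF a(1)] exp[OF a(2)] by simp
qed

text \<open>An orthogonal involution becomes adjoint to a symmetric bilinear form over the algebraic closure;
  comparison of dimensions gives \<open>N = n\<^sup>2\<close>.\<close>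

lemma orthogonal_involution_split:
  fixes F :: "'f ring" and B :: "('f, 'b) module" and \<tau> :: "'b \<Rightarrow> 'b"
  defines "L \<equiv> field.alg_closure F" and "j \<equiv> ring.indexed_const F" and "n \<equiv> alg_degree F B"
  defines "BL \<equiv> base_change F L j B" and "\<tau>L \<equiv> base_change_map F L j B B \<tau>"
  assumes B: "scalar_extension F B L j" and nontriv: "\<one>\<^bsub>B\<^esub> \<noteq> \<zero>\<^bsub>B\<^esub>"
    and two: "\<one>\<^bsub>L\<^esub> \<oplus>\<^bsub>L\<^esub> \<one>\<^bsub>L\<^esub> \<noteq> \<zero>\<^bsub>L\<^esub>" and orth: "orthogonal_involution F B \<tau>"
    and cs: "coordinate_system F B {..<N} b c"
  shows "\<exists>E G H t \<epsilon>. split_involution L BL E G H t \<and> (\<forall>x \<in> carrier BL. \<tau>L x = H \<otimes>\<^bsub>BL\<^esub> t x \<otimes>\<^bsub>BL\<^esub> G) \<and>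
      (\<forall>i < n. \<epsilon> i \<in> carrier BL \<and> E \<otimes>\<^bsub>BL\<^esub> \<epsilon> i = \<epsilon> i) \<and>
      (\<forall>a. (\<forall>i < n. a i \<in> carrier L) \<longrightarrow> (\<Oplus>\<^bsub>BL\<^esub>i \<in> {..<n}. a i \<odot>\<^bsub>BL\<^esub> \<epsilon> i) = \<zero>\<^bsub>BL\<^esub> \<longrightarrow> (\<forall>i < n. a i = \<zero>\<^bsub>L\<^esub>))"
    and "N = n\<^sup>2" and "0 < n"
proof -
  interpret B: scalar_extension F B L j by (rule B)
  have \<tau>: "\<tau> \<in> module_hom F B B" using orth by (auto simp: orthogonal_involution_def involution_def)
  interpret \<tau>: scalar_extension_hom F B B L j \<tau> using \<tau> by unfold_locales
  (* with n = 0 there are no conditions on a subspace, but coordinates of B over L *)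
  interpret C: chart F B L j b c N 0 using cs by unfold_locales simp_all
  obtain \<Phi> G0 where \<Phi>: "\<Phi> \<in> alg_iso L BL (matrix_alg n (self_alg L))"
    and G0: "G0 \<in> Units (matrix_alg n (self_alg L))" "mat_transpose n G0 = G0"
    and adj: "\<And>x. x \<in> carrier BL \<Longrightarrow> mat_transpose n (\<Phi> x) \<otimes>\<^bsub>matrix_alg n (self_alg L)\<^esub> G0
        = G0 \<otimes>\<^bsub>matrix_alg n (self_alg L)\<^esub> \<Phi> (\<tau>L x)"
    using orth unfolding orthogonal_involution_def Let_def L_def j_def n_def BL_def \<tau>L_def by blast
  have nt: "\<one>\<^bsub>BL\<^esub> \<noteq> \<zero>\<^bsub>BL\<^esub>"
    using nontriv B.incl_inj[of "\<one>\<^bsub>B\<^esub>" "\<zero>\<^bsub>B\<^esub>"] by (auto simp: BL_def B.incl_one B.incl_zero)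
  have cl: "\<tau>L x \<in> carrier BL" if "x \<in> carrier BL" for x
    using \<tau>.base_change_map_closed that by (simp add: BL_def \<tau>L_def)
  have fa: "field_algebra L BL" unfolding BL_def by (rule B.AK.field_algebra_axioms)
  note S = adjoint_involution_split[OF fa nt \<Phi> G0 cl adj two]
  show "\<exists>E G H t \<epsilon>. split_involution L BL E G H t \<and> (\<forall>x \<in> carrier BL. \<tau>L x = H \<otimes>\<^bsub>BL\<^esub> t x \<otimes>\<^bsub>BL\<^esub> G) \<and>
      (\<forall>i < n. \<epsilon> i \<in> carrier BL \<and> E \<otimes>\<^bsub>BL\<^esub> \<epsilon> i = \<epsilon> i) \<and>
      (\<forall>a. (\<forall>i < n. a i \<in> carrier L) \<longrightarrow> (\<Oplus>\<^bsub>BL\<^esub>i \<in> {..<n}. a i \<odot>\<^bsub>BL\<^esub> \<epsilon> i) = \<zero>\<^bsub>BL\<^esub> \<longrightarrow> (\<forall>i < n. a i = \<zero>\<^bsub>L\<^esub>))"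
    by (rule S(1))
  show "0 < n" by (rule S(3))
  show "N = n\<^sup>2"
    using S(2) coordinate_system_dim[OF B.AK.vectorspace_axioms C.csK] by (simp add: BL_def)
qed

text \<open>Otherwise the constant polynomial 1 would lie in the vanishing ideal of the chart, without vanishing
  at the generic point.\<close>

lemma chart_points_nonempty:
  fixes F :: "'f ring" and K :: "'k ring"
  assumes F: "field F" and K: "field K" and \<iota>: "\<iota> \<in> ring_hom F K"
    and x: "\<And>v. v \<in> chart_index F B \<Longrightarrow> x v \<in> carrier K"
    and gen: "{p \<in> ring.indexed_pset F (chart_index F B) (carrier F). poly_value F K \<iota> p x = \<zero>\<^bsub>K\<^esub>} = chart_ideal F B b"
  shows "chart_points F B b (field.alg_closure F) (ring.indexed_const F) \<noteq> {}"
proof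
  interpret F: field F by fact
  interpret K: field K by fact
  interpret X: polynomial_values F K \<iota> "chart_index F B" x
    by unfold_locales (use \<iota> x in auto)
  assume "chart_points F B b F.alg_closure F.indexed_const = {}"
  then have "F.indexed_const \<one>\<^bsub>F\<^esub> \<in> chart_ideal F B b"
    by (simp add: chart_ideal_def F.indexed_pset.indexed_const)
  then have "poly_value F K \<iota> (F.indexed_const \<one>\<^bsub>F\<^esub>) x = \<zero>\<^bsub>K\<^esub>" using gen by blast
  then show False using X.val_const[of "\<one>\<^bsub>F\<^esub>"] ring_hom_one[OF \<iota>] by simp
qed

text \<open>The hypothesis \<open>gen\<close> says that \<open>x\<close> is a generic point of the Zariski closure of \<open>Y\<close>.\<close>

lemma (in polynomial_transfer) generic_vanishing:
  assumes gen: "{p \<in> F.indexed_pset V (carrier F). poly_value F K \<iota> p x = \<zero>\<^bsub>K\<^esub>}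
      = {p \<in> F.indexed_pset V (carrier F). \<forall>y \<in> Y. poly_value F L j p y = \<zero>\<^bsub>L\<^esub>}"
    and p: "polynomial_pair f g" and f: "f = \<zero>\<^bsub>K\<^esub>" and y: "y \<in> Y"
  shows "g y = \<zero>\<^bsub>L\<^esub>"
proof -
  obtain p where p: "p \<in> F.indexed_pset V (carrier F)" "poly_value F K \<iota> p x = f" "\<forall>y \<in> Y. poly_value F L j p y = g y"
    using p unfolding polynomial_pair_def by blast
  then have "p \<in> {p \<in> F.indexed_pset V (carrier F). poly_value F K \<iota> p x = \<zero>\<^bsub>K\<^esub>}" using f by simp
  then show ?thesis using p(3) y unfolding gen by simp
qed

text \<open>The hypothesis \<open>fixed\<close> concerns the generic ideal only. It is transferred to all right ideals in the
  chart over the algebraic closure \<open>L\<close>, in particular to one generated by an anisotropic column,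
  where \<open>adjoint_determined\<close> yields \<open>\<tau>'\<^sub>L = \<tau>\<^sub>L\<close>. As \<open>B \<rightarrow> B\<^sub>L\<close> is injective, \<open>\<tau>' = \<tau>\<close> follows.\<close>

lemma hermitian_squares_determine_involution:
  fixes F :: "'f ring" and B :: "('f, 'b) module" and K :: "'k ring"
  assumes F: "field F" and two: "\<one>\<^bsub>F\<^esub> \<oplus>\<^bsub>F\<^esub> \<one>\<^bsub>F\<^esub> \<noteq> \<zero>\<^bsub>F\<^esub>"
    and B: "field_algebra F B" and fd: "vectorspace.fin_dim F B" and nontriv: "\<one>\<^bsub>B\<^esub> \<noteq> \<zero>\<^bsub>B\<^esub>"
    and orth: "orthogonal_involution F B \<tau>"
    and generic: "function_field_generic_ideal F B K \<iota> I"
    and \<tau>': "\<tau>' \<in> module_hom F B B"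
    and anti: "\<And>x y. x \<in> carrier B \<Longrightarrow> y \<in> carrier B \<Longrightarrow> \<tau>' (x \<otimes>\<^bsub>B\<^esub> y) = \<tau>' y \<otimes>\<^bsub>B\<^esub> \<tau>' x"
    and fixed: "\<And>g. g \<in> I \<Longrightarrow> base_change_map F K \<iota> B B \<tau>' (base_change_map F K \<iota> B B \<tau> g \<otimes>\<^bsub>base_change F K \<iota> B\<^esub> g)
        = base_change_map F K \<iota> B B \<tau> g \<otimes>\<^bsub>base_change F K \<iota> B\<^esub> g"
    and a: "a \<in> carrier B"
  shows "\<tau>' a = \<tau> a"
proof -
  define L where "L = field.alg_closure F"
  define j :: "'f \<Rightarrow> ('f list \<times> nat) multiset \<Rightarrow> 'f" where "j = ring.indexed_const F"
  define n where "n = alg_degree F B"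
  define N where "N = vectorspace.dim F B"
  interpret F: field F by (rule F)
  interpret B: field_algebra F B by (rule B)
  have frame: "finite_frame F B" by (rule finite_dimensional_frame[OF B.vectorspace_axioms fd])
  have K: "field K" and \<iota>: "\<iota> \<in> ring_hom F K"
    using generic by (auto simp: function_field_generic_ideal_def field_ext_def)
  interpret K: field K by (rule K)
  interpret closure: algebraic_closure L "F.indexed_const ` carrier F" unfolding L_def by (rule F.alg_closureE)
  have L: "field L" by (rule closure.field_axioms)
  interpret L: field L by (rule L)
  have j: "j \<in> ring_hom F L" unfolding L_def j_def by (rule F.alg_closureE)
  have twoL: "\<one>\<^bsub>L\<^esub> \<oplus>\<^bsub>L\<^esub> \<one>\<^bsub>L\<^esub> \<noteq> \<zero>\<^bsub>L\<^esub>" by (rule ring_hom_two_nonzero[OF F L j two])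
  have inf: "infinite (carrier L)" by (rule closure.infinite_carrier[OF twoL])
  have BL: "scalar_extension F B L j"
    by unfold_locales (use j frame in auto)
  have BK: "scalar_extension F B K \<iota>"
    by unfold_locales (use \<iota> frame in auto)
  obtain b x where b: "enum_basis F B b" and x: "x \<in> chart_points F B b K \<iota>"
    and Ix: "I = chart_subspace F B b K \<iota> x"
    and gen: "{p \<in> ring.indexed_pset F (chart_index F B) (carrier F). poly_value F K \<iota> p x = \<zero>\<^bsub>K\<^esub>}
            = chart_ideal F B b"
    using generic unfolding function_field_generic_ideal_def by (elim conjE exE bexE)
  obtain c where cs: "coordinate_system F B {..<N} b c"
    using basis_coordinate_system[OF B.vectorspace_axioms, of "{..<N}" b] b by (auto simp: enum_basis_def N_def)
  note split = orthogonal_involution_split[OF BL[unfolded L_def j_def] nontriv twoL[unfolded L_def] orth cs,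
      folded L_def j_def n_def]
  have N: "N = n\<^sup>2" and n0: "0 < n" by (rule split(2), rule split(3))
  have nN: "n \<le> N" unfolding N using n0 by (simp add: power2_eq_square)
  have idx: "chart_index F B = {..<n} \<times> {n..<N}" by (simp add: chart_index_def n_def N_def)
  define Y where "Y = chart_points F B b L j"
  have xc: "x v \<in> carrier K" if "v \<in> {..<n} \<times> {n..<N}" for v
    using x that unfolding chart_points_def idx by auto
  have Yc: "y v \<in> carrier L" if "y \<in> Y" "v \<in> {..<n} \<times> {n..<N}" for y v
    using that unfolding Y_def chart_points_def idx by auto
  have \<tau>: "\<tau> \<in> module_hom F B B" using orth by (auto simp: orthogonal_involution_def involution_def)
  interpret K: symmetry_defect F B K \<iota> b c N n \<tau> \<tau>'
    using BK cs nN \<tau> \<tau>' by (simp add: symmetry_defect_def chart_def chart_axioms_def scalar_extension_hom_def scalar_extension_hom_axioms_def)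
  interpret L: symmetry_defect F B L j b c N n \<tau> \<tau>'
    using BL cs nN \<tau> \<tau>' by (simp add: symmetry_defect_def chart_def chart_axioms_def scalar_extension_hom_def scalar_extension_hom_axioms_def)
  interpret T: chart_polynomial_transfer F K L \<iota> j n N x Y
    by unfold_locales (use \<iota> j xc Yc in auto)
  have xs: "x (s, t) \<in> carrier K" if "s < n" "n \<le> t" "t < N" for s t using xc that by simp
  have IK: "I = K.I x" unfolding Ix by (rule K.chart_subspace_I) (simp_all add: n_def N_def)
  have genT: "{p \<in> F.indexed_pset ({..<n} \<times> {n..<N}) (carrier F). poly_value F K \<iota> p x = \<zero>\<^bsub>K\<^esub>}
      = {p \<in> F.indexed_pset ({..<n} \<times> {n..<N}) (carrier F). \<forall>y \<in> Y. poly_value F L j p y = \<zero>\<^bsub>L\<^esub>}"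
    using gen unfolding chart_ideal_def idx Y_def L_def j_def .
  (* the coordinates of the defect are values of polynomials over F that vanish at the generic point x *)
  have transfer: "L.defect (L.w y s) (L.w y s') = \<zero>\<^bsub>L.AK\<^esub>" if y: "y \<in> Y" and s: "s < n" "s' < n" for y s s'
  proof (rule L.coord_eqI)
    have ys: "y (s, t) \<in> carrier L" if "s < n" "n \<le> t" "t < N" for s t using Yc[OF y] that by simp
    have wL: "L.w y s \<in> carrier L.AK" if "s < n" for s using L.w_closed[of s y] ys that by blast
    show "L.defect (L.w y s) (L.w y s') \<in> carrier L.AK" using wL s by simp
    fix k assume k: "k < N"
    have d: "c k (L.defectF (b i) (b i')) \<in> carrier F" if "i < N" "i' < N" for i i'
    proof -
      have ck: "c k \<in> functionals F B" using coordinate_systemD(3)[OF cs] k by blast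
      show ?thesis by (rule semilinear_closed[OF ck]; rule L.defectF_closed; rule L.b_closed; rule that)
    qed
    have wK: "K.w x s \<in> carrier K.AK" if "s < n" for s using K.w_closed[of s x] xs that by blast
    have "K.cK k (K.defect (K.w x s) (K.w x s')) = \<zero>\<^bsub>K\<^esub>"
    proof -
      have "K.defect (K.w x s) (K.w x s') = \<zero>\<^bsub>K.AK\<^esub>"
        by (rule K.fixed_imp_defect_zero[OF fixed[unfolded IK] K.I_submodule[of x, OF xs]
              K.w_in_I[of x, OF xs s(1)] K.w_in_I[of x, OF xs s(2)]])
      then show ?thesis using K.cK_zero[OF k] by simp
    qed
    moreover have "K.cK k (K.defect (K.w x s) (K.w x s')) =
      (\<Oplus>\<^bsub>K\<^esub>i \<in> {..<N}. chart_coord K n x s i \<otimes>\<^bsub>K\<^esub>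
        (\<Oplus>\<^bsub>K\<^esub>i' \<in> {..<N}. chart_coord K n x s' i' \<otimes>\<^bsub>K\<^esub> \<iota> (c k (L.defectF (b i) (b i')))))"
      by (rule K.defect_w_coordinates[of x, OF xs s k])
    ultimately have "(\<Oplus>\<^bsub>L\<^esub>i \<in> {..<N}. chart_coord L n y s i \<otimes>\<^bsub>L\<^esub>
        (\<Oplus>\<^bsub>L\<^esub>i' \<in> {..<N}. chart_coord L n y s' i' \<otimes>\<^bsub>L\<^esub> j (c k (L.defectF (b i) (b i'))))) = \<zero>\<^bsub>L\<^esub>"
      by (intro T.generic_vanishing[OF genT T.polynomial_pair_bilinear[OF s d] _ y]) simp_all
    moreover have "L.cK k (L.defect (L.w y s) (L.w y s')) =
      (\<Oplus>\<^bsub>L\<^esub>i \<in> {..<N}. chart_coord L n y s i \<otimes>\<^bsub>L\<^esub>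
        (\<Oplus>\<^bsub>L\<^esub>i' \<in> {..<N}. chart_coord L n y s' i' \<otimes>\<^bsub>L\<^esub> j (c k (L.defectF (b i) (b i')))))"
      by (rule L.defect_w_coordinates[of y, OF ys s k])
    ultimately show "L.cK k (L.defect (L.w y s) (L.w y s')) = L.cK k \<zero>\<^bsub>L.AK\<^esub>"
      using L.cK_zero[OF k] by simp
  qed simp
  have fixedL: "L.\<tau>'K (L.\<tau>K g \<otimes>\<^bsub>L.AK\<^esub> g) = L.\<tau>K g \<otimes>\<^bsub>L.AK\<^esub> g" if y: "y \<in> Y" and g: "g \<in> L.I y" for y g
  proof -
    have ys: "y (s, t) \<in> carrier L" if "s < n" "n \<le> t" "t < N" for s t using Yc[OF y] that by simp
    show ?thesis
      by (rule L.defect_zero_imp_fixed[OF twoL L.I_subset[of y, OF ys g] L.defect_span[of y, OF ys transfer[OF y] g g]])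
  qed
  obtain E G H t \<epsilon> where S: "split_involution L L.AK E G H t"
    and \<tau>L: "\<forall>x \<in> carrier L.AK. L.\<tau>K x = H \<otimes>\<^bsub>L.AK\<^esub> t x \<otimes>\<^bsub>L.AK\<^esub> G"
    and \<epsilon>: "\<forall>i < n. \<epsilon> i \<in> carrier L.AK \<and> E \<otimes>\<^bsub>L.AK\<^esub> \<epsilon> i = \<epsilon> i"
    and indep: "\<forall>a. (\<forall>i < n. a i \<in> carrier L) \<longrightarrow> (\<Oplus>\<^bsub>L.AK\<^esub>i \<in> {..<n}. a i \<odot>\<^bsub>L.AK\<^esub> \<epsilon> i) = \<zero>\<^bsub>L.AK\<^esub> \<longrightarrow> (\<forall>i < n. a i = \<zero>\<^bsub>L\<^esub>)"
    using split(1) by (elim exE conjE)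
  interpret S: split_involution L L.AK E G H t by (rule S)
  have "chart_points F B b (field.alg_closure F) (ring.indexed_const F) \<noteq> {}"
    by (rule chart_points_nonempty[OF F K \<iota> _ gen]) (use xc idx in simp)
  then obtain y0 where y0: "y0 \<in> chart_points F B b L j"
    unfolding ex_in_conv[symmetric] L_def j_def by (rule exE)
  obtain y v \<beta> where y: "y \<in> Y" and v: "v \<in> carrier L.AK" "v \<otimes>\<^bsub>L.AK\<^esub> E = v"
    and \<beta>: "\<beta> \<in> carrier L" "\<beta> \<noteq> \<zero>\<^bsub>L\<^esub>" "t v \<otimes>\<^bsub>L.AK\<^esub> G \<otimes>\<^bsub>L.AK\<^esub> v = \<beta> \<odot>\<^bsub>L.AK\<^esub> E"
    and vI: "\<forall>x \<in> carrier L.AK. v \<otimes>\<^bsub>L.AK\<^esub> x \<in> L.I y"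
    using L.exists_anisotropic_chart_point[OF n_def n0 N_def N S \<epsilon> indep inf y0] unfolding Y_def
    by (elim bexE conjE)
  have eq: "L.\<tau>K z = S.\<tau> z" if "z \<in> carrier L.AK" for z using \<tau>L that by (simp add: S.\<tau>_def)
  have "L.\<tau>'K z = S.\<tau> z" if z: "z \<in> carrier L.AK" for z
  proof (rule S.adjoint_determined[OF v \<beta> _ _ _ z])
    show "L.\<tau>'K \<in> module_hom L L.AK L.AK"
      by (rule module_homI) (simp_all add: L.\<tau>'.base_change_map_add L.\<tau>'.base_change_map_smult)
    show "L.\<tau>'K (x \<otimes>\<^bsub>L.AK\<^esub> y) = L.\<tau>'K y \<otimes>\<^bsub>L.AK\<^esub> L.\<tau>'K x" if "x \<in> carrier L.AK" "y \<in> carrier L.AK" for x y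
      by (rule L.\<tau>'.base_change_map_antimult[OF anti that])
    show "L.\<tau>'K (S.\<tau> (v \<otimes>\<^bsub>L.AK\<^esub> x) \<otimes>\<^bsub>L.AK\<^esub> (v \<otimes>\<^bsub>L.AK\<^esub> x)) = S.\<tau> (v \<otimes>\<^bsub>L.AK\<^esub> x) \<otimes>\<^bsub>L.AK\<^esub> (v \<otimes>\<^bsub>L.AK\<^esub> x)"
      if x: "x \<in> carrier L.AK" for x
      using fixedL[OF y, of "v \<otimes>\<^bsub>L.AK\<^esub> x"] vI x v eq[of "v \<otimes>\<^bsub>L.AK\<^esub> x"] by simp
  qed
  then have "L.\<tau>'K (L.incl a) = L.\<tau>K (L.incl a)" using a eq by simp
  then have "L.incl (\<tau>' a) = L.incl (\<tau> a)"
    using a by (simp add: L.\<tau>.base_change_map_incl L.\<tau>'.base_change_map_incl)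
  then show ?thesis using a by (intro L.incl_inj) simp_all
qed

section \<open>Direct summands and the generic ideal\<close>

theorem theorem3p1:
  fixes F :: "'f ring" and A :: "('f, 'a) module" and B :: "('f, 'b) module"
    and \<sigma> :: "'a \<Rightarrow> 'a" and \<tau> :: "'b \<Rightarrow> 'b"
    and K :: "'k ring" and \<iota> :: "'f \<Rightarrow> 'k" and I :: "('b \<Rightarrow> 'k) set set"
  assumes "field F" and "\<one>\<^bsub>F\<^esub> \<oplus>\<^bsub>F\<^esub> \<one>\<^bsub>F\<^esub> \<noteq> \<zero>\<^bsub>F\<^esub>"
    and "central_simple_algebra F A" and "orthogonal_involution F A \<sigma>"
    and "central_simple_algebra F B" and "orthogonal_involution F B \<tau>"
    and "brauer_equivalent F A B"
    and "function_field_generic_ideal F B K \<iota> I"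
  shows "direct_summand F A \<sigma> B \<tau> \<longleftrightarrow>
    (\<exists>e \<Psi>. symmetric_idempotent A \<sigma> e \<and> \<Psi> \<in> alg_iso F (corner A e) B \<and>
      (let AK = base_change F K \<iota> A; BK = base_change F K \<iota> B;
           eK = base_incl F K \<iota> A e;
           \<sigma>K = base_change_map F K \<iota> A A \<sigma>; \<tau>K = base_change_map F K \<iota> B B \<tau>;
           \<Psi>K = corner_base_change_map F K \<iota> A e B \<Psi>
       in \<forall>g \<in> I. \<exists>f \<in> carrier AK.
            \<Psi>K (eK \<otimes>\<^bsub>AK\<^esub> \<sigma>K f \<otimes>\<^bsub>AK\<^esub> f \<otimes>\<^bsub>AK\<^esub> eK) = \<tau>K g \<otimes>\<^bsub>BK\<^esub> g))"
proof
  interpret F: field F by fact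
  interpret A: central_simple_algebra F A by fact
  interpret B: central_simple_algebra F B by fact
  have K: "field K" "\<iota> \<in> ring_hom F K" and I: "I \<in> brauer_severi_points F B K \<iota>"
    using assms(8) by (auto simp: function_field_generic_ideal_def field_ext_def)
  interpret K: field K by (rule K(1))
  have AK: "scalar_extension F A K \<iota>"
    by (intro scalar_extension.intro A.field_algebra_axioms K(1) scalar_extension_axioms.intro K(2)
        finite_dimensional_frame A.vectorspace_axioms A.finite_dimensional)
  have BK: "scalar_extension F B K \<iota>"
    by (intro scalar_extension.intro B.field_algebra_axioms K(1) scalar_extension_axioms.intro K(2)
        finite_dimensional_frame B.vectorspace_axioms B.finite_dimensional)
  have \<sigma>: "involution F A \<sigma>" and \<tau>: "involution F B \<tau>"
    using assms(4,6) by (simp_all add: orthogonal_involution_def)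
  have iso: "corner_isomorphism F A B K \<iota> \<sigma> e \<Psi>"
    if "symmetric_idempotent A \<sigma> e" "\<Psi> \<in> alg_iso F (corner A e) B" for e \<Psi>
    by (intro corner_isomorphism.intro AK BK corner_isomorphism_axioms.intro \<sigma> that)
  let ?squares = "\<lambda>e \<Psi>. let AK = base_change F K \<iota> A; BK = base_change F K \<iota> B;
           eK = base_incl F K \<iota> A e;
           \<sigma>K = base_change_map F K \<iota> A A \<sigma>; \<tau>K = base_change_map F K \<iota> B B \<tau>;
           \<Psi>K = corner_base_change_map F K \<iota> A e B \<Psi>
       in \<forall>g \<in> I. \<exists>f \<in> carrier AK.
            \<Psi>K (eK \<otimes>\<^bsub>AK\<^esub> \<sigma>K f \<otimes>\<^bsub>AK\<^esub> f \<otimes>\<^bsub>AK\<^esub> eK) = \<tau>K g \<otimes>\<^bsub>BK\<^esub> g"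
  show "\<exists>e \<Psi>. symmetric_idempotent A \<sigma> e \<and> \<Psi> \<in> alg_iso F (corner A e) B \<and> ?squares e \<Psi>"
    if summand: "direct_summand F A \<sigma> B \<tau>"
  proof -
    obtain e \<Psi> where e: "symmetric_idempotent A \<sigma> e" and \<Psi>: "\<Psi> \<in> alg_iso F (corner A e) B"
      and comm: "\<forall>x \<in> carrier (corner A e). \<Psi> (\<sigma> x) = \<tau> (\<Psi> x)"
      using summand unfolding direct_summand_def by (elim exE conjE bexE)
    interpret corner_isomorphism F A B K \<iota> \<sigma> e \<Psi> by (rule iso[OF e \<Psi>])
    have "I \<subseteq> carrier (base_change F K \<iota> B)"
      using I additive_subgroup.a_subset unfolding brauer_severi_points_def right_ideal_def by blast
    then have "?squares e \<Psi>"
      unfolding Let_def using involutionD(1)[OF \<tau>] comm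
      by (intro ballI hermitian_square_represented) auto
    then show ?thesis using e \<Psi> by (intro exI conjI)
  qed
  show "direct_summand F A \<sigma> B \<tau>"
    if squares: "\<exists>e \<Psi>. symmetric_idempotent A \<sigma> e \<and> \<Psi> \<in> alg_iso F (corner A e) B \<and> ?squares e \<Psi>"
  proof -
    obtain e \<Psi> where e: "symmetric_idempotent A \<sigma> e" and \<Psi>: "\<Psi> \<in> alg_iso F (corner A e) B"
      and sq: "?squares e \<Psi>"
      using squares by (elim exE conjE)
    interpret corner_isomorphism F A B K \<iota> \<sigma> e \<Psi> by (rule iso[OF e \<Psi>])
    have fixed: "base_change_map F K \<iota> B B \<tau>' (base_change_map F K \<iota> B B \<tau> g \<otimes>\<^bsub>base_change F K \<iota> B\<^esub> g)
        = base_change_map F K \<iota> B B \<tau> g \<otimes>\<^bsub>base_change F K \<iota> B\<^esub> g" if g: "g \<in> I" for g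
    proof -
      obtain f where "f \<in> carrier (base_change F K \<iota> A)"
        and "corner_base_change_map F K \<iota> A e B \<Psi>
          (base_incl F K \<iota> A e \<otimes>\<^bsub>base_change F K \<iota> A\<^esub> base_change_map F K \<iota> A A \<sigma> f
            \<otimes>\<^bsub>base_change F K \<iota> A\<^esub> f \<otimes>\<^bsub>base_change F K \<iota> A\<^esub> base_incl F K \<iota> A e)
          = base_change_map F K \<iota> B B \<tau> g \<otimes>\<^bsub>base_change F K \<iota> B\<^esub> g"
        using sq[unfolded Let_def, THEN bspec, OF g] by (rule bexE)
      then show ?thesis by (intro hermitian_square_fixed[OF _ sym])
    qed
    have "\<Psi> (\<sigma> x) = \<tau> (\<Psi> x)" if x: "x \<in> carrier (corner A e)" for x
      using hermitian_squares_determine_involution[OF assms(1,2) B.field_algebra_axioms B.finite_dimensional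
          B.nontrivial assms(6,8) module_homs(5) \<tau>'_antimult fixed, of "\<Psi> x"] \<tau>'_\<Psi>[OF x] \<Psi>D(1)[OF x] by simp
    then show ?thesis unfolding direct_summand_def using e \<Psi> by blast
  qed
qed

end
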